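(* Let $L>0$, $\Omega=(-L,L)^2$ and $\mathbf{f}\in L^2(\Omega)^2$. For every $r$ with $0<r<L$ there exists a unique solution $\mathbf{u}_r\in \mathbb{V}_{0,r,\sigma}$ of the problem $$\int_{\Omega_r}\nabla \mathbf{u}_r:\nabla \mathbf{v}=\int_{\Omega_r}\mathbf{f}\cdot\mathbf{v}\qquad\text{for all } \mathbf{v}\in \mathbb{V}_{0,r,\sigma}.$$ Moreover, extending $\mathbf{u}_r$ by zero inside $D_r$ so that $\mathbf{u}_r$ is regarded as an element of $\mathbb{H}^1_{\mathrm{per},\sigma}(\Omega)$: (a) if $\int_\Omega \mathbf{f}=0$, then as $r\to0$ $$\mathbf{u}_r-\frac{1}{|\Omega|}\int_\Omega \mathbf{u}_r\to \mathbf{u}_0\qquad\text{and}\qquad \nabla \mathbf{u}_r\to\nabla \mathbf{u}_0,$$ where the limits are taken in $L^2(\Omega)$ (componentwise) and $\mathbf{u}_0\in\mathbb{H}^1_{\mathrm{per},\sigma}(\Omega)$ is the unique solution of the problem $$\int_\Omega\nabla \mathbf{u}_0:\nabla \mathbf{v}=\int_\Omega \mathbf{f}\cdot\mathbf{v}\qquad\text{for all } \mathbf{v}\in \mathbb{H}^1_{\mathrm{per},\sigma}(\Omega)$$ that satisfies $\int_\Omega \mathbf{u}_0=0$; (b) if $\int_\Omega \mathbf{f}\neq0$, then $\|\nabla \mathbf{u}_r\|_{L^2}$ is unbounded as $r\to0$.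
   Context: For $0<r<L$, $D_r=B(0,r)$ is the disc of radius $r$ centred at the origin in $\mathbb{R}^2$ and $\Omega_r=(-L,L)^2\setminus D_r$; also $\Omega_0=\Omega$. $\mathbb{H}^1_{\mathrm{per}}(\Omega)$ is the space of restrictions to $\Omega$ of $\mathbb{R}^2$-valued fields in $H^1_{\mathrm{loc}}(\mathbb{R}^2)^2$ that are $2L$-periodic in both coordinate directions. For $r>0$, $\mathbb{H}^1_{\mathrm{per}}(\Omega_r)$ is the closure in $H^1(\Omega_r)^2$ of the space of $\mathbb{R}^2$-valued $C^1$ fields on $\overline{\Omega}_r$ whose $2L$-periodic extension in both directions is $C^1$ (on the periodic extension of $\overline\Omega_r$). Set, for $r\ge 0$, $$\mathbb{H}^1_{\mathrm{per},\sigma}(\Omega_r)=\{\mathbf{v}\in \mathbb{H}^1_{\mathrm{per}}(\Omega_r):\ \operatorname{div}\mathbf{v}=0\text{ in }\Omega_r\},$$ and, for $r>0$, $$\mathbb{V}_{0,r,\sigma}=\{\mathbf{v}\in \mathbb{H}^1_{\mathrm{per},\sigma}(\Omega_r):\ \mathbf{v}=0\text{ on }\partial D_r\}$$ (in the sense of traces). Any field in $\mathbb{V}_{0,r,\sigma}$ is extended by zero inside $D_r$ to give a field in $\mathbb{H}^1_{\mathrm{per},\sigma}(\Omega)$; integrals and norms of $\mathbf{u}_r$ over $\Omega$ refer to this extension. The notation $\nabla\mathbf{u}:\nabla\mathbf{v}$ means $\sum_{i,j=1}^2(\partial_iu_j)(\partial_iv_j)$. *)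

theory Defs
  imports "HOL-Analysis.Analysis"
begin

definition L2 :: "'a measure \<Rightarrow> ('a \<Rightarrow> 'b::euclidean_space) set" where
  "L2 M = {g. g \<in> borel_measurable M \<and> integrable M (\<lambda>x. (norm (g x))\<^sup>2)}"

text \<open>The norm on \<^typ>\<open>real^2^2\<close> is the Frobenius norm, so for matrix fields this is the
  usual \<open>L\<^sup>2\<close> norm. Meaningful only for members of \<^const>\<open>L2\<close> (the integral is a Bochner
  integral, with value 0 on non-integrable functions).\<close>

definition L2norm :: "'a measure \<Rightarrow> ('a \<Rightarrow> 'b::euclidean_space) \<Rightarrow> real" where
  "L2norm M g = sqrt (LINT x|M. (norm (g x))\<^sup>2)"

definition pderiv_at :: "2 \<Rightarrow> (real^2 \<Rightarrow> real) \<Rightarrow> real^2 \<Rightarrow> real" where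
  "pderiv_at i \<phi> x = frechet_derivative \<phi> (at x) (axis i 1)"

primrec Ck :: "nat \<Rightarrow> (real^2 \<Rightarrow> real) \<Rightarrow> bool" where
  "Ck 0 \<phi> \<longleftrightarrow> continuous_on UNIV \<phi>"
| "Ck (Suc k) \<phi> \<longleftrightarrow> \<phi> differentiable_on UNIV \<and> (\<forall>i. Ck k (pderiv_at i \<phi>))"

definition test_function :: "(real^2) set \<Rightarrow> (real^2 \<Rightarrow> real) \<Rightarrow> bool" where
  "test_function S \<phi> \<longleftrightarrow> (\<forall>k. Ck k \<phi>) \<and>
     compact (closure {x. \<phi> x \<noteq> 0}) \<and> closure {x. \<phi> x \<noteq> 0} \<subseteq> S"

text \<open>The domains below are allowed to contain part of their boundary (always a null set);
  weak derivatives are taken on the interior.\<close>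

definition has_weak_pderiv ::
  "(real^2) set \<Rightarrow> 2 \<Rightarrow> (real^2 \<Rightarrow> real) \<Rightarrow> (real^2 \<Rightarrow> real) \<Rightarrow> bool" where
  "has_weak_pderiv S i u g \<longleftrightarrow>
     (\<forall>K. compact K \<and> K \<subseteq> interior S \<longrightarrow> integrable (lebesgue_on K) u \<and> integrable (lebesgue_on K) g) \<and>
     (\<forall>\<phi>. test_function (interior S) \<phi> \<longrightarrow>
        (LINT x|lebesgue_on S. u x * pderiv_at i \<phi> x) = - (LINT x|lebesgue_on S. g x * \<phi> x))"

definition weak_pderiv :: "(real^2) set \<Rightarrow> 2 \<Rightarrow> (real^2 \<Rightarrow> real) \<Rightarrow> (real^2 \<Rightarrow> real)" where
  "weak_pderiv S i u = (SOME g. has_weak_pderiv S i u g)"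

text \<open>Entry \<open>(i, j)\<close> is \<open>\<partial>\<^sub>i u\<^sub>j\<close>. The inner product \<open>\<bullet>\<close> on \<^typ>\<open>real^2^2\<close> is the sum over all
  entries, so \<open>wgrad S u x \<bullet> wgrad S v x\<close> is \<open>\<nabla>u : \<nabla>v\<close>.\<close>

definition wgrad :: "(real^2) set \<Rightarrow> (real^2 \<Rightarrow> real^2) \<Rightarrow> real^2 \<Rightarrow> real^2^2" where
  "wgrad S u x = (\<chi> i j. weak_pderiv S i (\<lambda>y. u y $ j) x)"

definition wdiv :: "(real^2) set \<Rightarrow> (real^2 \<Rightarrow> real^2) \<Rightarrow> real^2 \<Rightarrow> real" where
  "wdiv S u x = (\<Sum>i\<in>UNIV. weak_pderiv S i (\<lambda>y. u y $ i) x)"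

text \<open>Elements of function spaces on \<open>S\<close> are represented by total functions; their values
  outside \<open>S\<close> are irrelevant, and equality is equality almost everywhere on \<open>S\<close>.\<close>

definition H1 :: "(real^2) set \<Rightarrow> (real^2 \<Rightarrow> real) set" where
  "H1 S = {u \<in> L2 (lebesgue_on S). \<forall>i. \<exists>g \<in> L2 (lebesgue_on S). has_weak_pderiv S i u g}"

definition L2loc :: "(real^2 \<Rightarrow> real) set" where
  "L2loc = {u. \<forall>K. compact K \<longrightarrow> u \<in> L2 (lebesgue_on K)}"

definition H1loc :: "(real^2 \<Rightarrow> real) set" where
  "H1loc = {u \<in> L2loc. \<forall>i. \<exists>g \<in> L2loc. has_weak_pderiv UNIV i u g}"

definition H1norm :: "(real^2) set \<Rightarrow> (real^2 \<Rightarrow> real^2) \<Rightarrow> real" where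
  "H1norm S v = sqrt ((L2norm (lebesgue_on S) v)\<^sup>2 + (L2norm (lebesgue_on S) (wgrad S v))\<^sup>2)"

text \<open>\<^term>\<open>ball 0 0 = {}\<close>, so \<open>Omega L 0\<close> is the full square \<open>(-L, L)\<^sup>2\<close>.\<close>

definition Omega :: "real \<Rightarrow> real \<Rightarrow> (real^2) set" where
  "Omega L r = box (vec (- L)) (vec L) - ball 0 r"

definition periodic_field :: "real \<Rightarrow> (real^2 \<Rightarrow> real^2) \<Rightarrow> bool" where
  "periodic_field L w \<longleftrightarrow> (\<forall>x i. w (x + (2 * L) *\<^sub>R axis i 1) = w x)"

definition periodic_ext :: "real \<Rightarrow> (real^2) set \<Rightarrow> (real^2) set" where
  "periodic_ext L S = {y + (2 * L) *\<^sub>R (\<chi> i. of_int (k $ i)) | y (k :: int^2). y \<in> S}"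

text \<open>A field on the closure of \<open>\<Omega>\<^sub>r\<close> with \<open>C\<^sup>1\<close> periodic extension is represented by that
  extension. Its values inside the holes are arbitrary; \<open>C\<^sup>1\<close> on the closed set \<open>E\<close> means
  differentiable within \<open>E\<close> with derivative (Jacobian \<open>J\<close>) continuous on \<open>E\<close>.\<close>

definition C1per :: "real \<Rightarrow> real \<Rightarrow> (real^2 \<Rightarrow> real^2) set" where
  "C1per L r = {w. periodic_field L w \<and>
     (let E = periodic_ext L (closure (Omega L r)) in
       \<exists>J :: real^2 \<Rightarrow> real^2^2. continuous_on E J \<and>
         (\<forall>x\<in>E. (w has_derivative (\<lambda>h. J x *v h)) (at x within E)))}"

definition H1per :: "real \<Rightarrow> real \<Rightarrow> (real^2 \<Rightarrow> real^2) set" where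
  "H1per L r =
     (if r = 0 then
        {v. \<exists>w. periodic_field L w \<and> (\<forall>j. (\<lambda>x. w x $ j) \<in> H1loc) \<and>
                (AE x in lebesgue_on (Omega L 0). v x = w x)}
      else
        {v. (\<forall>j. (\<lambda>x. v x $ j) \<in> H1 (Omega L r)) \<and>
            (\<exists>w. (\<forall>n::nat. w n \<in> C1per L r) \<and>
                 (\<lambda>n. H1norm (Omega L r) (\<lambda>x. v x - w n x)) \<longlonglongrightarrow> 0)})"

definition H1per_sigma :: "real \<Rightarrow> real \<Rightarrow> (real^2 \<Rightarrow> real^2) set" where
  "H1per_sigma L r =
     {v \<in> H1per L r. AE x in lebesgue_on (Omega L r). wdiv (Omega L r) v x = 0}"

definition circle_pt :: "real \<Rightarrow> real \<Rightarrow> real^2" where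
  "circle_pt r \<theta> = vector [r * cos \<theta>, r * sin \<theta>]"

text \<open>\<open>g\<close> is the trace of \<open>v\<close> on the circle of radius \<open>r\<close>: the trace operator is the continuous
  extension to \<open>H1per L r\<close> of the restriction of \<open>C\<^sup>1\<close> fields, with values in \<open>L\<^sup>2\<close> of the
  circle. The latter is expressed in the angle \<open>\<theta>\<close>; the constant arc-length factor \<open>r\<close> does
  not affect membership or convergence.\<close>

definition has_trace ::
  "real \<Rightarrow> real \<Rightarrow> (real^2 \<Rightarrow> real^2) \<Rightarrow> (real^2 \<Rightarrow> real^2) \<Rightarrow> bool" where
  "has_trace L r v g \<longleftrightarrow>
     (\<lambda>\<theta>. g (circle_pt r \<theta>)) \<in> L2 (lebesgue_on {0..2*pi}) \<and>
     (\<exists>w. (\<forall>n::nat. w n \<in> C1per L r) \<and>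
          (\<lambda>n. H1norm (Omega L r) (\<lambda>x. v x - w n x)) \<longlonglongrightarrow> 0 \<and>
          (\<lambda>n. L2norm (lebesgue_on {0..2*pi})
                 (\<lambda>\<theta>. w n (circle_pt r \<theta>) - g (circle_pt r \<theta>))) \<longlonglongrightarrow> 0)"

definition V0_sigma :: "real \<Rightarrow> real \<Rightarrow> (real^2 \<Rightarrow> real^2) set" where
  "V0_sigma L r = {v \<in> H1per_sigma L r. has_trace L r v (\<lambda>_. 0)}"

definition zero_ext :: "real \<Rightarrow> (real^2 \<Rightarrow> real^2) \<Rightarrow> real^2 \<Rightarrow> real^2" where
  "zero_ext r v x = (if x \<in> ball 0 r then 0 else v x)"

definition weak_solution ::
  "(real^2) set \<Rightarrow> (real^2 \<Rightarrow> real^2) set \<Rightarrow> (real^2 \<Rightarrow> real^2) \<Rightarrow> (real^2 \<Rightarrow> real^2) \<Rightarrow> bool" where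
  "weak_solution S X f u \<longleftrightarrow> u \<in> X \<and>
     (\<forall>v\<in>X. (LINT x|lebesgue_on S. wgrad S u x \<bullet> wgrad S v x) = (LINT x|lebesgue_on S. f x \<bullet> v x))"

definition mean :: "(real^2) set \<Rightarrow> (real^2 \<Rightarrow> real^2) \<Rightarrow> real^2" where
  "mean S u = (1 / measure lebesgue S) *\<^sub>R (LINT x|lebesgue_on S. u x)"

end

(* The problem on Omega_r has a unique solution by the Riesz representation theorem: a field that
   vanishes on the disc satisfies a Poincare inequality with constant depending on r. Extended by
   zero, u_r satisfies the weak equation against every zero-extended test field.

   If f has mean zero, u_0 is the solution on the full torus, and by Galerkin orthogonality grad u_r
   is the best approximation of grad u_0 among the gradients of fields vanishing on the disc. Hence
   it suffices to approximate u_0, in the gradient norm and up to a constant, by divergence-free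
   fields vanishing near the origin. After mollification and subtraction of its value at 0 one may
   take u_0 = O(|x|) and C^1; it then has a stream function psi = O(|x|^2), and cutting psi off on
   the scale eps changes the gradient by O(1) on a disc of radius 2 eps. The zero-mean part of u_r
   converges by the Poincare inequality.

   If f has integral c <> 0, cutting off the stream function of the constant field c on the scale
   eps gives a test field close to c in L^2 whose gradient is supported in the annulus
   eps < |x| < 2 eps and has L^2 norm bounded independently of eps, by scale invariance of the
   Dirichlet integral in dimension 2. The weak equation pairs grad u_r with each of these gradients
   to at least |c|^2 / 2. Using n dyadic annuli >= r, Bessel's inequality gives
   ||grad u_r||^2 >= const * n. *)

theory Submission
  imports Defs
begin

section \<open>Square-integrable functions\<close>

text \<open>The stream function of a periodic field is in general not periodic, because the field
  may have a mean. One construction thus serves the approximation of \<open>u0\<close> and the test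
  fields close to a constant. The zero boundary value is only known as a limit of L^2 norms on the
  circle along C^1 fields. It enters through Green's formula for these fields, whose circle term is
  bounded by such a norm. In the limit the zero extension has the zero-extended gradient as its weak
  gradient on the torus, which reduces the estimates on the perforated square to estimates on the
  torus. The Poincare constant of the perforated square degenerates as the disc shrinks. It serves
  existence and uniqueness for fixed r; the passage to the limit uses the constant of the torus.
  Weak gradients are arbitrary choices up to null sets, so each is identified by exhibiting a
  candidate. Periodic fields are given by their values on one cell and tested there against
  periodised test functions.\<close>

lemma quadratic_bound:
  fixes a b d :: real
  assumes "a \<ge> 0" and *: "\<And>c. 2 * c * b + c\<^sup>2 * a \<ge> - d"
  shows "b\<^sup>2 \<le> d * a"
proof (cases "a = 0")
  case True
  have "b = 0"
  proof (rule ccontr)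
    assume "b \<noteq> 0"
    \<comment> \<open>Without the quadratic term the left side is linear in \<open>c\<close>; this
      value of \<open>c\<close> makes it \<open>- 2 * (\<bar>d\<bar> + 1)\<close>, which lies below
      \<open>- d\<close>.\<close>
    then have "2 * (-(\<bar>d\<bar> + 1) / b) * b = - 2 * (\<bar>d\<bar> + 1)" by simp
    then show False using *[of "-(\<bar>d\<bar> + 1) / b"] True by simp
  qed
  then show ?thesis using True by simp
next
  case False
  then have "a > 0" using assms by simp
  have "2 * (- b / a) * b + (- b / a)\<^sup>2 * a = - (b\<^sup>2 / a)"
    using \<open>a > 0\<close> by (simp add: power2_eq_square)
  then have "b\<^sup>2 / a \<le> d" using *[of "- b / a"] by simp
  then show ?thesis using \<open>a > 0\<close> by (simp add: pos_divide_le_eq)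
qed

text \<open>Functions equal almost everywhere are not identified, so the form is only semidefinite
  and limits are determined only up to its kernel. Two instances occur: the \<open>L2\<close>
  product, and the energy on a space with a Poincare inequality.\<close>

locale semi_inner =
  fixes V :: "('a \<Rightarrow> 'b::real_vector) set" and B :: "('a \<Rightarrow> 'b) \<Rightarrow> ('a \<Rightarrow> 'b) \<Rightarrow> real"
  assumes nonempty: "V \<noteq> {}"
    and lincomb: "\<lbrakk>u \<in> V; v \<in> V\<rbrakk> \<Longrightarrow> (\<lambda>x. u x + c *\<^sub>R v x) \<in> V"
    and sym: "\<lbrakk>u \<in> V; v \<in> V\<rbrakk> \<Longrightarrow> B u v = B v u"
    and lin: "\<lbrakk>u \<in> V; v \<in> V; w \<in> V\<rbrakk> \<Longrightarrow> B (\<lambda>x. u x + c *\<^sub>R v x) w = B u w + c * B v w"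
    and nonneg: "u \<in> V \<Longrightarrow> 0 \<le> B u u"
begin

abbreviation "sub u v \<equiv> (\<lambda>x. u x - v x)"

lemma diff: "\<lbrakk>u \<in> V; v \<in> V\<rbrakk> \<Longrightarrow> sub u v \<in> V"
  using lincomb[of u v "-1"] by simp

lemma lin_diff: "\<lbrakk>u \<in> V; v \<in> V; w \<in> V\<rbrakk> \<Longrightarrow> B (sub u v) w = B u w - B v w"
  using lin[of u v w "-1"] by simp

lemma expand: assumes "u \<in> V" "v \<in> V"
  shows "B (\<lambda>x. u x + c *\<^sub>R v x) (\<lambda>x. u x + c *\<^sub>R v x) = B u u + 2 * c * B u v + c\<^sup>2 * B v v"
proof -
  have "B (\<lambda>x. u x + c *\<^sub>R v x) (\<lambda>x. u x + c *\<^sub>R v x) 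
     = B u (\<lambda>x. u x + c *\<^sub>R v x) + c * B v (\<lambda>x. u x + c *\<^sub>R v x)"
    using assms by (intro lin lincomb)
  also have "\<dots> = (B u u + c * B v u) + c * (B u v + c * B v v)"
    using sym[OF assms(1) lincomb[OF assms]] sym[OF assms(2) lincomb[OF assms]]
      lin[OF assms assms(1)] lin[OF assms assms(2)] by simp
  also have "\<dots> = B u u + 2 * c * B u v + c\<^sup>2 * B v v"
    unfolding sym[OF assms(2,1)] by (simp add: algebra_simps power2_eq_square)
  finally show ?thesis .
qed

lemma Cauchy_Schwarz: assumes "u \<in> V" "v \<in> V" shows "(B u v)\<^sup>2 \<le> B u u * B v v"
proof (rule quadratic_bound)
  show "0 \<le> B v v" using assms nonneg by blast
  show "- B u u \<le> 2 * c * B u v + c\<^sup>2 * B v v" for c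
    using nonneg[OF lincomb[OF assms, of c]] unfolding expand[OF assms] by linarith
qed

lemma Cauchy_Schwarz_sqrt: assumes "u \<in> V" "v \<in> V" shows "\<bar>B u v\<bar> \<le> sqrt (B u u) * sqrt (B v v)"
  using real_sqrt_le_mono[OF Cauchy_Schwarz[OF assms]] by (simp add: real_sqrt_mult)

lemma triangle: assumes "u \<in> V" "v \<in> V"
  shows "sqrt (B (\<lambda>x. u x + c *\<^sub>R v x) (\<lambda>x. u x + c *\<^sub>R v x)) \<le> sqrt (B u u) + \<bar>c\<bar> * sqrt (B v v)"
proof (rule real_le_lsqrt)
  have n: "0 \<le> B u u" "0 \<le> B v v" using assms nonneg by auto
  show "0 \<le> sqrt (B u u) + \<bar>c\<bar> * sqrt (B v v)" using n by simp
  have "c * B u v \<le> \<bar>c\<bar> * \<bar>B u v\<bar>" by (metis abs_ge_self abs_mult)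
  also have "\<dots> \<le> \<bar>c\<bar> * (sqrt (B u u) * sqrt (B v v))"
    using Cauchy_Schwarz_sqrt[OF assms] by (simp add: mult_left_mono)
  finally show "B (\<lambda>x. u x + c *\<^sub>R v x) (\<lambda>x. u x + c *\<^sub>R v x) \<le> (sqrt (B u u) + \<bar>c\<bar> * sqrt (B v v))\<^sup>2"
    unfolding expand[OF assms] using n by (simp add: power2_sum power_mult_distrib algebra_simps)
qed

text \<open>A minimising sequence of \<open>J u = B u u - 2 * F u\<close> is Cauchy by the
  parallelogram law, and its limit satisfies the Euler equation. Completeness is assumed
  sequentially for the seminorm of \<open>B\<close>, which fits a space of functions without passing
  to a quotient.\<close>

lemma Riesz:
  assumes complete: "\<And>s. \<lbrakk>\<And>n. s n \<in> V;
        \<And>e. e > 0 \<Longrightarrow> \<exists>K. \<forall>m\<ge>K. \<forall>n\<ge>K. B (sub (s m) (s n)) (sub (s m) (s n)) < e\<rbrakk> \<Longrightarrow>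
        \<exists>l\<in>V. (\<lambda>n::nat. B (sub (s n) l) (sub (s n) l)) \<longlonglongrightarrow> 0"
    and F_lin: "\<And>u v c. \<lbrakk>u \<in> V; v \<in> V\<rbrakk> \<Longrightarrow> F (\<lambda>x. u x + c *\<^sub>R v x) = F u + c * F v"
    and F_bound: "\<And>u. u \<in> V \<Longrightarrow> (F u)\<^sup>2 \<le> C * B u u"
  shows "\<exists>u\<in>V. \<forall>v\<in>V. B u v = F v"
proof -
  define J where "J u = B u u - 2 * F u" for u
  have C0: "(F u)\<^sup>2 \<le> \<bar>C\<bar> * B u u" if "u \<in> V" for u
    using F_bound[OF that] nonneg[OF that] by (meson abs_ge_self mult_right_mono order_trans)
  have bdd: "J u \<ge> - \<bar>C\<bar>" if "u \<in> V" for u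
  proof -
    have "2 * F u \<le> 2 * sqrt (\<bar>C\<bar> * B u u)"
      using C0[OF that] real_le_rsqrt by simp
    also have "\<dots> \<le> \<bar>C\<bar> + B u u"
      using arith_geo_mean_sqrt[of "\<bar>C\<bar>" "B u u"] nonneg[OF that] by simp
    finally show ?thesis unfolding J_def by simp
  qed
  define m where "m = Inf (J ` V)"
  have bb: "bdd_below (J ` V)" using bdd by (intro bdd_belowI2[where m="-\<bar>C\<bar>"]) auto
  have m_le: "m \<le> J u" if "u \<in> V" for u unfolding m_def using bb that by (rule cINF_lower)
  have "\<exists>u\<in>V. J u < m + 1 / real (Suc n)" for n
  proof -
    have "\<exists>x\<in>J ` V. x < m + 1 / real (Suc n)"
      unfolding m_def using nonempty bb by (intro cInf_lessD) auto
    then show ?thesis by blast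
  qed
  then obtain s where s: "\<And>n. s n \<in> V" "\<And>n. J (s n) < m + 1 / real (Suc n)" by metis
  have Jexp: "J (\<lambda>x. u x + c *\<^sub>R v x) = J u + 2 * c * (B u v - F v) + c\<^sup>2 * B v v" if "u \<in> V" "v \<in> V" for u v c
    unfolding J_def using that by (simp add: expand F_lin algebra_simps)
  have near: "B (sub (s k) (s n)) (sub (s k) (s n)) \<le> 2 / real (Suc k) + 2 / real (Suc n)" for k n
  proof -
    let ?d = "sub (s n) (s k)"
    have d: "?d \<in> V" using s diff by auto
    \<comment> \<open>The infimum is compared with the midpoint of \<open>s k\<close> and
      \<open>s n\<close>. Eliminating the first-order term by the expansion of
      \<open>J (s n)\<close> bounds a quarter of \<open>B ?d ?d\<close> by the average excess of the
      two values over \<open>m\<close>.\<close>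
    have "m \<le> J (\<lambda>x. s k x + (1/2) *\<^sub>R ?d x)" using m_le lincomb s d by blast
    also have "\<dots> = J (s k) + (B (s k) ?d - F ?d) + (1/4) * B ?d ?d"
      using Jexp[of "s k" ?d "1/2"] s d by (simp add: power2_eq_square)
    finally have 1: "m \<le> J (s k) + (B (s k) ?d - F ?d) + (1/4) * B ?d ?d" .
    have "J (s n) = J (\<lambda>x. s k x + 1 *\<^sub>R ?d x)" by simp
    also have "\<dots> = J (s k) + 2 * (B (s k) ?d - F ?d) + B ?d ?d" using Jexp[of "s k" ?d 1] s d by simp
    finally have 2: "J (s n) = J (s k) + 2 * (B (s k) ?d - F ?d) + B ?d ?d" .
    have "B ?d ?d \<le> 2 * (J (s k) - m) + 2 * (J (s n) - m)" using 1 2 by simp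
    also have "\<dots> \<le> 2 * (1 / real (Suc k)) + 2 * (1 / real (Suc n))" 
      using s(2)[of k] s(2)[of n] by (intro add_mono mult_left_mono) auto
    finally have 3: "B ?d ?d \<le> 2 / real (Suc k) + 2 / real (Suc n)" by simp
    have "sub (s k) (s n) = (\<lambda>x. s k x + (-1) *\<^sub>R s n x)" "?d = (\<lambda>x. s n x + (-1) *\<^sub>R s k x)" by auto
    then have "B (sub (s k) (s n)) (sub (s k) (s n)) = B ?d ?d"
      using expand[of "s k" "s n" "-1"] expand[of "s n" "s k" "-1"] s sym[of "s k" "s n"] by simp
    then show ?thesis using 3 by simp
  qed
  have "\<exists>l\<in>V. (\<lambda>n. B (sub (s n) l) (sub (s n) l)) \<longlonglongrightarrow> 0"
  proof (rule complete)
    show "s n \<in> V" for n using s by auto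
    show "\<exists>K. \<forall>k\<ge>K. \<forall>n\<ge>K. B (sub (s k) (s n)) (sub (s k) (s n)) < e" if "e > 0" for e
    proof -
      obtain K where K: "4 / e < real K" using reals_Archimedean2 by blast
      have "2 / real (Suc k) < e / 2" if "k \<ge> K" for k
      proof -
        have "4 / e < real (Suc k)" using K that by simp
        then show ?thesis using \<open>e > 0\<close> by (simp add: field_simps)
      qed
      then have "2 / real (Suc k) + 2 / real (Suc n) < e" if "k \<ge> K" "n \<ge> K" for k n
        using that by (metis add_strict_mono field_sum_of_halves)
      then show ?thesis using near by (meson le_less_trans)
    qed
  qed
  then obtain l where l: "l \<in> V" "(\<lambda>n. B (sub (s n) l) (sub (s n) l)) \<longlonglongrightarrow> 0" by blast
  have "B l v = F v" if v: "v \<in> V" for v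
  proof -
    \<comment> \<open>A near-minimiser nearly solves the Euler equation: along \<open>v\<close> the
      functional can drop by at most \<open>1 / real (Suc n)\<close>, and the discriminant turns
      this into a bound for the residual.\<close>
    have *: "(B (s n) v - F v)\<^sup>2 \<le> 1 / real (Suc n) * B v v" for n
    proof (rule quadratic_bound)
      show "0 \<le> B v v" using nonneg v by auto
      show "- (1 / real (Suc n)) \<le> 2 * c * (B (s n) v - F v) + c\<^sup>2 * B v v" for c
        using m_le[OF lincomb[OF s(1)[of n] v, of c]] Jexp[OF s(1)[of n] v, of c] s(2)[of n] by linarith
    qed
    have "(\<lambda>n. 1 / real (Suc n)) \<longlonglongrightarrow> 0" by (rule LIMSEQ_Suc[OF lim_1_over_n])
    from tendsto_mult_right[OF this, of "B v v"] have lim0: "(\<lambda>n. 1 / real (Suc n) * B v v) \<longlonglongrightarrow> 0" by (simp only: mult_zero_left)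
    have "(\<lambda>n. (B (s n) v - F v)\<^sup>2) \<longlonglongrightarrow> 0"
      by (rule tendsto_sandwich[OF always_eventually always_eventually tendsto_const lim0]) (use * in \<open>auto simp del: of_nat_Suc\<close>)
    then have 1: "(\<lambda>n. B (s n) v - F v) \<longlonglongrightarrow> 0" by (simp add: power_tendsto_0_iff)
    from tendsto_mult_right[OF l(2), of "B v v"]
    have lim: "(\<lambda>n. B (sub (s n) l) (sub (s n) l) * B v v) \<longlonglongrightarrow> 0" by (simp only: mult_zero_left)
    have le: "(B (s n) v - B l v)\<^sup>2 \<le> B (sub (s n) l) (sub (s n) l) * B v v" for n
      using Cauchy_Schwarz[OF diff[OF s(1)[of n] l(1)] v] lin_diff[OF s(1)[of n] l(1) v] by simp
    have "(\<lambda>n. (B (s n) v - B l v)\<^sup>2) \<longlonglongrightarrow> 0"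
      by (rule tendsto_sandwich[OF always_eventually always_eventually tendsto_const lim]) (use le in auto)
    then have 2: "(\<lambda>n. B (s n) v - B l v) \<longlonglongrightarrow> 0" by (simp add: power_tendsto_0_iff)
    have "(\<lambda>n. (B (s n) v - F v) - (B (s n) v - B l v)) \<longlonglongrightarrow> 0 - 0" by (intro tendsto_diff 1 2)
    then have "(\<lambda>n::nat. B l v - F v) \<longlonglongrightarrow> 0" by simp
    then show ?thesis by (simp add: LIMSEQ_const_iff)
  qed
  then show ?thesis using l(1) by blast
qed

end

lemma L2_inner_integrable:
  fixes f g :: "'a \<Rightarrow> 'b::euclidean_space"
  assumes "f \<in> L2 M" "g \<in> L2 M"
  shows "integrable M (\<lambda>x. f x \<bullet> g x)"
proof (rule Bochner_Integration.integrable_bound)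
  show "integrable M (\<lambda>x. (norm (f x))\<^sup>2 + (norm (g x))\<^sup>2)" using assms by (simp add: L2_def)
  show "(\<lambda>x. f x \<bullet> g x) \<in> borel_measurable M" using assms by (auto simp: L2_def)
  have "norm (f x \<bullet> g x) \<le> norm ((norm (f x))\<^sup>2 + (norm (g x))\<^sup>2)" for x
  proof -
    have "\<bar>f x \<bullet> g x\<bar> \<le> norm (f x) * norm (g x)" by (rule Cauchy_Schwarz_ineq2)
    also have "\<dots> \<le> (norm (f x))\<^sup>2 + (norm (g x))\<^sup>2"
      using sum_squares_bound[of "norm (f x)" "norm (g x)"] mult_nonneg_nonneg[OF norm_ge_zero norm_ge_zero, of "f x" "g x"]
      by linarith
    finally show ?thesis by simp
  qed
  then show "AE x in M. norm (f x \<bullet> g x) \<le> norm ((norm (f x))\<^sup>2 + (norm (g x))\<^sup>2)" by simp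
qed

lemma L2_lincomb:
  fixes f g :: "'a \<Rightarrow> 'b::euclidean_space"
  assumes "f \<in> L2 M" "g \<in> L2 M"
  shows "(\<lambda>x. f x + c *\<^sub>R g x) \<in> L2 M"
proof -
  have e: "(norm (f x + c *\<^sub>R g x))\<^sup>2 = (norm (f x))\<^sup>2 + 2 * c * (f x \<bullet> g x) + c\<^sup>2 * (norm (g x))\<^sup>2" for x
    unfolding power2_norm_eq_inner inner_add_left inner_add_right inner_scaleR_left inner_scaleR_right
      inner_commute[of "g x" "f x"] by (simp add: algebra_simps power2_eq_square)
  have [measurable]: "f \<in> borel_measurable M" "g \<in> borel_measurable M" 
    and i: "integrable M (\<lambda>x. (norm (f x))\<^sup>2)" "integrable M (\<lambda>x. (norm (g x))\<^sup>2)"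
    using assms by (auto simp: L2_def)
  have "integrable M (\<lambda>x. (norm (f x + c *\<^sub>R g x))\<^sup>2)"
    unfolding e by (intro Bochner_Integration.integrable_add integrable_mult_right i L2_inner_integrable assms)
  moreover have "(\<lambda>x. f x + c *\<^sub>R g x) \<in> borel_measurable M" by measurable
  ultimately show ?thesis unfolding L2_def by blast
qed

lemma L2_zero: "(\<lambda>_. 0) \<in> L2 M" by (simp add: L2_def)

interpretation L2: semi_inner "L2 M :: ('a \<Rightarrow> 'b::euclidean_space) set" "\<lambda>f g. LINT x|M. f x \<bullet> g x"
proof
  show "L2 M \<noteq> {}" using L2_zero by blast
  show "(LINT x|M. (u x + c *\<^sub>R v x) \<bullet> w x) = (LINT x|M. u x \<bullet> w x) + c * (LINT x|M. v x \<bullet> w x)"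
    if "u \<in> L2 M" "v \<in> L2 M" "w \<in> L2 M" for u v w :: "'a \<Rightarrow> 'b" and c
    using that by (simp add: inner_add_left L2_inner_integrable)
qed (auto simp: L2_lincomb inner_commute)

lemma L2norm_sq_eq: "L2norm M f = sqrt (LINT x|M. f x \<bullet> f x)"
  by (simp add: L2norm_def power2_norm_eq_inner)

lemma L2norm_power2: "(L2norm M f)\<^sup>2 = (LINT x|M. (norm (f x))\<^sup>2)"
  by (simp add: L2norm_def)

lemma L2norm_nonneg [simp]: "0 \<le> L2norm M f"
  by (simp add: L2norm_def)

lemmas L2_diff = L2.diff

lemma L2_add: "f \<in> L2 M \<Longrightarrow> g \<in> L2 M \<Longrightarrow> (\<lambda>x. f x + g x) \<in> L2 M"
  using L2_lincomb[of f M g 1] by simp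

lemma L2_inner_bound:
  assumes "f \<in> L2 M" "g \<in> L2 M"
  shows "\<bar>LINT x|M. f x \<bullet> g x\<bar> \<le> L2norm M f * L2norm M g"
  using L2.Cauchy_Schwarz_sqrt[OF assms] by (simp add: L2norm_sq_eq)

lemma L2norm_add_le:
  assumes "f \<in> L2 M" "g \<in> L2 M"
  shows "L2norm M (\<lambda>x. f x + g x) \<le> L2norm M f + L2norm M g"
  using L2.triangle[OF assms, of 1] by (simp add: L2norm_sq_eq)

lemma L2norm_diff_le:
  assumes "f \<in> L2 M" "g \<in> L2 M"
  shows "L2norm M (\<lambda>x. f x - g x) \<le> L2norm M f + L2norm M g"
  using L2.triangle[OF assms, of "-1"] by (simp add: L2norm_sq_eq)

lemma L2norm_triangle_sub:
  assumes "f \<in> L2 M" "g \<in> L2 M"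
  shows "L2norm M f \<le> L2norm M g + L2norm M (\<lambda>x. f x - g x)"
  using L2norm_add_le[OF assms(2) L2_diff[OF assms]] by simp

lemma L2norm_minus_commute: "L2norm M (\<lambda>x. f x - g x) = L2norm M (\<lambda>x. g x - f x)"
  by (simp add: L2norm_def norm_minus_commute)

lemma L2norm_cong_AE:
  assumes "AE x in M. f x = g x" "f \<in> borel_measurable M" "g \<in> borel_measurable M"
  shows "L2norm M f = L2norm M g"
  unfolding L2norm_def using assms by (intro arg_cong[where f=sqrt] integral_cong_AE) auto

lemma L2_cong_AE:
  assumes "f \<in> L2 M" "AE x in M. f x = g x" "g \<in> borel_measurable M"
  shows "g \<in> L2 M"
  using assms unfolding L2_def
  by (auto elim!: integrable_cong_AE_imp)

lemma L2norm_eq_0: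
  assumes "f \<in> L2 M" "L2norm M f = 0" shows "AE x in M. f x = 0"
proof -
  have "(LINT x|M. (norm (f x))\<^sup>2) = 0" using assms L2norm_power2[of M f] by simp
  then have "AE x in M. (norm (f x))\<^sup>2 = 0"
    using assms by (subst (asm) integral_nonneg_eq_0_iff_AE) (auto simp: L2_def)
  then show ?thesis by simp
qed

text \<open>Riesz-Fischer for vector values: a rapidly converging subsequence has a limit almost
  everywhere, and Fatou's lemma makes this the limit in norm of the whole sequence.\<close>

lemma L2_complete:
  fixes f :: "nat \<Rightarrow> 'a \<Rightarrow> 'b::euclidean_space"
  assumes f: "\<And>n. f n \<in> L2 M"
    and Cauchy: "\<And>e. e > 0 \<Longrightarrow> \<exists>K. \<forall>m\<ge>K. \<forall>n\<ge>K. L2norm M (\<lambda>x. f m x - f n x) < e"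
  shows "\<exists>g\<in>L2 M. (\<lambda>n. L2norm M (\<lambda>x. f n x - g x)) \<longlonglongrightarrow> 0"
proof -
  have fm[measurable]: "f n \<in> borel_measurable M" for n using f by (auto simp: L2_def)
  have fi: "integrable M (\<lambda>x. (norm (f m x - f n x))\<^sup>2)" for m n
    using L2_diff[OF f f, of m n] by (simp add: L2_def)
  have nn: "(\<integral>\<^sup>+x. ennreal ((norm (f m x - f n x))\<^sup>2) \<partial>M) = ennreal ((L2norm M (\<lambda>x. f m x - f n x))\<^sup>2)" for m n
    by (subst nn_integral_eq_integral[OF fi]) (auto simp: L2norm_power2)
  have "\<exists>r. \<forall>n. (\<forall>k\<ge>r n. \<forall>l\<ge>r n. L2norm M (\<lambda>x. f k x - f l x) < (1/2)^n) \<and> r n < r (Suc n)"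
  proof (rule dependent_nat_choice)
    show "\<exists>x. \<forall>k\<ge>x. \<forall>l\<ge>x. L2norm M (\<lambda>x. f k x - f l x) < (1/2)^0" using Cauchy[of 1] by auto
    fix x n
    obtain K where K: "\<forall>k\<ge>K. \<forall>l\<ge>K. L2norm M (\<lambda>x. f k x - f l x) < (1/2)^(Suc n)"
      using Cauchy[of "(1/2)^(Suc n)"] by auto
    show "\<exists>y. (\<forall>k\<ge>y. \<forall>l\<ge>y. L2norm M (\<lambda>x. f k x - f l x) < (1/2)^(Suc n)) \<and> x < y"
      using K by (intro exI[of _ "max K (Suc x)"]) auto
  qed
  then obtain r where r: "\<And>n k l. k \<ge> r n \<Longrightarrow> l \<ge> r n \<Longrightarrow> L2norm M (\<lambda>x. f k x - f l x) < (1/2)^n"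
      "\<And>n. r n < r (Suc n)" by auto
  have mono: "strict_mono r" using r(2) by (simp add: strict_mono_Suc_iff)
  \<comment> \<open>The squares of the increments have integrals at most \<open>(1/4)^n\<close>, so
    they stay summable after weighting with \<open>2^n\<close>. Then \<open>2 * norm (d n x) \<le>
    2^n * (norm (d n x))\<^sup>2 + (1/2)^n\<close> yields absolute convergence almost
    everywhere.\<close>
  define d where "d n x = f (r (Suc n)) x - f (r n) x" for n x
  have dm[measurable]: "d n \<in> borel_measurable M" for n unfolding d_def by measurable
  have "(\<integral>\<^sup>+x. (\<Sum>n. ennreal (2^n * (norm (d n x))\<^sup>2)) \<partial>M) = (\<Sum>n. \<integral>\<^sup>+x. ennreal (2^n * (norm (d n x))\<^sup>2) \<partial>M)"
    by (rule nn_integral_suminf) measurable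
  also have "\<dots> \<le> (\<Sum>n. ennreal ((1/2)^n))"
  proof (intro suminf_le)
    fix n
    have "(\<integral>\<^sup>+x. ennreal (2^n * (norm (d n x))\<^sup>2) \<partial>M) = ennreal (2^n) * ennreal ((L2norm M (d n))\<^sup>2)"
    proof -
      have "d n = (\<lambda>x. f (r (Suc n)) x - f (r n) x)" by (auto simp: d_def)
      then have "(\<integral>\<^sup>+x. ennreal ((norm (d n x))\<^sup>2) \<partial>M) = ennreal ((L2norm M (d n))\<^sup>2)" using nn by simp
      moreover have "(\<integral>\<^sup>+x. ennreal (2^n * (norm (d n x))\<^sup>2) \<partial>M) = ennreal (2^n) * (\<integral>\<^sup>+x. ennreal ((norm (d n x))\<^sup>2) \<partial>M)"
        by (simp add: ennreal_mult' nn_integral_cmult)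
      ultimately show ?thesis by simp
    qed
    also have "\<dots> \<le> ennreal (2^n) * ennreal (((1/2)^n)\<^sup>2)"
      using r(1)[of n "r (Suc n)" "r n"] r(2)[of n] unfolding d_def[abs_def]
      by (intro mult_left_mono ennreal_leI power_mono) auto
    also have "\<dots> = ennreal ((1/2)^n)"
      by (subst ennreal_mult[symmetric]) (auto simp: power2_eq_square power_mult_distrib[symmetric] field_simps)
    finally show "(\<integral>\<^sup>+x. ennreal (2^n * (norm (d n x))\<^sup>2) \<partial>M) \<le> ennreal ((1/2)^n)" .
  qed auto
  also have "\<dots> < \<infinity>"
    by (subst suminf_ennreal2) (auto simp: summable_geometric)
  finally have "AE x in M. (\<Sum>n. ennreal (2^n * (norm (d n x))\<^sup>2)) \<noteq> \<infinity>"
    by (intro nn_integral_PInf_AE) auto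
  then have conv: "AE x in M. (\<lambda>n. f (r n) x) \<longlonglongrightarrow> lim (\<lambda>n. f (r n) x)"
  proof eventually_elim
    case (elim x)
    have "summable (\<lambda>n. 2^n * (norm (d n x))\<^sup>2)"
      by (rule summable_suminf_not_top) (use elim in auto)
    then have s: "summable (\<lambda>n. 2^n * (norm (d n x))\<^sup>2 + (1/2)^n)"
      by (intro summable_add summable_geometric) auto
    have "summable (\<lambda>n. norm (d n x))"
    proof (rule summable_comparison_test[OF _ s], intro exI allI impI)
      fix n :: nat
      have "norm (d n x) = (2^n * (norm (d n x))) * (1/2)^n" by (simp add: field_simps)
      have "0 \<le> (2^n * norm (d n x) - 1)\<^sup>2" by simp
      then have "2 * (2^n * norm (d n x)) \<le> (2^n * norm (d n x))\<^sup>2 + 1" by (simp add: power2_diff)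
      then have "2 * norm (d n x) \<le> 2^n * (norm (d n x))\<^sup>2 + (1/2)^n"
        by (simp add: field_simps power2_eq_square)
      then show "norm (norm (d n x)) \<le> 2^n * (norm (d n x))\<^sup>2 + (1/2)^n"
        using norm_ge_zero[of "d n x"] by (simp only: real_norm_def abs_norm_cancel)
    qed
    then have "summable (\<lambda>n. d n x)" by (rule summable_norm_cancel)
    then have "(\<lambda>n. (\<Sum>i<n. d i x) + f (r 0) x) \<longlonglongrightarrow> suminf (\<lambda>n. d n x) + f (r 0) x"
      by (intro tendsto_add summable_LIMSEQ tendsto_const)
    moreover have "(\<Sum>i<n. d i x) + f (r 0) x = f (r n) x" for n
      unfolding d_def by (subst sum_lessThan_telescope) simp
    ultimately have "convergent (\<lambda>n. f (r n) x)" by (auto simp: convergent_def)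
    then show ?case by (simp add: convergent_LIMSEQ_iff)
  qed
  define g where "g x = lim (\<lambda>n. f (r n) x)" for x
  have gm[measurable]: "g \<in> borel_measurable M" unfolding g_def by (rule borel_measurable_lim_metric) auto
  \<comment> \<open>Fatou along the subsequence: the squared distance from \<open>f m\<close> to the
    limit is at most the lower limit of its squared distances to \<open>f (r n)\<close>.\<close>
  have close: "(\<integral>\<^sup>+x. ennreal ((norm (f m x - g x))\<^sup>2) \<partial>M) \<le> ennreal (((1/2)^k)\<^sup>2)" if "m \<ge> r k" for m k
  proof -
    have "(\<integral>\<^sup>+x. ennreal ((norm (f m x - g x))\<^sup>2) \<partial>M) 
       = (\<integral>\<^sup>+x. liminf (\<lambda>n. ennreal ((norm (f m x - f (r n) x))\<^sup>2)) \<partial>M)"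
    proof (rule nn_integral_cong_AE)
      show "AE x in M. ennreal ((norm (f m x - g x))\<^sup>2) = liminf (\<lambda>n. ennreal ((norm (f m x - f (r n) x))\<^sup>2))"
        using conv
      proof eventually_elim
        case (elim x)
        then have "(\<lambda>n. ennreal ((norm (f m x - f (r n) x))\<^sup>2)) \<longlonglongrightarrow> ennreal ((norm (f m x - g x))\<^sup>2)"
          unfolding g_def by (intro tendsto_ennrealI tendsto_intros)
        then show ?case by (rule lim_imp_Liminf[OF trivial_limit_sequentially, symmetric])
      qed
    qed
    also have "\<dots> \<le> liminf (\<lambda>n. \<integral>\<^sup>+x. ennreal ((norm (f m x - f (r n) x))\<^sup>2) \<partial>M)"
      by (rule nn_integral_liminf) measurable
    also have "\<dots> \<le> ennreal (((1/2)^k)\<^sup>2)"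
    proof -
      have "\<forall>\<^sub>F n in sequentially. (\<integral>\<^sup>+x. ennreal ((norm (f m x - f (r n) x))\<^sup>2) \<partial>M) \<le> ennreal (((1/2)^k)\<^sup>2)"
        using eventually_ge_at_top[of k]
      proof eventually_elim
        case (elim n)
        then have "r k \<le> r n" using mono by (simp add: strict_mono_less_eq)
        then show ?case unfolding nn using r(1)[of k m "r n"] that
          by (intro ennreal_leI power_mono) auto
      qed
      then show ?thesis by (intro Liminf_le) auto
    qed
    finally show ?thesis .
  qed
  have int: "(\<lambda>x. f m x - g x) \<in> L2 M" if "m \<ge> r k" for m k
  proof -
    have "(\<integral>\<^sup>+x. ennreal ((norm (f m x - g x))\<^sup>2) \<partial>M) < \<infinity>"
      using le_less_trans[OF close[OF that] ennreal_less_top] by simp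
    then have "integrable M (\<lambda>x. (norm (f m x - g x))\<^sup>2)" by (intro integrableI_bounded) auto
    then show ?thesis by (simp add: L2_def)
  qed
  have "g \<in> L2 M"
    using L2_diff[OF f[of "r 0"] int[of 0 "r 0"]] by simp
  moreover have bound: "L2norm M (\<lambda>x. f m x - g x) \<le> (1/2)^k" if "m \<ge> r k" for m k
  proof -
    have "ennreal ((L2norm M (\<lambda>x. f m x - g x))\<^sup>2) \<le> ennreal (((1/2)^k)\<^sup>2)"
      using close[OF that] int[OF that] by (subst (asm) nn_integral_eq_integral) (auto simp: L2_def L2norm_power2)
    then have "(L2norm M (\<lambda>x. f m x - g x))\<^sup>2 \<le> ((1/2)^k)\<^sup>2" by (simp add: ennreal_le_iff)
    then show ?thesis by (rule power2_le_imp_le) simp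
  qed
  have "(\<lambda>n. L2norm M (\<lambda>x. f n x - g x)) \<longlonglongrightarrow> 0"
  proof (rule LIMSEQ_I)
    fix e :: real assume "e > 0"
    then obtain k where "(1/2)^k < e" using real_arch_pow_inv[of e "1/2"] by auto
    then have "\<forall>n\<ge>r k. norm (L2norm M (\<lambda>x. f n x - g x) - 0) < e"
      using bound le_less_trans by fastforce
    then show "\<exists>no. \<forall>n\<ge>no. norm (L2norm M (\<lambda>x. f n x - g x) - 0) < e" by blast
  qed
  ultimately show ?thesis by blast
qed

lemma L2_limit_inner:
  fixes f :: "nat \<Rightarrow> 'a \<Rightarrow> 'b::euclidean_space"
  assumes "\<And>n. f n \<in> L2 M" "g \<in> L2 M" "h \<in> L2 M" "(\<lambda>n. L2norm M (\<lambda>x. f n x - g x)) \<longlonglongrightarrow> 0"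
  shows "(\<lambda>n. LINT x|M. f n x \<bullet> h x) \<longlonglongrightarrow> (LINT x|M. g x \<bullet> h x)"
proof (rule LIM_zero_cancel, rule tendsto_0_le[where K="L2norm M h"])
  show "(\<lambda>n. L2norm M (\<lambda>x. f n x - g x)) \<longlonglongrightarrow> 0" by fact
  show "\<forall>\<^sub>F n in sequentially. norm ((LINT x|M. f n x \<bullet> h x) - (LINT x|M. g x \<bullet> h x)) \<le> norm (L2norm M (\<lambda>x. f n x - g x)) * L2norm M h"
  proof (rule always_eventually, rule allI)
    fix n
    have "(LINT x|M. f n x \<bullet> h x) - (LINT x|M. g x \<bullet> h x) = (LINT x|M. (f n x - g x) \<bullet> h x)"
      using L2.lin_diff[OF assms(1)[of n] assms(2,3)] by simp
    then show "norm ((LINT x|M. f n x \<bullet> h x) - (LINT x|M. g x \<bullet> h x)) \<le> norm (L2norm M (\<lambda>x. f n x - g x)) * L2norm M h"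
      using L2_inner_bound[OF L2_diff[OF assms(1)[of n] assms(2)] assms(3)] by simp
  qed
qed

section \<open>Test functions\<close>

lemma Ck_0 [simp]: "Ck k (\<lambda>_. 0)"
proof (induction k)
  case (Suc k)
  have "pderiv_at i (\<lambda>_. 0) = (\<lambda>_. 0)" for i by (auto simp: pderiv_at_def)
  then show ?case using Suc by simp
qed simp

lemma Ck_Suc_differentiable: "Ck (Suc k) \<phi> \<Longrightarrow> \<phi> differentiable (at x)"
  by (simp add: differentiable_on_def)

lemma frechet_at: "\<phi> differentiable (at x) \<Longrightarrow> (\<phi> has_derivative frechet_derivative \<phi> (at x)) (at x)"
  by (simp add: frechet_derivative_works)

lemma pderiv_atI: "(\<phi> has_derivative D) (at x) \<Longrightarrow> pderiv_at i \<phi> x = D (axis i 1)"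
  by (metis frechet_derivative_at pderiv_at_def)

lemma Ck_Suc_imp: "Ck (Suc k) \<phi> \<Longrightarrow> Ck k \<phi>"
proof (induction k arbitrary: \<phi>)
  case 0
  then show ?case by (auto simp: differentiable_imp_continuous_on)
next
  case (Suc k)
  then show ?case by auto
qed

lemma Ck_add: "Ck k \<phi> \<Longrightarrow> Ck k \<psi> \<Longrightarrow> Ck k (\<lambda>x. \<phi> x + \<psi> x)"
proof (induction k arbitrary: \<phi> \<psi>)
  case (Suc k)
  have "pderiv_at i (\<lambda>x. \<phi> x + \<psi> x) = (\<lambda>x. pderiv_at i \<phi> x + pderiv_at i \<psi> x)" for i
  proof
    fix x
    show "pderiv_at i (\<lambda>x. \<phi> x + \<psi> x) x = pderiv_at i \<phi> x + pderiv_at i \<psi> x"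
      using pderiv_atI[OF has_derivative_add[OF frechet_at[OF Ck_Suc_differentiable[OF Suc.prems(1)]]
          frechet_at[OF Ck_Suc_differentiable[OF Suc.prems(2)]]]]
      by (simp add: pderiv_at_def)
  qed
  then show ?case using Suc by (auto simp: differentiable_on_def)
qed (auto intro: continuous_intros)

lemma Ck_mult: "Ck k \<phi> \<Longrightarrow> Ck k \<psi> \<Longrightarrow> Ck k (\<lambda>x. \<phi> x * \<psi> x)"
proof (induction k arbitrary: \<phi> \<psi>)
  case (Suc k)
  have "pderiv_at i (\<lambda>x. \<phi> x * \<psi> x) = (\<lambda>x. \<phi> x * pderiv_at i \<psi> x + pderiv_at i \<phi> x * \<psi> x)" for i
  proof
    fix x
    show "pderiv_at i (\<lambda>x. \<phi> x * \<psi> x) x = \<phi> x * pderiv_at i \<psi> x + pderiv_at i \<phi> x * \<psi> x"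
      using pderiv_atI[OF has_derivative_mult[OF frechet_at[OF Ck_Suc_differentiable[OF Suc.prems(1)]]
          frechet_at[OF Ck_Suc_differentiable[OF Suc.prems(2)]]]]
      by (simp add: pderiv_at_def)
  qed
  moreover have "Ck k (\<lambda>x. \<phi> x * pderiv_at i \<psi> x + pderiv_at i \<phi> x * \<psi> x)" for i
    using Suc.prems Ck_Suc_imp[OF Suc.prems(1)] Ck_Suc_imp[OF Suc.prems(2)]
    by (intro Ck_add Suc.IH) auto
  ultimately show ?case using Suc.prems by (auto simp: differentiable_on_def)
qed (auto intro: continuous_intros)

lemma Ck_const: "Ck k (\<lambda>_. c)"
proof (cases k)
  case (Suc k)
  have "pderiv_at i (\<lambda>_. c) = (\<lambda>_. 0)" for i by (auto simp: pderiv_at_def)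
  then show ?thesis using Suc by simp
qed simp

lemma Ck_affine_comp:
  assumes "Ck k \<phi>" and "c \<noteq> 0"
  shows "Ck k (\<lambda>x. \<phi> (a + c *\<^sub>R x))"
  using assms
proof (induction k arbitrary: \<phi>)
  case 0
  then show ?case by (auto intro!: continuous_intros continuous_on_compose2[of UNIV \<phi>])
next
  case (Suc k)
  have D: "((\<lambda>x. \<phi> (a + c *\<^sub>R x)) has_derivative (\<lambda>h. frechet_derivative \<phi> (at (a + c *\<^sub>R x)) (c *\<^sub>R h))) (at x)" for x
    by (rule has_derivative_compose[of "\<lambda>x. a + c *\<^sub>R x" "\<lambda>h. c *\<^sub>R h", OF _ frechet_at[OF Ck_Suc_differentiable[OF Suc.prems(1)]]])
      (auto intro!: derivative_eq_intros)
  have "pderiv_at i (\<lambda>x. \<phi> (a + c *\<^sub>R x)) = (\<lambda>x. c * pderiv_at i \<phi> (a + c *\<^sub>R x))" for i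
  proof
    fix x
    have "linear (frechet_derivative \<phi> (at (a + c *\<^sub>R x)))"
      using frechet_at[OF Ck_Suc_differentiable[OF Suc.prems(1)]] has_derivative_linear by blast
    then show "pderiv_at i (\<lambda>x. \<phi> (a + c *\<^sub>R x)) x = c * pderiv_at i \<phi> (a + c *\<^sub>R x)"
      unfolding pderiv_atI[OF D] by (simp add: pderiv_at_def linear_scale)
  qed
  moreover have "Ck k (\<lambda>x. c * pderiv_at i \<phi> (a + c *\<^sub>R x))" for i
    using Suc by (intro Ck_mult Ck_const Suc.IH) auto
  ultimately show ?case using D by (auto simp: differentiable_on_def differentiable_def)
qed

text \<open>\<open>F\<close> is the whole sequence of derivatives, so that a partial derivative of
  the composition has the same form up to a constant factor and the induction on \<open>k\<close>
  closes.\<close>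

lemma Ck_smooth_coord:
  fixes F :: "nat \<Rightarrow> real \<Rightarrow> real"
  assumes "\<And>n t. (F n has_real_derivative F (Suc n) t) (at t)"
  shows "Ck k (\<lambda>x. F n (a + c * x $ j))"
proof (induction k arbitrary: n)
  case 0
  have "continuous_on UNIV (F n)" using assms DERIV_continuous_on by blast
  then show ?case by (auto intro!: continuous_intros continuous_on_compose2[of UNIV "F n"])
next
  case (Suc k)
  have D: "((\<lambda>x. F n (a + c * x $ j)) has_derivative (\<lambda>h. F (Suc n) (a + c * x $ j) * (c * h $ j))) (at x)" for x :: "real^2"
  proof (rule has_derivative_compose[of "\<lambda>x. a + c * x $ j" "\<lambda>h. c * h $ j"])
    show "((\<lambda>x. a + c * x $ j) has_derivative (\<lambda>h. c * h $ j)) (at x)"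
      by (auto intro!: derivative_eq_intros bounded_linear_imp_has_derivative bounded_linear_vec_nth)
    show "(F n has_derivative (\<lambda>b. F (Suc n) (a + c * x $ j) * b)) (at (a + c * x $ j))"
      using assms by (simp add: has_field_derivative_def)
  qed
  have "pderiv_at i (\<lambda>x. F n (a + c * x $ j)) = (\<lambda>x. (if i = j then c else 0) * F (Suc n) (a + c * x $ j))" for i
    by (rule ext) (auto simp: pderiv_atI[OF D] axis_def)
  then have "Ck k (pderiv_at i (\<lambda>x. F n (a + c * x $ j)))" for i
    by (simp add: Ck_mult Ck_const Suc.IH del: Ck.simps)
  then show ?case using D by (auto simp: differentiable_on_def differentiable_def)
qed

text \<open>The derivatives of \<open>exp (- 1 / t)\<close> (extended by 0 to \<open>t \<le> 0\<close>) are \<open>p (1 / t) exp (- 1 / t)\<close>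
  with polynomials \<open>p\<close>, and \<open>(p (s))' = - s\<^sup>2 p' (s)\<close> for \<open>s = 1 / t\<close>.\<close>

primrec flat_poly :: "nat \<Rightarrow> real poly" where
  "flat_poly 0 = 1"
| "flat_poly (Suc n) = monom 1 2 * (flat_poly n - pderiv (flat_poly n))"

definition flat :: "nat \<Rightarrow> real \<Rightarrow> real" where
  "flat n t = (if t > 0 then poly (flat_poly n) (1 / t) * exp (- 1 / t) else 0)"

lemma poly_exp_tendsto: "((\<lambda>t. poly p (1 / t) * exp (- 1 / t)) \<longlongrightarrow> (0::real)) (at_right 0)"
proof -
  have "((\<lambda>s. poly p s * exp (- s)) \<longlongrightarrow> 0) at_top"
  proof -
    have "((\<lambda>s. \<Sum>i\<le>degree p. coeff p i * (s ^ i / exp s)) \<longlongrightarrow> (\<Sum>i\<le>degree p. coeff p i * 0)) at_top"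
      by (intro tendsto_sum tendsto_mult tendsto_const tendsto_power_div_exp_0)
    moreover have "(\<Sum>i\<le>degree p. coeff p i * (s ^ i / exp s)) = poly p s * exp (- s)" for s
      by (simp add: poly_altdef exp_minus sum_distrib_right field_simps sum_divide_distrib)
    ultimately show ?thesis by simp
  qed
  from filterlim_compose[OF this filterlim_inverse_at_top_right]
  show ?thesis by (simp add: inverse_eq_divide)
qed

lemma flat_deriv: "(flat n has_real_derivative flat (Suc n) t) (at t)"
proof -
  consider "t > 0" | "t < 0" | "t = 0" by linarith
  then show ?thesis
  proof cases
    case 1
    have "((\<lambda>t. poly (flat_poly n) (1 / t) * exp (- 1 / t)) has_real_derivative flat (Suc n) t) (at t)"
      using 1 by (auto intro!: derivative_eq_intros poly_DERIV[THEN DERIV_chain2] 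
          simp: flat_def poly_monom field_simps power2_eq_square)
    then show ?thesis
      by (rule DERIV_cong_ev[THEN iffD1, rotated 3])
        (use 1 in \<open>auto simp: flat_def eventually_nhds intro!: exI[of _ "{0<..}"]\<close>)
  next
    case 2
    have "((\<lambda>_. 0) has_real_derivative flat (Suc n) t) (at t)" using 2 by (auto simp: flat_def)
    then show ?thesis
      by (rule DERIV_cong_ev[THEN iffD1, rotated 3])
        (use 2 in \<open>auto simp: flat_def eventually_nhds intro!: exI[of _ "{..<0}"]\<close>)
  next
    case 3
    \<comment> \<open>For positive \<open>h\<close> the difference quotient at 0 is
      \<open>s * p s * exp (- s)\<close> with \<open>s = 1 / h\<close>, again a polynomial times the
      exponential.\<close>
    have "((\<lambda>h. flat n h / h) \<longlongrightarrow> 0) (at_right 0)"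
    proof (rule Lim_transform_eventually[OF poly_exp_tendsto[of "monom 1 1 * flat_poly n"]])
      show "\<forall>\<^sub>F x in at_right 0. poly (monom 1 1 * flat_poly n) (1 / x) * exp (- 1 / x) = flat n x / x"
        by (auto simp: eventually_at_filter flat_def poly_monom intro!: always_eventually)
    qed
    moreover have "((\<lambda>h. flat n h / h) \<longlongrightarrow> 0) (at_left 0)"
    proof (rule Lim_transform_eventually[of "\<lambda>_. 0"])
      show "\<forall>\<^sub>F x in at_left 0. 0 = flat n x / x"
        by (auto simp: eventually_at_filter flat_def intro!: always_eventually)
    qed simp
    ultimately have "((\<lambda>h. flat n h / h) \<longlongrightarrow> 0) (at 0)" by (simp add: filterlim_split_at)
    then show ?thesis unfolding 3 DERIV_def by (simp add: flat_def)
  qed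
qed

lemma flat_0: "flat 0 t = (if t > 0 then exp (- 1 / t) else 0)"
  by (simp add: flat_def)

lemma flat_0_bounds: "0 \<le> flat 0 t" "flat 0 t \<le> 1"
  by (auto simp: flat_0)

lemma flat_0_tendsto: "(\<lambda>n. flat 0 (real n * t)) \<longlonglongrightarrow> (if t > 0 then 1 else 0)"
proof (cases "t > 0")
  case True
  have "(\<lambda>n. exp (- (1 / t) * (1 / real n))) \<longlonglongrightarrow> exp (- (1 / t) * 0)"
    by (intro tendsto_intros lim_1_over_n)
  then have "(\<lambda>n. exp (- (1 / t) * (1 / real n))) \<longlonglongrightarrow> 1" by simp
  then have "(\<lambda>n. flat 0 (real n * t)) \<longlonglongrightarrow> 1"
  proof (rule Lim_transform_eventually, intro eventually_mono[OF eventually_gt_at_top[of 0]])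
    fix n :: nat assume "0 < n"
    then show "exp (- (1 / t) * (1 / real n)) = flat 0 (real n * t)" using True by (simp add: flat_0)
  qed
  then show ?thesis using True by simp
next
  case False
  then have "\<not> real n * t > 0" for n by (auto simp: zero_less_mult_iff)
  then show ?thesis using False by (simp add: flat_0)
qed

text \<open>For \<open>n > 0\<close> a smooth function that is positive exactly on the open box;
  with growing \<open>n\<close> it steepens towards the indicator of the box. The limit recovers
  integrals over boxes from tests, and \<open>n = 1\<close> is the profile of the mollifier.\<close>

definition bump :: "nat \<Rightarrow> real^2 \<Rightarrow> real^2 \<Rightarrow> real^2 \<Rightarrow> real" where
  "bump n a b x = flat 0 (real n * (x $ 1 - a $ 1)) * flat 0 (real n * (b $ 1 - x $ 1)) *
     (flat 0 (real n * (x $ 2 - a $ 2)) * flat 0 (real n * (b $ 2 - x $ 2)))"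

lemma bump_bounds: "0 \<le> bump n a b x" "bump n a b x \<le> 1"
  unfolding bump_def by (intro mult_nonneg_nonneg mult_le_one flat_0_bounds)+

lemma Ck_bump: "Ck k (bump n a b)"
proof -
  have "Ck k (\<lambda>x. flat 0 (real n * (x $ j - a $ j)) * flat 0 (real n * (b $ j - x $ j)))" for j
    using Ck_mult[OF Ck_smooth_coord[of flat k 0 "- real n * a $ j" "real n" j, OF flat_deriv]
        Ck_smooth_coord[of flat k 0 "real n * b $ j" "- real n" j, OF flat_deriv]]
    by (simp add: algebra_simps)
  from Ck_mult[OF this[of 1] this[of 2]] show ?thesis unfolding bump_def[abs_def] .
qed

lemma bump_pos: "n > 0 \<Longrightarrow> x \<in> box a b \<Longrightarrow> bump n a b x > 0"
  by (auto simp: bump_def flat_0 mem_box_cart)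

lemma bump_0: "x \<notin> box a b \<Longrightarrow> bump n a b x = 0"
  by (auto simp: bump_def flat_0 mem_box_cart forall_2 zero_less_mult_iff)

lemma bump_tendsto: "(\<lambda>n. bump n a b x) \<longlonglongrightarrow> indicator (box a b) x"
proof -
  have "(\<lambda>n. bump n a b x) \<longlonglongrightarrow> (if 0 < x $ 1 - a $ 1 then 1 else 0) * (if 0 < b $ 1 - x $ 1 then 1 else 0) *
     ((if 0 < x $ 2 - a $ 2 then 1 else 0) * (if 0 < b $ 2 - x $ 2 then 1 else 0))"
    unfolding bump_def by (intro tendsto_mult flat_0_tendsto)
  then show ?thesis by (auto simp: indicator_def mem_box_cart forall_2 split: if_splits)
qed

lemma test_function_bump:
  assumes "cbox a b \<subseteq> S" shows "test_function S (bump n a b)"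
proof -
  have "{x. bump n a b x \<noteq> 0} \<subseteq> cbox a b" using bump_0 box_subset_cbox by blast
  then have "closure {x. bump n a b x \<noteq> 0} \<subseteq> cbox a b" by (rule closure_minimal[OF _ closed_cbox])
  moreover from this have "compact (closure {x. bump n a b x \<noteq> 0})"
    by (meson bounded_cbox bounded_subset closed_closure compact_eq_bounded_closed)
  ultimately show ?thesis unfolding test_function_def using Ck_bump assms by auto
qed

lemma test_function_translate:
  assumes "test_function UNIV \<phi>" "c \<noteq> 0"
  shows "test_function UNIV (\<lambda>x. \<phi> (a + c *\<^sub>R x))"
proof -
  have "{x. \<phi> (a + c *\<^sub>R x) \<noteq> 0} \<subseteq> (\<lambda>y. (1 / c) *\<^sub>R (y - a)) ` closure {x. \<phi> x \<noteq> 0}"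
  proof
    fix x assume "x \<in> {x. \<phi> (a + c *\<^sub>R x) \<noteq> 0}"
    then have "a + c *\<^sub>R x \<in> closure {x. \<phi> x \<noteq> 0}" by (intro subsetD[OF closure_subset]) auto
    then show "x \<in> (\<lambda>y. (1 / c) *\<^sub>R (y - a)) ` closure {x. \<phi> x \<noteq> 0}"
      using assms(2) by (intro image_eqI[of _ _ "a + c *\<^sub>R x"]) auto
  qed
  moreover have "compact ((\<lambda>y. (1 / c) *\<^sub>R (y - a)) ` closure {x. \<phi> x \<noteq> 0})"
    using assms by (intro compact_continuous_image continuous_intros) (auto simp: test_function_def)
  ultimately have "compact (closure {x. \<phi> (a + c *\<^sub>R x) \<noteq> 0})"
    unfolding compact_closure using bounded_subset[OF compact_imp_bounded] by blast
  then show ?thesis using assms Ck_affine_comp[of _ \<phi> c a] by (auto simp: test_function_def)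
qed

lemma test_function_mono: "test_function S \<phi> \<Longrightarrow> S \<subseteq> T \<Longrightarrow> test_function T \<phi>"
  by (auto simp: test_function_def)

lemma test_function_continuous:
  assumes "test_function S \<phi>" shows "continuous_on UNIV \<phi>" "continuous_on UNIV (pderiv_at i \<phi>)"
proof -
  have "Ck (Suc 0) \<phi>" using assms unfolding test_function_def by blast
  then show "continuous_on UNIV \<phi>" "continuous_on UNIV (pderiv_at i \<phi>)"
    by (auto simp: differentiable_imp_continuous_on)
qed

lemma test_function_has_derivative:
  assumes "test_function S \<phi>"
  shows "(\<phi> has_derivative (\<lambda>h. \<Sum>i\<in>UNIV. h $ i * pderiv_at i \<phi> x)) (at x)"
proof -
  have "Ck (Suc 0) \<phi>" using assms unfolding test_function_def by blast
  then have D: "(\<phi> has_derivative frechet_derivative \<phi> (at x)) (at x)" 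
    using frechet_at Ck_Suc_differentiable by blast
  then have l: "linear (frechet_derivative \<phi> (at x))" by (rule has_derivative_linear)
  have "frechet_derivative \<phi> (at x) h = (\<Sum>i\<in>UNIV. h $ i * pderiv_at i \<phi> x)" for h
  proof -
    have "h = (\<Sum>i\<in>UNIV. h $ i *\<^sub>R axis i 1)" by (metis basis_expansion scalar_mult_eq_scaleR)
    then have "frechet_derivative \<phi> (at x) h = frechet_derivative \<phi> (at x) (\<Sum>i\<in>UNIV. h $ i *\<^sub>R axis i 1)" by simp
    also have "\<dots> = (\<Sum>i\<in>UNIV. h $ i * pderiv_at i \<phi> x)"
      using l by (simp add: linear_sum linear_scale pderiv_at_def)
    finally show ?thesis .
  qed
  then have "frechet_derivative \<phi> (at x) = (\<lambda>h. \<Sum>i\<in>UNIV. h $ i * pderiv_at i \<phi> x)" by (rule ext)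
  with D show ?thesis by (simp only:)
qed

lemma test_function_outside:
  assumes "test_function S \<phi>" "x \<notin> closure {x. \<phi> x \<noteq> 0}"
  shows "\<phi> x = 0" "pderiv_at i \<phi> x = 0"
proof -
  have z: "\<phi> y = 0" if "y \<notin> closure {x. \<phi> x \<noteq> 0}" for y
    using subsetD[OF closure_subset, of y "{x. \<phi> x \<noteq> 0}"] that by blast
  show "\<phi> x = 0" using z assms(2) .
  have "(\<phi> has_derivative (\<lambda>_. 0)) (at x)"
  proof (rule has_derivative_transform_within_open[of "\<lambda>_. 0"])
    show "open (- closure {x. \<phi> x \<noteq> 0})" by auto
    show "0 = \<phi> y" if "y \<in> - closure {x. \<phi> x \<noteq> 0}" for y
      using z[OF ComplD[OF that]] by (rule sym)
  qed (use assms(2) in \<open>simp_all only: has_derivative_const Compl_iff UNIV_I not_False_eq_True\<close>)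
  then show "pderiv_at i \<phi> x = 0" by (simp add: pderiv_atI)
qed

section \<open>Weak derivatives\<close>

definition loc_int :: "(real^2) set \<Rightarrow> (real^2 \<Rightarrow> real) \<Rightarrow> bool" where
  "loc_int U u \<longleftrightarrow> (\<forall>K. compact K \<and> K \<subseteq> U \<longrightarrow> integrable (lebesgue_on K) u)"

lemma compact_sets_lebesgue: "compact K \<Longrightarrow> K \<in> sets lebesgue"
  using lmeasurable_compact by blast

lemma loc_int_indicator:
  "loc_int U u \<Longrightarrow> compact K \<Longrightarrow> K \<subseteq> U \<Longrightarrow> integrable lebesgue (\<lambda>x. indicator K x * u x)"
  using integrable_restrict_space[of K lebesgue u] compact_sets_lebesgue by (auto simp: loc_int_def)

lemma loc_int_mult:
  assumes "loc_int U u" "compact K" "K \<subseteq> U" "continuous_on UNIV \<psi>" "\<And>x. x \<notin> K \<Longrightarrow> \<psi> x = 0"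
  shows "integrable lebesgue (\<lambda>x. u x * \<psi> x)"
proof -
  obtain B where B: "\<And>x. x \<in> K \<Longrightarrow> norm (\<psi> x) \<le> B"
    using compact_continuous_image[OF continuous_on_subset[OF assms(4)] assms(2)] compact_imp_bounded[of "\<psi> ` K"]
    by (auto simp: bounded_iff)
  have m: "\<psi> \<in> borel_measurable lebesgue"
    using borel_measurable_continuous_onI[OF assms(4)] by (simp add: measurable_completion)
  have i: "integrable lebesgue (\<lambda>x. indicator K x * u x)" using assms loc_int_indicator by blast
  have "integrable lebesgue (\<lambda>x. (indicator K x * u x) * \<psi> x)"
  proof (rule Bochner_Integration.integrable_bound)
    show "integrable lebesgue (\<lambda>x. B * (indicator K x * u x))" using i by simp
    show "(\<lambda>x. indicator K x * u x * \<psi> x) \<in> borel_measurable lebesgue"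
      using borel_measurable_integrable[OF i] m by (rule borel_measurable_times)
    have "norm (indicator K x * u x * \<psi> x) \<le> norm (B * (indicator K x * u x))" for x
    proof (cases "x \<in> K")
      case True
      then have "\<bar>\<psi> x\<bar> \<le> \<bar>B\<bar>" using B[of x] by simp
      then show ?thesis using True by (simp add: abs_mult mult.commute mult_right_mono)
    qed simp
    then show "AE x in lebesgue. norm (indicator K x * u x * \<psi> x) \<le> norm (B * (indicator K x * u x))" by simp
  qed
  moreover have "(\<lambda>x. indicator K x * u x * \<psi> x) = (\<lambda>x. u x * \<psi> x)" 
    by (intro ext) (use assms(5) in \<open>auto simp: indicator_def\<close>)
  ultimately show ?thesis by simp
qed

lemma loc_int_test:
  assumes "loc_int U u" "test_function U \<phi>"
  shows "integrable lebesgue (\<lambda>x. u x * \<phi> x)" "integrable lebesgue (\<lambda>x. u x * pderiv_at i \<phi> x)"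
proof -
  have K: "compact (closure {x. \<phi> x \<noteq> 0})" "closure {x. \<phi> x \<noteq> 0} \<subseteq> U"
    using assms(2) by (auto simp: test_function_def)
  show "integrable lebesgue (\<lambda>x. u x * \<phi> x)" 
    using test_function_outside(1)[OF assms(2)] 
    by (intro loc_int_mult[OF assms(1) K] test_function_continuous[OF assms(2)])
  show "integrable lebesgue (\<lambda>x. u x * pderiv_at i \<phi> x)"
    using test_function_outside(2)[OF assms(2)]
    by (intro loc_int_mult[OF assms(1) K] test_function_continuous[OF assms(2)])
qed

lemma integral_lebesgue_on_eq:
  fixes f :: "real^2 \<Rightarrow> real"
  assumes "S \<in> sets lebesgue" "\<And>x. x \<notin> S \<Longrightarrow> f x = 0"
  shows "(LINT x|lebesgue_on S. f x) = (LINT x|lebesgue. f x)"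
proof -
  have "indicator S x *\<^sub>R f x = f x" for x using assms(2)[of x] by (cases "x \<in> S") auto
  then have "(\<lambda>x. indicator S x *\<^sub>R f x) = f" by (rule ext)
  then show ?thesis using integral_restrict_space[of S lebesgue f] assms(1) by simp
qed

text \<open>Test functions vanish off the domain, so all integrals may be taken over the plane. In
  this form the identity is compatible with restriction to subdomains, with translations and with
  unfolding over the lattice.\<close>

lemma has_weak_pderiv_iff:
  assumes "S \<in> sets lebesgue"
  shows "has_weak_pderiv S i u g \<longleftrightarrow> loc_int (interior S) u \<and> loc_int (interior S) g \<and>
    (\<forall>\<phi>. test_function (interior S) \<phi> \<longrightarrow>
      (LINT x|lebesgue. u x * pderiv_at i \<phi> x) = - (LINT x|lebesgue. g x * \<phi> x))"
proof -
  have "(LINT x|lebesgue_on S. u x * pderiv_at i \<phi> x) = (LINT x|lebesgue. u x * pderiv_at i \<phi> x)"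
       "(LINT x|lebesgue_on S. g x * \<phi> x) = (LINT x|lebesgue. g x * \<phi> x)" if "test_function (interior S) \<phi>" for \<phi>
  proof -
    have "x \<notin> closure {x. \<phi> x \<noteq> 0}" if "x \<notin> S" for x
      using \<open>test_function (interior S) \<phi>\<close> that interior_subset by (auto simp: test_function_def)
    note test_function_outside[OF that this]
    then show "(LINT x|lebesgue_on S. u x * pderiv_at i \<phi> x) = (LINT x|lebesgue. u x * pderiv_at i \<phi> x)"
       "(LINT x|lebesgue_on S. g x * \<phi> x) = (LINT x|lebesgue. g x * \<phi> x)"
      by (auto intro!: integral_lebesgue_on_eq[OF assms])
  qed
  then show ?thesis by (auto simp: has_weak_pderiv_def loc_int_def)
qed

text \<open>Boxes are stable under intersection and generate the Borel sets, so a Dynkin argument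
  applies; the vanishing total integral handles complements. Lebesgue sets follow up to null sets,
  and a density with zero integral over every measurable set is zero.\<close>

lemma set_integral_box_zero:
  fixes h :: "real^2 \<Rightarrow> real"
  assumes h: "integrable lebesgue h" and boxes: "\<And>c d. (LINT x|lebesgue. indicator (box c d) x * h x) = 0"
    and all: "(LINT x|lebesgue. h x) = 0"
  shows "AE x in lebesgue. h x = 0"
proof -
  let ?I = "\<lambda>A. (LINT x|lebesgue. indicator A x * h x)"
  have int: "integrable lebesgue (\<lambda>x. indicator A x * h x)" if "A \<in> sets lebesgue" for A
    using integrable_mult_indicator[OF that h] by simp
  have borel0: "?I A = 0" if "A \<in> sets borel" for A
  proof -
    have "Int_stable (range (\<lambda>(a, b). box a b :: (real^2) set))" by (auto simp: Int_stable_def box_Int_box)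
    moreover have "range (\<lambda>(a, b). box a b :: (real^2) set) \<subseteq> Pow UNIV" by simp
    moreover have "A \<in> sigma_sets UNIV (range (\<lambda>(a, b). box a b))" using that by (simp add: borel_eq_box)
    ultimately show ?thesis
    proof (induction A rule: sigma_sets_induct_disjoint)
      case (basic A)
      then show ?case using boxes by auto
    next
      case empty
      then show ?case by simp
    next
      case (compl A)
      then have "A \<in> sets borel" by (simp add: borel_eq_box)
      then have A: "A \<in> sets lebesgue" by simp
      have "?I (UNIV - A) = (LINT x|lebesgue. h x - indicator A x * h x)"
        by (intro Bochner_Integration.integral_cong) (auto simp: indicator_def)
      also have "\<dots> = 0" using compl all by (simp add: Bochner_Integration.integral_diff[OF h int[OF A]])
      finally show ?case .
    next
      case (union A)
      then have "A i \<in> sets borel" for i by (auto simp: borel_eq_box)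
      then have A: "A i \<in> sets lebesgue" for i by simp
      have AU: "(\<Union>i. A i) \<in> sets lebesgue" using A by (intro sets.countable_UN) auto
      have "(LINT x:(\<Union>i. A i)|lebesgue. h x) = (\<Sum>i. (LINT x:A i|lebesgue. h x))"
        using A union(1) integrable_mult_indicator[OF AU h]
        by (intro lebesgue_integral_countable_add) (auto simp: disjoint_family_on_def set_integrable_def)
      then show ?case using union by (simp add: set_lebesgue_integral_def)
    qed
  qed
  have "?I A = 0" if "A \<in> sets lebesgue" for A
  proof -
    obtain S N N' where *: "A = S \<union> N" "N \<subseteq> N'" "N' \<in> null_sets lborel" "S \<in> sets lborel"
      using \<open>A \<in> sets lebesgue\<close> by (auto elim: sets_completionE)
    have "AE x in lebesgue. x \<notin> N'" using *(3) by (intro AE_completion AE_not_in)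
    have "?I A = ?I S"
    proof (rule integral_cong_AE)
      show "AE x in lebesgue. indicator A x * h x = indicator S x * h x"
        using \<open>AE x in lebesgue. x \<notin> N'\<close> by eventually_elim (use *(1,2) in \<open>auto simp: indicator_def\<close>)
    qed (use int[OF that] int[of S] *(4) in auto)
    then show ?thesis using borel0 * by simp
  qed
  then have "AE x in lebesgue. h x = (\<lambda>_. 0) x"
    by (intro density_unique_real[OF h]) (auto simp: set_lebesgue_integral_def)
  then show ?thesis by simp
qed

lemma box_Int_box_real2: "\<exists>c' d'. box c d \<inter> box a b = box c' (d' :: real^2) \<and> (box c d \<inter> box a b \<noteq> {} \<longrightarrow> cbox c' d' \<subseteq> cbox a b)"
proof -
  let ?c = "\<chi> i. max (c $ i) (a $ i)" and ?d = "\<chi> i. min (d $ i) (b $ i)"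
  have "box c d \<inter> box a b = box ?c ?d" by (auto simp: mem_box_cart)
  moreover have "cbox ?c ?d \<subseteq> cbox a b" by (auto simp: mem_box_cart)
  ultimately show ?thesis by blast
qed

text \<open>Bumps converge boundedly to indicators, so \<open>g\<close> has zero integral over every
  open box whose closed box lies in \<open>U\<close>. This forces \<open>g\<close> to vanish almost
  everywhere on each closed box in \<open>U\<close>, and \<open>U\<close> is a countable union of
  such boxes.\<close>

lemma fundamental_lemma:
  assumes U: "open U" and g: "loc_int U g" 
    and *: "\<And>\<phi>. test_function U \<phi> \<Longrightarrow> (LINT x|lebesgue. g x * \<phi> x) = 0"
  shows "AE x in lebesgue. x \<in> U \<longrightarrow> g x = 0"
proof -
  have boxes: "(LINT x|lebesgue. indicator (box c d) x * g x) = 0" if "cbox c d \<subseteq> U" for c d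
  proof -
    have i: "integrable lebesgue (\<lambda>x. indicator (cbox c d) x * g x)"
      using loc_int_indicator[OF g compact_cbox that] .
    have m: "(\<lambda>x. g x * bump n c d x) \<in> borel_measurable lebesgue" for n
      using loc_int_test(1)[OF g test_function_bump[OF that]] by blast
    have "(\<lambda>n. LINT x|lebesgue. g x * bump n c d x) \<longlonglongrightarrow> (LINT x|lebesgue. indicator (box c d) x * g x)"
    proof (rule integral_dominated_convergence[where w="\<lambda>x. norm (indicator (cbox c d) x * g x)"])
      show "integrable lebesgue (\<lambda>x. norm (indicator (cbox c d) x * g x))" using i by simp
      show "AE x in lebesgue. (\<lambda>n. g x * bump n c d x) \<longlonglongrightarrow> indicator (box c d) x * g x"
        using tendsto_mult_left[OF bump_tendsto] by (simp add: mult.commute)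
      show "AE x in lebesgue. norm (g x * bump n c d x) \<le> norm (indicator (cbox c d) x * g x)" for n
      proof (rule AE_I2)
        fix x
        show "norm (g x * bump n c d x) \<le> norm (indicator (cbox c d) x * g x)"
        proof (cases "x \<in> box c d")
          case True
          then have "x \<in> cbox c d" using box_subset_cbox by blast
          then show ?thesis using bump_bounds[of n c d x] by (simp add: abs_mult mult_left_le)
        qed (simp add: bump_0)
      qed
      show "(\<lambda>x. indicator (box c d) x * g x) \<in> borel_measurable lebesgue"
      proof -
        have "(\<lambda>x. indicator (box c d) x * (indicator (cbox c d) x * g x)) \<in> borel_measurable lebesgue"
          using i by (intro borel_measurable_times borel_measurable_indicator borel_measurable_integrable) auto
        moreover have "(\<lambda>x. indicator (box c d) x * (indicator (cbox c d) x * g x)) = (\<lambda>x. indicator (box c d) x * g x)"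
          by (intro ext) (use box_subset_cbox[of c d] in \<open>auto simp: indicator_def\<close>)
        ultimately show ?thesis by simp
      qed
    qed (rule m)
    then show ?thesis using *[OF test_function_bump[OF that]] by (simp add: LIMSEQ_const_iff)
  qed
  have local: "AE x in lebesgue. x \<in> cbox a b \<longrightarrow> g x = 0" if "cbox a b \<subseteq> U" for a b
  proof -
    have i: "integrable lebesgue (\<lambda>x. indicator (box a b) x * g x)"
    proof -
      have "integrable lebesgue (\<lambda>x. indicator (box a b) x *\<^sub>R (indicator (cbox a b) x * g x))"
        using loc_int_indicator[OF g compact_cbox that] by (intro integrable_mult_indicator) auto
      moreover have "(\<lambda>x. indicator (box a b) x *\<^sub>R (indicator (cbox a b) x * g x)) = (\<lambda>x. indicator (box a b) x * g x)"
        by (intro ext) (use box_subset_cbox[of a b] in \<open>auto simp: indicator_def\<close>)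
      ultimately show ?thesis by simp
    qed
    have "AE x in lebesgue. indicator (box a b) x * g x = 0"
    proof (rule set_integral_box_zero[OF i])
      fix c d
      obtain c' d' where cd: "box c d \<inter> box a b = box c' d'" "box c d \<inter> box a b \<noteq> {} \<longrightarrow> cbox c' d' \<subseteq> cbox a b"
        using box_Int_box_real2 by blast
      have "(\<lambda>x. indicator (box c d) x * (indicator (box a b) x * g x)) = (\<lambda>x. indicator (box c d \<inter> box a b) x * g x)"
        by (auto simp: indicator_def)
      then show "(LINT x|lebesgue. indicator (box c d) x * (indicator (box a b) x * g x)) = 0"
        using cd boxes[of c' d'] that by (cases "box c d \<inter> box a b = {}") auto
    qed (use boxes that in auto)
    moreover have "AE x in lebesgue. x \<notin> cbox a b - box a b"
      by (intro AE_not_in) (metis negligible_frontier_interval negligible_iff_null_sets)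
    ultimately show ?thesis by eventually_elim (auto simp: indicator_def)
  qed
  show ?thesis
  proof (rule open_countable_Union_open_cbox[OF U])
    fix \<D> assume D: "countable \<D>" "\<D> \<subseteq> Pow U" "\<And>X. X \<in> \<D> \<Longrightarrow> \<exists>a b. X = cbox a b" "\<Union>\<D> = U"
    have "AE x in lebesgue. x \<in> X \<longrightarrow> g x = 0" if "X \<in> \<D>" for X
    proof -
      obtain a b where "X = cbox a b" using D(3)[OF \<open>X \<in> \<D>\<close>] by blast
      moreover have "X \<subseteq> U" using D(2) that by blast
      ultimately show ?thesis using local by blast
    qed
    then have "AE x in lebesgue. \<forall>X\<in>\<D>. x \<in> X \<longrightarrow> g x = 0"
      unfolding AE_ball_countable[OF D(1)] by blast
    then show ?thesis using D(4) by (auto elim!: eventually_mono)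
  qed
qed

text \<open>Weak derivatives see only the interior, whereas \<open>Omega L r\<close> contains the
  circle of radius \<open>r\<close>. Statements almost everywhere pass from one to the other when
  the difference is a null set.\<close>

definition null_boundary :: "(real^2) set \<Rightarrow> bool" where
  "null_boundary S \<longleftrightarrow> S \<in> sets lebesgue \<and> negligible (S - interior S)"

lemma null_boundaryD:
  assumes "null_boundary S" shows "S \<in> sets lebesgue" "AE x in lebesgue. x \<in> S \<longrightarrow> x \<in> interior S"
proof -
  show "S \<in> sets lebesgue" using assms by (simp add: null_boundary_def)
  have "AE x in lebesgue. x \<notin> S - interior S"
    using assms by (intro AE_not_in) (simp add: null_boundary_def negligible_iff_null_sets)
  then show "AE x in lebesgue. x \<in> S \<longrightarrow> x \<in> interior S" by (auto elim!: eventually_mono)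
qed

lemma null_boundary_UNIV: "null_boundary UNIV" by (simp add: null_boundary_def)

lemma AE_lebesgue_on_iff:
  "S \<in> sets lebesgue \<Longrightarrow> (AE x in lebesgue_on S. P x) \<longleftrightarrow> (AE x in lebesgue. x \<in> S \<longrightarrow> P x)"
  by (simp add: AE_restrict_space_iff)

text \<open>Completeness of Lebesgue measure. This is what lets an arbitrarily chosen weak gradient
  inherit measurability from any known representative.\<close>

lemma lebesgue_on_measurable_AE:
  fixes f g :: "'a::euclidean_space \<Rightarrow> 'b::euclidean_space"
  assumes "S \<in> sets lebesgue" "f \<in> borel_measurable (lebesgue_on S)" "AE x in lebesgue_on S. f x = g x"
  shows "g \<in> borel_measurable (lebesgue_on S)"
proof -
  have "(\<lambda>x. if x \<in> S then f x else 0) \<in> borel_measurable lebesgue"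
    using assms by (simp add: borel_measurable_if)
  moreover have "AE x in lebesgue. (if x \<in> S then f x else 0) = (if x \<in> S then g x else 0)"
    using assms by (auto simp: AE_restrict_space_iff elim!: eventually_mono)
  ultimately have "(\<lambda>x. if x \<in> S then g x else 0) \<in> borel_measurable lebesgue"
    by (rule borel_measurable_AE)
  then show ?thesis using assms by (simp add: borel_measurable_if)
qed

lemma L2_lebesgue_cong_AE:
  fixes f g :: "'a::euclidean_space \<Rightarrow> 'b::euclidean_space"
  assumes "S \<in> sets lebesgue" "f \<in> L2 (lebesgue_on S)" "AE x in lebesgue_on S. f x = g x"
  shows "g \<in> L2 (lebesgue_on S)"
  using L2_cong_AE[OF assms(2,3)] lebesgue_on_measurable_AE[OF assms(1) _ assms(3)] assms(2)
  by (auto simp: L2_def)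

lemma L2norm_lebesgue_cong_AE:
  fixes f g :: "'a::euclidean_space \<Rightarrow> 'b::euclidean_space"
  assumes "S \<in> sets lebesgue" "f \<in> L2 (lebesgue_on S)" "AE x in lebesgue_on S. f x = g x"
  shows "L2norm (lebesgue_on S) f = L2norm (lebesgue_on S) g"
  using L2norm_cong_AE[OF assms(3)] L2_lebesgue_cong_AE[OF assms] assms(2) by (auto simp: L2_def)

lemma loc_int_cong_AE:
  assumes "loc_int (interior S) u" "S \<in> sets lebesgue" "AE x in lebesgue_on S. u x = u' x"
  shows "loc_int (interior S) u'"
  unfolding loc_int_def
proof (intro allI impI)
  fix K :: "(real^2) set" assume K: "compact K \<and> K \<subseteq> interior S"
  then have i: "integrable (lebesgue_on K) u" using assms by (auto simp: loc_int_def)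
  have KS: "K \<subseteq> S" "K \<in> sets lebesgue" using K interior_subset compact_sets_lebesgue by blast+
  have "AE x in lebesgue_on K. u x = u' x"
    using assms KS by (auto simp: AE_lebesgue_on_iff elim!: eventually_mono)
  then show "integrable (lebesgue_on K) u'"
    using integrable_cong_AE_imp[OF i lebesgue_on_measurable_AE[OF KS(2) borel_measurable_integrable[OF i]]]
    by (auto simp: eq_commute)
qed

text \<open>On a set of finite measure, \<open>norm (u x) \<le> 1 + (norm (u x))\<^sup>2\<close> is
  an integrable bound.\<close>

lemma L2_imp_integrable_compact:
  fixes u :: "'a::euclidean_space \<Rightarrow> 'b::euclidean_space"
  assumes "u \<in> L2 (lebesgue_on S)" "S \<in> sets lebesgue" "K \<in> lmeasurable" "K \<subseteq> S"
  shows "integrable (lebesgue_on K) u"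
proof -
  have r: "lebesgue_on K = restrict_space (lebesgue_on S) K"
    using restrict_restrict_space[of S lebesgue K] assms(2-4) by (simp add: inf_absorb2 fmeasurableD)
  have KS: "K \<in> sets (lebesgue_on S)"
    using assms(2-4) by (simp add: sets_restrict_space_iff fmeasurableD)
  then have KS': "K \<inter> space (lebesgue_on S) \<in> sets (lebesgue_on S)" by (rule sets.Int[OF _ sets.top])
  show ?thesis
  proof (rule Bochner_Integration.integrable_bound)
    have "integrable (lebesgue_on S) (\<lambda>x. (norm (u x))\<^sup>2)" using assms(1) by (simp add: L2_def)
    from integrable_mult_indicator[OF KS this]
    have "integrable (lebesgue_on K) (\<lambda>x. (norm (u x))\<^sup>2)"
      unfolding r integrable_restrict_space[OF KS'] .
    then show "integrable (lebesgue_on K) (\<lambda>x. 1 + (norm (u x))\<^sup>2)"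
      by (rule Bochner_Integration.integrable_add[OF finite_measure.integrable_const[OF finite_measure_lebesgue_on[OF assms(3)]]])
    have "u \<in> borel_measurable (lebesgue_on S)" using assms(1) by (simp add: L2_def)
    then show "u \<in> borel_measurable (lebesgue_on K)" by (rule measurable_restrict_mono) (rule assms(4))
    have "norm (u x) \<le> norm (1 + (norm (u x))\<^sup>2)" for x
    proof -
      have "2 * norm (u x) \<le> (norm (u x))\<^sup>2 + 1" using sum_squares_bound[of "norm (u x)" 1] by simp
      then have "norm (u x) \<le> 1 + (norm (u x))\<^sup>2" using norm_ge_zero[of "u x"] by linarith
      then show ?thesis by simp
    qed
    then show "AE x in lebesgue_on K. norm (u x) \<le> norm (1 + (norm (u x))\<^sup>2)" by (rule AE_I2)
  qed
qed

lemma L2_imp_loc_int: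
  assumes "u \<in> L2 (lebesgue_on S)" "S \<in> sets lebesgue"
  shows "loc_int (interior S) u"
  unfolding loc_int_def
proof (intro allI impI)
  fix K :: "(real^2) set" assume "compact K \<and> K \<subseteq> interior S"
  then show "integrable (lebesgue_on K) u"
    using subset_trans[OF _ interior_subset] by (intro L2_imp_integrable_compact[OF assms] lmeasurable_compact) auto
qed

lemma has_weak_pderiv_unique:
  assumes S: "null_boundary S" and "has_weak_pderiv S i u g" "has_weak_pderiv S i u' g'"
    and eq: "AE x in lebesgue_on S. u x = u' x"
  shows "AE x in lebesgue_on S. g x = g' x"
proof -
  note Sm = null_boundaryD(1)[OF S]
  note u = assms(2)[unfolded has_weak_pderiv_iff[OF Sm]] and u' = assms(3)[unfolded has_weak_pderiv_iff[OF Sm]]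
  have "AE x in lebesgue. x \<in> interior S \<longrightarrow> g x - g' x = 0"
  proof (rule fundamental_lemma)
    show "loc_int (interior S) (\<lambda>x. g x - g' x)"
      using u u' by (auto simp: loc_int_def)
    fix \<phi> assume t: "test_function (interior S) \<phi>"
    have "(LINT x|lebesgue. u x * pderiv_at i \<phi> x) = (LINT x|lebesgue. u' x * pderiv_at i \<phi> x)"
    proof (rule integral_cong_AE)
      show "AE x in lebesgue. u x * pderiv_at i \<phi> x = u' x * pderiv_at i \<phi> x"
        using eq unfolding AE_lebesgue_on_iff[OF Sm]
      proof eventually_elim
        case (elim x)
        show ?case
        proof (cases "x \<in> S")
          case False
          then have "x \<notin> closure {x. \<phi> x \<noteq> 0}" using t interior_subset by (auto simp: test_function_def)
          from test_function_outside[OF t this] show ?thesis by (simp only: mult_zero_right)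
        qed (use elim in simp)
      qed
    qed (use loc_int_test[OF _ t] u u' in blast)+
    then show "(LINT x|lebesgue. (g x - g' x) * \<phi> x) = 0"
      using u u' t loc_int_test[OF _ t] by (simp add: left_diff_distrib)
  qed simp
  then show ?thesis unfolding AE_lebesgue_on_iff[OF Sm] using null_boundaryD(2)[OF S]
    by eventually_elim auto
qed

lemma has_weak_pderiv_cong_AE:
  assumes "S \<in> sets lebesgue" "has_weak_pderiv S i u g" 
    "AE x in lebesgue_on S. u x = u' x" "AE x in lebesgue_on S. g x = g' x"
  shows "has_weak_pderiv S i u' g'"
proof -
  note u = assms(2)[unfolded has_weak_pderiv_iff[OF assms(1)]]
  have l: "loc_int (interior S) u'" "loc_int (interior S) g'" using u assms loc_int_cong_AE by blast+
  have eq: "(LINT x|lebesgue. v x * \<psi> x) = (LINT x|lebesgue. v' x * \<psi> x)"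
    if "AE x in lebesgue_on S. v x = v' x" "\<And>x. x \<notin> S \<Longrightarrow> \<psi> x = 0" "integrable lebesgue (\<lambda>x. v x * \<psi> x)"
      "integrable lebesgue (\<lambda>x. v' x * \<psi> x)" for v v' \<psi> :: "real^2 \<Rightarrow> real"
  proof (rule integral_cong_AE)
    show "AE x in lebesgue. v x * \<psi> x = v' x * \<psi> x"
      using that(1) unfolding AE_lebesgue_on_iff[OF assms(1)] by eventually_elim (use that(2) in auto)
  qed (use that in auto)
  have "(LINT x|lebesgue. u' x * pderiv_at i \<phi> x) = - (LINT x|lebesgue. g' x * \<phi> x)" if t: "test_function (interior S) \<phi>" for \<phi>
  proof -
    have "x \<notin> closure {x. \<phi> x \<noteq> 0}" if "x \<notin> S" for x
      using t that interior_subset by (auto simp: test_function_def)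
    note o = test_function_outside[OF t this]
    have "(LINT x|lebesgue. u x * pderiv_at i \<phi> x) = (LINT x|lebesgue. u' x * pderiv_at i \<phi> x)"
      using loc_int_test[OF _ t] u l o assms by (intro eq) auto
    moreover have "(LINT x|lebesgue. g x * \<phi> x) = (LINT x|lebesgue. g' x * \<phi> x)"
      using loc_int_test[OF _ t] u l o assms by (intro eq) auto
    ultimately show ?thesis using u t by auto
  qed
  then show ?thesis using l by (simp add: has_weak_pderiv_iff[OF assms(1)])
qed

lemma has_weak_pderiv_lincomb:
  assumes "S \<in> sets lebesgue" "has_weak_pderiv S i u g" "has_weak_pderiv S i v h"
  shows "has_weak_pderiv S i (\<lambda>x. u x + c * v x) (\<lambda>x. g x + c * h x)"
proof -
  note u = assms(2)[unfolded has_weak_pderiv_iff[OF assms(1)]] and v = assms(3)[unfolded has_weak_pderiv_iff[OF assms(1)]]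
  have "loc_int (interior S) (\<lambda>x. u x + c * v x)" "loc_int (interior S) (\<lambda>x. g x + c * h x)"
    using u v by (auto simp: loc_int_def)
  moreover have "(LINT x|lebesgue. (u x + c * v x) * pderiv_at i \<phi> x) = - (LINT x|lebesgue. (g x + c * h x) * \<phi> x)" 
    if t: "test_function (interior S) \<phi>" for \<phi>
    using u v t loc_int_test[OF _ t] by (simp add: distrib_right mult.assoc)
  ultimately show ?thesis by (simp add: has_weak_pderiv_iff[OF assms(1)])
qed

lemma has_weak_pderiv_subset:
  assumes "S \<in> sets lebesgue" "T \<in> sets lebesgue" "T \<subseteq> S" "has_weak_pderiv S i u g"
  shows "has_weak_pderiv T i u g"
proof -
  note I = interior_mono[OF assms(3)] and w = assms(4)[unfolded has_weak_pderiv_iff[OF assms(1)]]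
  have "loc_int (interior T) u" "loc_int (interior T) g"
    using w I unfolding loc_int_def by (meson order_trans)+
  moreover have "(LINT x|lebesgue. u x * pderiv_at i \<phi> x) = - (LINT x|lebesgue. g x * \<phi> x)" if "test_function (interior T) \<phi>" for \<phi>
    using w test_function_mono[OF that I] by blast
  ultimately show ?thesis unfolding has_weak_pderiv_iff[OF assms(2)] by blast
qed

lemma compact_support_L2:
  fixes \<psi> :: "real^2 \<Rightarrow> real"
  assumes "continuous_on UNIV \<psi>" "compact K" "\<And>x. x \<notin> K \<Longrightarrow> \<psi> x = 0" "T \<in> sets lebesgue"
  shows "\<psi> \<in> L2 (lebesgue_on T)"
proof -
  have "integrable lborel (\<lambda>x. indicator K x *\<^sub>R (norm (\<psi> x))\<^sup>2)"
    using assms by (intro borel_integrable_compact continuous_intros continuous_on_subset[OF assms(1)]) auto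
  moreover have "(\<lambda>x. indicator K x *\<^sub>R (norm (\<psi> x))\<^sup>2) = (\<lambda>x. (norm (\<psi> x))\<^sup>2)"
    by (intro ext) (use assms(3) in \<open>auto simp: indicator_def\<close>)
  ultimately have "integrable lebesgue (\<lambda>x. (norm (\<psi> x))\<^sup>2)"
    using integrable_completion[of "\<lambda>x. (norm (\<psi> x))\<^sup>2" lborel] borel_measurable_integrable by force
  from integrable_mult_indicator[OF assms(4) this]
  have "integrable (lebesgue_on T) (\<lambda>x. (norm (\<psi> x))\<^sup>2)"
    using assms(4) by (subst integrable_restrict_space) auto
  moreover have "\<psi> \<in> borel_measurable (lebesgue_on T)"
    using continuous_imp_measurable_on_sets_lebesgue[OF continuous_on_subset[OF assms(1)] assms(4)] by simp
  ultimately show ?thesis by (simp add: L2_def)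
qed

lemma test_function_L2:
  assumes "test_function S \<phi>" "T \<in> sets lebesgue"
  shows "\<phi> \<in> L2 (lebesgue_on T)" "pderiv_at i \<phi> \<in> L2 (lebesgue_on T)"
proof -
  have K: "compact (closure {x. \<phi> x \<noteq> 0})" using assms by (auto simp: test_function_def)
  show "\<phi> \<in> L2 (lebesgue_on T)" "pderiv_at i \<phi> \<in> L2 (lebesgue_on T)" 
    using compact_support_L2[OF _ K _ assms(2)] test_function_continuous[OF assms(1)] test_function_outside[OF assms(1)] by blast+
qed

lemma continuous_compact_L2:
  fixes f :: "'a::euclidean_space \<Rightarrow> 'b::euclidean_space"
  assumes "continuous_on K f" "compact K" "T \<subseteq> K" "T \<in> sets lebesgue"
  shows "f \<in> L2 (lebesgue_on T)"
proof -
  have T: "T \<in> lmeasurable" using assms lmeasurable_compact[OF assms(2)] fmeasurableI2 by blast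
  obtain B where B: "\<And>x. x \<in> K \<Longrightarrow> norm (f x) \<le> B"
    using compact_continuous_image[OF assms(1,2)] compact_imp_bounded[of "f ` K"] by (auto simp: bounded_iff)
  have [measurable]: "f \<in> borel_measurable (lebesgue_on T)"
    using continuous_imp_measurable_on_sets_lebesgue[OF continuous_on_subset[OF assms(1,3)] assms(4)] by simp
  have "integrable (lebesgue_on T) (\<lambda>x. (norm (f x))\<^sup>2)"
  proof (rule finite_measure.integrable_const_bound[OF finite_measure_lebesgue_on[OF T]])
    show "AE x in lebesgue_on T. norm ((norm (f x))\<^sup>2) \<le> B\<^sup>2"
      using B assms(3) by (intro AE_I2) (auto intro!: power_mono)
  qed measurable
  then show ?thesis by (simp add: L2_def)
qed

lemma L2_component_iff:
  fixes f :: "'a \<Rightarrow> 'b::euclidean_space^'n"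
  shows "f \<in> L2 M \<longleftrightarrow> (\<forall>j. (\<lambda>x. f x $ j) \<in> L2 M)"
proof
  assume f: "f \<in> L2 M"
  show "\<forall>j. (\<lambda>x. f x $ j) \<in> L2 M"
  proof
    fix j
    have [measurable]: "f \<in> borel_measurable M" using f by (simp add: L2_def)
    have m: "(\<lambda>x. f x $ j) \<in> borel_measurable M"
      by (rule measurable_compose[OF \<open>f \<in> borel_measurable M\<close>]) (intro borel_measurable_continuous_onI continuous_intros)
    have "integrable M (\<lambda>x. (norm (f x $ j))\<^sup>2)"
    proof (rule Bochner_Integration.integrable_bound)
      show "integrable M (\<lambda>x. (norm (f x))\<^sup>2)" using f by (simp add: L2_def)
      show "(\<lambda>x. (norm (f x $ j))\<^sup>2) \<in> borel_measurable M" using m by measurable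
      show "AE x in M. norm ((norm (f x $ j))\<^sup>2) \<le> norm ((norm (f x))\<^sup>2)"
        by (intro AE_I2) (auto intro!: power_mono Finite_Cartesian_Product.norm_nth_le)
    qed
    then show "(\<lambda>x. f x $ j) \<in> L2 M" using m by (simp add: L2_def)
  qed
next
  assume f: "\<forall>j. (\<lambda>x. f x $ j) \<in> L2 M"
  have e: "(norm (f x))\<^sup>2 = (\<Sum>j\<in>UNIV. (norm (f x $ j))\<^sup>2)" for x
    by (simp add: norm_vec_def L2_set_def sum_nonneg)
  have "integrable M (\<lambda>x. (norm (f x))\<^sup>2)"
    unfolding e using f by (intro Bochner_Integration.integrable_sum) (auto simp: L2_def)
  moreover have "f \<in> borel_measurable M"
  proof (subst borel_measurable_euclidean_space, intro ballI)
    fix b :: "'b^'n" assume "b \<in> Basis"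
    then obtain j c where "b = axis j c" by (auto simp: Basis_vec_def)
    then show "(\<lambda>x. f x \<bullet> b) \<in> borel_measurable M"
      using f by (auto simp: inner_axis L2_def intro: borel_measurable_inner)
  qed
  ultimately show "f \<in> L2 M" by (simp add: L2_def)
qed

lemma L2norm_component_le:
  fixes f :: "'a \<Rightarrow> 'b::euclidean_space^'n"
  assumes "f \<in> L2 M" shows "L2norm M (\<lambda>x. f x $ j) \<le> L2norm M f"
proof -
  have "(\<lambda>x. f x $ j) \<in> L2 M" using assms L2_component_iff by blast
  then show ?thesis
    unfolding L2norm_def using assms
    by (intro real_sqrt_le_mono integral_mono) (auto simp: L2_def intro!: power_mono Finite_Cartesian_Product.norm_nth_le)
qed

lemma L2norm_component_sum:
  fixes f :: "'a \<Rightarrow> 'b::euclidean_space^'n"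
  assumes "f \<in> L2 M" shows "(L2norm M f)\<^sup>2 = (\<Sum>j\<in>UNIV. (L2norm M (\<lambda>x. f x $ j))\<^sup>2)"
proof -
  have e: "(norm (f x))\<^sup>2 = (\<Sum>j\<in>UNIV. (norm (f x $ j))\<^sup>2)" for x
    by (simp add: norm_vec_def L2_set_def sum_nonneg)
  have "(\<lambda>x. f x $ j) \<in> L2 M" for j using assms L2_component_iff by blast
  then show ?thesis unfolding L2norm_power2 e by (intro Bochner_Integration.integral_sum) (simp add: L2_def)
qed

lemma L2_limit_integral:
  fixes f :: "nat \<Rightarrow> 'a \<Rightarrow> real"
  assumes "\<And>n. f n \<in> L2 M" "g \<in> L2 M" "h \<in> L2 M" "(\<lambda>n. L2norm M (\<lambda>x. f n x - g x)) \<longlonglongrightarrow> 0"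
  shows "(\<lambda>n. LINT x|M. f n x * h x) \<longlonglongrightarrow> (LINT x|M. g x * h x)"
  using L2_limit_inner[OF assms] by simp

text \<open>For a fixed test function, itself square integrable, both sides of the defining identity
  are continuous in \<open>L2\<close>.\<close>

lemma has_weak_pderiv_limit:
  assumes S: "S \<in> sets lebesgue" and "\<And>n. has_weak_pderiv S i (u n) (g n)"
    and L: "\<And>n. u n \<in> L2 (lebesgue_on S)" "\<And>n. g n \<in> L2 (lebesgue_on S)" "v \<in> L2 (lebesgue_on S)" "h \<in> L2 (lebesgue_on S)"
    and "(\<lambda>n. L2norm (lebesgue_on S) (\<lambda>x. u n x - v x)) \<longlonglongrightarrow> 0" "(\<lambda>n. L2norm (lebesgue_on S) (\<lambda>x. g n x - h x)) \<longlonglongrightarrow> 0"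
  shows "has_weak_pderiv S i v h"
  unfolding has_weak_pderiv_def
proof (intro conjI allI impI)
  fix \<phi> assume t: "test_function (interior S) \<phi>"
  note T = test_function_L2[OF t S]
  have "(LINT x|lebesgue_on S. u n x * pderiv_at i \<phi> x) = - (LINT x|lebesgue_on S. g n x * \<phi> x)" for n
    using assms(2)[of n] t by (auto simp: has_weak_pderiv_def)
  then have "(\<lambda>n. - (LINT x|lebesgue_on S. g n x * \<phi> x)) \<longlonglongrightarrow> (LINT x|lebesgue_on S. v x * pderiv_at i \<phi> x)"
    using L2_limit_integral[OF L(1) L(3) T(2)[of i] assms(7)] by simp
  moreover have "(\<lambda>n. - (LINT x|lebesgue_on S. g n x * \<phi> x)) \<longlonglongrightarrow> - (LINT x|lebesgue_on S. h x * \<phi> x)"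
    by (intro tendsto_minus L2_limit_integral L T assms)
  ultimately show "(LINT x|lebesgue_on S. v x * pderiv_at i \<phi> x) = - (LINT x|lebesgue_on S. h x * \<phi> x)"
    by (rule LIMSEQ_unique)
qed (use L2_imp_loc_int[OF L(3) S] L2_imp_loc_int[OF L(4) S] in \<open>auto simp: loc_int_def\<close>)

section \<open>Vector fields in H^1 and their weak gradients\<close>

definition H1_field :: "(real^2) set \<Rightarrow> (real^2 \<Rightarrow> real^2) set" where
  "H1_field S = {v. \<forall>j. (\<lambda>x. v x $ j) \<in> H1 S}"

lemma weak_pderiv_works: "has_weak_pderiv S i u g \<Longrightarrow> has_weak_pderiv S i u (weak_pderiv S i u)"
  unfolding weak_pderiv_def by (rule someI[where P="\<lambda>g. has_weak_pderiv S i u g"])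

text \<open>\<open>weak_pderiv\<close> is an arbitrary choice among derivatives that agree almost
  everywhere. Gradients are therefore computed by naming a candidate \<open>G\<close> and appealing
  to uniqueness.\<close>

lemma wgrad_eqI:
  assumes S: "null_boundary S" and "\<And>i j. has_weak_pderiv S i (\<lambda>x. v x $ j) (\<lambda>x. G x $ i $ j)"
  shows "AE x in lebesgue_on S. wgrad S v x = G x"
proof -
  have "AE x in lebesgue_on S. weak_pderiv S i (\<lambda>x. v x $ j) x = G x $ i $ j" for i j
    using has_weak_pderiv_unique[OF S weak_pderiv_works[OF assms(2)] assms(2)] by simp
  then have "AE x in lebesgue_on S. \<forall>i j. weak_pderiv S i (\<lambda>x. v x $ j) x = G x $ i $ j" by (simp add: AE_all_countable)
  then show ?thesis by eventually_elim (simp add: wgrad_def vec_eq_iff)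
qed

lemma H1_fieldD:
  assumes S: "null_boundary S" and "v \<in> H1_field S"
  shows "v \<in> L2 (lebesgue_on S)" "has_weak_pderiv S i (\<lambda>x. v x $ j) (\<lambda>x. wgrad S v x $ i $ j)" "wgrad S v \<in> L2 (lebesgue_on S)"
proof -
  show "v \<in> L2 (lebesgue_on S)" using assms by (auto simp: L2_component_iff[of v] H1_field_def H1_def)
  have g: "\<exists>g\<in>L2 (lebesgue_on S). has_weak_pderiv S i (\<lambda>x. v x $ j) g" for i j
    using assms by (auto simp: H1_field_def H1_def)
  then show w: "has_weak_pderiv S i (\<lambda>x. v x $ j) (\<lambda>x. wgrad S v x $ i $ j)" for i j
  proof -
    obtain g where "has_weak_pderiv S i (\<lambda>x. v x $ j) g" using g by blast
    from weak_pderiv_works[OF this] show ?thesis by (simp add: wgrad_def)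
  qed
  show "wgrad S v \<in> L2 (lebesgue_on S)"
    unfolding L2_component_iff
  proof (intro allI)
    fix i j
    obtain g where g: "g\<in>L2 (lebesgue_on S)" "has_weak_pderiv S i (\<lambda>x. v x $ j) g" using g by blast
    show "(\<lambda>x. wgrad S v x $ i $ j) \<in> L2 (lebesgue_on S)"
      using has_weak_pderiv_unique[OF S g(2) w] L2_lebesgue_cong_AE[OF null_boundaryD(1)[OF S] g(1)] by simp
  qed
qed

lemma H1_fieldI:
  assumes "v \<in> L2 (lebesgue_on S)" "G \<in> L2 (lebesgue_on S)" "\<And>i j. has_weak_pderiv S i (\<lambda>x. v x $ j) (\<lambda>x. G x $ i $ j)"
  shows "v \<in> H1_field S"
proof -
  have "(\<lambda>x. v x $ j) \<in> L2 (lebesgue_on S)" for j using assms(1) unfolding L2_component_iff[of v] by blast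
  moreover have "(\<lambda>x. G x $ i $ j) \<in> L2 (lebesgue_on S)" for i j 
    using assms(2) unfolding L2_component_iff[of G] L2_component_iff[of "\<lambda>x. G x $ _"] by blast
  ultimately show ?thesis using assms(3) unfolding H1_field_def H1_def by blast
qed

lemma H1_field_lincomb:
  assumes S: "null_boundary S" and "u \<in> H1_field S" "v \<in> H1_field S"
  shows "(\<lambda>x. u x + c *\<^sub>R v x) \<in> H1_field S"
    "AE x in lebesgue_on S. wgrad S (\<lambda>x. u x + c *\<^sub>R v x) x = wgrad S u x + c *\<^sub>R wgrad S v x"
proof -
  note u = H1_fieldD[OF S assms(2)] and v = H1_fieldD[OF S assms(3)]
  have w: "has_weak_pderiv S i (\<lambda>x. (u x + c *\<^sub>R v x) $ j) (\<lambda>x. (wgrad S u x + c *\<^sub>R wgrad S v x) $ i $ j)" for i j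
    using has_weak_pderiv_lincomb[OF null_boundaryD(1)[OF S] u(2) v(2)] by simp
  show "(\<lambda>x. u x + c *\<^sub>R v x) \<in> H1_field S"
    by (rule H1_fieldI[OF L2_lincomb[OF u(1) v(1)] L2_lincomb[OF u(3) v(3)] w])
  show "AE x in lebesgue_on S. wgrad S (\<lambda>x. u x + c *\<^sub>R v x) x = wgrad S u x + c *\<^sub>R wgrad S v x"
    by (rule wgrad_eqI[OF S w])
qed

lemma H1_field_diff:
  assumes S: "null_boundary S" and "u \<in> H1_field S" "v \<in> H1_field S"
  shows "(\<lambda>x. u x - v x) \<in> H1_field S"
    "AE x in lebesgue_on S. wgrad S (\<lambda>x. u x - v x) x = wgrad S u x - wgrad S v x"
  using H1_field_lincomb[OF assms, of "-1"] by simp_all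

lemma wdiv_eq: "wdiv S u x = (\<Sum>i\<in>UNIV. wgrad S u x $ i $ i)"
  by (simp add: wdiv_def wgrad_def)

section \<open>Green's formula on the perforated square\<close>

definition pt :: "2 \<Rightarrow> real \<Rightarrow> real \<Rightarrow> real^2" where
  "pt i s t = (\<chi> k. if k = i then s else t)"

lemma pt_nth: "pt i s t $ k = (if k = i then s else t)" by (simp add: pt_def)

lemma two_cases: obtains j :: 2 where "j \<noteq> i" "UNIV = {i, j}" "\<forall>k. k = i \<or> k = j"
proof (cases "i = 1")
  case True
  show ?thesis
  proof (rule that[of 2])
    show "2 \<noteq> i" using True by simp
    show "UNIV = {i, 2}" using True by (simp add: UNIV_2)
    show "\<forall>k. k = i \<or> k = 2" using True exhaust_2 by simp
  qed
next
  case False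
  then have "i = 2" using exhaust_2[of i] by simp
  show ?thesis
  proof (rule that[of 1])
    show "1 \<noteq> i" using False by simp
    show "UNIV = {i, 1}" unfolding \<open>i = 2\<close> by (simp add: UNIV_2 insert_commute)
    show "\<forall>k. k = i \<or> k = 1" using \<open>i = 2\<close> exhaust_2 by blast
  qed
qed

lemma pt_exists: assumes "j \<noteq> (i::2)" shows "x = pt i (x $ i) (x $ j)"
proof -
  obtain j' where j': "j' \<noteq> i" "UNIV = {i, j'}" "\<forall>k. k = i \<or> k = j'" by (rule two_cases[of i])
  then have "j' = j" using spec[OF j'(3), of j] assms by blast
  then have "x $ k = pt i (x $ i) (x $ j) $ k" for k using spec[OF j'(3), of k] \<open>j' = j\<close> by (auto simp: pt_nth)
  then show ?thesis by (rule iffD2[OF vec_eq_iff allI])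
qed

lemma norm_pt: "(norm (pt i s t))\<^sup>2 = s\<^sup>2 + t\<^sup>2"
proof -
  obtain j where j: "j \<noteq> i" "UNIV = {i, j}" "\<forall>k. k = i \<or> k = j" by (rule two_cases[of i])
  have "(norm (pt i s t))\<^sup>2 = (\<Sum>k\<in>UNIV. (pt i s t $ k)\<^sup>2)" by (simp add: norm_vec_def L2_set_def sum_nonneg)
  also have "\<dots> = s\<^sup>2 + t\<^sup>2" unfolding j(2) using j(1) by (simp add: pt_nth)
  finally show ?thesis .
qed

lemma continuous_on_pt [continuous_intros]:
  "continuous_on S f \<Longrightarrow> continuous_on S g \<Longrightarrow> continuous_on S (\<lambda>x. pt i (f x) (g x))"
  unfolding pt_def
proof (rule continuous_on_vec_lambda)
  fix k assume "continuous_on S f" "continuous_on S g"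
  then show "continuous_on S (\<lambda>x. if k = i then f x else g x)" by (cases "k = i") auto
qed

lemma has_derivative_pt: "((\<lambda>s. pt i s t) has_derivative (\<lambda>h. h *\<^sub>R axis i 1)) F"
proof -
  have "pt i s t = pt i 0 t + s *\<^sub>R axis i 1" for s by (simp add: vec_eq_iff pt_nth axis_def)
  then have "(\<lambda>s. pt i s t) = (\<lambda>s. pt i 0 t + s *\<^sub>R axis i 1)" by (rule ext)
  then show ?thesis by (auto intro!: derivative_eq_intros)
qed

lemma prod_Basis_real2:
  fixes f :: "real^2 \<Rightarrow> 'a::comm_monoid_mult"
  shows "(\<Prod>b\<in>Basis. f b) = (\<Prod>i\<in>UNIV. f (axis i 1))"
proof -
  have B: "(Basis :: (real^2) set) = range (\<lambda>i. axis i 1)" by (auto simp: Basis_vec_def)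
  have "inj (\<lambda>i. axis i 1 :: real^2)" by (auto simp: inj_def axis_eq_axis)
  then show ?thesis unfolding B by (subst prod.reindex) auto
qed

text \<open>Lebesgue measure is determined by its values on boxes, and the preimage of a box is a
  product of two intervals for either choice of \<open>i\<close>. Fubini's theorem for pairs thereby
  applies to lines in direction \<open>i\<close>.\<close>

lemma lborel_pt: "distr (lborel \<Otimes>\<^sub>M lborel) borel (\<lambda>(s, t). pt i s t) = lborel"
proof (rule lborel_eqI[symmetric])
  have [measurable]: "(\<lambda>(s, t). pt i s t) \<in> borel_measurable (lborel \<Otimes>\<^sub>M lborel)"
  proof -
    have "(\<lambda>(s, t). pt i s t) \<in> borel_measurable borel"
      unfolding case_prod_beta by (intro borel_measurable_continuous_onI continuous_intros)
    then show ?thesis by (simp add: lborel_prod)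
  qed
  obtain j where j: "j \<noteq> i" "UNIV = {i, j}" "\<forall>k. k = i \<or> k = j" by (rule two_cases[of i])
  fix l u :: "real^2" assume lu: "\<And>b. b \<in> Basis \<Longrightarrow> l \<bullet> b \<le> u \<bullet> b"
  have le: "l $ k \<le> u $ k" for k using lu[of "axis k 1"] by (auto simp: inner_axis Basis_vec_def)
  have "(\<lambda>(s, t). pt i s t) -` box l u = box (l $ i) (u $ i) \<times> box (l $ j) (u $ j)"
  proof (intro set_eqI)
    fix x :: "real \<times> real"
    have "pt i (fst x) (snd x) \<in> box l u \<longleftrightarrow> (\<forall>k\<in>{i,j}. l $ k < pt i (fst x) (snd x) $ k \<and> pt i (fst x) (snd x) $ k < u $ k)"
      unfolding mem_box_cart j(2)[symmetric] by simp
    then show "x \<in> (\<lambda>(s, t). pt i s t) -` box l u \<longleftrightarrow> x \<in> box (l $ i) (u $ i) \<times> box (l $ j) (u $ j)"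
      using j(1) by (auto simp: pt_nth case_prod_beta mem_Times_iff)
  qed
  then have "emeasure (distr (lborel \<Otimes>\<^sub>M lborel) borel (\<lambda>(s, t). pt i s t)) (box l u)
     = emeasure (lborel \<Otimes>\<^sub>M lborel) (box (l $ i) (u $ i) \<times> box (l $ j) (u $ j))"
    by (subst emeasure_distr) (auto simp: space_pair_measure)
  also have "\<dots> = ennreal (u $ i - l $ i) * ennreal (u $ j - l $ j)"
    using le by (subst lborel.emeasure_pair_measure_Times) auto
  also have "\<dots> = ennreal (\<Prod>b\<in>Basis. (u - l) \<bullet> b)"
    unfolding prod_Basis_real2 j(2) using j(1) le by (simp add: inner_axis ennreal_mult)
  finally show "emeasure (distr (lborel \<Otimes>\<^sub>M lborel) borel (\<lambda>(s, t). pt i s t)) (box l u) = ennreal (\<Prod>b\<in>Basis. (u - l) \<bullet> b)" .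
qed simp

lemma pt_measurable: "(\<lambda>(s, t). pt i s t) \<in> (lborel \<Otimes>\<^sub>M lborel) \<rightarrow>\<^sub>M borel"
proof -
  have "(\<lambda>(s, t). pt i s t) \<in> borel_measurable borel"
    unfolding case_prod_beta by (intro borel_measurable_continuous_onI continuous_intros)
  then show ?thesis by (simp add: lborel_prod)
qed

lemma fubini_pt:
  fixes f :: "real^2 \<Rightarrow> real"
  assumes f: "integrable lborel f"
  shows "AE t in lborel. integrable lborel (\<lambda>s. f (pt i s t))"
    "integrable lborel (\<lambda>t. LINT s|lborel. f (pt i s t))"
    "(LINT t|lborel. LINT s|lborel. f (pt i s t)) = (LINT x|lborel. f x)"
proof -
  have fm: "f \<in> borel_measurable borel" using f by simp
  have "integrable (lborel \<Otimes>\<^sub>M lborel) (\<lambda>z. f (case z of (s, t) \<Rightarrow> pt i s t))"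
    using f integrable_distr_eq[OF pt_measurable fm] lborel_pt by metis
  then have i: "integrable (lborel \<Otimes>\<^sub>M lborel) (\<lambda>(s, t). f (pt i s t))" by (simp add: case_prod_beta')
  show "AE t in lborel. integrable lborel (\<lambda>s. f (pt i s t))" by (rule lborel_pair.AE_integrable_snd[OF i])
  show "integrable lborel (\<lambda>t. LINT s|lborel. f (pt i s t))" by (rule lborel_pair.integrable_snd[OF i])
  have "(LINT x|lborel. f x) = (LINT z|(lborel \<Otimes>\<^sub>M lborel). f (case z of (s, t) \<Rightarrow> pt i s t))"
    using integral_distr[OF pt_measurable fm, of i] lborel_pt[of i] by simp
  then show "(LINT t|lborel. LINT s|lborel. f (pt i s t)) = (LINT x|lborel. f x)"
    using lborel_pair.integral_snd[OF i] by (simp add: case_prod_beta')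
qed

lemma fubini_pt_bound:
  fixes f :: "real^2 \<Rightarrow> real"
  assumes "integrable lborel f" "integrable lborel b" "AE t in lborel. \<bar>LINT s|lborel. f (pt i s t)\<bar> \<le> b t"
  shows "\<bar>LINT x|lborel. f x\<bar> \<le> (LINT t|lborel. b t)"
proof -
  have "\<bar>LINT x|lborel. f x\<bar> \<le> (LINT t|lborel. \<bar>LINT s|lborel. f (pt i s t)\<bar>)"
    unfolding fubini_pt(3)[OF assms(1), of i, symmetric] by (rule integral_abs_bound)
  also have "\<dots> \<le> (LINT t|lborel. b t)"
    using assms fubini_pt(2)[OF assms(1), of i] by (intro integral_mono_AE) auto
  finally show ?thesis .
qed

lemma line_integral_zero:
  fixes F f :: "real \<Rightarrow> real"
  assumes "\<And>s. (F has_vector_derivative f s) (at s)" "continuous_on UNIV f" "\<And>s. \<bar>s\<bar> \<ge> R \<Longrightarrow> F s = 0" "\<And>s. \<bar>s\<bar> \<ge> R \<Longrightarrow> f s = 0" 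
  shows "(LINT s|lborel. f s) = 0"
proof -
  let ?R = "max R 0"
  have "(LINT s|lborel. indicator {-?R..?R} s *\<^sub>R f s) = F ?R - F (- ?R)"
    using assms by (intro integral_FTC_atLeastAtMost) (auto intro: has_vector_derivative_at_within continuous_on_subset)
  moreover have "F ?R = 0" "F (- ?R) = 0" using assms(3) by auto
  moreover have "(\<lambda>s. indicator {-?R..?R} s *\<^sub>R f s) = f"
  proof
    fix s show "indicator {-?R..?R} s *\<^sub>R f s = f s"
      using assms(4)[of s] by (cases "\<bar>s\<bar> \<ge> R") (auto simp: indicator_def)
  qed
  ultimately show ?thesis by simp
qed

text \<open>The product of \<open>u\<close> and \<open>\<phi>\<close> is C^1 with compact support on
  the whole plane. Along each line in direction \<open>i\<close> its derivative integrates to zero,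
  and Fubini's theorem concludes.\<close>

lemma C1_integration_by_parts:
  assumes U: "open U" and u: "\<And>x. x \<in> U \<Longrightarrow> (u has_derivative (\<lambda>h. \<Sum>k\<in>UNIV. D k x * h $ k)) (at x)"
    and D: "continuous_on U (D i)" and t: "test_function U \<phi>"
  shows "(LINT x|lebesgue. u x * pderiv_at i \<phi> x) = - (LINT x|lebesgue. D i x * \<phi> x)"
proof -
  define K where "K = closure {x. \<phi> x \<noteq> 0}"
  have K: "compact K" "K \<subseteq> U" using t by (auto simp: K_def test_function_def)
  have zero: "\<phi> x = 0" "pderiv_at k \<phi> x = 0" if "x \<notin> K" for x k
    using test_function_outside[OF t that[unfolded K_def]] by auto
  have uc: "continuous_on U u" 
    using u has_derivative_continuous continuous_at_imp_continuous_on by blast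
  \<comment> \<open>Nothing is known about \<open>u\<close> off \<open>U\<close>. But the open sets
    \<open>U\<close> and \<open>- K\<close> cover the plane, and the product is zero on the
    second.\<close>
  have cont: "continuous_on UNIV (\<lambda>x. v x * \<psi> x)" if "continuous_on U v" "continuous_on UNIV \<psi>" "\<And>x. x \<notin> K \<Longrightarrow> \<psi> x = 0" for v \<psi> :: "real^2 \<Rightarrow> real"
  proof -
    have "continuous_on (U \<union> - K) (\<lambda>x. v x * \<psi> x)"
    proof (rule continuous_on_open_Un)
      show "open (- K)" using K compact_imp_closed by auto
      show "continuous_on U (\<lambda>x. v x * \<psi> x)" using that continuous_on_subset by (intro continuous_intros) blast+
      show "continuous_on (- K) (\<lambda>x. v x * \<psi> x)" 
        by (rule continuous_on_eq[of _ "\<lambda>_. 0"]) (use that(3) in auto)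
    qed (rule U)
    moreover have "U \<union> - K = UNIV" using K by auto
    ultimately show ?thesis by simp
  qed
  have c1: "continuous_on UNIV (\<lambda>x. u x * pderiv_at i \<phi> x)" and c2: "continuous_on UNIV (\<lambda>x. D i x * \<phi> x)"
    using cont[OF uc test_function_continuous(2)[OF t]] cont[OF D test_function_continuous(1)[OF t]] zero by blast+
  have int: "integrable lborel g" if "continuous_on UNIV g" "\<And>x. x \<notin> K \<Longrightarrow> g x = 0" for g :: "real^2 \<Rightarrow> real"
  proof -
    have "integrable lborel (\<lambda>x. indicator K x *\<^sub>R g x)" 
      by (rule borel_integrable_compact[OF K(1) continuous_on_subset[OF that(1) subset_UNIV]])
    moreover have "(\<lambda>x. indicator K x *\<^sub>R g x) = g" by (rule ext) (use that(2) in \<open>auto simp: indicator_def\<close>)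
    ultimately show ?thesis by simp
  qed
  have i1: "integrable lborel (\<lambda>x. u x * pderiv_at i \<phi> x)" and i2: "integrable lborel (\<lambda>x. D i x * \<phi> x)"
    using int[OF c1] int[OF c2] zero by auto
  obtain R where R: "\<And>x. x \<in> K \<Longrightarrow> norm x < R" using compact_imp_bounded[OF K(1)] by (metis bounded_pos_less)
  have out: "pt i s t \<notin> K" if "\<bar>s\<bar> \<ge> R" for s t
    using R[of "pt i s t"] that component_le_norm_cart[of "pt i s t" i] by (auto simp: pt_nth)
  let ?g = "\<lambda>x. u x * pderiv_at i \<phi> x + D i x * \<phi> x"
  have line: "(LINT s|lborel. ?g (pt i s t)) = 0" for t
  proof (rule line_integral_zero[where F="\<lambda>s. u (pt i s t) * \<phi> (pt i s t)" and R=R])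
    fix s
    have "((\<lambda>x. u x * \<phi> x) has_derivative (\<lambda>h. \<Sum>k\<in>UNIV. (u x * pderiv_at k \<phi> x + D k x * \<phi> x) * h $ k)) (at x)" for x
    proof (cases "x \<in> U")
      case True
      have "(\<lambda>h. \<Sum>k\<in>UNIV. (u x * pderiv_at k \<phi> x + D k x * \<phi> x) * h $ k) = 
         (\<lambda>h. u x * (\<Sum>k\<in>UNIV. h $ k * pderiv_at k \<phi> x) + (\<Sum>k\<in>UNIV. D k x * h $ k) * \<phi> x)"
        by (rule ext) (simp add: sum_distrib_left sum_distrib_right sum.distrib[symmetric] algebra_simps)
      then show ?thesis
        using has_derivative_mult[OF u[OF True] test_function_has_derivative[OF t, of x]] by simp
    next
      case False
      have "((\<lambda>_. 0) has_derivative (\<lambda>_. 0)) (at x)" by simp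
      moreover have "open (- K)" "x \<in> - K" using K compact_imp_closed False by auto
      ultimately have "((\<lambda>x. u x * \<phi> x) has_derivative (\<lambda>_. 0)) (at x)"
        by (rule has_derivative_transform_within_open) (simp add: zero)
      moreover have "x \<notin> K" using K False by auto
      ultimately show ?thesis by (simp add: zero)
    qed
    from has_derivative_compose[OF has_derivative_pt[of i t "at s"] this]
    have "((\<lambda>s. u (pt i s t) * \<phi> (pt i s t)) has_derivative (\<lambda>h. \<Sum>k\<in>UNIV. (u (pt i s t) * pderiv_at k \<phi> (pt i s t) + D k (pt i s t) * \<phi> (pt i s t)) * (h *\<^sub>R axis i 1) $ k)) (at s)" .
    moreover have "(\<Sum>k\<in>UNIV. c k * (h *\<^sub>R axis i 1 :: real^2) $ k) = h * c i" for c :: "2 \<Rightarrow> real" and h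
    proof -
      have "(\<Sum>k\<in>UNIV. c k * (h *\<^sub>R axis i 1 :: real^2) $ k) = (\<Sum>k\<in>UNIV. if k = i then h * c i else 0)"
        by (rule sum.cong) (auto simp: axis_def)
      then show ?thesis by simp
    qed
    ultimately show "((\<lambda>s. u (pt i s t) * \<phi> (pt i s t)) has_vector_derivative ?g (pt i s t)) (at s)"
      by (simp add: has_vector_derivative_def)
  next
    show "continuous_on UNIV (\<lambda>s. ?g (pt i s t))"
      by (rule continuous_on_compose2[OF continuous_on_add[OF c1 c2]]) (auto intro!: continuous_intros)
  qed (use zero out in auto)
  have "(LINT x|lborel. ?g x) = 0" using fubini_pt(3)[of ?g i] i1 i2 line by simp
  then have "(LINT x|lborel. u x * pderiv_at i \<phi> x) = - (LINT x|lborel. D i x * \<phi> x)" using i1 i2 by simp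
  then show ?thesis using i1 i2 by (simp add: integral_completion)
qed

text \<open>Change of variables followed by the bound on the derivative of \<open>g\<close>. The
  endpoints may come in either order, since sine and cosine decrease on some of the arcs to which
  this is applied.\<close>

lemma substitution_bound:
  fixes g g' h :: "real \<Rightarrow> real"
  assumes ab: "a \<le> b" and ends: "g a = lo \<and> g b = hi \<or> g a = hi \<and> g b = lo" "lo \<le> hi"
    and sub: "g ` {a..b} \<subseteq> {lo..hi}" and h: "continuous_on {lo..hi} h" "\<And>x. x \<in> {lo..hi} \<Longrightarrow> 0 \<le> h x"
    and g: "\<And>x. (g has_field_derivative g' x) (at x)" and g': "\<And>x. \<bar>g' x\<bar> \<le> r" "r \<ge> 0"
  shows "integral {lo..hi} h \<le> r * integral {a..b} (\<lambda>x. h (g x))"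
proof -
  have gc: "continuous_on {a..b} g" using g DERIV_continuous_on by (metis DERIV_subset top_greatest)
  have I: "((\<lambda>x. g' x *\<^sub>R h (g x)) has_integral (integral {g a..g b} h - integral {g b..g a} h)) {a..b}"
    by (rule has_integral_substitution_general[OF finite.emptyI ab sub h(1) gc has_field_derivative_at_within[OF g]])
  have "\<bar>integral {g a..g b} h - integral {g b..g a} h\<bar> = integral {lo..hi} h"
  proof (cases "lo = hi")
    case True then show ?thesis using ends by auto
  next
    case False
    then have "{hi..lo} = {}" using ends(2) by auto
    moreover have "0 \<le> integral {lo..hi} h" using h by (intro integral_nonneg integrable_continuous_interval) auto
    ultimately show ?thesis using ends(1) by auto
  qed
  moreover have "norm (integral {a..b} (\<lambda>x. g' x *\<^sub>R h (g x))) \<le> integral {a..b} (\<lambda>x. r * h (g x))"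
  proof (rule integral_norm_bound_integral)
    show "(\<lambda>x. g' x *\<^sub>R h (g x)) integrable_on {a..b}" using I by blast
    show "(\<lambda>x. r * h (g x)) integrable_on {a..b}"
      by (intro integrable_continuous_interval continuous_intros continuous_on_compose2[OF h(1) gc sub])
    show "norm (g' x *\<^sub>R h (g x)) \<le> r * h (g x)" if "x \<in> {a..b}" for x
    proof -
      have "0 \<le> h (g x)" using sub that by (intro h(2)) blast
      then show ?thesis using g'(1)[of x] by (simp add: abs_mult mult_right_mono)
    qed
  qed
  ultimately show ?thesis using integral_unique[OF I] by simp
qed

section \<open>The closed perforated square and its boundary circle\<close>

definition Cl :: "real \<Rightarrow> real \<Rightarrow> (real^2) set" where
  "Cl L r = cbox (vec (- L)) (vec L) - ball 0 r"

lemma mem_Cl: "x \<in> Cl L r \<longleftrightarrow> (\<forall>k. \<bar>x $ k\<bar> \<le> L) \<and> r \<le> norm x"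
  by (auto simp: Cl_def mem_box_cart dist_norm abs_le_iff minus_le_iff)

lemma mem_Omega: "x \<in> Omega L r \<longleftrightarrow> (\<forall>k. \<bar>x $ k\<bar> < L) \<and> r \<le> norm x"
  by (auto simp: Omega_def mem_box_cart dist_norm abs_less_iff minus_less_iff)

lemma compact_Cl: "compact (Cl L r)"
  unfolding Cl_def by (intro compact_diff compact_cbox open_ball)

lemma Omega_subset_Cl: "Omega L r \<subseteq> Cl L r"
  unfolding Omega_def Cl_def using box_subset_cbox by blast

lemma Omega_sets [simp]: "Omega L r \<in> sets lebesgue"
  unfolding Omega_def by (intro sets.Diff) auto

lemma Omega_lmeasurable: "Omega L r \<in> lmeasurable"
  using fmeasurableI2[OF lmeasurable_compact[OF compact_Cl] Omega_subset_Cl] by simp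

lemma AE_Omega_Cl: "AE x in lebesgue. x \<in> Cl L r \<longrightarrow> x \<in> Omega L r"
proof -
  have "negligible (cbox (vec (- L)) (vec L) - box (vec (- L)) (vec L) :: (real^2) set)"
    by (rule negligible_frontier_interval)
  then have "AE x in lebesgue. x \<notin> cbox (vec (- L)) (vec L) - box (vec (- L)) (vec L :: real^2)"
    by (intro AE_not_in) (simp add: negligible_iff_null_sets)
  then show ?thesis by (rule eventually_mono) (auto simp: Cl_def Omega_def)
qed

lemma null_boundary_Omega: "null_boundary (Omega L r)"
proof -
  have "box (vec (- L)) (vec L) - cball 0 r \<subseteq> interior (Omega L r)"
    by (rule interior_maximal) (auto simp: Omega_def open_Diff)
  then have "Omega L r - interior (Omega L r) \<subseteq> cball 0 r - ball 0 r" by (auto simp: Omega_def)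
  moreover have "negligible (cball 0 r - ball 0 r :: (real^2) set)"
    unfolding cball_diff_eq_sphere by (rule negligible_sphere)
  ultimately show ?thesis unfolding null_boundary_def by (meson Omega_sets negligible_subset)
qed

text \<open>Fields in \<open>C1per\<close> are regular on the closure of the domain; this makes
  their regularity available on the compact set \<open>Cl L r\<close>. Points of the circle already
  lie in \<open>Omega L r\<close>, and any other point is a limit of its contractions towards the
  origin.\<close>

lemma Cl_subset_closure:
  assumes "0 < r" "r < L" shows "Cl L r \<subseteq> closure (Omega L r)"
proof
  fix x assume x: "x \<in> Cl L r"
  show "x \<in> closure (Omega L r)"
  proof (cases "norm x = r")
    case True
    then have "\<bar>x $ k\<bar> < L" for k using component_le_norm_cart[of x k] assms by linarith
    then have "x \<in> Omega L r" using True by (simp add: mem_Omega)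
    then show ?thesis using closure_subset by blast
  next
    case False
    then have r: "r < norm x" using x by (simp add: mem_Cl)
    have "((\<lambda>e. (1 - e) *\<^sub>R x) \<longlongrightarrow> (1 - 0) *\<^sub>R x) (at_right 0)" by (intro tendsto_intros)
    then have lim: "((\<lambda>e. (1 - e) *\<^sub>R x) \<longlongrightarrow> x) (at_right 0)" by simp
    have "\<forall>\<^sub>F e in at_right 0. r < norm ((1 - e) *\<^sub>R x)"
      by (rule order_tendstoD(1)[OF tendsto_norm[OF lim] r])
    moreover have "\<forall>\<^sub>F e in at_right 0. e < (1 :: real)" "\<forall>\<^sub>F e in at_right 0. 0 < (e :: real)"
      by (auto intro: eventually_at_right_less simp: eventually_at_right_real eventually_at_right[of 0 1] intro!: exI[of _ 1])
    ultimately have "\<forall>\<^sub>F e in at_right 0. (1 - e) *\<^sub>R x \<in> closure (Omega L r)"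
    proof eventually_elim
      case (elim e)
      have "\<bar>((1 - e) *\<^sub>R x) $ k\<bar> < L" for k
      proof -
        have "(1 - e) * \<bar>x $ k\<bar> \<le> (1 - e) * L" using x elim by (intro mult_left_mono) (auto simp: mem_Cl)
        also have "\<dots> < L" using elim assms by simp
        finally show ?thesis using elim by (simp add: abs_mult)
      qed
      then have "(1 - e) *\<^sub>R x \<in> Omega L r" using elim by (simp only: mem_Omega) auto
      then show ?case using closure_subset by blast
    qed
    then show ?thesis by (rule Lim_in_closed_set[OF closed_closure _ trivial_limit_at_right_real lim])
  qed
qed

lemma circle_pt_1: "circle_pt r \<theta> = pt 1 (r * cos \<theta>) (r * sin \<theta>)"
  by (simp add: circle_pt_def vec_eq_iff pt_nth forall_2)

lemma circle_pt_2: "circle_pt r \<theta> = pt 2 (r * sin \<theta>) (r * cos \<theta>)"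
  by (simp add: circle_pt_def vec_eq_iff pt_nth forall_2)

lemma norm_circle_pt: "0 \<le> r \<Longrightarrow> norm (circle_pt r \<theta>) = r"
proof -
  assume "0 \<le> r"
  have "(norm (circle_pt r \<theta>))\<^sup>2 = r\<^sup>2 * ((cos \<theta>)\<^sup>2 + (sin \<theta>)\<^sup>2)"
    unfolding circle_pt_1 norm_pt by (simp only: power_mult_distrib distrib_left)
  then have "(norm (circle_pt r \<theta>))\<^sup>2 = r\<^sup>2" by (simp only: sin_cos_squared_add2 mult_1_right)
  then show ?thesis using \<open>0 \<le> r\<close> by (metis norm_ge_zero power2_eq_iff_nonneg)
qed

lemma circle_pt_Cl: "0 \<le> r \<Longrightarrow> r \<le> L \<Longrightarrow> circle_pt r \<theta> \<in> Cl L r"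
  using norm_circle_pt[of r \<theta>] component_le_norm_cart[of "circle_pt r \<theta>"] order_trans by (auto simp: mem_Cl)

lemma continuous_on_circle_pt: "continuous_on S (circle_pt r)"
  unfolding circle_pt_1[abs_def] by (intro continuous_intros)

lemma sqrt_circle: "0 < r \<Longrightarrow> sqrt (r\<^sup>2 - (r * sin \<theta>)\<^sup>2) = r * \<bar>cos \<theta>\<bar>" "0 < r \<Longrightarrow> sqrt (r\<^sup>2 - (r * cos \<theta>)\<^sup>2) = r * \<bar>sin \<theta>\<bar>"
proof -
  assume r: "0 < r"
  have e: "r\<^sup>2 - (r * sin \<theta>)\<^sup>2 = (r * cos \<theta>)\<^sup>2" "r\<^sup>2 - (r * cos \<theta>)\<^sup>2 = (r * sin \<theta>)\<^sup>2"
    by (simp_all add: power_mult_distrib cos_squared_eq right_diff_distrib)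
  show "sqrt (r\<^sup>2 - (r * sin \<theta>)\<^sup>2) = r * \<bar>cos \<theta>\<bar>" "sqrt (r\<^sup>2 - (r * cos \<theta>)\<^sup>2) = r * \<bar>sin \<theta>\<bar>"
    unfolding e real_sqrt_abs using r by (simp_all add: abs_mult)
qed

text \<open>\<open>h\<close> is the modulus of \<open>p\<close> on a half circle, as a function of
  the coordinate \<open>t\<close> transverse to direction \<open>i\<close>; \<open>\<sigma>\<close>
  selects the half. Passing to the angle costs a factor at most \<open>r\<close>. It is
  \<open>t\<close> that is differentiated with respect to the angle and not conversely, so the ends
  of the half circle cause no singularity.\<close>

lemma boundary_arcs:
  fixes p :: "real^2 \<Rightarrow> real" and i :: 2
  assumes r: "0 < r" "r < L" and p: "continuous_on (Cl L r) p"
    and \<sigma>: "\<sigma> = 1 \<or> \<sigma> = -1"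
  defines "h \<equiv> \<lambda>t. \<bar>p (pt i (\<sigma> * sqrt (r\<^sup>2 - t\<^sup>2)) t)\<bar>"
  shows "continuous_on {-r..r} h"
    "integral {-r..r} h \<le> r * integral {0..2*pi} (\<lambda>\<theta>. \<bar>p (circle_pt r \<theta>)\<bar>)"
proof -
  have inCl: "pt i (\<sigma> * sqrt (r\<^sup>2 - t\<^sup>2)) t \<in> Cl L r" if "t \<in> {-r..r}" for t
  proof -
    have "t\<^sup>2 \<le> r\<^sup>2" using that abs_le_square_iff[of t r] r by auto
    then have "(norm (pt i (\<sigma> * sqrt (r\<^sup>2 - t\<^sup>2)) t))\<^sup>2 = r\<^sup>2" 
      using \<sigma> unfolding norm_pt by auto
    then have n: "norm (pt i (\<sigma> * sqrt (r\<^sup>2 - t\<^sup>2)) t) = r" using r by (metis less_imp_le norm_ge_zero power2_eq_iff_nonneg)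
    show ?thesis unfolding mem_Cl
    proof (intro conjI allI)
      fix k show "\<bar>pt i (\<sigma> * sqrt (r\<^sup>2 - t\<^sup>2)) t $ k\<bar> \<le> L"
        using component_le_norm_cart[of "pt i (\<sigma> * sqrt (r\<^sup>2 - t\<^sup>2)) t" k] n r by linarith
    qed (simp add: n)
  qed
  show hc: "continuous_on {-r..r} h"
    unfolding h_def
    by (intro continuous_on_rabs continuous_on_compose2[OF p] continuous_intros) (use inCl in auto)
  have h0: "0 \<le> h t" for t by (simp add: h_def)
  define q where "q \<theta> = \<bar>p (circle_pt r \<theta>)\<bar>" for \<theta>
  have qc: "continuous_on S q" for S
    unfolding q_def by (intro continuous_on_rabs continuous_on_compose2[OF p continuous_on_circle_pt]) (use circle_pt_Cl r in auto)
  have q0: "0 \<le> q \<theta>" for \<theta> by (simp add: q_def)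
  have qi: "q integrable_on {a..b}" for a b by (intro integrable_continuous_interval qc)
  have arc: "integral {lo..hi} h \<le> r * integral {a..b} q"
    if "a \<le> b" "g a = lo \<and> g b = hi \<or> g a = hi \<and> g b = lo" "lo \<le> hi" "g ` {a..b} \<subseteq> {lo..hi}" "-r \<le> lo" "hi \<le> r"
       "\<And>\<theta>. \<theta> \<in> {a..b} \<Longrightarrow> h (g \<theta>) = q \<theta>" "g = (\<lambda>\<theta>. r * sin \<theta>) \<or> g = (\<lambda>\<theta>. r * cos \<theta>)" for a b lo hi g
  proof -
    obtain g' where g': "\<And>x. (g has_field_derivative g' x) (at x)" "\<And>x. \<bar>g' x\<bar> \<le> r"
    proof -
      have d: "((\<lambda>\<theta>. r * sin \<theta>) has_field_derivative r * cos x) (at x)" "((\<lambda>\<theta>. r * cos \<theta>) has_field_derivative - r * sin x) (at x)" for x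
        by (auto intro!: derivative_eq_intros)
      have b: "\<bar>r * cos x\<bar> \<le> r" "\<bar>- r * sin x\<bar> \<le> r" for x using r by (auto simp: abs_mult mult_left_le)
      show ?thesis
      proof (cases "g = (\<lambda>\<theta>. r * sin \<theta>)")
        case True
        then show ?thesis using d(1) b(1) by (intro that[of "\<lambda>x. r * cos x"]) blast+
      next
        case False
        then have "g = (\<lambda>\<theta>. r * cos \<theta>)" using \<open>g = _ \<or> g = _\<close> by blast
        then show ?thesis using d(2) b(2) by (intro that[of "\<lambda>x. - r * sin x"]) blast+
      qed
    qed
    have "integral {lo..hi} h \<le> r * integral {a..b} (\<lambda>\<theta>. h (g \<theta>))"
      by (rule substitution_bound[OF that(1-4) continuous_on_subset[OF hc] h0 g'(1) g'(2)]) (use that r in auto)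
    also have "integral {a..b} (\<lambda>\<theta>. h (g \<theta>)) = integral {a..b} q"
      by (rule integral_cong) (use that in auto)
    finally show ?thesis .
  qed
  have mono: "integral {a..b} q \<le> integral {0..2*pi} q" if "0 \<le> a" "b \<le> 2*pi" for a b
    by (rule integral_subset_le) (use that qi q0 in auto)
  have split: "integral {0..2*pi} q = integral {0..pi/2} q + integral {pi/2..3*pi/2} q + integral {3*pi/2..2*pi} q"
    using Henstock_Kurzweil_Integration.integral_combine[of 0 "3*pi/2" "2*pi" q] Henstock_Kurzweil_Integration.integral_combine[of 0 "pi/2" "3*pi/2" q] qi by simp
  have sc: "-r \<le> r * sin \<theta>" "r * sin \<theta> \<le> r" "-r \<le> r * cos \<theta>" "r * cos \<theta> \<le> r" for \<theta>
    using r mult_left_mono[of "-1" "sin \<theta>" r] mult_left_mono[of "-1" "cos \<theta>" r] by (auto simp: mult_left_le)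
  have three: "sin (3*pi/2) = -1" "cos (3*pi/2) = 0"
    using sin_add[of pi "pi/2"] cos_add[of pi "pi/2"] by (simp_all add: field_simps)
  \<comment> \<open>Every half circle is a single interval of angles in \<open>{0..2*pi}\<close>,
    except the right one: the starting angle 0 splits it into an upper and a lower quarter.\<close>
  consider "i = 1" "\<sigma> = 1" | "i = 1" "\<sigma> = -1" | "i = 2" using \<sigma> exhaust_2[of i] by auto
  then show "integral {-r..r} h \<le> r * integral {0..2*pi} (\<lambda>\<theta>. \<bar>p (circle_pt r \<theta>)\<bar>)"
  proof cases
    case 1
    have hq: "h (r * sin \<theta>) = q \<theta>" if "cos \<theta> \<ge> 0" for \<theta>
      using that r 1 by (simp add: h_def q_def sqrt_circle circle_pt_1)
    have s: "sin \<theta> \<ge> 0" if "\<theta> \<in> {0..pi/2}" for \<theta> using that by (auto intro!: sin_ge_zero)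
    have c: "cos \<theta> \<ge> 0" if "\<theta> \<in> {0..pi/2}" for \<theta> using that by (auto intro!: cos_ge_zero)
    have s': "sin \<theta> \<le> 0" if "\<theta> \<in> {3*pi/2..2*pi}" for \<theta> 
      using that sin_ge_zero[of "\<theta> - pi"] by auto
    have c': "cos \<theta> \<ge> 0" if "\<theta> \<in> {3*pi/2..2*pi}" for \<theta>
      using that cos_ge_zero[of "2*pi - \<theta>"] cos_2pi_minus[of \<theta>] by auto
    have "integral {0..r} h \<le> r * integral {0..pi/2} q"
      by (rule arc[of _ _ "\<lambda>\<theta>. r * sin \<theta>"]) (use r s c hq sc in auto)
    moreover have "integral {-r..0} h \<le> r * integral {3*pi/2..2*pi} q"
      by (rule arc[of _ _ "\<lambda>\<theta>. r * sin \<theta>"]) (use r s' c' hq sc three in \<open>auto simp: mult_nonneg_nonpos\<close>)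
    moreover have "integral {-r..r} h = integral {-r..0} h + integral {0..r} h"
      using Henstock_Kurzweil_Integration.integral_combine[of "-r" 0 r h] integrable_continuous_interval[OF hc] r by simp
    moreover have "0 \<le> r * integral {pi/2..3*pi/2} q" using r q0 qi by (intro mult_nonneg_nonneg integral_nonneg) auto
    ultimately show ?thesis using split unfolding q_def[symmetric] by (simp add: distrib_left)
  next
    case 2
    have c': "cos \<theta> \<le> 0" if "\<theta> \<in> {pi/2..3*pi/2}" for \<theta>
      using that cos_ge_zero[of "\<theta> - pi"] cos_minus_pi[of \<theta>] by auto
    have hq: "h (r * sin \<theta>) = q \<theta>" if "cos \<theta> \<le> 0" for \<theta>
      using that r 2 by (simp add: h_def q_def sqrt_circle circle_pt_1 abs_of_nonpos)
    have "integral {-r..r} h \<le> r * integral {pi/2..3*pi/2} q"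
      by (rule arc[of _ _ "\<lambda>\<theta>. r * sin \<theta>"]) 
        (use r c' hq sc three in auto)
    also have "\<dots> \<le> r * integral {0..2*pi} q" using r by (intro mult_left_mono mono) auto
    finally show ?thesis unfolding q_def .
  next
    case 3
    have s: "sin \<theta> \<ge> 0" if "\<theta> \<in> {0..pi}" for \<theta> using that by (auto intro!: sin_ge_zero)
    have s': "sin \<theta> \<le> 0" if "\<theta> \<in> {pi..2*pi}" for \<theta> 
      using that sin_ge_zero[of "\<theta> - pi"] by auto
    show ?thesis
    proof (cases "\<sigma> = 1")
      case True
      have "integral {-r..r} h \<le> r * integral {0..pi} q"
        by (rule arc[of _ _ "\<lambda>\<theta>. r * cos \<theta>"]) 
          (use r 3 True s sc in \<open>auto simp: h_def q_def sqrt_circle circle_pt_2\<close>)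
      also have "\<dots> \<le> r * integral {0..2*pi} q" using r by (intro mult_left_mono mono) auto
      finally show ?thesis unfolding q_def .
    next
      case False
      then have "\<sigma> = -1" using \<sigma> by simp
      have hq: "h (r * cos \<theta>) = q \<theta>" if "sin \<theta> \<le> 0" for \<theta>
        using that r 3 \<open>\<sigma> = -1\<close> by (simp add: h_def q_def sqrt_circle circle_pt_2 abs_of_nonpos)
      have "integral {-r..r} h \<le> r * integral {pi..2*pi} q"
        by (rule arc[of _ _ "\<lambda>\<theta>. r * cos \<theta>"]) 
          (use r s' hq sc in auto)
      also have "\<dots> \<le> r * integral {0..2*pi} q" using r by (intro mult_left_mono mono) auto
      finally show ?thesis unfolding q_def .
    qed
  qed
qed

text \<open>On each line in direction \<open>i\<close> the fundamental theorem of calculus leaves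
  endpoint values. Those on the outer sides cancel by periodicity, and those on the circle are the
  two terms of \<open>boundary_arcs\<close>. Each is bounded by the integral over the whole circle,
  hence the factor 2.\<close>

lemma Green_bound:
  fixes p D :: "real^2 \<Rightarrow> real"
  assumes r: "0 < r" "r < L" and p: "continuous_on (Cl L r) p" and D: "continuous_on (Cl L r) D"
    and deriv: "\<And>s t. pt i s t \<in> Cl L r \<Longrightarrow> 
       ((\<lambda>s. p (pt i s t)) has_vector_derivative D (pt i s t)) (at s within {s. pt i s t \<in> Cl L r})"
    and per: "\<And>t. \<bar>t\<bar> \<le> L \<Longrightarrow> p (pt i L t) = p (pt i (- L) t)"
  shows "\<bar>LINT x|lebesgue_on (Omega L r). D x\<bar> \<le> 2 * r * integral {0..2*pi} (\<lambda>\<theta>. \<bar>p (circle_pt r \<theta>)\<bar>)"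
proof -
  let ?f = "\<lambda>x. indicator (Cl L r) x *\<^sub>R D x"
  have f: "integrable lborel ?f" by (rule borel_integrable_compact[OF compact_Cl D])
  have "(LINT x|lebesgue_on (Omega L r). D x) = (LINT x|lebesgue. indicator (Omega L r) x *\<^sub>R D x)"
    by (subst integral_restrict_space) auto
  also have "\<dots> = (LINT x|lebesgue. ?f x)"
  proof (rule integral_cong_AE)
    have fm: "?f \<in> borel_measurable lebesgue" using f by (simp add: measurable_completion)
    then show "?f \<in> borel_measurable lebesgue" .
    have "(\<lambda>x. indicator (Omega L r) x *\<^sub>R ?f x) \<in> borel_measurable lebesgue"
      by (rule borel_measurable_scaleR[OF borel_measurable_indicator fm]) simp
    moreover have "(\<lambda>x. indicator (Omega L r) x *\<^sub>R ?f x) = (\<lambda>x. indicator (Omega L r) x *\<^sub>R D x)"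
      by (rule ext) (use Omega_subset_Cl[of L r] in \<open>auto simp: indicator_def\<close>)
    ultimately show "(\<lambda>x. indicator (Omega L r) x *\<^sub>R D x) \<in> borel_measurable lebesgue" by simp
    show "AE x in lebesgue. indicator (Omega L r) x *\<^sub>R D x = ?f x"
      using AE_Omega_Cl[of L r] by eventually_elim (use Omega_subset_Cl[of L r] in \<open>auto simp: indicator_def\<close>)
  qed
  also have "\<dots> = (LINT x|lborel. ?f x)" using f by (intro integral_completion) simp
  finally have eq: "(LINT x|lebesgue_on (Omega L r). D x) = (LINT x|lborel. ?f x)" .
  define h where "h \<sigma> t = \<bar>p (pt i (\<sigma> * sqrt (r\<^sup>2 - t\<^sup>2)) t)\<bar>" for \<sigma> t
  note arc = boundary_arcs[OF r p, of _ i, folded h_def]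
  let ?b = "\<lambda>t. indicator {-r..r} t *\<^sub>R (h 1 t + h (-1) t)"
  have hc: "continuous_on {-r..r} (\<lambda>t. h 1 t + h (-1) t)" by (intro continuous_intros arc) auto
  have bi: "set_integrable lborel {-r..r} (\<lambda>t. h 1 t + h (-1) t)" by (rule borel_integrable_atLeastAtMost'[OF hc])
  have Cl_line: "pt i s t \<in> Cl L r \<longleftrightarrow> \<bar>s\<bar> \<le> L \<and> \<bar>t\<bar> \<le> L \<and> r\<^sup>2 \<le> s\<^sup>2 + t\<^sup>2" for s t
  proof -
    obtain j where j: "j \<noteq> i" "UNIV = {i, j}" "\<forall>k. k = i \<or> k = j" by (rule two_cases[of i])
    have "(\<forall>k. \<bar>pt i s t $ k\<bar> \<le> L) \<longleftrightarrow> \<bar>s\<bar> \<le> L \<and> \<bar>t\<bar> \<le> L"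
    proof
      assume *: "\<forall>k. \<bar>pt i s t $ k\<bar> \<le> L"
      show "\<bar>s\<bar> \<le> L \<and> \<bar>t\<bar> \<le> L" using spec[OF *, of i] spec[OF *, of j] j(1) by (simp add: pt_nth)
    qed (simp add: pt_nth)
    moreover have "r \<le> norm (pt i s t) \<longleftrightarrow> r\<^sup>2 \<le> s\<^sup>2 + t\<^sup>2"
      unfolding norm_pt[of i, symmetric] using r abs_le_square_iff[of r "norm (pt i s t)"] by simp
    ultimately show ?thesis by (simp add: mem_Cl)
  qed
  have seg: "set_integrable lborel {a..b} (\<lambda>s. D (pt i s t)) \<and>
      (LINT s|lborel. indicator {a..b} s *\<^sub>R D (pt i s t)) = p (pt i b t) - p (pt i a t)"
    if "a \<le> b" "\<And>s. s \<in> {a..b} \<Longrightarrow> pt i s t \<in> Cl L r" for a b t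
  proof -
    have c: "continuous_on {a..b} (\<lambda>s. D (pt i s t))"
      by (rule continuous_on_compose2[OF D]) (use that in \<open>auto intro!: continuous_intros\<close>)
    have "((\<lambda>s. p (pt i s t)) has_vector_derivative D (pt i s t)) (at s within {a..b})" if "a \<le> s" "s \<le> b" for s
      by (rule has_vector_derivative_within_subset[OF deriv]) (use \<open>\<And>s. s \<in> {a..b} \<Longrightarrow> pt i s t \<in> Cl L r\<close> that in auto)
    then show ?thesis using integral_FTC_atLeastAtMost[OF that(1) _ c] borel_integrable_atLeastAtMost'[OF c] by blast
  qed
  have line: "\<bar>LINT s|lborel. ?f (pt i s t)\<bar> \<le> ?b t" for t
  proof -
    have b0: "0 \<le> ?b t" by (simp add: h_def)
    \<comment> \<open>The line misses the square, crosses it without entering the hole, or is cut by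
      the hole into two segments. In the last case \<open>c\<close> is half the length of the
      chord.\<close>
    consider "\<bar>t\<bar> > L" | "r \<le> \<bar>t\<bar>" "\<bar>t\<bar> \<le> L" | "\<bar>t\<bar> < r" by linarith
    then show ?thesis
    proof cases
      case 1
      then have "?f (pt i s t) = 0" for s using Cl_line[of s t] by (simp add: indicator_def)
      then have "(\<lambda>s. ?f (pt i s t)) = (\<lambda>_. 0)" by (rule ext)
      then show ?thesis using b0 by (simp only: integral_zero abs_zero)
    next
      case 2
      have "r\<^sup>2 \<le> t\<^sup>2" using 2(1) r abs_le_square_iff[of r t] by simp
      then have "r\<^sup>2 \<le> s\<^sup>2 + t\<^sup>2" for s by (simp add: add_increasing)
      then have *: "pt i s t \<in> Cl L r \<longleftrightarrow> s \<in> {-L..L}" for s using 2(2) Cl_line[of s t] by auto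
      then have "?f (pt i s t) = indicator {-L..L} s *\<^sub>R D (pt i s t)" for s by (simp add: indicator_def)
      then have "(\<lambda>s. ?f (pt i s t)) = (\<lambda>s. indicator {-L..L} s *\<^sub>R D (pt i s t))" by (rule ext)
      moreover have "(LINT s|lborel. indicator {-L..L} s *\<^sub>R D (pt i s t)) = 0"
        using seg[of "-L" L t] * per[of t] 2 r by simp
      ultimately show ?thesis using b0 by (simp only: abs_zero)
    next
      case 3
      define c where "c = sqrt (r\<^sup>2 - t\<^sup>2)"
      have "t\<^sup>2 < r\<^sup>2" using 3 r abs_le_square_iff[of r t] by simp
      then have c: "0 < c" "c\<^sup>2 = r\<^sup>2 - t\<^sup>2" by (auto simp: c_def)
      have "c\<^sup>2 \<le> r\<^sup>2" unfolding c(2) by simp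
      then have "c \<le> r" using r c(1) by (metis less_imp_le power2_le_imp_le)
      have *: "pt i s t \<in> Cl L r \<longleftrightarrow> s \<in> {-L..-c} \<or> s \<in> {c..L}" for s
      proof -
        have "r\<^sup>2 \<le> s\<^sup>2 + t\<^sup>2 \<longleftrightarrow> c\<^sup>2 \<le> s\<^sup>2" unfolding c(2) by auto
        also have "\<dots> \<longleftrightarrow> c \<le> \<bar>s\<bar>" using c(1) abs_le_square_iff[of c s] by simp
        finally show ?thesis using 3 r c(1) Cl_line[of s t] by auto
      qed
      have "?f (pt i s t) = indicator {-L..-c} s *\<^sub>R D (pt i s t) + indicator {c..L} s *\<^sub>R D (pt i s t)" for s
        using *[of s] c(1) by (auto simp: indicator_def)
      then have "(\<lambda>s. ?f (pt i s t)) = (\<lambda>s. indicator {-L..-c} s *\<^sub>R D (pt i s t) + indicator {c..L} s *\<^sub>R D (pt i s t))" by (rule ext)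
      then have "(LINT s|lborel. ?f (pt i s t)) = (p (pt i (-c) t) - p (pt i (-L) t)) + (p (pt i L t) - p (pt i c t))"
        using seg[of "-L" "-c" t] seg[of c L t] * \<open>c \<le> r\<close> r by (simp add: set_integrable_def)
      also have "\<dots> = p (pt i (-c) t) - p (pt i c t)" using per[of t] 3 r by simp
      finally have "(LINT s|lborel. ?f (pt i s t)) = p (pt i (-c) t) - p (pt i c t)" .
      moreover have "indicator {-r..r} t = (1::real)" using 3 by (auto simp: indicator_def)
      moreover have "h 1 t = \<bar>p (pt i c t)\<bar>" "h (-1) t = \<bar>p (pt i (-c) t)\<bar>" by (simp_all add: h_def c_def)
      ultimately show ?thesis using abs_triangle_ineq4[of "p (pt i (-c) t)" "p (pt i c t)"] by simp
    qed
  qed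
  have "\<bar>LINT x|lborel. ?f x\<bar> \<le> (LINT t|lborel. ?b t)"
    using line bi by (intro fubini_pt_bound[OF f]) (auto simp: set_integrable_def)
  also have "\<dots> = integral {-r..r} (\<lambda>t. h 1 t + h (-1) t)"
    using set_borel_integral_eq_integral(2)[OF bi] by (simp add: set_lebesgue_integral_def)
  also have "\<dots> = integral {-r..r} (h 1) + integral {-r..r} (h (-1))"
    using arc(1) by (intro integral_add integrable_continuous_interval) auto
  also have "\<dots> \<le> 2 * r * integral {0..2*pi} (\<lambda>\<theta>. \<bar>p (circle_pt r \<theta>)\<bar>)"
    using arc(2)[of 1] arc(2)[of "-1"] by simp
  finally show ?thesis unfolding eq .
qed

section \<open>Periodic fields\<close>

lemma C1perD:
  assumes r: "0 < r" "r < L" and w: "w \<in> C1per L r"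
  obtains J where "continuous_on (Cl L r) J" "\<forall>x\<in>Cl L r. (w has_derivative (\<lambda>h. J x *v h)) (at x within Cl L r)"
    "periodic_field L w" "continuous_on (Cl L r) w"
proof -
  have sub: "Cl L r \<subseteq> periodic_ext L (closure (Omega L r))"
  proof
    fix x assume "x \<in> Cl L r"
    then have "x \<in> closure (Omega L r)" using Cl_subset_closure[OF r] by blast
    moreover have "x = x + (2 * L) *\<^sub>R (\<chi> i. of_int ((0 :: int^2) $ i))" by (simp add: vec_eq_iff)
    ultimately show "x \<in> periodic_ext L (closure (Omega L r))" unfolding periodic_ext_def by blast
  qed
  obtain J where J: "continuous_on (periodic_ext L (closure (Omega L r))) J"
    "\<forall>x\<in>periodic_ext L (closure (Omega L r)). (w has_derivative (\<lambda>h. J x *v h)) (at x within periodic_ext L (closure (Omega L r)))"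
    using w by (auto simp: C1per_def Let_def)
  show ?thesis
  proof (rule that[of J])
    show "continuous_on (Cl L r) J" using J(1) sub by (rule continuous_on_subset)
    show d: "\<forall>x\<in>Cl L r. (w has_derivative (\<lambda>h. J x *v h)) (at x within Cl L r)"
      using J(2) sub has_derivative_subset by blast
    show "periodic_field L w" using w by (simp add: C1per_def)
    show "continuous_on (Cl L r) w" 
      unfolding continuous_on_eq_continuous_within using has_derivative_continuous[OF bspec[OF d]] by blast
  qed
qed

lemma has_derivative_component:
  fixes w :: "real^2 \<Rightarrow> real^2"
  assumes "(w has_derivative (\<lambda>h. A *v h)) F"
  shows "((\<lambda>x. w x $ j) has_derivative (\<lambda>h. \<Sum>k\<in>UNIV. A $ j $ k * h $ k)) F"
  using bounded_linear.has_derivative[OF bounded_linear_vec_nth assms, of j] by (simp add: matrix_vector_mult_def)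

lemma continuous_on_nth: "continuous_on S f \<Longrightarrow> continuous_on S (\<lambda>x. f x $ i)"
  by (intro continuous_intros)

text \<open>Classical derivatives are weak ones by integration by parts. The direction of
  differentiation is the first index of \<open>wgrad\<close> and the second of the Jacobian, hence
  the transposition.\<close>

lemma C1_H1_field:
  assumes J: "continuous_on (Cl L r) J" and d: "\<forall>x\<in>Cl L r. (w has_derivative (\<lambda>h. J x *v h)) (at x within Cl L r)"
  shows "w \<in> H1_field (Omega L r)" "AE x in lebesgue_on (Omega L r). wgrad (Omega L r) w x = transpose (J x)"
    "has_weak_pderiv (Omega L r) i (\<lambda>x. w x $ j) (\<lambda>x. transpose (J x) $ i $ j)"
    "(\<lambda>x. transpose (J x)) \<in> L2 (lebesgue_on (Omega L r))"
proof -
  have wc: "continuous_on (Cl L r) w" 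
    unfolding continuous_on_eq_continuous_within using has_derivative_continuous[OF bspec[OF d]] by blast
  have wL: "w \<in> L2 (lebesgue_on (Omega L r))"
    by (rule continuous_compact_L2[OF wc compact_Cl Omega_subset_Cl Omega_sets])
  have "continuous_on (Cl L r) (\<lambda>x. transpose (J x))"
    unfolding transpose_def by (intro continuous_on_vec_lambda continuous_on_nth J)
  then show JL: "(\<lambda>x. transpose (J x)) \<in> L2 (lebesgue_on (Omega L r))"
    by (rule continuous_compact_L2[OF _ compact_Cl Omega_subset_Cl Omega_sets])
  show weak: "has_weak_pderiv (Omega L r) i (\<lambda>x. w x $ j) (\<lambda>x. transpose (J x) $ i $ j)" for i j
    unfolding has_weak_pderiv_iff[OF Omega_sets]
  proof (intro conjI allI impI)
    show "loc_int (interior (Omega L r)) (\<lambda>x. w x $ j)"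
      using wL unfolding L2_component_iff[of w] by (intro L2_imp_loc_int) auto
    show "loc_int (interior (Omega L r)) (\<lambda>x. transpose (J x) $ i $ j)"
      using JL unfolding L2_component_iff[of "\<lambda>x. transpose (J x)"] L2_component_iff[of "\<lambda>x. transpose (J x) $ _"]
      by (intro L2_imp_loc_int) auto
    fix \<phi> assume t: "test_function (interior (Omega L r)) \<phi>"
    have sub: "interior (Omega L r) \<subseteq> Cl L r" using interior_subset Omega_subset_Cl by blast
    have "(LINT x|lebesgue. w x $ j * pderiv_at i \<phi> x) = - (LINT x|lebesgue. J x $ j $ i * \<phi> x)"
    proof (rule C1_integration_by_parts[OF open_interior _ _ t])
      fix x assume x: "x \<in> interior (Omega L r)"
      then have "x \<in> interior (Cl L r)" using interior_mono[OF Omega_subset_Cl] by blast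
      then have "at x within Cl L r = at x" by (rule at_within_interior)
      then have "(w has_derivative (\<lambda>h. J x *v h)) (at x)" using d x sub by (metis subset_iff)
      then show "((\<lambda>x. w x $ j) has_derivative (\<lambda>h. \<Sum>k\<in>UNIV. J x $ j $ k * h $ k)) (at x)"
        by (rule has_derivative_component)
    next
      show "continuous_on (interior (Omega L r)) (\<lambda>x. J x $ j $ i)"
        by (intro continuous_on_nth continuous_on_subset[OF J sub])
    qed
    then show "(LINT x|lebesgue. w x $ j * pderiv_at i \<phi> x) = - (LINT x|lebesgue. transpose (J x) $ i $ j * \<phi> x)"
      by (simp add: transpose_def)
  qed
  show "w \<in> H1_field (Omega L r)" by (rule H1_fieldI[OF wL JL weak])
  show "AE x in lebesgue_on (Omega L r). wgrad (Omega L r) w x = transpose (J x)"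
    by (rule wgrad_eqI[OF null_boundary_Omega weak])
qed

section \<open>The period lattice and reduction to the fundamental cell\<close>

definition lat :: "real \<Rightarrow> int^2 \<Rightarrow> real^2" where "lat L k = (2 * L) *\<^sub>R (\<chi> i. of_int (k $ i))"

text \<open>The cells are the lattice translates of the half-open square \<open>[-L, L)^2\<close>.
  For \<open>L > 0\<close> they partition the plane, and the fundamental one differs from
  \<open>Omega L 0\<close> by a null set.\<close>

definition cell :: "real \<Rightarrow> real^2 \<Rightarrow> int^2" where "cell L x = (\<chi> i. \<lfloor>(x $ i + L) / (2 * L)\<rfloor>)"

definition wrap :: "real \<Rightarrow> real^2 \<Rightarrow> real^2" where "wrap L x = x - lat L (cell L x)"

lemma lat_nth: "lat L k $ i = 2 * L * of_int (k $ i)" by (simp add: lat_def)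

lemma lat_0: "lat L 0 = 0" by (simp add: vec_eq_iff lat_nth)

lemma cell_eq_iff:
  assumes "L > 0"
  shows "cell L x = k \<longleftrightarrow> (\<forall>i. - L \<le> (x - lat L k) $ i \<and> (x - lat L k) $ i < L)"
proof -
  have "\<lfloor>(x $ i + L) / (2 * L)\<rfloor> = k $ i \<longleftrightarrow> - L \<le> (x - lat L k) $ i \<and> (x - lat L k) $ i < L" for i
    unfolding floor_eq_iff using assms by (auto simp: lat_nth field_simps)
  then show ?thesis by (simp add: cell_def vec_eq_iff)
qed

lemma wrap_bounds: "L > 0 \<Longrightarrow> - L \<le> wrap L x $ i \<and> wrap L x $ i < L"
  using cell_eq_iff[of L x "cell L x"] by (simp add: wrap_def)

lemma cell_add_lat: "L > 0 \<Longrightarrow> (\<forall>i. - L \<le> y $ i \<and> y $ i < L) \<Longrightarrow> cell L (y + lat L k) = k"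
  by (simp add: cell_eq_iff)

lemma wrap_add_lat: "L > 0 \<Longrightarrow> (\<forall>i. - L \<le> y $ i \<and> y $ i < L) \<Longrightarrow> wrap L (y + lat L k) = y"
  by (simp add: wrap_def cell_add_lat)

lemma wrap_id: "L > 0 \<Longrightarrow> (\<forall>i. - L \<le> y $ i \<and> y $ i < L) \<Longrightarrow> wrap L y = y"
  using wrap_add_lat[of L y 0] by (simp add: lat_0)

lemma Omega_bounds: assumes "y \<in> Omega L r" shows "\<forall>i. - L \<le> y $ i \<and> y $ i < L"
proof
  fix i
  have "\<bar>y $ i\<bar> < L" using assms by (simp add: mem_Omega)
  then show "- L \<le> y $ i \<and> y $ i < L" by linarith
qed

lemma bounds_Cl: assumes "\<forall>i. - L \<le> y $ i \<and> y $ i < L" shows "y \<in> Cl L 0"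
  unfolding mem_Cl
proof (intro conjI allI)
  fix i show "\<bar>y $ i\<bar> \<le> L" using spec[OF assms, of i] by linarith
qed simp

lemma wrap_Omega: "L > 0 \<Longrightarrow> y \<in> Omega L r \<Longrightarrow> wrap L y = y"
  by (rule wrap_id) (auto dest: Omega_bounds)

lemma lat_add: "lat L k + lat L l = lat L (k + l)"
  by (simp add: vec_eq_iff lat_nth distrib_left)

lemma wrap_periodic: assumes "L > 0" shows "wrap L (x + lat L k) = wrap L x"
proof -
  have "x + lat L k = wrap L x + lat L (cell L x + k)" by (simp add: wrap_def lat_add[symmetric])
  then show ?thesis using wrap_add_lat[OF assms, of "wrap L x" "cell L x + k"] wrap_bounds[OF assms] by simp
qed

lemma periodic_field_lat:
  assumes "periodic_field L w" shows "w (x + lat L k) = w x"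
proof -
  have step: "w (x + (2 * L) *\<^sub>R axis i 1) = w x" for x i using assms by (auto simp: periodic_field_def)
  have nat: "w (x + (2 * L * real n) *\<^sub>R axis i 1) = w x" for x i n
  proof (induction n arbitrary: x)
    case (Suc n)
    have "x + (2 * L * real (Suc n)) *\<^sub>R axis i 1 = (x + (2 * L) *\<^sub>R axis i 1) + (2 * L * real n) *\<^sub>R axis i 1"
      by (simp add: algebra_simps)
    then show ?case by (simp only: Suc.IH step)
  qed simp
  have int: "w (x + (2 * L * of_int m) *\<^sub>R axis i 1) = w x" for x i m
  proof (cases "m \<ge> 0")
    case True
    then show ?thesis using nat[of x "nat m" i] by simp
  next
    case False
    then show ?thesis using nat[of "x + (2 * L * of_int m) *\<^sub>R axis i 1" "nat (- m)" i] by (simp add: algebra_simps)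
  qed
  have "x + lat L k = (x + (2 * L * of_int (k $ 1)) *\<^sub>R axis 1 1) + (2 * L * of_int (k $ 2)) *\<^sub>R axis 2 1"
    by (simp add: vec_eq_iff lat_nth forall_2 axis_def)
  then show ?thesis by (simp only: int)
qed

lemma periodic_field_wrap: "periodic_field L w \<Longrightarrow> w (wrap L x) = w x"
  using periodic_field_lat[of L w "wrap L x" "cell L x"] by (simp add: wrap_def)

lemma periodic_field_comp_wrap: assumes "L > 0" shows "periodic_field L (\<lambda>x. v (wrap L x))"
proof -
  have "(2 * L) *\<^sub>R axis i 1 = lat L (axis i 1)" for i by (simp add: vec_eq_iff lat_nth axis_def)
  then show ?thesis using wrap_periodic[OF assms] by (simp add: periodic_field_def)
qed

section \<open>Translation invariance and integration over lattice cells\<close>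

lemma lebesgue_translation: "distr lebesgue lebesgue (\<lambda>x :: 'a::euclidean_space. a + x) = lebesgue"
  and lebesgue_translation_measurable: "(\<lambda>x. a + x) \<in> lebesgue \<rightarrow>\<^sub>M (lebesgue :: 'a measure)"
proof -
  have e: "(\<lambda>x. a + (\<Sum>j\<in>Basis. (1 * (x \<bullet> j)) *\<^sub>R j)) = (\<lambda>x. a + x)" by (simp add: euclidean_representation)
  show "(\<lambda>x. a + x) \<in> lebesgue \<rightarrow>\<^sub>M lebesgue" using lebesgue_affine_measurable[of "\<lambda>_. 1" a] unfolding e by simp
  have "lebesgue = density (distr lebesgue lebesgue (\<lambda>x. a + x)) (\<lambda>_. 1)"
    using lebesgue_affine_euclidean[of "\<lambda>_. 1" a] unfolding e by simp
  then show "distr lebesgue lebesgue (\<lambda>x. a + x) = lebesgue" by (simp add: density_1)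
qed

lemma integral_translation:
  fixes f :: "'a::euclidean_space \<Rightarrow> 'b::{banach, second_countable_topology}"
  assumes "f \<in> borel_measurable lebesgue"
  shows "(LINT x|lebesgue. f (a + x)) = (LINT x|lebesgue. f x)"
  using integral_distr[OF lebesgue_translation_measurable assms, of a] by (simp add: lebesgue_translation)

lemma integrable_translation:
  fixes f :: "'a::euclidean_space \<Rightarrow> 'b::{banach, second_countable_topology}"
  assumes "integrable lebesgue f"
  shows "integrable lebesgue (\<lambda>x. f (a + x))"
  using integrable_distr[OF lebesgue_translation_measurable, of a f] assms by (simp add: lebesgue_translation)

lemma AE_translation:
  fixes P :: "'a::euclidean_space \<Rightarrow> bool"
  assumes "AE x in lebesgue. P x" shows "AE x in lebesgue. P (a + x)"
proof -
  obtain N where N: "N \<in> null_sets lebesgue" "{x \<in> space lebesgue. \<not> P x} \<subseteq> N" using assms by (auto simp: eventually_ae_filter)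
  have "(\<lambda>x. a + x) -` N \<inter> space lebesgue \<in> null_sets (lebesgue :: 'a measure)"
  proof -
    have "emeasure (distr lebesgue lebesgue (\<lambda>x :: 'a. a + x)) N = emeasure lebesgue ((\<lambda>x. a + x) -` N \<inter> space lebesgue)"
      using N by (intro emeasure_distr lebesgue_translation_measurable) auto
    then show ?thesis using N measurable_sets[OF lebesgue_translation_measurable[of a], of N]
      by (auto simp: lebesgue_translation null_sets_def)
  qed
  then show ?thesis using N(2) by (auto simp: eventually_ae_filter intro!: bexI[of _ "(\<lambda>x. a + x) -` N \<inter> space lebesgue"])
qed

text \<open>The exceptional points lie in a countable union of null sets: the lattice translates of
  the bad points in the square and of its boundary.\<close>

lemma AE_wrap:
  assumes L: "L > 0" and P: "AE y in lebesgue_on (Omega L 0). P y"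
  shows "AE x in lebesgue. wrap L x \<in> Omega L 0 \<and> P (wrap L x)"
proof -
  have "AE y in lebesgue. y \<in> Omega L 0 \<longrightarrow> P y" using P by (simp add: AE_lebesgue_on_iff)
  moreover note AE_Omega_Cl[of L 0]
  ultimately have "AE y in lebesgue. y \<in> Cl L 0 \<longrightarrow> y \<in> Omega L 0 \<and> P y" by eventually_elim auto
  then have "AE x in lebesgue. - lat L k + x \<in> Cl L 0 \<longrightarrow> - lat L k + x \<in> Omega L 0 \<and> P (- lat L k + x)" for k
    by (rule AE_translation)
  then have "AE x in lebesgue. \<forall>k. - lat L k + x \<in> Cl L 0 \<longrightarrow> - lat L k + x \<in> Omega L 0 \<and> P (- lat L k + x)"
    by (simp add: AE_all_countable)
  then show ?thesis
  proof eventually_elim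
    case (elim x)
    have "wrap L x \<in> Cl L 0" using wrap_bounds[OF L, of x] by (intro bounds_Cl) blast
    then show ?case using elim[rule_format, of "cell L x"] by (simp add: wrap_def)
  qed
qed

definition Cell :: "real \<Rightarrow> int^2 \<Rightarrow> (real^2) set" where "Cell L k = {x. cell L x = k}"

lemma Cell_eq: assumes "L > 0" shows "Cell L k = (\<lambda>y. lat L k + y) ` Cell L 0"
proof -
  have "Cell L l = {x. \<forall>i. - L \<le> (x - lat L l) $ i \<and> (x - lat L l) $ i < L}" for l
    using cell_eq_iff[OF assms] by (auto simp: Cell_def)
  then have C: "x \<in> Cell L k \<longleftrightarrow> x - lat L k \<in> Cell L 0" for x by (simp add: lat_0)
  show ?thesis
  proof (intro set_eqI iffI)
    fix x assume "x \<in> Cell L k"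
    then show "x \<in> (\<lambda>y. lat L k + y) ` Cell L 0" using C by (intro image_eqI[of _ _ "x - lat L k"]) auto
  next
    fix x assume "x \<in> (\<lambda>y. lat L k + y) ` Cell L 0"
    then obtain y where "x = lat L k + y" "y \<in> Cell L 0" by blast
    then show "x \<in> Cell L k" using C[of x] by simp
  qed
qed

lemma Cell_sets: assumes "L > 0" shows "Cell L k \<in> sets lebesgue"
proof -
  have "Cell L 0 = (\<Inter>i. {x. - L \<le> x $ i} \<inter> {x. x $ i < L})" using cell_eq_iff[OF assms] by (auto simp: Cell_def lat_0)
  moreover have "{x :: real^2. - L \<le> x $ i} \<in> sets borel" "{x :: real^2. x $ i < L} \<in> sets borel" for i
    by (auto intro!: borel_closed borel_open closed_Collect_le open_Collect_less continuous_intros)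
  ultimately have "Cell L 0 \<in> sets borel" by auto
  then show ?thesis unfolding Cell_eq[OF assms, of k] by (intro lebesgue_sets_translation) simp
qed

lemma AE_Cell_Omega: assumes "L > 0" shows "AE y in lebesgue. y \<in> Cell L 0 \<longleftrightarrow> y \<in> Omega L 0"
proof -
  have C: "y \<in> Cell L 0 \<longleftrightarrow> (\<forall>i. - L \<le> y $ i \<and> y $ i < L)" for y using cell_eq_iff[OF assms] by (auto simp: Cell_def lat_0)
  show ?thesis using AE_Omega_Cl[of L 0]
  proof eventually_elim
    case (elim y)
    then show ?case using bounds_Cl[of L y] Omega_bounds[of y L 0] unfolding C by blast
  qed
qed

lemma wrap_comp_measurable:
  fixes F :: "real^2 \<Rightarrow> 'b::euclidean_space"
  assumes L: "L > 0" and F: "F \<in> borel_measurable (lebesgue_on (Omega L 0))"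
  shows "(\<lambda>x. F (wrap L x)) \<in> borel_measurable lebesgue"
proof -
  define G where "G x = (if x \<in> Omega L 0 then F x else 0)" for x
  have G: "G \<in> borel_measurable lebesgue" using F unfolding G_def by (simp add: borel_measurable_if)
  have "(\<lambda>x. G (wrap L x)) \<in> borel_measurable lebesgue"
  proof (rule measurableI)
    fix A :: "'b set" assume A: "A \<in> sets borel"
    \<comment> \<open>On a single cell \<open>wrap L\<close> is a translation, so the preimage is a
      countable union of translated measurable pieces.\<close>
    have "(\<lambda>x. G (wrap L x)) -` A \<inter> space lebesgue = (\<Union>k. Cell L k \<inter> ((\<lambda>x. - lat L k + x) -` (G -` A \<inter> space lebesgue) \<inter> space lebesgue))"
      by (auto simp: Cell_def wrap_def)
    also have "\<dots> \<in> sets lebesgue"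
      by (intro sets.countable_UN'' countableI_type sets.Int[OF Cell_sets[OF L] measurable_sets[OF lebesgue_translation_measurable measurable_sets[OF G A]]])
    finally show "(\<lambda>x. G (wrap L x)) -` A \<inter> space lebesgue \<in> sets lebesgue" .
  qed simp
  moreover have "AE x in lebesgue. G (wrap L x) = F (wrap L x)"
    using AE_wrap[OF L, of "\<lambda>_. True"] by (auto simp: G_def elim!: eventually_mono)
  ultimately show ?thesis by (rule borel_measurable_AE)
qed

lemma Cell_integral:
  fixes h :: "real^2 \<Rightarrow> real"
  assumes L: "L > 0" and h: "integrable (lebesgue_on (Omega L 0)) (\<lambda>y. h (y + lat L k))"
  shows "integrable lebesgue (\<lambda>x. indicator (Cell L k) x * h x)"
    "(LINT x|lebesgue. indicator (Cell L k) x * h x) = (LINT y|lebesgue_on (Omega L 0). h (y + lat L k))"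
proof -
  let ?g = "\<lambda>y. indicator (Cell L 0) y * h (y + lat L k)"
  let ?g' = "\<lambda>y. indicator (Omega L 0) y *\<^sub>R h (y + lat L k)"
  have g': "integrable lebesgue ?g'" using h by (subst (asm) integrable_restrict_space) auto
  have ae: "AE y in lebesgue. ?g' y = ?g y" using AE_Cell_Omega[OF L] by eventually_elim (auto simp: indicator_def)
  have gm: "?g \<in> borel_measurable lebesgue" by (rule borel_measurable_AE[OF borel_measurable_integrable[OF g'] ae])
  have g: "integrable lebesgue ?g" by (rule integrable_cong_AE_imp[OF g' gm ae])
  have e: "?g (- lat L k + x) = indicator (Cell L k) x * h x" for x
    unfolding Cell_eq[OF L, of k] by (auto simp: indicator_def image_iff algebra_simps)
  show "integrable lebesgue (\<lambda>x. indicator (Cell L k) x * h x)"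
    using integrable_translation[OF g, of "- lat L k"] unfolding e .
  have "(LINT x|lebesgue. indicator (Cell L k) x * h x) = (LINT y|lebesgue. ?g y)"
    using integral_translation[OF gm, of "- lat L k"] unfolding e .
  also have "\<dots> = (LINT y|lebesgue. ?g' y)" by (rule integral_cong_AE[symmetric, OF borel_measurable_integrable[OF g'] gm ae])
  also have "\<dots> = (LINT y|lebesgue_on (Omega L 0). h (y + lat L k))" by (subst integral_restrict_space) auto
  finally show "(LINT x|lebesgue. indicator (Cell L k) x * h x) = (LINT y|lebesgue_on (Omega L 0). h (y + lat L k))" .
qed

lemma unfold_integral:
  fixes h :: "real^2 \<Rightarrow> real"
  assumes L: "L > 0" and K: "finite K" "\<And>x. cell L x \<notin> K \<Longrightarrow> h x = 0"
    and h: "\<And>k. k \<in> K \<Longrightarrow> integrable (lebesgue_on (Omega L 0)) (\<lambda>y. h (y + lat L k))"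
  shows "integrable lebesgue h" "(LINT x|lebesgue. h x) = (\<Sum>k\<in>K. LINT y|lebesgue_on (Omega L 0). h (y + lat L k))"
proof -
  have "h x = (\<Sum>k\<in>K. indicator (Cell L k) x * h x)" for x
  proof (cases "cell L x \<in> K")
    case True
    have "(\<Sum>k\<in>K. indicator (Cell L k) x * h x) = (\<Sum>k\<in>K. if k = cell L x then h x else 0)"
      by (intro sum.cong) (auto simp: Cell_def indicator_def)
    then show ?thesis using True K(1) by simp
  next
    case False
    then show ?thesis using K(2) by simp
  qed
  then have e: "h = (\<lambda>x. \<Sum>k\<in>K. indicator (Cell L k) x * h x)" by (rule ext)
  show "integrable lebesgue h" by (subst e) (intro Bochner_Integration.integrable_sum Cell_integral(1)[OF L h])
  have "(LINT x|lebesgue. h x) = (\<Sum>k\<in>K. LINT x|lebesgue. indicator (Cell L k) x * h x)"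
    by (subst e, intro Bochner_Integration.integral_sum Cell_integral(1)[OF L h])
  then show "(LINT x|lebesgue. h x) = (\<Sum>k\<in>K. LINT y|lebesgue_on (Omega L 0). h (y + lat L k))"
    using Cell_integral(2)[OF L h] by simp
qed

definition cells :: "nat \<Rightarrow> (int^2) set" where "cells N = {k. \<forall>i. \<bar>k $ i\<bar> \<le> int N}"

lemma finite_cells: "finite (cells N)"
proof -
  have "cells N \<subseteq> (\<lambda>(a, b). \<chi> i. if i = 1 then a else b) ` ({- int N..int N} \<times> {- int N..int N})"
  proof
    fix k assume k: "k \<in> cells N"
    have "k = (\<chi> i. if i = 1 then k $ 1 else k $ 2)" by (simp add: vec_eq_iff forall_2)
    then show "k \<in> (\<lambda>(a, b). \<chi> i. if i = 1 then a else b) ` ({- int N..int N} \<times> {- int N..int N})"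
    proof (intro image_eqI[of _ _ "(k $ 1, k $ 2)"])
      have "\<bar>k $ 1\<bar> \<le> int N" "\<bar>k $ 2\<bar> \<le> int N" using k by (auto simp: cells_def)
      then show "(k $ 1, k $ 2) \<in> {- int N..int N} \<times> {- int N..int N}" by auto
    qed simp
  qed
  then show ?thesis by (rule finite_subset) simp
qed

lemma cell_in_cells:
  assumes L: "L > 0" and "norm x \<le> 2 * L * real N"
  shows "cell L x \<in> cells N"
  unfolding cells_def
proof (intro CollectI allI)
  fix i
  have x: "\<bar>x $ i\<bar> \<le> 2 * L * real N" using component_le_norm_cart[of x i] assms(2) by linarith
  have c: "- L \<le> x $ i - 2 * L * of_int (cell L x $ i)" "x $ i - 2 * L * of_int (cell L x $ i) < L"
    using wrap_bounds[OF L, of x i] by (simp_all add: wrap_def lat_nth)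
  have "2 * L * of_int (cell L x $ i) < 2 * L * (real N + 1)" "2 * L * (- real N - 1) < 2 * L * of_int (cell L x $ i)"
    using x c L by (auto simp: algebra_simps)
  then have "of_int (cell L x $ i) < real N + 1" "- real N - 1 < of_int (cell L x $ i)" 
    using L by (simp_all only: mult_less_cancel_left_pos[of "2 * L"] mult_pos_pos zero_less_numeral)
  then show "\<bar>cell L x $ i\<bar> \<le> int N" by linarith
qed

text \<open>A bounded set meets only finitely many cells, and the integral over each full cell
  equals that over the fundamental one.\<close>

lemma wrap_comp_L2:
  fixes F :: "real^2 \<Rightarrow> 'b::euclidean_space"
  assumes L: "L > 0" and F: "F \<in> L2 (lebesgue_on (Omega L 0))" and K: "bounded K" "K \<in> sets lebesgue"
  shows "(\<lambda>x. F (wrap L x)) \<in> L2 (lebesgue_on K)"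
proof -
  obtain R where R: "\<And>x. x \<in> K \<Longrightarrow> norm x \<le> R" using K(1) by (auto simp: bounded_iff)
  obtain N where "R / (2 * L) \<le> real N" using real_arch_simple by blast
  then have N: "R \<le> 2 * L * real N" using L by (simp add: field_simps)
  let ?h = "\<lambda>x. if cell L x \<in> cells N then (norm (F (wrap L x)))\<^sup>2 else 0"
  have "integrable lebesgue ?h"
  proof (rule unfold_integral(1)[OF L finite_cells[of N]])
    fix k assume k: "k \<in> cells N"
    have i: "integrable (lebesgue_on (Omega L 0)) (\<lambda>y. (norm (F y))\<^sup>2)" using F by (simp add: L2_def)
    have "?h (y + lat L k) = (norm (F y))\<^sup>2" if "y \<in> Omega L 0" for y
    proof -
      have "\<forall>i. - L \<le> y $ i \<and> y $ i < L" by (rule Omega_bounds[OF that])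
      then show ?thesis using k cell_add_lat[OF L] wrap_add_lat[OF L] by simp
    qed
    then show "integrable (lebesgue_on (Omega L 0)) (\<lambda>y. ?h (y + lat L k))"
      using i by (subst Bochner_Integration.integrable_cong[OF refl, of _ _ "\<lambda>y. (norm (F y))\<^sup>2"]) auto
  qed simp
  from integrable_mult_indicator[OF K(2) this]
  have "integrable (lebesgue_on K) ?h" using K(2) by (subst integrable_restrict_space) auto
  moreover have "?h x = (norm (F (wrap L x)))\<^sup>2" if "x \<in> K" for x
    using cell_in_cells[OF L order_trans[OF R[OF that] N]] by simp
  ultimately have "integrable (lebesgue_on K) (\<lambda>x. (norm (F (wrap L x)))\<^sup>2)"
    by (subst Bochner_Integration.integrable_cong[OF refl, of _ _ ?h]) auto
  moreover have "(\<lambda>x. F (wrap L x)) \<in> borel_measurable (lebesgue_on K)"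
    using wrap_comp_measurable[OF L] F by (auto simp: L2_def intro: measurable_restrict_space1)
  ultimately show ?thesis by (simp add: L2_def)
qed

lemma wrap_comp_loc_int:
  assumes L: "L > 0" and F: "F \<in> L2 (lebesgue_on (Omega L 0))"
  shows "loc_int UNIV (\<lambda>x. F (wrap L x))"
  unfolding loc_int_def
proof (intro allI impI)
  fix K :: "(real^2) set" assume K: "compact K \<and> K \<subseteq> UNIV"
  then have "(\<lambda>x. F (wrap L x)) \<in> L2 (lebesgue_on K)"
    by (intro wrap_comp_L2[OF L F] compact_imp_bounded compact_sets_lebesgue) auto
  then show "integrable (lebesgue_on K) (\<lambda>x. F (wrap L x))"
    using L2_imp_integrable_compact[OF _ compact_sets_lebesgue lmeasurable_compact, of _ K K] K by blast
qed

section \<open>Zero extension\<close>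

abbreviation "LM L \<equiv> lebesgue_on (Omega L 0)"

lemma pderiv_at_translate:
  assumes "test_function S \<phi>" shows "pderiv_at i (\<lambda>y. \<phi> (a + y)) x = pderiv_at i \<phi> (a + x)"
proof -
  have "((\<lambda>y. a + y) has_derivative (\<lambda>h. h)) (at x)" by (auto intro!: derivative_eq_intros)
  from has_derivative_compose[OF this test_function_has_derivative[OF assms]]
  have D: "((\<lambda>y. \<phi> (a + y)) has_derivative (\<lambda>h. \<Sum>k\<in>UNIV. h $ k * pderiv_at k \<phi> (a + x))) (at x)" .
  have "(\<Sum>k\<in>UNIV. axis i 1 $ k * pderiv_at k \<phi> (a + x)) = (\<Sum>k\<in>UNIV. if k = i then pderiv_at i \<phi> (a + x) else 0)"
    by (rule sum.cong) (auto simp: axis_def)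
  then show ?thesis unfolding pderiv_atI[OF D] by simp
qed

lemma test_function_translate1: "test_function UNIV \<phi> \<Longrightarrow> test_function UNIV (\<lambda>y. \<phi> (a + y))"
  using test_function_translate[of \<phi> 1 a] by simp

lemma has_weak_pderiv_translate:
  assumes "has_weak_pderiv UNIV i u g"
  shows "has_weak_pderiv UNIV i (\<lambda>x. u (a + x)) (\<lambda>x. g (a + x))"
proof -
  have U: "(UNIV :: (real^2) set) \<in> sets lebesgue" by simp
  note w = assms[unfolded has_weak_pderiv_iff[OF U] interior_UNIV]
  have l: "loc_int UNIV (\<lambda>x. f (a + x))" if f: "loc_int UNIV f" for f
    unfolding loc_int_def
  proof (intro allI impI)
    fix K :: "(real^2) set" assume K: "compact K \<and> K \<subseteq> UNIV"
    then have "compact ((\<lambda>x. a + x) ` K)" by (intro compact_continuous_image continuous_intros) auto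
    from integrable_translation[OF loc_int_indicator[OF f this subset_UNIV], of a]
    have "integrable lebesgue (\<lambda>x. indicator ((\<lambda>x. a + x) ` K) (a + x) * f (a + x))" .
    moreover have "indicator ((\<lambda>x. a + x) ` K) (a + x) = (indicator K x :: real)" for x by (auto simp: indicator_def)
    ultimately show "integrable (lebesgue_on K) (\<lambda>x. f (a + x))"
      using K compact_sets_lebesgue by (subst integrable_restrict_space) auto
  qed
  have "(LINT x|lebesgue. u (a + x) * pderiv_at i \<phi> x) = - (LINT x|lebesgue. g (a + x) * \<phi> x)" if t: "test_function UNIV \<phi>" for \<phi>
  proof -
    note t' = test_function_translate1[OF t, of "- a"]
    have "(LINT x|lebesgue. u (a + x) * pderiv_at i \<phi> x) = (LINT x|lebesgue. u x * pderiv_at i (\<lambda>y. \<phi> (- a + y)) x)"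
    proof -
      have e: "pderiv_at i (\<lambda>y. \<phi> (- a + y)) (a + x) = pderiv_at i \<phi> x" for x
        using pderiv_at_translate[OF t, of i "- a" "a + x"] by simp
      show ?thesis
        using integral_translation[OF borel_measurable_integrable[OF loc_int_test(2)[OF conjunct1[OF w] t', of i]], of a]
        unfolding e .
    qed
    also have "\<dots> = - (LINT x|lebesgue. g x * \<phi> (- a + x))" using w t' by blast
    also have "(LINT x|lebesgue. g x * \<phi> (- a + x)) = (LINT x|lebesgue. g (a + x) * \<phi> x)"
      using integral_translation[OF borel_measurable_integrable[OF loc_int_test(1)[OF conjunct1[OF conjunct2[OF w]] t']], of a]
      by simp
    finally show ?thesis .
  qed
  then show ?thesis using l w by (simp add: has_weak_pderiv_iff[OF U])
qed

lemma continuous_L2_Omega: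
  fixes f :: "real^2 \<Rightarrow> 'b::euclidean_space"
  assumes "continuous_on UNIV f" shows "f \<in> L2 (lebesgue_on (Omega L r))"
  by (rule continuous_compact_L2[OF continuous_on_subset[OF assms subset_UNIV] compact_Cl Omega_subset_Cl Omega_sets])

text \<open>Cutting the plane into cells turns a test of the periodic extension against
  \<open>\<psi>\<close> into a test of \<open>F\<close> on one cell against the periodisation of
  \<open>\<psi>\<close>. The sum is finite because \<open>\<psi>\<close> vanishes on all cells
  outside \<open>cells N\<close>.\<close>

lemma unfold_test:
  fixes F \<psi> :: "real^2 \<Rightarrow> real"
  assumes L: "L > 0" and F: "F \<in> L2 (LM L)" and \<psi>: "continuous_on UNIV \<psi>" "\<And>x. norm x > 2 * L * real N \<Longrightarrow> \<psi> x = 0"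
  shows "(LINT x|lebesgue. F (wrap L x) * \<psi> x) = (LINT y|LM L. F y * (\<Sum>k\<in>cells N. \<psi> (y + lat L k)))"
proof -
  have c: "continuous_on UNIV (\<lambda>y. \<psi> (y + lat L k))" for k
    by (rule continuous_on_compose2[OF \<psi>(1)]) (auto intro!: continuous_intros)
  have i: "integrable (LM L) (\<lambda>y. F y * \<psi> (y + lat L k))" for k
    using L2_inner_integrable[OF F continuous_L2_Omega[OF c[of k]]] by simp
  have e: "F (wrap L (y + lat L k)) * \<psi> (y + lat L k) = F y * \<psi> (y + lat L k)" if "y \<in> Omega L 0" for y k
    using wrap_periodic[OF L] wrap_Omega[OF L that] by simp
  have "(LINT x|lebesgue. F (wrap L x) * \<psi> x) = (\<Sum>k\<in>cells N. LINT y|LM L. F (wrap L (y + lat L k)) * \<psi> (y + lat L k))"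
  proof (rule unfold_integral(2)[OF L finite_cells])
    fix x assume "cell L x \<notin> cells N"
    then have "norm x > 2 * L * real N" using cell_in_cells[OF L, of x N] by fastforce
    then show "F (wrap L x) * \<psi> x = 0" using \<psi>(2) by simp
  next
    fix k
    show "integrable (LM L) (\<lambda>y. F (wrap L (y + lat L k)) * \<psi> (y + lat L k))"
      by (rule Bochner_Integration.integrable_cong[THEN iffD2, OF refl _ i[of k]]) (simp add: e)
  qed
  also have "\<dots> = (\<Sum>k\<in>cells N. LINT y|LM L. F y * \<psi> (y + lat L k))"
    by (intro sum.cong refl Bochner_Integration.integral_cong) (simp add: e)
  also have "\<dots> = (LINT y|LM L. F y * (\<Sum>k\<in>cells N. \<psi> (y + lat L k)))"
    unfolding sum_distrib_left by (rule Bochner_Integration.integral_sum[symmetric]) (rule i)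
  finally show ?thesis .
qed

lemma test_function_support:
  assumes "L > 0" "test_function UNIV \<phi>" obtains N where "closure {x. \<phi> x \<noteq> 0} \<subseteq> cball 0 (2 * L * real N)"
proof -
  have "bounded (closure {x. \<phi> x \<noteq> 0})" using assms(2) by (auto simp: test_function_def compact_imp_bounded)
  then obtain R where R: "\<And>x. x \<in> closure {x. \<phi> x \<noteq> 0} \<Longrightarrow> norm x \<le> R" by (auto simp: bounded_iff)
  obtain N where "R / (2 * L) \<le> real N" using real_arch_simple by blast
  then have "R \<le> 2 * L * real N" using assms(1) by (simp add: field_simps)
  then have "closure {x. \<phi> x \<noteq> 0} \<subseteq> cball 0 (2 * L * real N)" using order_trans[OF R] by (intro subsetI) simp
  then show ?thesis by (rule that)
qed

text \<open>The identities on the plane become identities on one cell. There \<open>L2\<close>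
  limits can be taken, and Green's formula on \<open>Omega L r\<close> can be applied. Any
  \<open>N\<close> whose ball contains the support gives the same condition.\<close>

lemma has_weak_per_iff:
  assumes L: "L > 0" and v: "v \<in> L2 (LM L)" and g: "g \<in> L2 (LM L)"
  shows "has_weak_pderiv UNIV i (\<lambda>x. v (wrap L x)) (\<lambda>x. g (wrap L x)) \<longleftrightarrow>
    (\<forall>\<phi> N. test_function UNIV \<phi> \<longrightarrow> closure {x. \<phi> x \<noteq> 0} \<subseteq> cball 0 (2 * L * real N) \<longrightarrow>
      (LINT y|LM L. v y * (\<Sum>k\<in>cells N. pderiv_at i \<phi> (y + lat L k))) = - (LINT y|LM L. g y * (\<Sum>k\<in>cells N. \<phi> (y + lat L k))))"
proof -
  have U: "(UNIV :: (real^2) set) \<in> sets lebesgue" by simp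
  have l: "loc_int UNIV (\<lambda>x. v (wrap L x))" "loc_int UNIV (\<lambda>x. g (wrap L x))" using wrap_comp_loc_int[OF L] v g by auto
  have e: "(LINT x|lebesgue. v (wrap L x) * pderiv_at i \<phi> x) = (LINT y|LM L. v y * (\<Sum>k\<in>cells N. pderiv_at i \<phi> (y + lat L k)))"
    "(LINT x|lebesgue. g (wrap L x) * \<phi> x) = (LINT y|LM L. g y * (\<Sum>k\<in>cells N. \<phi> (y + lat L k)))"
    if t: "test_function UNIV \<phi>" and s: "closure {x. \<phi> x \<noteq> 0} \<subseteq> cball 0 (2 * L * real N)" for \<phi> N
  proof -
    have "x \<notin> closure {x. \<phi> x \<noteq> 0}" if "norm x > 2 * L * real N" for x using s that by (auto simp: subset_iff)
    note o = test_function_outside[OF t this]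
    show "(LINT x|lebesgue. v (wrap L x) * pderiv_at i \<phi> x) = (LINT y|LM L. v y * (\<Sum>k\<in>cells N. pderiv_at i \<phi> (y + lat L k)))"
      by (rule unfold_test[OF L v test_function_continuous(2)[OF t] o(2)])
    show "(LINT x|lebesgue. g (wrap L x) * \<phi> x) = (LINT y|LM L. g y * (\<Sum>k\<in>cells N. \<phi> (y + lat L k)))"
      by (rule unfold_test[OF L g test_function_continuous(1)[OF t] o(1)])
  qed
  show ?thesis
  proof
    assume "has_weak_pderiv UNIV i (\<lambda>x. v (wrap L x)) (\<lambda>x. g (wrap L x))"
    then have w: "(LINT x|lebesgue. v (wrap L x) * pderiv_at i \<phi> x) = - (LINT x|lebesgue. g (wrap L x) * \<phi> x)" if "test_function UNIV \<phi>" for \<phi>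
      using that unfolding has_weak_pderiv_iff[OF U] by simp
    show "\<forall>\<phi> N. test_function UNIV \<phi> \<longrightarrow> closure {x. \<phi> x \<noteq> 0} \<subseteq> cball 0 (2 * L * real N) \<longrightarrow>
      (LINT y|LM L. v y * (\<Sum>k\<in>cells N. pderiv_at i \<phi> (y + lat L k))) = - (LINT y|LM L. g y * (\<Sum>k\<in>cells N. \<phi> (y + lat L k)))"
    proof (intro allI impI)
      fix \<phi> N assume t: "test_function UNIV \<phi>" and s: "closure {x. \<phi> x \<noteq> 0} \<subseteq> cball 0 (2 * L * real N)"
      show "(LINT y|LM L. v y * (\<Sum>k\<in>cells N. pderiv_at i \<phi> (y + lat L k))) = - (LINT y|LM L. g y * (\<Sum>k\<in>cells N. \<phi> (y + lat L k)))"
        unfolding e[OF t s, symmetric] by (rule w[OF t])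
    qed
  next
    assume *: "\<forall>\<phi> N. test_function UNIV \<phi> \<longrightarrow> closure {x. \<phi> x \<noteq> 0} \<subseteq> cball 0 (2 * L * real N) \<longrightarrow>
      (LINT y|LM L. v y * (\<Sum>k\<in>cells N. pderiv_at i \<phi> (y + lat L k))) = - (LINT y|LM L. g y * (\<Sum>k\<in>cells N. \<phi> (y + lat L k)))"
    have "(LINT x|lebesgue. v (wrap L x) * pderiv_at i \<phi> x) = - (LINT x|lebesgue. g (wrap L x) * \<phi> x)" if t: "test_function UNIV \<phi>" for \<phi>
    proof -
      obtain N where s: "closure {x. \<phi> x \<noteq> 0} \<subseteq> cball 0 (2 * L * real N)" by (rule test_function_support[OF L t])
      show ?thesis unfolding e[OF t s] using * t s by blast
    qed
    then show "has_weak_pderiv UNIV i (\<lambda>x. v (wrap L x)) (\<lambda>x. g (wrap L x))"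
      unfolding has_weak_pderiv_iff[OF U] using l by simp
  qed
qed

lemma per_sum_continuous:
  fixes \<psi> :: "real^2 \<Rightarrow> real"
  assumes "continuous_on UNIV \<psi>" shows "continuous_on S (\<lambda>y. \<Sum>k\<in>cells N. \<psi> (y + lat L k))"
  by (intro continuous_on_sum continuous_on_compose2[OF assms]) (auto intro!: continuous_intros)

lemma has_weak_per_limit:
  assumes L: "L > 0" and "\<And>n. has_weak_pderiv UNIV i (\<lambda>x. v n (wrap L x)) (\<lambda>x. g n (wrap L x))"
    and v: "\<And>n. v n \<in> L2 (LM L)" "v' \<in> L2 (LM L)" "(\<lambda>n. L2norm (LM L) (\<lambda>x. v n x - v' x)) \<longlonglongrightarrow> 0"
    and g: "\<And>n. g n \<in> L2 (LM L)" "g' \<in> L2 (LM L)" "(\<lambda>n. L2norm (LM L) (\<lambda>x. g n x - g' x)) \<longlonglongrightarrow> 0"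
  shows "has_weak_pderiv UNIV i (\<lambda>x. v' (wrap L x)) (\<lambda>x. g' (wrap L x))"
  unfolding has_weak_per_iff[OF L v(2) g(2)]
proof (intro allI impI)
  fix \<phi> N assume t: "test_function UNIV \<phi>" and s: "closure {x. \<phi> x \<noteq> 0} \<subseteq> cball 0 (2 * L * real N)"
  let ?a = "\<lambda>y. \<Sum>k\<in>cells N. pderiv_at i \<phi> (y + lat L k)" and ?b = "\<lambda>y. \<Sum>k\<in>cells N. \<phi> (y + lat L k)"
  have a: "?a \<in> L2 (LM L)" and b: "?b \<in> L2 (LM L)"
    by (intro continuous_L2_Omega per_sum_continuous test_function_continuous[OF t])+
  have "(\<lambda>n. LINT y|LM L. v n y * ?a y) \<longlonglongrightarrow> (LINT y|LM L. v' y * ?a y)" by (rule L2_limit_integral[OF v(1,2) a v(3)])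
  moreover have "(LINT y|LM L. v n y * ?a y) = - (LINT y|LM L. g n y * ?b y)" for n
    using assms(2)[of n] t s unfolding has_weak_per_iff[OF L v(1) g(1)] by blast
  ultimately have "(\<lambda>n. - (LINT y|LM L. g n y * ?b y)) \<longlonglongrightarrow> (LINT y|LM L. v' y * ?a y)" by simp
  moreover have "(\<lambda>n. - (LINT y|LM L. g n y * ?b y)) \<longlonglongrightarrow> - (LINT y|LM L. g' y * ?b y)"
    by (intro tendsto_minus L2_limit_integral[OF g(1,2) b g(3)])
  ultimately show "(LINT y|LM L. v' y * ?a y) = - (LINT y|LM L. g' y * ?b y)" by (rule LIMSEQ_unique)
qed

text \<open>Periodic fields are represented by their values on \<open>\<Omega>\<close>: the periodic extension of \<open>v\<close> is \<open>v \<circ> wrap L\<close>.\<close>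

definition per_weak :: "real \<Rightarrow> (real^2 \<Rightarrow> real^2) \<Rightarrow> (real^2 \<Rightarrow> real^2^2) \<Rightarrow> bool" where
  "per_weak L v G \<longleftrightarrow> v \<in> L2 (LM L) \<and> G \<in> L2 (LM L) \<and>
     (\<forall>i j. has_weak_pderiv UNIV i (\<lambda>x. v (wrap L x) $ j) (\<lambda>x. G (wrap L x) $ i $ j))"

lemma L2_nth: "f \<in> L2 M \<Longrightarrow> (\<lambda>x. f x $ j) \<in> L2 M" for f :: "'a \<Rightarrow> 'b::euclidean_space^'n"
  unfolding L2_component_iff[of f] by blast

lemma per_weakD:
  assumes L: "L > 0" and p: "per_weak L v G"
  shows "v \<in> H1per L 0" "v \<in> H1_field (Omega L 0)" "AE x in LM L. wgrad (Omega L 0) v x = G x"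
proof -
  have v: "v \<in> L2 (LM L)" and G: "G \<in> L2 (LM L)" 
    and w: "\<And>i j. has_weak_pderiv UNIV i (\<lambda>x. v (wrap L x) $ j) (\<lambda>x. G (wrap L x) $ i $ j)"
    using p by (auto simp: per_weak_def)
  have weak: "has_weak_pderiv (Omega L 0) i (\<lambda>x. v x $ j) (\<lambda>x. G x $ i $ j)" for i j
  proof (rule has_weak_pderiv_cong_AE[OF Omega_sets has_weak_pderiv_subset[OF _ Omega_sets subset_UNIV w[of i j]]])
    show "AE x in LM L. v (wrap L x) $ j = v x $ j" "AE x in LM L. G (wrap L x) $ i $ j = G x $ i $ j"
      by (auto intro!: AE_I2 simp: wrap_Omega[OF L])
  qed simp
  show "v \<in> H1_field (Omega L 0)" by (rule H1_fieldI[OF v G weak])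
  show "AE x in LM L. wgrad (Omega L 0) v x = G x" by (rule wgrad_eqI[OF null_boundary_Omega weak])
  have loc: "(\<lambda>x. F (wrap L x)) \<in> L2loc" if "F \<in> L2 (LM L)" for F
    unfolding L2loc_def using wrap_comp_L2[OF L that] compact_imp_bounded compact_sets_lebesgue by blast
  have "(\<lambda>x. v (wrap L x) $ j) \<in> H1loc" for j
    unfolding H1loc_def using loc[OF L2_nth[OF v]] loc[OF L2_nth[OF L2_nth[OF G]]] w by blast
  moreover have "AE x in LM L. v x = v (wrap L x)" by (auto intro!: AE_I2 simp: wrap_Omega[OF L])
  ultimately show "v \<in> H1per L 0"
    unfolding H1per_def using periodic_field_comp_wrap[OF L, of v] by auto
qed

text \<open>The periodic representative \<open>w\<close> is determined by its values on one cell,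
  but its weak derivatives are just some functions in \<open>L2loc\<close>. A lattice translate of
  such a derivative is again a weak derivative of \<open>w\<close>; by uniqueness the derivative is
  periodic almost everywhere and may be replaced by its own reduction to the cell.\<close>

lemma H1per_0D:
  assumes L: "L > 0" and v: "v \<in> H1per L 0"
  shows "v \<in> H1_field (Omega L 0)" "per_weak L v (wgrad (Omega L 0) v)"
proof -
  obtain w where w: "periodic_field L w" "\<And>j. (\<lambda>x. w x $ j) \<in> H1loc" and vw: "AE x in LM L. v x = w x"
    using v by (auto simp: H1per_def)
  have "\<exists>g\<in>L2loc. has_weak_pderiv UNIV i (\<lambda>x. w x $ j) g" for i j using w(2)[of j] by (auto simp: H1loc_def)
  then obtain g where g: "\<And>i j. g i j \<in> L2loc" "\<And>i j. has_weak_pderiv UNIV i (\<lambda>x. w x $ j) (g i j)" by metis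
  have L2: "F \<in> L2 (LM L)" if "F \<in> L2loc" for F
  proof -
    have F: "F \<in> L2 (lebesgue_on (Cl L 0))" using that compact_Cl by (auto simp: L2loc_def)
    then have "F \<in> borel_measurable (lebesgue_on (Cl L 0))" by (simp add: L2_def)
    then have m: "F \<in> borel_measurable (LM L)" by (rule measurable_restrict_mono) (rule Omega_subset_Cl)
    have "integrable (lebesgue_on (Cl L 0)) (\<lambda>x. (norm (F x))\<^sup>2)" using F by (simp add: L2_def)
    then have "integrable lebesgue (\<lambda>x. indicator (Cl L 0) x *\<^sub>R (norm (F x))\<^sup>2)"
      using compact_sets_lebesgue[OF compact_Cl] by (subst (asm) integrable_restrict_space) auto
    from integrable_mult_indicator[OF Omega_sets this]
    have "integrable lebesgue (\<lambda>x. indicator (Omega L 0) x *\<^sub>R (norm (F x))\<^sup>2)"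
      by (rule Bochner_Integration.integrable_cong[THEN iffD1, OF refl, rotated]) (use Omega_subset_Cl[of L 0] in \<open>auto simp: indicator_def\<close>)
    then have "integrable (LM L) (\<lambda>x. (norm (F x))\<^sup>2)" by (subst integrable_restrict_space) auto
    then show ?thesis using m by (simp add: L2_def)
  qed
  let ?G = "\<lambda>x. \<chi> i j. g i j x"
  have G: "?G \<in> L2 (LM L)"
    unfolding L2_component_iff[of ?G] L2_component_iff[of "\<lambda>x. ?G x $ _"] using L2[OF g(1)] by simp
  have wL: "w \<in> L2 (LM L)" unfolding L2_component_iff[of w] using L2 w(2) by (auto simp: H1loc_def)
  have weak: "has_weak_pderiv (Omega L 0) i (\<lambda>x. w x $ j) (\<lambda>x. ?G x $ i $ j)" for i j
    using has_weak_pderiv_subset[OF _ Omega_sets subset_UNIV g(2)[of i j]] by simp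
  have weakv: "has_weak_pderiv (Omega L 0) i (\<lambda>x. v x $ j) (\<lambda>x. ?G x $ i $ j)" for i j
    by (rule has_weak_pderiv_cong_AE[OF Omega_sets weak[of i j]]) (use vw in \<open>auto elim!: eventually_mono\<close>)
  have "AE x in LM L. w x = v x" using vw by eventually_elim simp
  then have vL: "v \<in> L2 (LM L)" by (rule L2_lebesgue_cong_AE[OF Omega_sets wL])
  show vH: "v \<in> H1_field (Omega L 0)" by (rule H1_fieldI[OF vL G weakv])
  have vG: "AE x in LM L. wgrad (Omega L 0) v x = ?G x" by (rule wgrad_eqI[OF null_boundary_Omega weakv])
  have gper: "AE x in lebesgue. g i j (wrap L x) = g i j x" for i j
  proof -
    have "AE x in lebesgue. g i j (lat L k + x) = g i j x" for k
    proof -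
      have "w (lat L k + x) = w x" for x using periodic_field_lat[OF w(1), of x k] by (simp add: add.commute)
      then have "has_weak_pderiv UNIV i (\<lambda>x. w x $ j) (\<lambda>x. g i j (lat L k + x))"
        using has_weak_pderiv_translate[OF g(2)[of i j], of "lat L k"] by simp
      from has_weak_pderiv_unique[OF null_boundary_UNIV this g(2)[of i j]] have "AE x in lebesgue_on UNIV. g i j (lat L k + x) = g i j x" by simp
      then show ?thesis by (subst (asm) AE_lebesgue_on_iff) simp_all
    qed
    then have "AE x in lebesgue. \<forall>k. g i j (lat L k + x) = g i j x" by (simp add: AE_all_countable)
    then show ?thesis
    proof eventually_elim
      case (elim x)
      have "lat L (- cell L x) + x = wrap L x" by (simp add: wrap_def vec_eq_iff lat_nth)
      then show ?case using elim[rule_format, of "- cell L x"] by simp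
    qed
  qed
  have "has_weak_pderiv UNIV i (\<lambda>x. v (wrap L x) $ j) (\<lambda>x. wgrad (Omega L 0) v (wrap L x) $ i $ j)" for i j
  proof (rule has_weak_pderiv_cong_AE[OF _ g(2)[of i j]])
    have "AE x in lebesgue. w x $ j = v (wrap L x) $ j"
      using AE_wrap[OF L vw] by eventually_elim (simp add: periodic_field_wrap[OF w(1)])
    then show "AE x in lebesgue_on UNIV. w x $ j = v (wrap L x) $ j" by (subst AE_lebesgue_on_iff) simp_all
    have "AE x in lebesgue. g i j x = wgrad (Omega L 0) v (wrap L x) $ i $ j"
      using AE_wrap[OF L vG] gper[of i j] by eventually_elim simp
    then show "AE x in lebesgue_on UNIV. g i j x = wgrad (Omega L 0) v (wrap L x) $ i $ j" by (subst AE_lebesgue_on_iff) simp_all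
  qed simp
  then show "per_weak L v (wgrad (Omega L 0) v)"
    using vL H1_fieldD(3)[OF null_boundary_Omega vH] by (simp add: per_weak_def)
qed

text \<open>Green's formula for a component of \<open>w\<close> times the periodised test function.
  Both factors are periodic, so only the circle contributes. There the test function is bounded by
  \<open>B\<close>, and Cauchy-Schwarz on an interval of length \<open>2 * pi\<close> passes from
  the L^1 to the L^2 norm of \<open>w\<close>.\<close>

lemma Green_trace_bound:
  assumes L: "0 < r" "r < L" and w: "w \<in> C1per L r" and t: "test_function UNIV \<phi>" 
    and s: "closure {x. \<phi> x \<noteq> 0} \<subseteq> cball 0 (2 * L * real N)"
    and B: "\<And>x. x \<in> Cl L r \<Longrightarrow> \<bar>\<Sum>k\<in>cells N. \<phi> (x + lat L k)\<bar> \<le> B"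
  shows "\<bar>(LINT y|lebesgue_on (Omega L r). w y $ j * (\<Sum>k\<in>cells N. pderiv_at i \<phi> (y + lat L k))) +
      (LINT y|lebesgue_on (Omega L r). wgrad (Omega L r) w y $ i $ j * (\<Sum>k\<in>cells N. \<phi> (y + lat L k)))\<bar>
    \<le> 2 * r * B * sqrt (2 * pi) * L2norm (lebesgue_on {0..2*pi}) (\<lambda>\<theta>. w (circle_pt r \<theta>))"
proof -
  obtain J where J: "continuous_on (Cl L r) J" "\<forall>x\<in>Cl L r. (w has_derivative (\<lambda>h. J x *v h)) (at x within Cl L r)"
    and per: "periodic_field L w" and wc: "continuous_on (Cl L r) w" by (rule C1perD[OF L w])
  note H = C1_H1_field[OF J]
  let ?b = "\<lambda>y. \<Sum>k\<in>cells N. \<phi> (y + lat L k)" and ?a = "\<lambda>l y. \<Sum>k\<in>cells N. pderiv_at l \<phi> (y + lat L k)"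
  have bc: "continuous_on S ?b" and ac: "continuous_on S (?a l)" for S l
    by (intro per_sum_continuous test_function_continuous[OF t])+
  have bd: "(?b has_derivative (\<lambda>h. \<Sum>l\<in>UNIV. ?a l x * h $ l)) (at x within S)" for x S
  proof -
    have 1: "((\<lambda>y. \<phi> (y + lat L k)) has_derivative (\<lambda>h. \<Sum>l\<in>UNIV. h $ l * pderiv_at l \<phi> (x + lat L k))) (at x within S)" for k
    proof -
      have "((\<lambda>y. y + lat L k) has_derivative (\<lambda>h. h)) (at x within S)" by (auto intro!: derivative_eq_intros)
      from has_derivative_compose[OF this test_function_has_derivative[OF t]] show ?thesis .
    qed
    have "(\<lambda>h. \<Sum>k\<in>cells N. \<Sum>l\<in>UNIV. h $ l * pderiv_at l \<phi> (x + lat L k)) = (\<lambda>h :: real^2. \<Sum>l\<in>UNIV. ?a l x * h $ l)"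
      by (rule ext, subst sum.swap) (simp add: sum_distrib_left sum_distrib_right mult.commute)
    moreover have "(?b has_derivative (\<lambda>h. \<Sum>k\<in>cells N. \<Sum>l\<in>UNIV. h $ l * pderiv_at l \<phi> (x + lat L k))) (at x within S)"
      by (rule has_derivative_sum) (rule 1)
    ultimately show ?thesis by (simp only:)
  qed
  let ?p = "\<lambda>y. w y $ j * ?b y" and ?D = "\<lambda>y. w y $ j * ?a i y + J y $ j $ i * ?b y"
  have pc: "continuous_on (Cl L r) ?p" and Dc: "continuous_on (Cl L r) ?D"
    by (intro continuous_on_add continuous_on_mult continuous_on_nth wc J bc ac)+
  have "\<bar>LINT y|lebesgue_on (Omega L r). ?D y\<bar> \<le> 2 * r * integral {0..2*pi} (\<lambda>\<theta>. \<bar>?p (circle_pt r \<theta>)\<bar>)"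
  proof (rule Green_bound[OF L pc Dc, of i])
    fix s t assume st: "pt i s t \<in> Cl L r"
    let ?S = "{s. pt i s t \<in> Cl L r}"
    have "(?p has_derivative (\<lambda>h. w (pt i s t) $ j * (\<Sum>l\<in>UNIV. ?a l (pt i s t) * h $ l) + (\<Sum>l\<in>UNIV. J (pt i s t) $ j $ l * h $ l) * ?b (pt i s t))) (at (pt i s t) within Cl L r)"
      using has_derivative_mult[OF has_derivative_component[OF bspec[OF J(2) st], of j] bd] by simp
    then have d: "(?p has_derivative (\<lambda>h. w (pt i s t) $ j * (\<Sum>l\<in>UNIV. ?a l (pt i s t) * h $ l) + (\<Sum>l\<in>UNIV. J (pt i s t) $ j $ l * h $ l) * ?b (pt i s t))) (at (pt i s t) within (\<lambda>s. pt i s t) ` ?S)"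
      by (rule has_derivative_subset) auto
    have ax: "(\<Sum>l\<in>UNIV. c l * (h *\<^sub>R axis i 1 :: real^2) $ l) = h * c i" for c :: "2 \<Rightarrow> real" and h
    proof -
      have "(\<Sum>l\<in>UNIV. c l * (h *\<^sub>R axis i 1 :: real^2) $ l) = (\<Sum>l\<in>UNIV. if l = i then h * c i else 0)"
        by (rule sum.cong) (auto simp: axis_def)
      then show ?thesis by simp
    qed
    from has_derivative_in_compose[OF has_derivative_pt d]
    show "((\<lambda>s. ?p (pt i s t)) has_vector_derivative ?D (pt i s t)) (at s within ?S)"
      unfolding has_vector_derivative_def ax by (simp add: algebra_simps)
  next
    fix t assume "\<bar>t\<bar> \<le> L"
    have sh: "pt i L t = pt i (- L) t + (2 * L) *\<^sub>R axis i 1" by (simp add: vec_eq_iff pt_nth axis_def)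
    have "w (pt i L t) = w (pt i (- L) t)" unfolding sh using per by (simp add: periodic_field_def)
    \<comment> \<open>The truncated sum takes equal values on opposite sides because
      \<open>\<phi>\<close> vanishes on the layers that the shift by one cell loses: for index
      \<open>N\<close> on one side and \<open>- N\<close> on the other, the \<open>i\<close>-th
      coordinate exceeds \<open>2 * L * real N\<close> in modulus.\<close>
    moreover have "?b (pt i L t) = ?b (pt i (- L) t)"
    proof (rule sum.reindex_bij_witness_not_neutral[where i="\<lambda>k. k - axis i 1" and j="\<lambda>k. k + axis i 1" 
          and S'="{k \<in> cells N. k $ i = int N}" and T'="{k \<in> cells N. k $ i = - int N}"])
      have out: "\<phi> x = 0" if "\<bar>x $ i\<bar> > 2 * L * real N" for x
      proof -
        have "norm x > 2 * L * real N" using that component_le_norm_cart[of x i] by linarith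
        then have "x \<notin> closure {x. \<phi> x \<noteq> 0}" using s by (auto simp: subset_iff)
        then show ?thesis by (rule test_function_outside(1)[OF \<open>test_function UNIV \<phi>\<close>])
      qed
      show "\<phi> (pt i L t + lat L k) = 0" if "k \<in> {k \<in> cells N. k $ i = int N}" for k
      proof (rule out)
        have "0 \<le> 2 * L * real N" using L by simp
        moreover have "(pt i L t + lat L k) $ i = L + 2 * L * real N" using that by (simp add: pt_nth lat_nth)
        ultimately show "2 * L * real N < \<bar>(pt i L t + lat L k) $ i\<bar>" using L by linarith
      qed
      show "\<phi> (pt i (- L) t + lat L k) = 0" if "k \<in> {k \<in> cells N. k $ i = - int N}" for k
      proof (rule out)
        have "0 \<le> 2 * L * real N" using L by simp
        moreover have "(pt i (- L) t + lat L k) $ i = - L - 2 * L * real N" using that by (simp add: pt_nth lat_nth)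
        ultimately show "2 * L * real N < \<bar>(pt i (- L) t + lat L k) $ i\<bar>" using L by linarith
      qed
      show "\<phi> (pt i (- L) t + lat L (k + axis i 1)) = \<phi> (pt i L t + lat L k)" for k
      proof -
        have "pt i (- L) t + lat L (k + axis i 1) = pt i L t + lat L k"
          unfolding sh by (simp add: vec_eq_iff lat_nth axis_def algebra_simps)
        then show ?thesis by simp
      qed
      fix k assume k: "k \<in> cells N - {k \<in> cells N. k $ i = int N}"
      have b: "\<bar>k $ l\<bar> \<le> int N" "k $ i \<noteq> int N" for l using k by (auto simp: cells_def)
      have "\<bar>(k + axis i 1) $ l\<bar> \<le> int N" for l using b(1)[of l] b(2) by (cases "l = i") (auto simp: axis_def)
      moreover have "(k + axis i 1) $ i \<noteq> - int N" using b(1)[of i] by (auto simp: axis_def)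
      ultimately show "k + axis i 1 \<in> cells N - {k \<in> cells N. k $ i = - int N}" by (simp only: cells_def Diff_iff mem_Collect_eq) blast
    next
      fix k assume k: "k \<in> cells N - {k \<in> cells N. k $ i = - int N}"
      have b: "\<bar>k $ l\<bar> \<le> int N" "k $ i \<noteq> - int N" for l using k by (auto simp: cells_def)
      have "\<bar>(k - axis i 1) $ l\<bar> \<le> int N" for l using b(1)[of l] b(2) by (cases "l = i") (auto simp: axis_def)
      moreover have "(k - axis i 1) $ i \<noteq> int N" using b(1)[of i] by (auto simp: axis_def)
      ultimately show "k - axis i 1 \<in> cells N - {k \<in> cells N. k $ i = int N}" by (simp only: cells_def Diff_iff mem_Collect_eq) blast
    qed (auto intro!: finite_subset[OF _ finite_cells[of N]])
    ultimately show "?p (pt i L t) = ?p (pt i (- L) t)" by simp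
  qed
  also have "integral {0..2*pi} (\<lambda>\<theta>. \<bar>?p (circle_pt r \<theta>)\<bar>) \<le> B * (sqrt (2 * pi) * L2norm (lebesgue_on {0..2*pi}) (\<lambda>\<theta>. w (circle_pt r \<theta>)))"
  proof -
    let ?M = "lebesgue_on {0..2*pi}"
    have inCl: "circle_pt r \<theta> \<in> Cl L r" for \<theta> using circle_pt_Cl L by auto
    have cc: "continuous_on {0..2*pi} (\<lambda>\<theta>. f (circle_pt r \<theta>))" if "continuous_on (Cl L r) f" for f :: "real^2 \<Rightarrow> 'c::topological_space"
      by (rule continuous_on_compose2[OF that continuous_on_circle_pt]) (use inCl in auto)
    have "0 \<le> \<bar>?b (circle_pt r 0)\<bar>" by simp
    then have B0: "0 \<le> B" using B[OF inCl[of 0]] by linarith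
    let ?W = "\<lambda>\<theta>. norm (w (circle_pt r \<theta>))"
    have Wc: "continuous_on {0..2*pi} ?W" by (intro continuous_on_norm cc wc)
    have "integral {0..2*pi} (\<lambda>\<theta>. \<bar>?p (circle_pt r \<theta>)\<bar>) \<le> integral {0..2*pi} (\<lambda>\<theta>. B * ?W \<theta>)"
    proof (rule integral_le)
      show "(\<lambda>\<theta>. \<bar>?p (circle_pt r \<theta>)\<bar>) integrable_on {0..2*pi}"
        by (intro integrable_continuous_interval continuous_on_rabs cc pc)
      show "(\<lambda>\<theta>. B * ?W \<theta>) integrable_on {0..2*pi}"
        by (intro integrable_continuous_interval continuous_on_mult_left Wc)
      show "\<bar>?p (circle_pt r \<theta>)\<bar> \<le> B * ?W \<theta>" for \<theta>
        unfolding abs_mult using B[OF inCl] B0 component_le_norm_cart[of "w (circle_pt r \<theta>)" j]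
        by (subst mult.commute) (intro mult_mono, auto)
    qed
    also have "\<dots> = B * integral {0..2*pi} ?W" by simp
    also have "integral {0..2*pi} ?W = (LINT \<theta>|?M. ?W \<theta>)"
      by (rule lebesgue_integral_eq_integral[OF continuous_imp_integrable_real[OF Wc], symmetric]) simp
    also have "(LINT \<theta>|?M. ?W \<theta>) \<le> sqrt (2 * pi) * L2norm ?M (\<lambda>\<theta>. w (circle_pt r \<theta>))"
    proof -
      have W: "?W \<in> L2 ?M" by (rule continuous_compact_L2[OF Wc]) auto
      have one: "(\<lambda>_. 1 :: real) \<in> L2 ?M" by (simp add: L2_def)
      have "\<bar>LINT \<theta>|?M. 1 \<bullet> ?W \<theta>\<bar> \<le> L2norm ?M (\<lambda>_. 1 :: real) * L2norm ?M ?W" by (rule L2_inner_bound[OF one W])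
      moreover have "L2norm ?M (\<lambda>_. 1 :: real) = sqrt (2 * pi)" by (simp add: L2norm_def measure_restrict_space)
      moreover have "L2norm ?M ?W = L2norm ?M (\<lambda>\<theta>. w (circle_pt r \<theta>))" by (simp add: L2norm_def)
      ultimately show ?thesis by simp
    qed
    finally show ?thesis using B0 by (simp add: mult_left_mono)
  qed
  finally have *: "\<bar>LINT y|lebesgue_on (Omega L r). ?D y\<bar> \<le> 2 * r * (B * (sqrt (2 * pi) * L2norm (lebesgue_on {0..2*pi}) (\<lambda>\<theta>. w (circle_pt r \<theta>))))"
    using L by (simp add: mult_left_mono)
  have wL: "(\<lambda>y. w y $ j) \<in> L2 (lebesgue_on (Omega L r))" using L2_nth[OF H1_fieldD(1)[OF null_boundary_Omega H(1)]] .
  have GL: "(\<lambda>y. wgrad (Omega L r) w y $ i $ j) \<in> L2 (lebesgue_on (Omega L r))"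
    using L2_nth[OF L2_nth[OF H1_fieldD(3)[OF null_boundary_Omega H(1)]]] .
  have i1: "integrable (lebesgue_on (Omega L r)) (\<lambda>y. w y $ j * ?a i y)"
    using L2_inner_integrable[OF wL continuous_L2_Omega[OF ac]] by simp
  have i2: "integrable (lebesgue_on (Omega L r)) (\<lambda>y. wgrad (Omega L r) w y $ i $ j * ?b y)"
    using L2_inner_integrable[OF GL continuous_L2_Omega[OF bc]] by simp
  have "(LINT y|lebesgue_on (Omega L r). w y $ j * ?a i y) + (LINT y|lebesgue_on (Omega L r). wgrad (Omega L r) w y $ i $ j * ?b y)
     = (LINT y|lebesgue_on (Omega L r). w y $ j * ?a i y + wgrad (Omega L r) w y $ i $ j * ?b y)"
    using i1 i2 by simp
  also have "\<dots> = (LINT y|lebesgue_on (Omega L r). ?D y)"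
  proof (rule integral_cong_AE)
    have "?D \<in> L2 (lebesgue_on (Omega L r))" by (rule continuous_compact_L2[OF Dc compact_Cl Omega_subset_Cl Omega_sets])
    then show "?D \<in> borel_measurable (lebesgue_on (Omega L r))" by (simp add: L2_def)
    show "AE y in lebesgue_on (Omega L r). w y $ j * ?a i y + wgrad (Omega L r) w y $ i $ j * ?b y = ?D y"
      using H(2) by eventually_elim (simp add: transpose_def)
  qed (use i1 i2 in \<open>auto intro!: borel_measurable_add\<close>)
  finally show ?thesis using * by (simp add: mult.assoc)
qed

section \<open>Extension by zero into the hole, for fields and for gradients\<close>

definition zext :: "real \<Rightarrow> (real^2 \<Rightarrow> 'b::zero) \<Rightarrow> real^2 \<Rightarrow> 'b" where
  "zext r h x = (if x \<in> ball 0 r then 0 else h x)"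

lemma zero_ext_zext: "zero_ext r v = zext r v" by (auto simp: zero_ext_def zext_def)

lemma zext_if: "(if x \<in> Omega L 0 then zext r h x else 0) = (if x \<in> Omega L r then h x else 0)"
  by (auto simp: zext_def Omega_def)

lemma Omega_mono: "0 \<le> r \<Longrightarrow> Omega L r \<subseteq> Omega L 0"
  by (auto simp: Omega_def)

lemma zext_integral:
  fixes h :: "real^2 \<Rightarrow> 'b::euclidean_space"
  shows "(LINT x|LM L. zext r h x) = (LINT x|lebesgue_on (Omega L r). h x)"
  using Lebesgue_Measure.integral_restrict_UNIV[OF Omega_sets[of L 0], where f="zext r h"] Lebesgue_Measure.integral_restrict_UNIV[OF Omega_sets[of L r], where f=h]
  by (simp only: zext_if)

lemma zext_integrable:
  fixes h :: "real^2 \<Rightarrow> 'b::euclidean_space"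
  shows "integrable (LM L) (zext r h) \<longleftrightarrow> integrable (lebesgue_on (Omega L r)) h"
  using Lebesgue_Measure.integrable_restrict_UNIV[OF Omega_sets[of L 0], where f="zext r h"] Lebesgue_Measure.integrable_restrict_UNIV[OF Omega_sets[of L r], where f=h]
  by (simp only: zext_if)

lemma zext_measurable:
  fixes h :: "real^2 \<Rightarrow> 'b::euclidean_space"
  shows "zext r h \<in> borel_measurable (LM L) \<longleftrightarrow> h \<in> borel_measurable (lebesgue_on (Omega L r))"
  using borel_measurable_if[OF Omega_sets[of L 0], where f="zext r h"] borel_measurable_if[OF Omega_sets[of L r], where f=h]
  by (simp only: zext_if)

lemma zext_L2:
  fixes h :: "real^2 \<Rightarrow> 'b::euclidean_space"
  assumes "h \<in> L2 (lebesgue_on (Omega L r))" shows "zext r h \<in> L2 (LM L)"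
proof -
  have "integrable (LM L) (zext r (\<lambda>x. (norm (h x))\<^sup>2))" using assms by (simp add: zext_integrable L2_def)
  moreover have "zext r (\<lambda>x. (norm (h x))\<^sup>2) = (\<lambda>x. (norm (zext r h x))\<^sup>2)" by (auto simp: zext_def)
  ultimately show ?thesis using assms by (simp add: zext_measurable L2_def)
qed

lemma zext_L2norm:
  fixes h :: "real^2 \<Rightarrow> 'b::euclidean_space"
  shows "L2norm (LM L) (zext r h) = L2norm (lebesgue_on (Omega L r)) h"
proof -
  have "zext r (\<lambda>x. (norm (h x))\<^sup>2) = (\<lambda>x. (norm (zext r h x))\<^sup>2)" by (auto simp: zext_def)
  then show ?thesis unfolding L2norm_def using zext_integral[where h="\<lambda>x. (norm (h x))\<^sup>2"] by metis
qed

lemma L2_restrict: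
  fixes f :: "real^2 \<Rightarrow> 'b::euclidean_space"
  assumes "0 \<le> r" "f \<in> L2 (LM L)" shows "f \<in> L2 (lebesgue_on (Omega L r))"
proof -
  have "f \<in> borel_measurable (lebesgue_on (Omega L r))"
    using assms measurable_restrict_mono[OF _ Omega_mono[OF assms(1)]] by (auto simp: L2_def)
  moreover have "integrable (lebesgue_on (Omega L r)) (\<lambda>x. (norm (f x))\<^sup>2)"
  proof -
    have "integrable (LM L) (\<lambda>x. (norm (f x))\<^sup>2)" using assms by (simp add: L2_def)
    then have "integrable lebesgue (\<lambda>x. indicator (Omega L 0) x *\<^sub>R (norm (f x))\<^sup>2)" by (subst (asm) integrable_restrict_space) auto
    from integrable_mult_indicator[OF Omega_sets[of L r] this]
    have "integrable lebesgue (\<lambda>x. indicator (Omega L r) x *\<^sub>R (norm (f x))\<^sup>2)"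
      by (rule Bochner_Integration.integrable_cong[THEN iffD1, OF refl, rotated]) (use Omega_mono[OF assms(1), of L] in \<open>auto simp: indicator_def\<close>)
    then show ?thesis by (subst integrable_restrict_space) auto
  qed
  ultimately show ?thesis by (simp add: L2_def)
qed

lemma L2_conv_nth:
  fixes f :: "nat \<Rightarrow> 'a \<Rightarrow> 'b::euclidean_space^'n"
  assumes "\<And>n. f n \<in> L2 M" "g \<in> L2 M" "(\<lambda>n. L2norm M (\<lambda>x. f n x - g x)) \<longlonglongrightarrow> 0"
  shows "(\<lambda>n. L2norm M (\<lambda>x. f n x $ j - g x $ j)) \<longlonglongrightarrow> 0"
proof (rule tendsto_sandwich[OF always_eventually always_eventually tendsto_const assms(3)]; rule allI)
  fix n
  show "L2norm M (\<lambda>x. f n x $ j - g x $ j) \<le> L2norm M (\<lambda>x. f n x - g x)"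
    using L2norm_component_le[OF L2_diff[OF assms(1,2)], of n j] by simp
qed simp

lemma H1norm_conv:
  assumes S: "null_boundary S" and v: "v \<in> H1_field S" and w: "\<And>n. w n \<in> H1_field S"
    and c: "(\<lambda>n. H1norm S (\<lambda>x. v x - w n x)) \<longlonglongrightarrow> 0"
  shows "(\<lambda>n. L2norm (lebesgue_on S) (\<lambda>x. w n x - v x)) \<longlonglongrightarrow> 0"
    "(\<lambda>n. L2norm (lebesgue_on S) (\<lambda>x. wgrad S (w n) x - wgrad S v x)) \<longlonglongrightarrow> 0"
proof -
  have le: "L2norm (lebesgue_on S) (\<lambda>x. w n x - v x) \<le> H1norm S (\<lambda>x. v x - w n x)" for n
    unfolding H1norm_def by (subst L2norm_minus_commute, rule real_le_rsqrt) simp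
  have le2: "L2norm (lebesgue_on S) (\<lambda>x. wgrad S (w n) x - wgrad S v x) \<le> H1norm S (\<lambda>x. v x - w n x)" for n
  proof -
    have "L2norm (lebesgue_on S) (\<lambda>x. wgrad S (w n) x - wgrad S v x) = L2norm (lebesgue_on S) (\<lambda>x. wgrad S v x - wgrad S (w n) x)"
      by (rule L2norm_minus_commute)
    also have "\<dots> = L2norm (lebesgue_on S) (wgrad S (\<lambda>x. v x - w n x))"
    proof (rule L2norm_lebesgue_cong_AE[OF null_boundaryD(1)[OF S]])
      show "(\<lambda>x. wgrad S v x - wgrad S (w n) x) \<in> L2 (lebesgue_on S)"
        by (intro L2_diff H1_fieldD(3)[OF S] v w)
      show "AE x in lebesgue_on S. wgrad S v x - wgrad S (w n) x = wgrad S (\<lambda>x. v x - w n x) x"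
        using H1_field_diff(2)[OF S v w[of n]] by eventually_elim simp
    qed
    also have "\<dots> \<le> H1norm S (\<lambda>x. v x - w n x)" unfolding H1norm_def by (rule real_le_rsqrt) simp
    finally show ?thesis .
  qed
  show "(\<lambda>n. L2norm (lebesgue_on S) (\<lambda>x. w n x - v x)) \<longlonglongrightarrow> 0"
    by (rule tendsto_sandwich[OF always_eventually always_eventually tendsto_const c]) (auto intro: le)
  show "(\<lambda>n. L2norm (lebesgue_on S) (\<lambda>x. wgrad S (w n) x - wgrad S v x)) \<longlonglongrightarrow> 0"
    by (rule tendsto_sandwich[OF always_eventually always_eventually tendsto_const c]) (auto intro: le2)
qed

lemma C1per_H1_field: "0 < r \<Longrightarrow> r < L \<Longrightarrow> w \<in> C1per L r \<Longrightarrow> w \<in> H1_field (Omega L r)"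
  by (erule (2) C1perD) (rule C1_H1_field(1))

lemma H1per_H1_field: "0 < r \<Longrightarrow> v \<in> H1per L r \<Longrightarrow> v \<in> H1_field (Omega L r)"
  by (auto simp: H1per_def H1_field_def)

text \<open>Along C^1 fields that realise the zero trace, the circle term of Green's formula is at
  most a fixed multiple of their L^2 norm on the circle and tends to zero. In the limit the extended
  gradient satisfies the periodic test identities for the extended field.\<close>

lemma V0_per_weak:
  assumes r: "0 < r" "r < L" and v: "v \<in> V0_sigma L r"
  shows "per_weak L (zero_ext r v) (zext r (wgrad (Omega L r) v))"
proof -
  have L: "L > 0" using r by simp
  let ?S = "Omega L r" let ?M = "lebesgue_on (Omega L r)"
  note S = null_boundary_Omega[of L r]
  have vH: "v \<in> H1_field ?S" using v H1per_H1_field[OF r(1)] by (auto simp: V0_sigma_def H1per_sigma_def)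
  note vD = H1_fieldD[OF S vH]
  obtain w where w: "\<And>n::nat. w n \<in> C1per L r" and c: "(\<lambda>n. H1norm ?S (\<lambda>x. v x - w n x)) \<longlonglongrightarrow> 0"
    and tr: "(\<lambda>n. L2norm (lebesgue_on {0..2*pi}) (\<lambda>\<theta>. w n (circle_pt r \<theta>))) \<longlonglongrightarrow> 0"
    using v by (auto simp: V0_sigma_def has_trace_def)
  have wH: "w n \<in> H1_field ?S" for n using C1per_H1_field[OF r w] .
  note wD = H1_fieldD[OF S wH]
  note conv = H1norm_conv[OF S vH wH c]
  have weak: "has_weak_pderiv UNIV i (\<lambda>x. zero_ext r v (wrap L x) $ j) (\<lambda>x. zext r (wgrad ?S v) (wrap L x) $ i $ j)" for i j
    unfolding has_weak_per_iff[OF L L2_nth[OF zext_L2[OF vD(1), folded zero_ext_zext], of j] L2_nth[OF L2_nth[OF zext_L2[OF vD(3)]], of i j]]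
  proof (intro allI impI)
    fix \<phi> N assume t: "test_function UNIV \<phi>" and s: "closure {x. \<phi> x \<noteq> 0} \<subseteq> cball 0 (2 * L * real N)"
    let ?b = "\<lambda>y. \<Sum>k\<in>cells N. \<phi> (y + lat L k)" and ?a = "\<lambda>y. \<Sum>k\<in>cells N. pderiv_at i \<phi> (y + lat L k)"
    have bc: "continuous_on S ?b" and ac: "continuous_on S ?a" for S
      by (intro per_sum_continuous test_function_continuous[OF t])+
    have bL: "?b \<in> L2 ?M" and aL: "?a \<in> L2 ?M" by (intro continuous_L2_Omega ac bc)+
    obtain B where B: "\<And>x. x \<in> Cl L r \<Longrightarrow> \<bar>?b x\<bar> \<le> B"
      using compact_imp_bounded[OF compact_continuous_image[OF bc compact_Cl[of L r]]] by (auto simp: bounded_iff)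
    have c1: "(\<lambda>n. LINT y|?M. w n y $ j * ?a y) \<longlonglongrightarrow> (LINT y|?M. v y $ j * ?a y)"
      by (rule L2_limit_integral[OF L2_nth[OF wD(1)] L2_nth[OF vD(1)] aL L2_conv_nth[OF wD(1) vD(1) conv(1)]])
    have c2: "(\<lambda>n. LINT y|?M. wgrad ?S (w n) y $ i $ j * ?b y) \<longlonglongrightarrow> (LINT y|?M. wgrad ?S v y $ i $ j * ?b y)"
      by (rule L2_limit_integral[OF L2_nth[OF L2_nth[OF wD(3)]] L2_nth[OF L2_nth[OF vD(3)]] bL 
            L2_conv_nth[OF L2_nth[OF wD(3)] L2_nth[OF vD(3)] L2_conv_nth[OF wD(3) vD(3) conv(2)]]])
    have "(\<lambda>n. 2 * r * B * sqrt (2 * pi) * L2norm (lebesgue_on {0..2*pi}) (\<lambda>\<theta>. w n (circle_pt r \<theta>))) \<longlonglongrightarrow> 2 * r * B * sqrt (2 * pi) * 0"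
      by (intro tendsto_mult_left tr)
    then have z: "(\<lambda>n. 2 * r * B * sqrt (2 * pi) * L2norm (lebesgue_on {0..2*pi}) (\<lambda>\<theta>. w n (circle_pt r \<theta>))) \<longlonglongrightarrow> 0" by simp
    have "(\<lambda>n. (LINT y|?M. w n y $ j * ?a y) + (LINT y|?M. wgrad ?S (w n) y $ i $ j * ?b y)) \<longlonglongrightarrow> 0"
      by (rule Lim_null_comparison[OF always_eventually z]) (use Green_trace_bound[OF r w t s B, of _ j i] in auto)
    from LIMSEQ_unique[OF this tendsto_add[OF c1 c2]]
    have eq: "(LINT y|?M. v y $ j * ?a y) = - (LINT y|?M. wgrad ?S v y $ i $ j * ?b y)" by simp
    have "(\<lambda>y. zero_ext r v y $ j * ?a y) = zext r (\<lambda>y. v y $ j * ?a y)" "(\<lambda>y. zext r (wgrad ?S v) y $ i $ j * ?b y) = zext r (\<lambda>y. wgrad ?S v y $ i $ j * ?b y)"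
      by (auto simp: zero_ext_def zext_def)
    then show "(LINT y|LM L. zero_ext r v y $ j * ?a y) = - (LINT y|LM L. zext r (wgrad ?S v) y $ i $ j * ?b y)"
      using eq by (simp only: zext_integral)
  qed
  show ?thesis unfolding per_weak_def using zext_L2[OF vD(1)] zext_L2[OF vD(3)] weak by (simp add: zero_ext_zext)
qed

lemma V0_zero_ext:
  assumes r: "0 < r" "r < L" and v: "v \<in> V0_sigma L r"
  shows "zero_ext r v \<in> H1per_sigma L 0" 
    "AE x in LM L. wgrad (Omega L 0) (zero_ext r v) x = zext r (wgrad (Omega L r) v) x"
proof -
  have L: "L > 0" using r by simp
  note p = per_weakD[OF L V0_per_weak[OF assms]]
  show G: "AE x in LM L. wgrad (Omega L 0) (zero_ext r v) x = zext r (wgrad (Omega L r) v) x" by (rule p(3))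
  have "AE x in lebesgue_on (Omega L r). wdiv (Omega L r) v x = 0" using v by (auto simp: V0_sigma_def H1per_sigma_def)
  then have "AE x in lebesgue. x \<in> Omega L r \<longrightarrow> wdiv (Omega L r) v x = 0" by (simp add: AE_lebesgue_on_iff)
  moreover have "AE x in lebesgue. x \<in> Omega L 0 \<longrightarrow> wgrad (Omega L 0) (zero_ext r v) x = zext r (wgrad (Omega L r) v) x"
    using G by (simp add: AE_lebesgue_on_iff)
  ultimately have "AE x in lebesgue. x \<in> Omega L 0 \<longrightarrow> wdiv (Omega L 0) (zero_ext r v) x = 0"
    by eventually_elim (auto simp: wdiv_eq zext_def Omega_def)
  then show "zero_ext r v \<in> H1per_sigma L 0" using p(1) by (simp add: H1per_sigma_def AE_lebesgue_on_iff)
qed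

section \<open>Mollification\<close>

lemma Sigma2_bound: 
  fixes h :: "real^2" and c :: "2 \<Rightarrow> real"
  assumes "\<And>i. \<bar>c i\<bar> \<le> B i" shows "\<bar>\<Sum>i\<in>UNIV. h $ i * c i\<bar> \<le> (\<Sum>i\<in>UNIV. B i) * norm h"
proof -
  have "\<bar>\<Sum>i\<in>UNIV. h $ i * c i\<bar> \<le> (\<Sum>i\<in>UNIV. \<bar>h $ i * c i\<bar>)" by (rule sum_abs)
  also have "\<dots> \<le> (\<Sum>i\<in>UNIV. B i * norm h)"
  proof (rule sum_mono)
    fix i
    have "0 \<le> B i" using assms[of i] by linarith
    then show "\<bar>h $ i * c i\<bar> \<le> B i * norm h"
      using assms[of i] component_le_norm_cart[of h i] unfolding abs_mult by (subst mult.commute) (intro mult_mono, auto)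
  qed
  finally show ?thesis by (simp add: sum_distrib_right)
qed

section \<open>Convolution with a test function\<close>

definition moll :: "(real^2 \<Rightarrow> real) \<Rightarrow> (real^2 \<Rightarrow> real) \<Rightarrow> real^2 \<Rightarrow> real" where
  "moll \<rho> g x = (LINT y|lebesgue. g y * \<rho> (x - y))"

lemma loc_int_moll:
  assumes g: "loc_int UNIV g" and \<rho>: "continuous_on UNIV \<rho>" "\<And>x. norm x > R \<Longrightarrow> \<rho> x = 0"
  shows "integrable lebesgue (\<lambda>y. g y * \<rho> (x - y))"
proof (rule loc_int_mult[OF g])
  show "compact (cball x R)" by simp
  show "continuous_on UNIV (\<lambda>y. \<rho> (x - y))"
    by (rule continuous_on_compose2[OF \<rho>(1)]) (auto intro!: continuous_intros)
  show "\<rho> (x - y) = 0" if "y \<notin> cball x R" for y using that \<rho>(2)[of "x - y"] by (simp add: dist_norm)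
qed simp

text \<open>A single dominating function works for all kernels with a common bound and a common ball
  as support. It is applied to translates for continuity and to remainder quotients for
  differentiability.\<close>

lemma moll_dominated:
  assumes g: "loc_int UNIV g" and q: "\<And>n. integrable lebesgue (\<lambda>y. g y * q n y)" 
    and lim: "\<And>y. (\<lambda>n. q n y) \<longlonglongrightarrow> q' y" and B: "\<And>n y. \<bar>q n y\<bar> \<le> B" and R: "\<And>n y. norm y > R \<Longrightarrow> q n y = 0"
    and m: "(\<lambda>y. g y * q' y) \<in> borel_measurable lebesgue"
  shows "(\<lambda>n. LINT y|lebesgue. g y * q n y) \<longlonglongrightarrow> (LINT y|lebesgue. g y * q' y)"
proof (rule integral_dominated_convergence[where w="\<lambda>y. B * \<bar>indicator (cball 0 R) y * g y\<bar>"])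
  show "integrable lebesgue (\<lambda>y. B * \<bar>indicator (cball 0 R) y * g y\<bar>)"
    using loc_int_indicator[OF g compact_cball, of 0 R] by simp
  show "AE y in lebesgue. (\<lambda>n. g y * q n y) \<longlonglongrightarrow> g y * q' y"
    by (intro AE_I2 tendsto_mult_left lim)
  show "AE y in lebesgue. norm (g y * q n y) \<le> B * \<bar>indicator (cball 0 R) y * g y\<bar>" for n
  proof (rule AE_I2)
    fix y
    show "norm (g y * q n y) \<le> B * \<bar>indicator (cball 0 R) y * g y\<bar>"
    proof (cases "norm y > R")
      case True then show ?thesis using R[OF True, of n] by simp
    next
      case False
      then have "indicator (cball 0 R) y = (1 :: real)" by simp
      moreover have "\<bar>q n y\<bar> * \<bar>g y\<bar> \<le> B * \<bar>g y\<bar>" by (rule mult_right_mono[OF B]) simp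
      ultimately show ?thesis by (simp add: abs_mult mult.commute)
    qed
  qed
  show "(\<lambda>y. g y * q n y) \<in> borel_measurable lebesgue" for n using q by blast
qed (rule m)

lemma compact_support_bounded:
  assumes "continuous_on UNIV \<rho>" "\<And>x :: real^2. norm x > R \<Longrightarrow> \<rho> x = (0 :: real)"
  shows "\<exists>B\<ge>0. \<forall>x. \<bar>\<rho> x\<bar> \<le> B"
proof -
  have "bounded (\<rho> ` cball 0 R)"
    by (rule compact_imp_bounded[OF compact_continuous_image[OF continuous_on_subset[OF assms(1) subset_UNIV] compact_cball]])
  then obtain B where "\<forall>y\<in>\<rho> ` cball 0 R. norm y \<le> B" unfolding bounded_iff by blast
  then have B: "\<bar>\<rho> x\<bar> \<le> B" if "x \<in> cball 0 R" for x using that by auto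
  have "\<bar>\<rho> x\<bar> \<le> \<bar>B\<bar>" for x
    using B[of x] assms(2)[of x] by (cases "norm x > R") auto
  then show ?thesis by (intro exI[of _ "\<bar>B\<bar>"]) simp
qed

lemma moll_continuous:
  assumes g: "loc_int UNIV g" and \<rho>: "continuous_on UNIV \<rho>" "\<And>x. norm x > R \<Longrightarrow> \<rho> x = 0"
  shows "continuous_on UNIV (moll \<rho> g)"
  unfolding continuous_on_eq_continuous_at[OF open_UNIV]
proof (intro ballI)
  fix x :: "real^2"
  obtain B where "\<forall>x. \<bar>\<rho> x\<bar> \<le> B" using compact_support_bounded[OF \<rho>] by blast
  then have B: "\<bar>\<rho> x\<bar> \<le> B" for x by blast
  have "(\<lambda>n. moll \<rho> g (X n)) \<longlonglongrightarrow> moll \<rho> g x" if X: "X \<longlonglongrightarrow> x" for X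
  proof -
    obtain C where C: "\<And>n. norm (X n) \<le> C" using X by (metis Bseq_def convergentI convergent_imp_Bseq)
    show ?thesis unfolding moll_def
    proof (rule moll_dominated[OF g loc_int_moll[OF g \<rho>] _ B])
      have "isCont \<rho> z" for z using \<rho>(1) by (simp add: continuous_on_eq_continuous_at)
      then show "(\<lambda>n. \<rho> (X n - y)) \<longlonglongrightarrow> \<rho> (x - y)" for y
        by (rule isCont_tendsto_compose) (intro tendsto_diff X tendsto_const)
      show "\<rho> (X n - y) = 0" if "norm y > R + C" for n y
      proof (rule \<rho>(2))
        have "norm y \<le> norm (X n - y) + norm (X n)" by (metis add.commute norm_minus_commute norm_triangle_sub)
        then show "R < norm (X n - y)" using C[of n] that by linarith
      qed
      show "(\<lambda>y. g y * \<rho> (x - y)) \<in> borel_measurable lebesgue" using loc_int_moll[OF g \<rho>, of R x] by blast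
    qed
  qed
  then show "isCont (moll \<rho> g) x" by (simp add: continuous_at_sequentially comp_def)
qed

lemma test_function_radius:
  assumes "test_function UNIV \<rho>" shows "\<exists>R>0. \<forall>x. norm x > R \<longrightarrow> \<rho> x = 0 \<and> (\<forall>i. pderiv_at i \<rho> x = 0)"
proof -
  have "bounded (closure {x. \<rho> x \<noteq> 0})" using assms by (auto simp: test_function_def compact_imp_bounded)
  then obtain R where R: "R > 0" "\<And>x. x \<in> closure {x. \<rho> x \<noteq> 0} \<Longrightarrow> norm x \<le> R" by (auto simp: bounded_pos)
  have "x \<notin> closure {x. \<rho> x \<noteq> 0}" if "norm x > R" for x using R(2)[of x] that by linarith
  note o = test_function_outside[OF assms this]
  then show ?thesis using R(1) by blast
qed

text \<open>Differentiation under the integral along arbitrary sequences \<open>H\<close>, which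
  gives the full derivative and not only the partial ones. The remainder quotient of
  \<open>\<rho>\<close> tends to zero pointwise and is at most \<open>2 * B\<close>: once for the
  Lipschitz increment, once for the linear term.\<close>

lemma moll_has_derivative:
  assumes g: "loc_int UNIV g" and t: "test_function UNIV \<rho>"
  shows "(moll \<rho> g has_derivative (\<lambda>h. \<Sum>i\<in>UNIV. h $ i * moll (pderiv_at i \<rho>) g x)) (at x)"
proof -
  obtain R where R0: "R > 0" "\<forall>x. norm x > R \<longrightarrow> \<rho> x = 0 \<and> (\<forall>i. pderiv_at i \<rho> x = 0)"
    using test_function_radius[OF t] by blast
  then have R: "\<rho> x = 0" "pderiv_at i \<rho> x = 0" if "norm x > R" for x i using that by blast+
  note \<rho>c = test_function_continuous[OF t]
  have i0: "integrable lebesgue (\<lambda>y. g y * \<rho> (x - y))" for x by (rule loc_int_moll[OF g \<rho>c(1)]) (rule R(1))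
  have i1: "integrable lebesgue (\<lambda>y. g y * pderiv_at i \<rho> (x - y))" for x i by (rule loc_int_moll[OF g \<rho>c(2)]) (rule R(2))
  have "\<exists>B. \<forall>x. \<bar>pderiv_at i \<rho> x\<bar> \<le> B" for i using compact_support_bounded[OF \<rho>c(2) R(2)] by blast
  then have "\<exists>Bi. \<forall>i x. \<bar>pderiv_at i \<rho> x\<bar> \<le> Bi i" by (rule choice[OF allI])
  then obtain Bi where "\<forall>i x. \<bar>pderiv_at i \<rho> x\<bar> \<le> Bi i" ..
  then have Bi: "\<bar>pderiv_at i \<rho> x\<bar> \<le> Bi i" for i x by blast
  define B where "B = (\<Sum>i\<in>UNIV. Bi i)"
  have Dz: "\<bar>\<Sum>i\<in>UNIV. h $ i * pderiv_at i \<rho> z\<bar> \<le> B * norm h" for h z unfolding B_def by (rule Sigma2_bound[OF Bi])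
  have Lip: "\<bar>\<rho> a - \<rho> b\<bar> \<le> B * norm (a - b)" for a b
  proof -
    have "norm (\<rho> a - \<rho> b) \<le> B * norm (a - b)"
    proof (rule differentiable_bound[OF convex_UNIV])
      show "(\<rho> has_derivative (\<lambda>h. \<Sum>i\<in>UNIV. h $ i * pderiv_at i \<rho> x)) (at x within UNIV)" for x
        using test_function_has_derivative[OF t] by simp
      show "onorm (\<lambda>h. \<Sum>i\<in>UNIV. h $ i * pderiv_at i \<rho> x) \<le> B" for x
        by (rule onorm_le) (simp only: real_norm_def Dz)
    qed auto
    then show ?thesis by simp
  qed
  let ?D = "\<lambda>h. \<Sum>i\<in>UNIV. h $ i * moll (pderiv_at i \<rho>) g x"
  have Dm: "?D h = (LINT y|lebesgue. g y * (\<Sum>i\<in>UNIV. h $ i * pderiv_at i \<rho> (x - y)))" for h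
  proof -
    have "(LINT y|lebesgue. g y * (\<Sum>i\<in>UNIV. h $ i * pderiv_at i \<rho> (x - y))) = (LINT y|lebesgue. (\<Sum>i\<in>UNIV. h $ i * (g y * pderiv_at i \<rho> (x - y))))"
      by (intro Bochner_Integration.integral_cong refl) (simp add: sum_distrib_left mult.left_commute)
    also have "\<dots> = (\<Sum>i\<in>UNIV. LINT y|lebesgue. h $ i * (g y * pderiv_at i \<rho> (x - y)))"
      by (intro Bochner_Integration.integral_sum integrable_mult_right i1)
    finally show ?thesis unfolding moll_def by simp
  qed
  have iD: "integrable lebesgue (\<lambda>y. g y * (\<Sum>i\<in>UNIV. h $ i * pderiv_at i \<rho> (x - y)))" for h
  proof -
    have "integrable lebesgue (\<lambda>y. \<Sum>i\<in>UNIV. h $ i * (g y * pderiv_at i \<rho> (x - y)))"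
      by (intro Bochner_Integration.integrable_sum integrable_mult_right i1)
    then show ?thesis by (simp add: sum_distrib_left mult.left_commute)
  qed
  have lin: "bounded_linear ?D"
    by (intro bounded_linear_sum bounded_linear_mult_const[THEN bounded_linear_compose] bounded_linear_vec_nth bounded_linear_mult_left[THEN bounded_linear_compose[of "\<lambda>a. a * _"]])
  have "((\<lambda>h. norm (moll \<rho> g (x + h) - moll \<rho> g x - ?D h) / norm h) \<longlongrightarrow> 0) (at 0)"
    unfolding tendsto_at_iff_sequentially comp_def
  proof (intro allI impI)
    fix H :: "nat \<Rightarrow> real^2" assume Hn: "\<forall>n. H n \<in> UNIV - {0}" and H: "H \<longlonglongrightarrow> 0"
    obtain C where C: "\<And>n. norm (H n) \<le> C" using H by (metis Bseq_def convergentI convergent_imp_Bseq)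
    have C0: "0 \<le> C" using C[of 0] norm_ge_zero order_trans by blast
    have B0: "0 \<le> B" unfolding B_def using Bi abs_ge_zero order_trans by (intro sum_nonneg) blast
    define q where "q n y = (\<rho> (x + H n - y) - \<rho> (x - y) - (\<Sum>i\<in>UNIV. H n $ i * pderiv_at i \<rho> (x - y))) / norm (H n)" for n y
    have gq: "g y * q n y = (1 / norm (H n)) * (g y * \<rho> (x + H n - y) - g y * \<rho> (x - y) - g y * (\<Sum>i\<in>UNIV. H n $ i * pderiv_at i \<rho> (x - y)))" for n y
      unfolding q_def by (simp add: algebra_simps diff_divide_distrib add_divide_distrib)
    have iq: "integrable lebesgue (\<lambda>y. g y * q n y)" for n
      unfolding gq by (intro integrable_mult_right Bochner_Integration.integrable_diff i0 iD)
    have eq: "(LINT y|lebesgue. g y * q n y) = (moll \<rho> g (x + H n) - moll \<rho> g x - ?D (H n)) / norm (H n)" for n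
    proof -
      have "(LINT y|lebesgue. g y * q n y) = (1 / norm (H n)) * ((LINT y|lebesgue. g y * \<rho> (x + H n - y)) - (LINT y|lebesgue. g y * \<rho> (x - y))
          - (LINT y|lebesgue. g y * (\<Sum>i\<in>UNIV. H n $ i * pderiv_at i \<rho> (x - y))))"
        unfolding gq using i0 iD by simp
      then show ?thesis unfolding Dm[symmetric] by (simp add: moll_def)
    qed
    have "(\<lambda>n. LINT y|lebesgue. g y * q n y) \<longlonglongrightarrow> (LINT y|lebesgue. g y * 0)"
    proof (rule moll_dominated[OF g iq])
      show "(\<lambda>n. q n y) \<longlonglongrightarrow> 0" for y
      proof -
        have "((\<lambda>h. norm (\<rho> (x - y + h) - \<rho> (x - y) - (\<Sum>i\<in>UNIV. h $ i * pderiv_at i \<rho> (x - y))) / norm h) \<longlongrightarrow> 0) (at 0)"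
          using test_function_has_derivative[OF t, of "x - y"] unfolding has_derivative_at by blast
        then have "(\<lambda>n. norm (\<rho> (x - y + H n) - \<rho> (x - y) - (\<Sum>i\<in>UNIV. H n $ i * pderiv_at i \<rho> (x - y))) / norm (H n)) \<longlonglongrightarrow> 0"
          unfolding tendsto_at_iff_sequentially comp_def using Hn H by blast
        then have "(\<lambda>n. norm (q n y)) \<longlonglongrightarrow> 0" unfolding q_def by (simp add: algebra_simps)
        then show ?thesis by (simp add: tendsto_rabs_zero_iff)
      qed
      show "\<bar>q n y\<bar> \<le> 2 * B" for n y
      proof -
        have h: "norm (H n) > 0" using Hn by auto
        have "\<bar>\<rho> (x + H n - y) - \<rho> (x - y) - (\<Sum>i\<in>UNIV. H n $ i * pderiv_at i \<rho> (x - y))\<bar>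
           \<le> \<bar>\<rho> (x + H n - y) - \<rho> (x - y)\<bar> + \<bar>\<Sum>i\<in>UNIV. H n $ i * pderiv_at i \<rho> (x - y)\<bar>" by (rule abs_triangle_ineq4)
        also have "\<dots> \<le> B * norm (H n) + B * norm (H n)" 
          using Lip[of "x + H n - y" "x - y"] Dz[of "H n" "x - y"] by (intro add_mono) (simp_all add: algebra_simps)
        finally show ?thesis using h unfolding q_def by (simp add: abs_divide pos_divide_le_eq)
      qed
      show "q n y = 0" if "norm y > R + C + norm x" for n y
      proof -
        have "norm y \<le> norm (x + H n - y) + norm x + norm (H n)" "norm y \<le> norm (x - y) + norm x"
          using norm_triangle_ineq4[of "x + H n" "x + H n - y"] norm_triangle_ineq[of x "H n"] norm_triangle_ineq4[of x "x - y"] by (simp_all add: algebra_simps)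
        then have "norm (x + H n - y) > R" "norm (x - y) > R" using that C[of n] C0 by linarith+
        then show ?thesis unfolding q_def using R by simp
      qed
    qed simp
    then have "(\<lambda>n. (moll \<rho> g (x + H n) - moll \<rho> g x - ?D (H n)) / norm (H n)) \<longlonglongrightarrow> 0" unfolding eq by simp
    from tendsto_norm[OF this, unfolded norm_divide]
    show "(\<lambda>n. norm (moll \<rho> g (x + H n) - moll \<rho> g x - ?D (H n)) / norm (H n)) \<longlonglongrightarrow> 0"
      by (simp only: real_norm_def abs_norm_cancel abs_zero)
  qed
  then show ?thesis unfolding has_derivative_at using lin by blast
qed

text \<open>Testing with \<open>\<lambda>y. \<rho> (x - y)\<close>, whose derivative carries a minus
  sign, cancels the sign in the definition of the weak derivative.\<close>

lemma moll_weak_pderiv: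
  assumes w: "has_weak_pderiv UNIV i u g" and t: "test_function UNIV \<rho>"
  shows "moll (pderiv_at i \<rho>) u x = moll \<rho> g x"
proof -
  have U: "(UNIV :: (real^2) set) \<in> sets lebesgue" by simp
  note w = w[unfolded has_weak_pderiv_iff[OF U] interior_UNIV]
  have t': "test_function UNIV (\<lambda>y. \<rho> (x + (- 1) *\<^sub>R y))" by (rule test_function_translate[OF t]) simp
  have p: "pderiv_at i (\<lambda>y. \<rho> (x + (- 1) *\<^sub>R y)) y = - pderiv_at i \<rho> (x - y)" for y
  proof -
    have "((\<lambda>y. x + (- 1) *\<^sub>R y) has_derivative (\<lambda>h. - h)) (at y)" by (auto intro!: derivative_eq_intros)
    from has_derivative_compose[OF this test_function_has_derivative[OF t]]
    have D: "((\<lambda>y. \<rho> (x + (- 1) *\<^sub>R y)) has_derivative (\<lambda>h. \<Sum>k\<in>UNIV. (- h) $ k * pderiv_at k \<rho> (x + (- 1) *\<^sub>R y))) (at y)" .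
    have "(\<Sum>k\<in>UNIV. (- axis i 1 :: real^2) $ k * pderiv_at k \<rho> (x + (- 1) *\<^sub>R y)) = (\<Sum>k\<in>UNIV. if k = i then - pderiv_at i \<rho> (x - y) else 0)"
      by (rule sum.cong) (auto simp: axis_def)
    then show ?thesis unfolding pderiv_atI[OF D] by simp
  qed
  have "(LINT y|lebesgue. u y * - pderiv_at i \<rho> (x - y)) = - (LINT y|lebesgue. g y * \<rho> (x + (- 1) *\<^sub>R y))"
    using w t' unfolding p[symmetric] by blast
  then show ?thesis by (simp add: moll_def)
qed

lemma moll_periodic:
  assumes "\<And>x. g (a + x) = g x" "\<And>x. (\<lambda>y. g y * \<rho> (x - y)) \<in> borel_measurable lebesgue" shows "moll \<rho> g (a + x) = moll \<rho> g x"
proof -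
  have "moll \<rho> g (a + x) = (LINT y|lebesgue. g (a + y) * \<rho> (a + x - (a + y)))"
    unfolding moll_def by (rule integral_translation[OF assms(2), symmetric])
  then show ?thesis by (simp add: moll_def assms(1))
qed

section \<open>A mollifying kernel and convergence in L^2\<close>

definition kernel :: "real \<Rightarrow> real^2 \<Rightarrow> real" where
  "kernel e x = bump 1 (vec (- e)) (vec e) x / (LINT y|lebesgue. bump 1 (vec (- e)) (vec e) y)"

lemma kernel:
  assumes "e > 0"
  shows "test_function UNIV (kernel e)" "0 \<le> kernel e x" "(\<exists>i. \<bar>x $ i\<bar> > e) \<Longrightarrow> kernel e x = 0" 
    "integrable lebesgue (kernel e)" "(LINT y|lebesgue. kernel e y) = 1"
proof -
  let ?b = "bump 1 (vec (- e)) (vec e :: real^2)"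
  let ?c = "LINT y|lebesgue. ?b y"
  have t: "test_function UNIV ?b" by (rule test_function_bump) simp
  have bc: "continuous_on UNIV ?b" by (rule test_function_continuous(1)[OF t])
  have "loc_int UNIV (\<lambda>_. 1)" unfolding loc_int_def
    using finite_measure.integrable_const[OF finite_measure_lebesgue_on[OF lmeasurable_compact]] by blast
  from loc_int_test(1)[OF this t] have ib: "integrable lebesgue ?b" by simp
  have "?c \<noteq> 0"
  proof
    assume "?c = 0"
    then have "AE x in lebesgue. ?b x = 0" using ib bump_bounds(1) by (subst (asm) integral_nonneg_eq_0_iff_AE) auto
    then have "AE x in lebesgue. x \<notin> box (vec (- e)) (vec e :: real^2)"
      by eventually_elim (use bump_pos[of 1] in fastforce)
    then have "box (vec (- e)) (vec e :: real^2) \<in> null_sets lebesgue"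
      by (subst (asm) AE_iff_null) (auto simp: Collect_neg_eq)
    then have "negligible (box (vec (- e)) (vec e :: real^2))" by (simp add: negligible_iff_null_sets)
    moreover have "0 \<in> box (vec (- e)) (vec e :: real^2)" using assms by (simp add: mem_box_cart)
    ultimately show False using open_not_negligible[OF open_box] by blast
  qed
  moreover have "0 \<le> ?c" by (rule Bochner_Integration.integral_nonneg) (simp add: bump_bounds)
  ultimately have c: "?c > 0" by simp
  have "Ck k (\<lambda>x. (1 / ?c) * ?b x)" for k by (intro Ck_mult Ck_const Ck_bump)
  moreover have ke: "kernel e = (\<lambda>x. (1 / ?c) * ?b x)" by (rule ext) (simp add: kernel_def)
  moreover have "{x. kernel e x \<noteq> 0} = {x. ?b x \<noteq> 0}" using c by (auto simp: kernel_def)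
  ultimately show "test_function UNIV (kernel e)" using t by (simp add: test_function_def)
  show "0 \<le> kernel e x" using c by (simp add: kernel_def bump_bounds)
  show "integrable lebesgue (kernel e)" unfolding ke using ib by simp
  show "(LINT y|lebesgue. kernel e y) = 1" unfolding ke using c by simp
  assume "\<exists>i. \<bar>x $ i\<bar> > e"
  then obtain i where "e < \<bar>x $ i\<bar>" ..
  then have "x \<notin> box (vec (- e)) (vec e)" by (auto simp: mem_box_cart intro!: exI[of _ i])
  then show "kernel e x = 0" by (simp add: kernel_def bump_0)
qed

text \<open>The support lies in the square of half-side \<open>e\<close>, where the sum of the
  absolute coordinates, and hence the norm, is at most \<open>2 * e\<close>.\<close>

lemma kernel_norm: assumes "e > 0" "norm x > 2 * e" shows "kernel e x = 0"
proof (rule kernel(3)[OF assms(1)], rule ccontr)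
  assume "\<not> (\<exists>i. e < \<bar>x $ i\<bar>)"
  then have "\<bar>x $ i\<bar> \<le> e" for i by (meson not_less)
  then have "(\<Sum>i\<in>UNIV. \<bar>x $ i\<bar>) \<le> (\<Sum>i\<in>(UNIV :: 2 set). e)" by (intro sum_mono)
  then show False using norm_le_l1_cart[of x] assms by simp
qed

lemma kernel_sym: "kernel e (- x) = kernel e x"
  by (simp add: kernel_def bump_def mult_ac add.commute)

lemma kernel_continuous: "e > 0 \<Longrightarrow> continuous_on UNIV (kernel e)"
  by (rule test_function_continuous(1)[OF kernel(1)])

lemma kernel_shift: assumes "e > 0" 
  shows "integrable lebesgue (\<lambda>y. kernel e (x - y))" "(LINT y|lebesgue. kernel e (x - y)) = 1"
    "integrable lebesgue (\<lambda>y. kernel e (y - x))" "(LINT y|lebesgue. kernel e (y - x)) = 1"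
proof -
  have e: "kernel e (x - y) = kernel e (- x + y)" for y using kernel_sym[of e "x - y"] by simp
  have e': "kernel e (y - x) = kernel e (- x + y)" for y by simp
  show "integrable lebesgue (\<lambda>y. kernel e (x - y))" "(LINT y|lebesgue. kernel e (x - y)) = 1"
    unfolding e using integrable_translation[OF kernel(4)[OF assms], of "- x"] 
      integral_translation[OF borel_measurable_integrable[OF kernel(4)[OF assms]], of "- x"] kernel(5)[OF assms] by simp_all
  show "integrable lebesgue (\<lambda>y. kernel e (y - x))" "(LINT y|lebesgue. kernel e (y - x)) = 1"
    unfolding e' using integrable_translation[OF kernel(4)[OF assms], of "- x"] 
      integral_translation[OF borel_measurable_integrable[OF kernel(4)[OF assms]], of "- x"] kernel(5)[OF assms] by simp_all
qed

lemma loc_int_kernel: "loc_int UNIV g \<Longrightarrow> e > 0 \<Longrightarrow> integrable lebesgue (\<lambda>y. g y * kernel e (x - y))"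
  by (rule loc_int_moll[OF _ kernel_continuous kernel_norm])

lemma Cl_shift:
  assumes "e \<le> L" "x \<in> Omega L 0" "\<And>i. \<bar>(x - y) $ i\<bar> \<le> e" shows "y \<in> Cl (2 * L) 0"
  unfolding mem_Cl
proof (intro conjI allI)
  fix i
  have "\<bar>x $ i\<bar> < L" using assms(2) by (simp add: mem_Omega)
  then show "\<bar>y $ i\<bar> \<le> 2 * L" using assms(3)[of i] assms(1) by simp
qed simp

text \<open>Jensen's inequality bounds the square of the mollification by the mollification of the
  square; Tonelli and the unit mass of the kernel then give the estimate. The right-hand norm is
  over the doubled square because points of \<open>Omega L 0\<close> see values at coordinate
  distance up to \<open>e \<le> L\<close>.\<close>

lemma moll_contraction:
  assumes e: "0 < e" "e \<le> L" and d: "loc_int UNIV d" "loc_int UNIV (\<lambda>y. (d y)\<^sup>2)" "d \<in> L2 (lebesgue_on (Cl (2 * L) 0))"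
  shows "L2norm (LM L) (moll (kernel e) d) \<le> L2norm (lebesgue_on (Cl (2 * L) 0)) d"
proof -
  let ?k = "kernel e" and ?B = "Cl (2 * L) 0"
  let ?m = "moll ?k d"
  have Bs: "?B \<in> sets lebesgue" using compact_Cl compact_sets_lebesgue by blast
  have pw: "(?m x)\<^sup>2 \<le> (LINT y|lebesgue. (d y)\<^sup>2 * ?k (x - y))" for x
  proof -
    note i = loc_int_kernel[OF d(1) e(1), of x] loc_int_kernel[OF d(2) e(1), of x] kernel_shift(1)[OF e(1), of x]
    \<comment> \<open>Jensen's inequality for the square, as nonnegativity of the variance with
      respect to the probability density \<open>?k (x - y)\<close>.\<close>
    have "0 \<le> (LINT y|lebesgue. (d y - ?m x)\<^sup>2 * ?k (x - y))"
      by (rule Bochner_Integration.integral_nonneg) (simp add: kernel(2)[OF e(1)])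
    also have "\<dots> = (LINT y|lebesgue. (d y)\<^sup>2 * ?k (x - y) - 2 * ?m x * (d y * ?k (x - y)) + (?m x)\<^sup>2 * ?k (x - y))"
      by (intro Bochner_Integration.integral_cong refl) (simp add: power2_diff algebra_simps)
    also have "\<dots> = (LINT y|lebesgue. (d y)\<^sup>2 * ?k (x - y)) - 2 * ?m x * ?m x + (?m x)\<^sup>2"
      using i by (simp add: kernel_shift(2)[OF e(1)] moll_def)
    finally show ?thesis by (simp add: power2_eq_square)
  qed
  have mc: "continuous_on UNIV ?m" by (rule moll_continuous[OF d(1) kernel_continuous[OF e(1)] kernel_norm[OF e(1)]])
  have mL: "?m \<in> L2 (LM L)" by (rule continuous_L2_Omega[OF mc])
  have "(\<lambda>y. (d y)\<^sup>2) \<in> borel_measurable lebesgue"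
  proof -
    have m: "(\<lambda>y. indicator (cball 0 (real n)) y * (d y)\<^sup>2) \<in> borel_measurable lebesgue" for n
      using loc_int_indicator[OF d(2) compact_cball subset_UNIV] by blast
    show ?thesis
    proof (rule borel_measurable_LIMSEQ_real[OF _ m])
      fix x :: "real^2"
      obtain n0 where "norm x \<le> real n0" using real_arch_simple by blast
      then have "\<forall>n\<ge>n0. indicator (cball 0 (real n)) x * (d x)\<^sup>2 = (d x)\<^sup>2" by (auto simp: indicator_def)
      then show "(\<lambda>n. indicator (cball 0 (real n)) x * (d x)\<^sup>2) \<longlonglongrightarrow> (d x)\<^sup>2"
        by (intro tendsto_eventually) (auto simp: eventually_sequentially)
    qed
  qed
  \<comment> \<open>Tonelli is applied to the product of two copies of \<open>lborel\<close>, so the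
    square of \<open>d\<close> is replaced by a Borel function equal to it almost
    everywhere.\<close>
  then obtain D where D: "D \<in> borel_measurable lborel" "AE y in lborel. (d y)\<^sup>2 = D y"
    using completion_ex_borel_measurable_real by blast
  have [measurable]: "D \<in> borel_measurable borel" using D(1) by simp
  have [measurable]: "?k \<in> borel_measurable borel" by (rule borel_measurable_continuous_onI[OF kernel_continuous[OF e(1)]])
  have [measurable]: "Omega L 0 \<in> sets borel" "?B \<in> sets borel" unfolding Omega_def Cl_def by auto
  have D': "AE y in lebesgue. (d y)\<^sup>2 = D y" using D(2) by (rule AE_completion)
  have nn1: "(\<integral>\<^sup>+y. ennreal (D y) * ennreal (?k (x - y)) \<partial>lborel) = ennreal (LINT y|lebesgue. (d y)\<^sup>2 * ?k (x - y))" for x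
  proof -
    have "(\<integral>\<^sup>+y. ennreal (D y) * ennreal (?k (x - y)) \<partial>lborel) = (\<integral>\<^sup>+y. ennreal (D y) * ennreal (?k (x - y)) \<partial>lebesgue)"
      by (rule nn_integral_completion[symmetric])
    also have "\<dots> = (\<integral>\<^sup>+y. ennreal ((d y)\<^sup>2 * ?k (x - y)) \<partial>lebesgue)"
    proof (rule nn_integral_cong_AE)
      show "AE y in lebesgue. ennreal (D y) * ennreal (?k (x - y)) = ennreal ((d y)\<^sup>2 * ?k (x - y))"
        using D'
      proof eventually_elim
        case (elim y)
        show ?case unfolding elim[symmetric] by (rule ennreal_mult[OF zero_le_power2 kernel(2)[OF e(1)], symmetric])
      qed
    qed
    also have "\<dots> = ennreal (LINT y|lebesgue. (d y)\<^sup>2 * ?k (x - y))"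
      using loc_int_kernel[OF d(2) e(1), of x] by (intro nn_integral_eq_integral) (simp_all add: kernel(2)[OF e(1)])
    finally show ?thesis .
  qed
  have "ennreal ((L2norm (LM L) ?m)\<^sup>2) = (\<integral>\<^sup>+x. ennreal ((?m x)\<^sup>2) \<partial>LM L)"
    using mL unfolding L2norm_power2 L2_def by (subst nn_integral_eq_integral) auto
  also have "\<dots> = (\<integral>\<^sup>+x. ennreal ((?m x)\<^sup>2) * indicator (Omega L 0) x \<partial>lebesgue)"
    by (rule nn_integral_restrict_space) simp
  also have "\<dots> = (\<integral>\<^sup>+x. ennreal ((?m x)\<^sup>2) * indicator (Omega L 0) x \<partial>lborel)" by (rule nn_integral_completion)
  also have "\<dots> \<le> (\<integral>\<^sup>+x. (\<integral>\<^sup>+y. ennreal (D y) * ennreal (?k (x - y)) * indicator (Omega L 0) x \<partial>lborel) \<partial>lborel)"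
  proof (rule nn_integral_mono)
    fix x
    have "(\<integral>\<^sup>+y. ennreal (D y) * ennreal (?k (x - y)) * indicator (Omega L 0) x \<partial>lborel) = (\<integral>\<^sup>+y. ennreal (D y) * ennreal (?k (x - y)) \<partial>lborel) * indicator (Omega L 0) x"
      by (rule nn_integral_multc) measurable
    also have "\<dots> \<ge> ennreal ((?m x)\<^sup>2) * indicator (Omega L 0) x"
      unfolding nn1 using pw[of x] by (intro mult_right_mono ennreal_leI) auto
    finally show "ennreal ((?m x)\<^sup>2) * indicator (Omega L 0) x \<le> (\<integral>\<^sup>+y. ennreal (D y) * ennreal (?k (x - y)) * indicator (Omega L 0) x \<partial>lborel)" .
  qed
  also have "\<dots> = (\<integral>\<^sup>+y. (\<integral>\<^sup>+x. ennreal (D y) * ennreal (?k (x - y)) * indicator (Omega L 0) x \<partial>lborel) \<partial>lborel)"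
    by (rule lborel_pair.Fubini'[symmetric]) measurable
  also have "\<dots> \<le> (\<integral>\<^sup>+y. ennreal (D y) * indicator ?B y \<partial>lborel)"
  proof (rule nn_integral_mono)
    fix y
    have "(\<integral>\<^sup>+x. ennreal (D y) * ennreal (?k (x - y)) * indicator (Omega L 0) x \<partial>lborel) \<le> (\<integral>\<^sup>+x. (ennreal (D y) * indicator ?B y) * ennreal (?k (x - y)) \<partial>lborel)"
    proof (rule nn_integral_mono)
      fix x
      show "ennreal (D y) * ennreal (?k (x - y)) * indicator (Omega L 0) x \<le> (ennreal (D y) * indicator ?B y) * ennreal (?k (x - y))"
      proof (cases "x \<in> Omega L 0 \<and> ?k (x - y) \<noteq> 0")
        case True
        then have "\<bar>(x - y) $ i\<bar> \<le> e" for i using kernel(3)[OF e(1), of "x - y"] by (meson not_less)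
        then have "y \<in> ?B" using Cl_shift[OF e(2)] True by blast
        then show ?thesis using True by simp
      qed auto
    qed
    also have "\<dots> = (ennreal (D y) * indicator ?B y) * (\<integral>\<^sup>+x. ennreal (?k (x - y)) \<partial>lborel)"
      by (rule nn_integral_cmult) measurable
    also have "(\<integral>\<^sup>+x. ennreal (?k (x - y)) \<partial>lborel) = (\<integral>\<^sup>+x. ennreal (?k (x - y)) \<partial>lebesgue)" by (rule nn_integral_completion[symmetric])
    also have "\<dots> = 1"
      using kernel_shift(3,4)[OF e(1), of y] by (subst nn_integral_eq_integral) (auto simp: kernel(2)[OF e(1)])
    finally show "(\<integral>\<^sup>+x. ennreal (D y) * ennreal (?k (x - y)) * indicator (Omega L 0) x \<partial>lborel) \<le> ennreal (D y) * indicator ?B y" by simp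
  qed
  also have "\<dots> = (\<integral>\<^sup>+y. ennreal (D y) * indicator ?B y \<partial>lebesgue)" by (rule nn_integral_completion[symmetric])
  also have "\<dots> = (\<integral>\<^sup>+y. ennreal ((d y)\<^sup>2) * indicator ?B y \<partial>lebesgue)"
  proof (rule nn_integral_cong_AE)
    show "AE y in lebesgue. ennreal (D y) * indicator ?B y = ennreal ((d y)\<^sup>2) * indicator ?B y"
      using D' by eventually_elim simp
  qed
  also have "\<dots> = (\<integral>\<^sup>+y. ennreal ((d y)\<^sup>2) \<partial>lebesgue_on ?B)"
    using Bs by (intro nn_integral_restrict_space[symmetric]) simp
  also have "\<dots> = ennreal ((L2norm (lebesgue_on ?B) d)\<^sup>2)"
    using d(3) unfolding L2norm_power2 L2_def by (subst nn_integral_eq_integral) auto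
  finally have "(L2norm (LM L) ?m)\<^sup>2 \<le> (L2norm (lebesgue_on ?B) d)\<^sup>2" by (simp add: ennreal_le_iff)
  then show ?thesis by (rule power2_le_imp_le) simp
qed

lemma L2norm_dominated:
  fixes f :: "nat \<Rightarrow> 'a \<Rightarrow> real"
  assumes "\<And>n. f n \<in> borel_measurable M" "g \<in> borel_measurable M" "integrable M w"
    "AE x in M. (\<lambda>n. f n x) \<longlonglongrightarrow> g x" "\<And>n. AE x in M. (g x - f n x)\<^sup>2 \<le> w x"
  shows "(\<lambda>n. L2norm M (\<lambda>x. g x - f n x)) \<longlonglongrightarrow> 0"
proof -
  have "(\<lambda>n. LINT x|M. (norm (g x - f n x))\<^sup>2) \<longlonglongrightarrow> (LINT x|M. 0)"
  proof (rule integral_dominated_convergence[OF _ _ assms(3)])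
    show "(\<lambda>x. (norm (g x - f n x))\<^sup>2) \<in> borel_measurable M" for n using assms(1,2) by measurable
    show "AE x in M. (\<lambda>n. (norm (g x - f n x))\<^sup>2) \<longlonglongrightarrow> 0"
      using assms(4)
    proof eventually_elim
      case (elim x)
      have "(\<lambda>n. (norm (g x - f n x))\<^sup>2) \<longlonglongrightarrow> (norm (g x - g x))\<^sup>2" by (intro tendsto_intros elim)
      then show ?case by simp
    qed
    show "AE x in M. norm ((norm (g x - f n x))\<^sup>2) \<le> w x" for n using assms(5)[of n] by eventually_elim simp
  qed simp
  from tendsto_real_sqrt[OF this] show ?thesis by (simp add: L2norm_def)
qed

text \<open>Truncation at height \<open>n\<close> converges by dominated convergence. The truncated
  function is an almost everywhere limit of continuous functions by the definition of
  \<open>measurable_on\<close>; clipping these at the same height keeps them dominated by a constant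
  on a set of finite measure.\<close>

lemma continuous_dense_L2:
  fixes g :: "'a::euclidean_space \<Rightarrow> real"
  assumes g: "g \<in> L2 (lebesgue_on B)" and B: "B \<in> lmeasurable" and "\<delta> > 0"
  shows "\<exists>c. continuous_on UNIV c \<and> L2norm (lebesgue_on B) (\<lambda>x. g x - c x) < \<delta>"
proof -
  let ?M = "lebesgue_on B"
  define cl where "cl K z = max (- K) (min K z)" for K z :: real
  have [measurable]: "g \<in> borel_measurable ?M" and gi: "integrable ?M (\<lambda>x. (g x)\<^sup>2)" using g by (simp_all add: L2_def)
  have clm: "(\<lambda>x. cl K (f x)) \<in> borel_measurable ?M" if "f \<in> borel_measurable ?M" for f K
    unfolding cl_def using that by measurable
  have "(\<lambda>n. L2norm ?M (\<lambda>x. g x - cl (real n) (g x))) \<longlonglongrightarrow> 0"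
  proof (rule L2norm_dominated[OF clm _ gi])
    show "AE x in ?M. (\<lambda>n. cl (real n) (g x)) \<longlonglongrightarrow> g x"
    proof (rule AE_I2)
      fix x
      obtain n0 where "\<bar>g x\<bar> \<le> real n0" using real_arch_simple by blast
      then have "\<forall>n\<ge>n0. cl (real n) (g x) = g x" by (auto simp: cl_def)
      then show "(\<lambda>n. cl (real n) (g x)) \<longlonglongrightarrow> g x" by (intro tendsto_eventually) (auto simp: eventually_sequentially)
    qed
    show "AE x in ?M. (g x - cl (real n) (g x))\<^sup>2 \<le> (g x)\<^sup>2" for n
      by (rule AE_I2) (auto simp: cl_def abs_le_square_iff[symmetric] max_def min_def)
  qed auto
  then have "\<forall>\<^sub>F n in sequentially. L2norm ?M (\<lambda>x. g x - cl (real n) (g x)) < \<delta> / 2"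
    using order_tendstoD(2) assms(3) half_gt_zero by blast
  then obtain n where n: "L2norm ?M (\<lambda>x. g x - cl (real n) (g x)) < \<delta> / 2" by (auto simp: eventually_sequentially)
  define K where "K = real n"
  define gK where "gK x = cl K (g x)" for x
  have gKm: "gK \<in> borel_measurable ?M" unfolding gK_def by (rule clm) measurable
  have "gK measurable_on B" using gKm B by (simp add: measurable_on_iff_borel_measurable fmeasurableD)
  then obtain N h where N: "negligible N" and hc: "\<And>n. continuous_on UNIV (h n)" 
    and hl: "\<And>x. x \<notin> N \<Longrightarrow> (\<lambda>n. h n x) \<longlonglongrightarrow> (if x \<in> B then gK x else 0)"
    unfolding measurable_on_def by blast
  have cc: "continuous_on UNIV (\<lambda>x. cl K (h n x))" for n
    unfolding cl_def by (intro continuous_on_max continuous_on_min continuous_on_const hc)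
  have clb: "\<bar>cl K z\<bar> \<le> K" for z by (auto simp: cl_def K_def)
  have "(\<lambda>n. L2norm ?M (\<lambda>x. gK x - cl K (h n x))) \<longlonglongrightarrow> 0"
  proof (rule L2norm_dominated[OF _ gKm])
    show "(\<lambda>x. cl K (h n x)) \<in> borel_measurable ?M" for n
      using continuous_imp_measurable_on_sets_lebesgue[OF continuous_on_subset[OF cc subset_UNIV]] B by (simp add: fmeasurableD)
    show "integrable ?M (\<lambda>_. (2 * K)\<^sup>2)" by (rule finite_measure.integrable_const[OF finite_measure_lebesgue_on[OF B]])
    have "AE x in lebesgue. x \<notin> N" using N by (intro AE_not_in) (simp add: negligible_iff_null_sets)
    then have "AE x in lebesgue. x \<in> B \<longrightarrow> (\<lambda>n. cl K (h n x)) \<longlonglongrightarrow> gK x"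
    proof eventually_elim
      case (elim x)
      show ?case
      proof
        assume "x \<in> B"
        then have "(\<lambda>n. h n x) \<longlonglongrightarrow> gK x" using hl[OF elim] by simp
        then have "(\<lambda>n. cl K (h n x)) \<longlonglongrightarrow> cl K (gK x)" unfolding cl_def by (intro tendsto_max tendsto_min tendsto_const)
        moreover have "cl K (gK x) = gK x" by (auto simp: gK_def cl_def K_def)
        ultimately show "(\<lambda>n. cl K (h n x)) \<longlonglongrightarrow> gK x" by simp
      qed
    qed
    then show "AE x in ?M. (\<lambda>n. cl K (h n x)) \<longlonglongrightarrow> gK x" using B by (simp add: AE_lebesgue_on_iff fmeasurableD)
    show "AE x in ?M. (gK x - cl K (h n x))\<^sup>2 \<le> (2 * K)\<^sup>2" for n
    proof (rule AE_I2)
      fix x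
      have "\<bar>gK x - cl K (h n x)\<bar> \<le> \<bar>2 * K\<bar>" using clb[of "g x"] clb[of "h n x"] unfolding gK_def by linarith
      then show "(gK x - cl K (h n x))\<^sup>2 \<le> (2 * K)\<^sup>2" by (simp only: abs_le_square_iff)
    qed
  qed
  then have "\<forall>\<^sub>F n in sequentially. L2norm ?M (\<lambda>x. gK x - cl K (h n x)) < \<delta> / 2"
    using order_tendstoD(2) assms(3) half_gt_zero by blast
  then obtain k where k: "L2norm ?M (\<lambda>x. gK x - cl K (h k x)) < \<delta> / 2" by (auto simp: eventually_sequentially)
  have bL: "f \<in> L2 ?M" if "f \<in> borel_measurable ?M" "\<And>x. \<bar>f x\<bar> \<le> K" for f
  proof -
    have "integrable ?M (\<lambda>x. (norm (f x))\<^sup>2)"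
    proof (rule finite_measure.integrable_const_bound[OF finite_measure_lebesgue_on[OF B]])
      have "(f x)\<^sup>2 \<le> K\<^sup>2" for x using that(2)[of x] by (simp add: abs_le_square_iff[symmetric] K_def)
      then show "AE x in ?M. norm ((norm (f x))\<^sup>2) \<le> K\<^sup>2" by simp
      show "(\<lambda>x. (norm (f x))\<^sup>2) \<in> borel_measurable ?M" using that(1) by measurable
    qed
    then show ?thesis using that by (simp add: L2_def)
  qed
  have gKL: "gK \<in> L2 ?M" by (rule bL[OF gKm]) (simp add: gK_def clb)
  have hL: "(\<lambda>x. cl K (h k x)) \<in> L2 ?M"
    using continuous_imp_measurable_on_sets_lebesgue[OF continuous_on_subset[OF cc subset_UNIV]] B clb by (intro bL) (auto simp: fmeasurableD)
  have "L2norm ?M (\<lambda>x. g x - cl K (h k x)) = L2norm ?M (\<lambda>x. (g x - gK x) + (gK x - cl K (h k x)))" by simp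
  also have "\<dots> \<le> L2norm ?M (\<lambda>x. g x - gK x) + L2norm ?M (\<lambda>x. gK x - cl K (h k x))"
    by (intro L2norm_add_le L2_diff g gKL hL)
  also have "\<dots> < \<delta>" using n k unfolding gK_def K_def by simp
  finally show ?thesis using cc by blast
qed

section \<open>Density of smooth fields; Poincare's inequality\<close>

lemma L2norm_cong: "(\<And>x. x \<in> space M \<Longrightarrow> f x = g x) \<Longrightarrow> L2norm M f = L2norm M g"
  unfolding L2norm_def by (intro arg_cong[where f=sqrt] Bochner_Integration.integral_cong) auto

lemma continuous_loc_int: assumes "continuous_on UNIV c" shows "loc_int UNIV c"
  unfolding loc_int_def
proof (intro allI impI)
  fix K :: "(real^2) set" assume K: "compact K \<and> K \<subseteq> UNIV"
  then have "c \<in> L2 (lebesgue_on K)"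
    using compact_sets_lebesgue by (intro continuous_compact_L2[OF continuous_on_subset[OF assms subset_UNIV]]) auto
  then show "integrable (lebesgue_on K) c" using K compact_sets_lebesgue lmeasurable_compact by (intro L2_imp_integrable_compact[of c K K]) auto
qed

lemma L2norm_const_bound:
  fixes f :: "'a::euclidean_space \<Rightarrow> real"
  assumes B: "B \<in> lmeasurable" and f: "f \<in> L2 (lebesgue_on B)" "\<And>x. x \<in> B \<Longrightarrow> \<bar>f x\<bar> \<le> K"
  shows "L2norm (lebesgue_on B) f \<le> \<bar>K\<bar> * sqrt (measure lebesgue B)"
proof -
  let ?M = "lebesgue_on B"
  have "(LINT x|?M. (norm (f x))\<^sup>2) \<le> (LINT x|?M. K\<^sup>2)"
  proof (rule integral_mono)
    show "integrable ?M (\<lambda>x. (norm (f x))\<^sup>2)" using f(1) by (simp add: L2_def)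
    show "integrable ?M (\<lambda>_. K\<^sup>2)" by (rule finite_measure.integrable_const[OF finite_measure_lebesgue_on[OF B]])
    show "(norm (f x))\<^sup>2 \<le> K\<^sup>2" if "x \<in> space ?M" for x
      using f(2)[of x] that by (simp add: abs_le_square_iff[symmetric])
  qed
  also have "\<dots> = K\<^sup>2 * measure lebesgue B" using B by (simp add: measure_restrict_space fmeasurableD)
  finally have "L2norm ?M f \<le> sqrt (K\<^sup>2 * measure lebesgue B)" unfolding L2norm_def by (rule real_sqrt_le_mono)
  then show ?thesis by (simp add: real_sqrt_mult)
qed

text \<open>Split \<open>g\<close> into a continuous \<open>c\<close> and a small rest
  \<open>q\<close>. Mollification keeps \<open>q\<close> small by the contraction estimate, and it
  moves \<open>c\<close> little by uniform continuity on the doubled square.\<close>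

lemma moll_conv:
  assumes L: "0 < L" and g: "loc_int UNIV g" "loc_int UNIV (\<lambda>y. (g y)\<^sup>2)" "g \<in> L2 (lebesgue_on (Cl (2 * L) 0))" "g \<in> L2 (LM L)"
  shows "((\<lambda>e. L2norm (LM L) (\<lambda>x. moll (kernel e) g x - g x)) \<longlongrightarrow> 0) (at_right 0)"
proof (rule tendstoI)
  fix \<delta> :: real assume \<delta>: "\<delta> > 0"
  let ?B = "Cl (2 * L) 0"
  have BM: "?B \<in> lmeasurable" by (rule lmeasurable_compact[OF compact_Cl])
  obtain c where cc: "continuous_on UNIV c" and c: "L2norm (lebesgue_on ?B) (\<lambda>x. g x - c x) < \<delta> / 3"
    using continuous_dense_L2[OF g(3) BM, of "\<delta> / 3"] \<delta> by auto
  define V where "V = sqrt (measure lebesgue (Omega L 0))"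
  \<comment> \<open>A uniform error \<open>\<eta>\<close> costs at most \<open>\<eta> * V\<close> in
    norm; the summand 1 makes the resulting bound strictly smaller than
    \<open>\<delta> / 3\<close>.\<close>
  define \<eta> where "\<eta> = \<delta> / (3 * (1 + V))"
  have V0: "0 \<le> V" by (simp add: V_def)
  have \<eta>: "\<eta> > 0" "\<eta> * V < \<delta> / 3" using \<delta> V0 by (auto simp: \<eta>_def field_simps)
  have "uniformly_continuous_on ?B c" by (rule compact_uniformly_continuous[OF continuous_on_subset[OF cc subset_UNIV] compact_Cl])
  then obtain d where d: "d > 0" "\<And>x y. x \<in> ?B \<Longrightarrow> y \<in> ?B \<Longrightarrow> dist y x < d \<Longrightarrow> dist (c y) (c x) < \<eta>"
    unfolding uniformly_continuous_on_def using \<eta>(1) by meson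
  have cl: "loc_int UNIV c" "loc_int UNIV (\<lambda>y. (c y)\<^sup>2)" by (intro continuous_loc_int continuous_intros cc)+
  have cL: "c \<in> L2 (lebesgue_on ?B)" by (rule continuous_compact_L2[OF continuous_on_subset[OF cc subset_UNIV] compact_Cl]) (use BM in auto)
  have cLM: "c \<in> L2 (LM L)" by (rule continuous_L2_Omega[OF cc])
  define q where "q x = g x - c x" for x
  have ql: "loc_int UNIV q" using g(1) cl(1) unfolding loc_int_def q_def[abs_def] by (blast intro: Bochner_Integration.integrable_diff)
  have q2: "loc_int UNIV (\<lambda>y. (q y)\<^sup>2)"
    unfolding loc_int_def
  proof (intro allI impI)
    fix K :: "(real^2) set" assume K: "compact K \<and> K \<subseteq> UNIV"
    have gm: "g \<in> L2 (lebesgue_on K)" using g(1,2) K by (auto simp: loc_int_def L2_def)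
    have cm: "c \<in> L2 (lebesgue_on K)" using cl K by (auto simp: loc_int_def L2_def)
    show "integrable (lebesgue_on K) (\<lambda>y. (q y)\<^sup>2)" using L2_diff[OF gm cm] by (simp add: L2_def q_def)
  qed
  have qB: "q \<in> L2 (lebesgue_on ?B)" unfolding q_def by (rule L2_diff[OF g(3) cL])
  have sub: "Omega L 0 \<subseteq> ?B"
  proof
    fix x assume "x \<in> Omega L 0"
    then show "x \<in> ?B" using Cl_shift[of L L x x] L by simp
  qed
  show "\<forall>\<^sub>F e in at_right 0. dist (L2norm (LM L) (\<lambda>x. moll (kernel e) g x - g x)) 0 < \<delta>"
    unfolding eventually_at_right_field
  proof (intro exI[of _ "min L (d / 4)"] conjI allI impI)
    show "0 < min L (d / 4)" using L d by simp
    fix e :: real assume e0: "0 < e" and "e < min L (d / 4)"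
    then have e: "e \<le> L" "4 * e < d" by auto
    let ?m = "moll (kernel e)"
    have mL: "?m f \<in> L2 (LM L)" if "loc_int UNIV f" for f
      by (rule continuous_L2_Omega[OF moll_continuous[OF that kernel_continuous[OF e0] kernel_norm[OF e0]]])
    have lin: "?m g x = ?m q x + ?m c x" for x
      using loc_int_kernel[OF ql e0, of x] loc_int_kernel[OF cl(1) e0, of x] unfolding moll_def
      by (subst Bochner_Integration.integral_add[symmetric]) (auto simp: q_def algebra_simps)
    have 1: "L2norm (LM L) (?m q) < \<delta> / 3" 
      using moll_contraction[OF e0 e(1) ql q2 qB] c by (simp add: q_def[abs_def])
    have 2: "L2norm (LM L) (\<lambda>x. ?m c x - c x) < \<delta> / 3"
    proof -
      have "L2norm (LM L) (\<lambda>x. ?m c x - c x) \<le> \<bar>\<eta>\<bar> * V" unfolding V_def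
      proof (rule L2norm_const_bound[OF Omega_lmeasurable L2_diff[OF mL[OF cl(1)] cLM]])
        fix x assume x: "x \<in> Omega L 0"
        note ik = kernel_shift(1,2)[OF e0, of x]
        have "?m c x - c x = (LINT y|lebesgue. c y * kernel e (x - y)) - (LINT y|lebesgue. c x * kernel e (x - y))"
          using ik by (simp add: moll_def)
        also have "\<dots> = (LINT y|lebesgue. c y * kernel e (x - y) - c x * kernel e (x - y))"
          using ik loc_int_kernel[OF cl(1) e0, of x] by simp
        finally have eq: "?m c x - c x = (LINT y|lebesgue. c y * kernel e (x - y) - c x * kernel e (x - y))" .
        have "\<bar>?m c x - c x\<bar> \<le> (LINT y|lebesgue. \<bar>c y * kernel e (x - y) - c x * kernel e (x - y)\<bar>)"
          unfolding eq by (rule integral_abs_bound)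
        also have "\<dots> \<le> (LINT y|lebesgue. \<eta> * kernel e (x - y))"
        proof (rule integral_mono)
          show "integrable lebesgue (\<lambda>y. \<bar>c y * kernel e (x - y) - c x * kernel e (x - y)\<bar>)"
            using ik loc_int_kernel[OF cl(1) e0, of x] by (intro integrable_abs Bochner_Integration.integrable_diff integrable_mult_right)
          show "integrable lebesgue (\<lambda>y. \<eta> * kernel e (x - y))" using ik by simp
          fix y
          show "\<bar>c y * kernel e (x - y) - c x * kernel e (x - y)\<bar> \<le> \<eta> * kernel e (x - y)"
          proof (cases "kernel e (x - y) = 0")
            case False
            then have b: "\<bar>(x - y) $ i\<bar> \<le> e" for i using kernel(3)[OF e0, of "x - y"] by (meson not_less)
            have n: "norm (x - y) \<le> 2 * e" using kernel_norm[OF e0, of "x - y"] False by (meson not_less)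
            have "dist (c y) (c x) < \<eta>"
            proof (rule d(2))
              show "x \<in> ?B" using x sub by blast
              show "y \<in> ?B" by (rule Cl_shift[OF e(1) x b])
              show "dist y x < d" using n e e0 by (simp add: dist_norm norm_minus_commute)
            qed
            then have "\<bar>c y - c x\<bar> * kernel e (x - y) \<le> \<eta> * kernel e (x - y)"
              by (intro mult_right_mono kernel(2)[OF e0]) (simp add: dist_real_def)
            then show ?thesis using kernel(2)[OF e0, of "x - y"] by (simp add: left_diff_distrib[symmetric] abs_mult)
          qed simp
        qed
        also have "\<dots> = \<eta>" using ik by simp
        finally show "\<bar>?m c x - c x\<bar> \<le> \<eta>" .
      qed
      then show ?thesis using \<eta> by simp
    qed
    have 3: "L2norm (LM L) (\<lambda>x. c x - g x) < \<delta> / 3"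
    proof -
      have "(LINT x|LM L. (norm (c x - g x))\<^sup>2) \<le> (LINT x|lebesgue_on ?B. (norm (g x - c x))\<^sup>2)"
        by (rule integral_mono_lebesgue_on_AE) (use qB sub BM in \<open>auto simp: L2_def q_def power2_commute fmeasurableD\<close>)
      then have "L2norm (LM L) (\<lambda>x. c x - g x) \<le> L2norm (lebesgue_on ?B) (\<lambda>x. g x - c x)"
        unfolding L2norm_def by (rule real_sqrt_le_mono)
      then show ?thesis using c by simp
    qed
    have "L2norm (LM L) (\<lambda>x. ?m g x - g x) = L2norm (LM L) (\<lambda>x. ?m q x + ((?m c x - c x) + (c x - g x)))"
      by (rule L2norm_cong) (simp add: lin)
    also have "\<dots> \<le> L2norm (LM L) (?m q) + L2norm (LM L) (\<lambda>x. (?m c x - c x) + (c x - g x))"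
      by (intro L2norm_add_le L2_add L2_diff mL ql cl cLM g)
    also have "L2norm (LM L) (\<lambda>x. (?m c x - c x) + (c x - g x)) \<le> L2norm (LM L) (\<lambda>x. ?m c x - c x) + L2norm (LM L) (\<lambda>x. c x - g x)"
      by (intro L2norm_add_le L2_diff mL cl cLM g)
    finally show "dist (L2norm (LM L) (\<lambda>x. ?m g x - g x)) 0 < \<delta>" using 1 2 3 by simp
  qed
qed

lemma L2norm_le_sum:
  fixes f :: "'a \<Rightarrow> 'b::euclidean_space^'n"
  assumes "f \<in> L2 M" shows "L2norm M f \<le> (\<Sum>j\<in>UNIV. L2norm M (\<lambda>x. f x $ j))"
proof (rule power2_le_imp_le)
  show "(L2norm M f)\<^sup>2 \<le> (\<Sum>j\<in>UNIV. L2norm M (\<lambda>x. f x $ j))\<^sup>2"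
  proof -
    have "(\<Sum>j\<in>UNIV. (L2norm M (\<lambda>x. f x $ j))\<^sup>2) \<le> (\<Sum>j\<in>UNIV. L2norm M (\<lambda>x. f x $ j) * (\<Sum>j\<in>UNIV. L2norm M (\<lambda>x. f x $ j)))"
      unfolding power2_eq_square by (intro sum_mono mult_left_mono member_le_sum) auto
    then show ?thesis unfolding L2norm_component_sum[OF assms] by (simp add: power2_eq_square sum_distrib_right)
  qed
qed (simp add: sum_nonneg)

lemma has_derivative_vecI:
  fixes f :: "'a::real_normed_vector \<Rightarrow> real^'n"
  assumes "\<And>j. ((\<lambda>x. f x $ j) has_derivative (\<lambda>h. f' h $ j)) (at a within S)"
  shows "(f has_derivative f') (at a within S)"
  unfolding has_derivative_componentwise_within[of f]
proof
  fix b :: "real^'n" assume "b \<in> Basis"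
  then obtain j where "b = axis j 1" by (auto simp: Basis_vec_def)
  then show "((\<lambda>x. f x \<bullet> b) has_derivative (\<lambda>h. f' h \<bullet> b)) (at a within S)" using assms[of j] by (simp add: inner_axis)
qed

text \<open>The periodic extension is mollified component by component. This commutes with weak
  derivatives, so the Jacobian is the mollified gradient: it converges too, and a divergence that
  vanishes almost everywhere becomes zero at every point.\<close>

lemma smooth_density:
  assumes L: "0 < L" and v: "v \<in> H1per L 0" and \<delta>: "\<delta> > 0"
  shows "\<exists>w J. (\<forall>x. (w has_derivative (\<lambda>h. J x *v h)) (at x)) \<and> continuous_on UNIV J \<and> periodic_field L w \<and>
    L2norm (LM L) (\<lambda>x. w x - v x) < \<delta> \<and> L2norm (LM L) (\<lambda>x. transpose (J x) - wgrad (Omega L 0) v x) < \<delta> \<and>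
    ((AE x in LM L. wdiv (Omega L 0) v x = 0) \<longrightarrow> (\<forall>x. (\<Sum>i\<in>UNIV. J x $ i $ i) = 0))"
proof -
  let ?S = "Omega L 0"
  note H = H1per_0D[OF L v]
  have vL: "v \<in> L2 (LM L)" and GL: "wgrad ?S v \<in> L2 (LM L)"
    and weak: "\<And>i j. has_weak_pderiv UNIV i (\<lambda>x. v (wrap L x) $ j) (\<lambda>x. wgrad ?S v (wrap L x) $ i $ j)"
    using H(2) by (auto simp: per_weak_def)
  define u where "u j x = v (wrap L x) $ j" for j x
  define G where "G i j x = wgrad ?S v (wrap L x) $ i $ j" for i j x
  have F: "loc_int UNIV (\<lambda>x. F (wrap L x)) \<and> loc_int UNIV (\<lambda>x. (F (wrap L x))\<^sup>2) \<and> (\<lambda>x. F (wrap L x)) \<in> L2 (lebesgue_on (Cl (2 * L) 0)) \<and> (\<lambda>x. F (wrap L x)) \<in> L2 (LM L)"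
    if "F \<in> L2 (LM L)" for F :: "real^2 \<Rightarrow> real"
  proof (intro conjI)
    note W = wrap_comp_L2[OF L that compact_imp_bounded compact_sets_lebesgue]
    show "loc_int UNIV (\<lambda>x. F (wrap L x))" by (rule wrap_comp_loc_int[OF L that])
    show "loc_int UNIV (\<lambda>x. (F (wrap L x))\<^sup>2)" unfolding loc_int_def using W by (auto simp: L2_def)
    show "(\<lambda>x. F (wrap L x)) \<in> L2 (lebesgue_on (Cl (2 * L) 0))" by (rule W[OF compact_Cl compact_Cl])
    show "(\<lambda>x. F (wrap L x)) \<in> L2 (LM L)"
      by (rule L2_lebesgue_cong_AE[OF Omega_sets that]) (auto intro!: AE_I2 simp: wrap_Omega[OF L])
  qed
  have uF: "loc_int UNIV (u j)" "((\<lambda>e. L2norm (LM L) (\<lambda>x. moll (kernel e) (u j) x - u j x)) \<longlongrightarrow> 0) (at_right 0)" for j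
    using F[OF L2_nth[OF vL], of j] moll_conv[OF L, of "u j"] unfolding u_def[abs_def] by blast+
  have GF: "loc_int UNIV (G i j)" "((\<lambda>e. L2norm (LM L) (\<lambda>x. moll (kernel e) (G i j) x - G i j x)) \<longlongrightarrow> 0) (at_right 0)" for i j
    using F[OF L2_nth[OF L2_nth[OF GL, of i], of j]] moll_conv[OF L, of "G i j"] unfolding G_def[abs_def] by blast+
  have "\<forall>\<^sub>F e in at_right 0. L2norm (LM L) (\<lambda>x. moll (kernel e) (u j) x - u j x) < \<delta> / 5" for j
    by (rule order_tendstoD(2)[OF uF(2)]) (use \<delta> in simp)
  then have ev1: "\<forall>\<^sub>F e in at_right 0. \<forall>j. L2norm (LM L) (\<lambda>x. moll (kernel e) (u j) x - u j x) < \<delta> / 5"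
    by (rule eventually_all_finite)
  have "\<forall>\<^sub>F e in at_right 0. L2norm (LM L) (\<lambda>x. moll (kernel e) (G i j) x - G i j x) < \<delta> / 5" for i j
    by (rule order_tendstoD(2)[OF GF(2)]) (use \<delta> in simp)
  then have ev2: "\<forall>\<^sub>F e in at_right 0. \<forall>i j. L2norm (LM L) (\<lambda>x. moll (kernel e) (G i j) x - G i j x) < \<delta> / 5"
    by (intro eventually_all_finite)
  have "\<forall>\<^sub>F e in at_right 0. 0 < (e :: real)" by (rule eventually_at_right_less)
  from eventually_happens'[OF trivial_limit_at_right_real eventually_conj[OF this eventually_conj[OF ev1 ev2]]]
  obtain e where e: "0 < e" and e12: "\<forall>j. L2norm (LM L) (\<lambda>x. moll (kernel e) (u j) x - u j x) < \<delta> / 5"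
    "\<forall>i j. L2norm (LM L) (\<lambda>x. moll (kernel e) (G i j) x - G i j x) < \<delta> / 5" by blast
  note e1 = spec[OF e12(1)] and e2 = spec[OF spec[OF e12(2)]]
  define w where "w x = (\<chi> j. moll (kernel e) (u j) x)" for x
  define J where "J x = (\<chi> j i. moll (kernel e) (G i j) x)" for x
  have mc: "continuous_on UNIV (moll (kernel e) f)" if "loc_int UNIV f" for f
    by (rule moll_continuous[OF that kernel_continuous[OF e] kernel_norm[OF e]])
  have d: "(w has_derivative (\<lambda>h. J x *v h)) (at x)" for x
  proof -
    have "((\<lambda>x. w x $ j) has_derivative (\<lambda>h. (J x *v h) $ j)) (at x)" for j
    proof -
      have "moll (pderiv_at i (kernel e)) (u j) x = moll (kernel e) (G i j) x" for i
        using moll_weak_pderiv[OF weak kernel(1)[OF e], of i j x] unfolding u_def[abs_def] G_def[abs_def] .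
      then have "(\<lambda>h. \<Sum>i\<in>UNIV. h $ i * moll (pderiv_at i (kernel e)) (u j) x) = (\<lambda>h. (J x *v h) $ j)"
        by (simp add: J_def matrix_vector_mult_def mult.commute)
      then show ?thesis using moll_has_derivative[OF uF(1) kernel(1)[OF e], of j x] by (simp add: w_def)
    qed
    then show ?thesis by (rule has_derivative_vecI)
  qed
  have Jc: "continuous_on UNIV J" unfolding J_def by (intro continuous_on_vec_lambda mc GF(1))
  have wc: "continuous_on UNIV w" unfolding w_def by (intro continuous_on_vec_lambda mc uF(1))
  have per: "periodic_field L w"
    unfolding periodic_field_def
  proof (intro allI)
    fix x :: "real^2" and i
    have s: "x + (2 * L) *\<^sub>R axis i 1 = lat L (axis i 1) + x" by (simp add: vec_eq_iff lat_nth axis_def)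
    have "moll (kernel e) (u j) (lat L (axis i 1) + x) = moll (kernel e) (u j) x" for j
    proof (rule moll_periodic)
      show "u j (lat L (axis i 1) + x) = u j x" for x
        unfolding u_def using wrap_periodic[OF L, of x "axis i 1"] by (simp add: add.commute)
      show "(\<lambda>y. u j y * kernel e (x - y)) \<in> borel_measurable lebesgue" for x
        using loc_int_kernel[OF uF(1) e, of j x] by blast
    qed
    then show "w (x + (2 * L) *\<^sub>R axis i 1) = w x" unfolding s w_def by simp
  qed
  have JTc: "continuous_on UNIV (\<lambda>x. transpose (J x))"
    unfolding transpose_def by (intro continuous_on_vec_lambda continuous_on_nth Jc)
  have dw: "(\<lambda>x. w x - v x) \<in> L2 (LM L)" and dJ: "(\<lambda>x. transpose (J x) - wgrad ?S v x) \<in> L2 (LM L)"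
    by (intro L2_diff continuous_L2_Omega wc JTc vL GL)+
  have "L2norm (LM L) (\<lambda>x. w x - v x) \<le> (\<Sum>j\<in>UNIV. L2norm (LM L) (\<lambda>x. (w x - v x) $ j))" by (rule L2norm_le_sum[OF dw])
  also have "\<dots> \<le> (\<Sum>j\<in>(UNIV :: 2 set). \<delta> / 5)"
  proof (rule sum_mono)
    fix j
    have "L2norm (LM L) (\<lambda>x. (w x - v x) $ j) = L2norm (LM L) (\<lambda>x. moll (kernel e) (u j) x - u j x)"
      by (rule L2norm_cong) (simp add: w_def u_def wrap_Omega[OF L])
    then show "L2norm (LM L) (\<lambda>x. (w x - v x) $ j) \<le> \<delta> / 5" using e1[of j] by simp
  qed
  also have "\<dots> < \<delta>" using \<delta> by simp
  finally have n1: "L2norm (LM L) (\<lambda>x. w x - v x) < \<delta>" .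
  have "L2norm (LM L) (\<lambda>x. transpose (J x) - wgrad ?S v x) \<le> (\<Sum>i\<in>UNIV. L2norm (LM L) (\<lambda>x. (transpose (J x) - wgrad ?S v x) $ i))"
    by (rule L2norm_le_sum[OF dJ])
  also have "\<dots> \<le> (\<Sum>i\<in>UNIV. \<Sum>j\<in>UNIV. L2norm (LM L) (\<lambda>x. (transpose (J x) - wgrad ?S v x) $ i $ j))"
    by (intro sum_mono L2norm_le_sum L2_nth[OF dJ])
  \<comment> \<open>Four matrix entries of size \<open>\<delta> / 5\<close> add up to strictly less
    than \<open>\<delta>\<close>.\<close>
  also have "\<dots> \<le> (\<Sum>i\<in>(UNIV :: 2 set). \<Sum>j\<in>(UNIV :: 2 set). \<delta> / 5)"
  proof (intro sum_mono)
    fix i j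
    have "L2norm (LM L) (\<lambda>x. (transpose (J x) - wgrad ?S v x) $ i $ j) = L2norm (LM L) (\<lambda>x. moll (kernel e) (G i j) x - G i j x)"
      by (rule L2norm_cong) (simp add: J_def G_def transpose_def wrap_Omega[OF L])
    then show "L2norm (LM L) (\<lambda>x. (transpose (J x) - wgrad ?S v x) $ i $ j) \<le> \<delta> / 5" using e2[of i j] by simp
  qed
  also have "\<dots> < \<delta>" using \<delta> by simp
  finally have n2: "L2norm (LM L) (\<lambda>x. transpose (J x) - wgrad ?S v x) < \<delta>" .
  have "(\<Sum>i\<in>UNIV. J x $ i $ i) = 0" if div: "AE x in LM L. wdiv ?S v x = 0" for x
  proof -
    have i: "integrable lebesgue (\<lambda>y. G i i y * kernel e (x - y))" for i by (rule loc_int_kernel[OF GF(1) e])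
    have "(\<Sum>i\<in>UNIV. J x $ i $ i) = (\<Sum>i\<in>UNIV. LINT y|lebesgue. G i i y * kernel e (x - y))" by (simp add: J_def moll_def)
    also have "\<dots> = (LINT y|lebesgue. (\<Sum>i\<in>UNIV. G i i y * kernel e (x - y)))"
      by (rule Bochner_Integration.integral_sum[symmetric]) (rule i)
    also have "\<dots> = 0"
    proof (rule integral_eq_zero_AE)
      show "AE y in lebesgue. (\<Sum>i\<in>UNIV. G i i y * kernel e (x - y)) = 0"
        using AE_wrap[OF L div] by eventually_elim (simp add: G_def wdiv_eq sum_distrib_right[symmetric])
    qed
    finally show ?thesis .
  qed
  then show ?thesis using d Jc per n1 n2 by blast
qed

section \<open>Poincare's inequality for C^1 functions on the square\<close>

lemma integral_Omega_continuous:
  fixes f :: "real^2 \<Rightarrow> real"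
  assumes "continuous_on UNIV f"
  shows "integrable (LM L) f" "integrable lborel (\<lambda>x. indicator (Cl L 0) x *\<^sub>R f x)"
    "(LINT x|LM L. f x) = (LINT x|lborel. indicator (Cl L 0) x *\<^sub>R f x)"
proof -
  show i: "integrable (LM L) f"
    using L2_imp_integrable_compact[OF continuous_L2_Omega[OF assms] Omega_sets Omega_lmeasurable] by blast
  show il: "integrable lborel (\<lambda>x. indicator (Cl L 0) x *\<^sub>R f x)"
    by (rule borel_integrable_compact[OF compact_Cl continuous_on_subset[OF assms subset_UNIV]])
  have "(LINT x|LM L. f x) = (LINT x|lebesgue. indicator (Omega L 0) x *\<^sub>R f x)" by (subst integral_restrict_space) auto
  also have "\<dots> = (LINT x|lebesgue. indicator (Cl L 0) x *\<^sub>R f x)"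
  proof (rule integral_cong_AE)
    show "AE x in lebesgue. indicator (Omega L 0) x *\<^sub>R f x = indicator (Cl L 0) x *\<^sub>R f x"
      using AE_Omega_Cl[of L 0] by eventually_elim (use Omega_subset_Cl[of L 0] in \<open>auto simp: indicator_def\<close>)
    show "(\<lambda>x. indicator (Omega L 0) x *\<^sub>R f x) \<in> borel_measurable lebesgue"
      using i by (subst (asm) integrable_restrict_space) auto
    show "(\<lambda>x. indicator (Cl L 0) x *\<^sub>R f x) \<in> borel_measurable lebesgue"
      using borel_measurable_integrable[OF il] by (intro measurable_completion) simp
  qed
  also have "\<dots> = (LINT x|lborel. indicator (Cl L 0) x *\<^sub>R f x)" using il by (intro integral_completion) simp
  finally show "(LINT x|LM L. f x) = (LINT x|lborel. indicator (Cl L 0) x *\<^sub>R f x)" .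
qed

lemma measure_Omega: "0 < L \<Longrightarrow> measure lebesgue (Omega L 0) = (2 * L)\<^sup>2"
proof -
  assume L: "0 < L"
  have "Omega L 0 = box (vec (- L)) (vec L)" by (simp add: Omega_def)
  moreover have "emeasure lborel (box (vec (- L)) (vec L :: real^2)) = ennreal (\<Prod>b\<in>Basis. (vec L - vec (- L) :: real^2) \<bullet> b)"
    using L by (subst emeasure_lborel_box_eq) (auto simp: Basis_vec_def inner_axis)
  moreover have "(\<Prod>b\<in>Basis. (vec L - vec (- L) :: real^2) \<bullet> b) = (2 * L)\<^sup>2"
    unfolding prod_Basis_real2 by (simp add: inner_axis power2_eq_square)
  ultimately show ?thesis by (simp add: measure_def)
qed

text \<open>Cauchy-Schwarz on an interval, obtained by expanding the squared deviation of
  \<open>D\<close> from its mean \<open>m\<close>.\<close>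

lemma segment_square:
  fixes D :: "real \<Rightarrow> real"
  assumes c: "continuous_on {b..a} D" and "b \<le> a"
  shows "(integral {b..a} D)\<^sup>2 \<le> (a - b) * integral {b..a} (\<lambda>s. (D s)\<^sup>2)"
proof (cases "a = b")
  case False
  then have l: "a - b > 0" using assms(2) by simp
  define X where "X = integral {b..a} D"
  define m where "m = X / (a - b)"
  note ci = integrable_continuous_interval
  have "0 \<le> integral {b..a} (\<lambda>s. (D s - m)\<^sup>2)" by (intro integral_nonneg ci continuous_intros c) simp
  also have "(\<lambda>s. (D s - m)\<^sup>2) = (\<lambda>s. ((D s)\<^sup>2 - 2 * m * D s) + m\<^sup>2)" by (rule ext) (simp add: power2_diff)
  also have "integral {b..a} \<dots> = integral {b..a} (\<lambda>s. (D s)\<^sup>2) - 2 * m * X + m\<^sup>2 * (a - b)"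
  proof -
    have "integral {b..a} (\<lambda>s. ((D s)\<^sup>2 - 2 * m * D s) + m\<^sup>2) = integral {b..a} (\<lambda>s. (D s)\<^sup>2 - 2 * m * D s) + integral {b..a} (\<lambda>s. m\<^sup>2)"
      by (intro Henstock_Kurzweil_Integration.integral_add ci continuous_intros c)
    also have "integral {b..a} (\<lambda>s. (D s)\<^sup>2 - 2 * m * D s) = integral {b..a} (\<lambda>s. (D s)\<^sup>2) - integral {b..a} (\<lambda>s. 2 * m * D s)"
      by (intro Henstock_Kurzweil_Integration.integral_diff ci continuous_intros c)
    finally show ?thesis using assms(2) by (simp add: X_def)
  qed
  finally have "0 \<le> integral {b..a} (\<lambda>s. (D s)\<^sup>2) - X\<^sup>2 / (a - b)"
    using l by (simp add: m_def power2_eq_square)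
  then have "X\<^sup>2 / (a - b) \<le> integral {b..a} (\<lambda>s. (D s)\<^sup>2)" by simp
  then show ?thesis using l by (simp add: X_def pos_divide_le_eq mult.commute)
qed simp

text \<open>When \<open>D\<close> is the partial derivative in direction \<open>i\<close>, this is
  the one-dimensional Dirichlet energy along the line at height \<open>t\<close>.\<close>

definition line_energy :: "real \<Rightarrow> (real^2 \<Rightarrow> real) \<Rightarrow> 2 \<Rightarrow> real \<Rightarrow> real" where
  "line_energy L D i t = integral {- L..L} (\<lambda>s. (D (pt i s t))\<^sup>2)"

lemma line_energy_continuous:
  assumes "continuous_on UNIV D" shows "continuous_on UNIV (line_energy L D i)"
proof -
  have "continuous_on (UNIV \<times> cbox (- L) L) (\<lambda>(t, s). (D (pt i s t))\<^sup>2)"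
    unfolding case_prod_beta by (intro continuous_on_power continuous_on_compose2[OF assms] continuous_intros) auto
  from integral_continuous_on_param[OF this] show ?thesis by (simp add: line_energy_def[abs_def])
qed

text \<open>The integrand is constant in the \<open>i\<close>-th coordinate, and integrating that
  coordinate out gives the factor \<open>2 * L\<close>.\<close>

lemma line_energy_integral:
  assumes L: "0 < L" and D: "continuous_on UNIV D" and "j \<noteq> i"
  shows "(LINT x|LM L. line_energy L D i (x $ j)) = 2 * L * (L2norm (LM L) D)\<^sup>2"
proof -
  have Sc: "continuous_on UNIV (\<lambda>x :: real^2. line_energy L D i (x $ j))"
    by (rule continuous_on_compose2[OF line_energy_continuous[OF D]]) (auto intro!: continuous_intros)
  have Dc: "continuous_on UNIV (\<lambda>x. (D x)\<^sup>2)" by (intro continuous_intros D)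
  have Cl_line: "indicator (Cl L 0) (pt i s t) = (indicator {-L..L} s * indicator {-L..L} t :: real)" for s t
  proof -
    obtain j where j: "j \<noteq> i" "UNIV = {i, j}" "\<forall>k. k = i \<or> k = j" by (rule two_cases[of i])
    have "pt i s t \<in> Cl L 0 \<longleftrightarrow> \<bar>s\<bar> \<le> L \<and> \<bar>t\<bar> \<le> L"
    proof
      assume "pt i s t \<in> Cl L 0"
      then have *: "\<forall>k. \<bar>pt i s t $ k\<bar> \<le> L" by (simp add: mem_Cl)
      show "\<bar>s\<bar> \<le> L \<and> \<bar>t\<bar> \<le> L" using spec[OF *, of i] spec[OF *, of j] j(1) by (simp add: pt_nth)
    qed (simp add: pt_nth mem_Cl)
    then show ?thesis by (auto simp: indicator_def)
  qed
  have e: "(LINT s|lborel. indicator {-L..L} s *\<^sub>R (D (pt i s t))\<^sup>2) = line_energy L D i t" for t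
  proof -
    have "continuous_on {-L..L} (\<lambda>s. (D (pt i s t))\<^sup>2)"
      by (intro continuous_on_power continuous_on_compose2[OF D] continuous_intros) auto
    from set_borel_integral_eq_integral(2)[OF borel_integrable_atLeastAtMost'[OF this]]
    show ?thesis by (simp add: set_lebesgue_integral_def line_energy_def)
  qed
  have "(LINT x|LM L. line_energy L D i (x $ j)) = (LINT t|lborel. LINT s|lborel. indicator (Cl L 0) (pt i s t) *\<^sub>R line_energy L D i (pt i s t $ j))"
    unfolding integral_Omega_continuous(3)[OF Sc] by (rule fubini_pt(3)[OF integral_Omega_continuous(2)[OF Sc], symmetric])
  also have "\<dots> = (LINT t|lborel. indicator {-L..L} t * (2 * L * line_energy L D i t))"
  proof (rule Bochner_Integration.integral_cong[OF refl])
    fix t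
    have "(LINT s|lborel. indicator (Cl L 0) (pt i s t) *\<^sub>R line_energy L D i (pt i s t $ j)) = (LINT s|lborel. indicator {-L..L} s *\<^sub>R (indicator {-L..L} t * line_energy L D i t))"
      using assms(3) by (intro Bochner_Integration.integral_cong refl) (simp add: Cl_line pt_nth)
    also have "\<dots> = 2 * L * (indicator {-L..L} t * line_energy L D i t)" using L by simp
    finally show "(LINT s|lborel. indicator (Cl L 0) (pt i s t) *\<^sub>R line_energy L D i (pt i s t $ j)) = indicator {-L..L} t * (2 * L * line_energy L D i t)" by simp
  qed
  also have "\<dots> = (LINT t|lborel. 2 * L * (indicator {-L..L} t * line_energy L D i t))"
    by (intro Bochner_Integration.integral_cong refl) simp
  also have "\<dots> = 2 * L * (LINT t|lborel. indicator {-L..L} t * line_energy L D i t)" by simp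
  also have "(LINT t|lborel. indicator {-L..L} t * line_energy L D i t) = (LINT t|lborel. LINT s|lborel. indicator (Cl L 0) (pt i s t) *\<^sub>R (D (pt i s t))\<^sup>2)"
  proof (rule Bochner_Integration.integral_cong[OF refl])
    fix t
    have "(LINT s|lborel. indicator (Cl L 0) (pt i s t) *\<^sub>R (D (pt i s t))\<^sup>2) = (LINT s|lborel. indicator {-L..L} t * (indicator {-L..L} s *\<^sub>R (D (pt i s t))\<^sup>2))"
      by (intro Bochner_Integration.integral_cong refl) (simp add: Cl_line mult_ac)
    also have "\<dots> = indicator {-L..L} t * line_energy L D i t" unfolding e[symmetric] by simp
    finally show "indicator {-L..L} t * line_energy L D i t = (LINT s|lborel. indicator (Cl L 0) (pt i s t) *\<^sub>R (D (pt i s t))\<^sup>2)" by simp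
  qed
  also have "\<dots> = (LINT x|LM L. (D x)\<^sup>2)"
    unfolding integral_Omega_continuous(3)[OF Dc] by (rule fubini_pt(3)[OF integral_Omega_continuous(2)[OF Dc]])
  finally show ?thesis by (simp add: L2norm_power2)
qed

text \<open>The segment between the two points has length at most \<open>2 * L\<close>, and its
  energy is at most that of the whole line.\<close>

lemma line_difference:
  assumes p: "\<And>x. (p has_derivative (\<lambda>h. \<Sum>k\<in>UNIV. D k x * h $ k)) (at x)" and D: "\<And>k. continuous_on UNIV (D k)"
    and ab: "\<bar>a\<bar> \<le> L" "\<bar>b\<bar> \<le> L"
  shows "(p (pt i a t) - p (pt i b t))\<^sup>2 \<le> 2 * L * line_energy L (D i) i t"
proof -
  have Dc: "continuous_on S (\<lambda>s. D i (pt i s t))" for S by (rule continuous_on_compose2[OF D]) (auto intro!: continuous_intros)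
  have vd: "((\<lambda>s. p (pt i s t)) has_vector_derivative D i (pt i s t)) (at s within S)" for s S
  proof -
    have ax: "(\<Sum>l\<in>UNIV. c l * (h *\<^sub>R axis i 1 :: real^2) $ l) = h * c i" for c :: "2 \<Rightarrow> real" and h
    proof -
      have "(\<Sum>l\<in>UNIV. c l * (h *\<^sub>R axis i 1 :: real^2) $ l) = (\<Sum>l\<in>UNIV. if l = i then h * c i else 0)"
        by (rule sum.cong) (auto simp: axis_def)
      then show ?thesis by simp
    qed
    have "((\<lambda>s. p (pt i s t)) has_derivative (\<lambda>h. \<Sum>k\<in>UNIV. D k (pt i s t) * (h *\<^sub>R axis i 1) $ k)) (at s within S)"
      by (rule has_derivative_compose[OF has_derivative_pt p])
    from this[unfolded ax] show ?thesis unfolding has_vector_derivative_def by simp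
  qed
  have *: "(p (pt i a t) - p (pt i b t))\<^sup>2 \<le> 2 * L * line_energy L (D i) i t" if "b \<le> a" "\<bar>a\<bar> \<le> L" "\<bar>b\<bar> \<le> L" for a b
  proof -
    have "integral {b..a} (\<lambda>s. D i (pt i s t)) = p (pt i a t) - p (pt i b t)"
      by (rule integral_unique[OF fundamental_theorem_of_calculus[OF that(1) vd]])
    then have "(p (pt i a t) - p (pt i b t))\<^sup>2 \<le> (a - b) * integral {b..a} (\<lambda>s. (D i (pt i s t))\<^sup>2)"
      using segment_square[OF Dc that(1)] by simp
    also have "\<dots> \<le> 2 * L * line_energy L (D i) i t" unfolding line_energy_def
    proof (rule mult_mono)
      show "integral {b..a} (\<lambda>s. (D i (pt i s t))\<^sup>2) \<le> integral {-L..L} (\<lambda>s. (D i (pt i s t))\<^sup>2)"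
        using that by (intro integral_subset_le integrable_continuous_interval continuous_intros Dc) auto
      show "0 \<le> integral {b..a} (\<lambda>s. (D i (pt i s t))\<^sup>2)"
        by (intro integral_nonneg integrable_continuous_interval continuous_intros Dc) auto
    qed (use that in auto)
    finally show ?thesis .
  qed
  show ?thesis
  proof (cases "b \<le> a")
    case True then show ?thesis using * ab by blast
  next
    case False
    then have "(p (pt i b t) - p (pt i a t))\<^sup>2 \<le> 2 * L * line_energy L (D i) i t" using * ab by simp
    then show ?thesis by (simp add: power2_commute)
  qed
qed

text \<open>Join \<open>x\<close> to \<open>y\<close> by a segment in direction 1 followed by one in
  direction 2. The first leg is controlled by a line energy that depends only on the second
  coordinate of \<open>x\<close>, the other by one that depends only on the first coordinate of
  \<open>y\<close>. Integrating over both points therefore leaves only norms of the two partial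
  derivatives.\<close>

lemma Poincare_C1:
  assumes L: "0 < L" and p: "\<And>x. (p has_derivative (\<lambda>h. \<Sum>k\<in>UNIV. D k x * h $ k)) (at x)" and D: "\<And>k. continuous_on UNIV (D k)"
    and mean: "(LINT x|LM L. p x) = 0"
  shows "(L2norm (LM L) p)\<^sup>2 \<le> 8 * L\<^sup>2 * ((L2norm (LM L) (D 1))\<^sup>2 + (L2norm (LM L) (D 2))\<^sup>2)"
proof -
  have pc: "continuous_on UNIV p" by (rule continuous_at_imp_continuous_on) (use has_derivative_continuous[OF p] in blast)
  let ?A = "\<lambda>x :: real^2. line_energy L (D 1) 1 (x $ 2)" and ?B = "\<lambda>x :: real^2. line_energy L (D 2) 2 (x $ 1)"
  define V where "V = (2 * L)\<^sup>2"
  have V: "V > 0" using L by (simp add: V_def)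
  have Ac: "continuous_on UNIV ?A" and Bc: "continuous_on UNIV ?B"
    by (rule continuous_on_compose2[OF line_energy_continuous[OF D]]; auto intro!: continuous_intros)+
  have p2c: "continuous_on UNIV (\<lambda>x. (p x)\<^sup>2)" by (intro continuous_intros pc)
  note I = integral_Omega_continuous(1)
  have cst: "(LINT y|LM L. c) = V * c" "integrable (LM L) (\<lambda>_. c)" for c :: real
    using measure_Omega[OF L] by (simp_all add: V_def measure_restrict_space I[OF continuous_on_const])
  have pw: "(p x - p y)\<^sup>2 \<le> 4 * L * (?A x + ?B y)" if x: "x \<in> Omega L 0" and y: "y \<in> Omega L 0" for x y
  proof -
    have b: "\<bar>x $ i\<bar> \<le> L" "\<bar>y $ i\<bar> \<le> L" for i using x y by (auto simp: mem_Omega less_imp_le)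
    have ex: "x = pt 1 (x $ 1) (x $ 2)" by (rule pt_exists) simp
    have ey: "y = pt 2 (y $ 2) (y $ 1)" by (rule pt_exists) simp
    have mid: "pt 1 (y $ 1) (x $ 2) = pt 2 (x $ 2) (y $ 1)" by (simp add: vec_eq_iff pt_nth forall_2)
    have 1: "(p x - p (pt 1 (y $ 1) (x $ 2)))\<^sup>2 \<le> 2 * L * ?A x"
      using line_difference[OF p D b(1)[of 1] b(2)[of 1], of 1 "x $ 2"] unfolding ex[symmetric] .
    have 2: "(p (pt 2 (x $ 2) (y $ 1)) - p y)\<^sup>2 \<le> 2 * L * ?B y"
      using line_difference[OF p D b(1)[of 2] b(2)[of 2], of 2 "y $ 1"] unfolding ey[symmetric] .
    let ?a = "p x - p (pt 1 (y $ 1) (x $ 2))" and ?b = "p (pt 2 (x $ 2) (y $ 1)) - p y"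
    have "p x - p y = ?a + ?b" using mid by simp
    then have "(p x - p y)\<^sup>2 \<le> 2 * ?a\<^sup>2 + 2 * ?b\<^sup>2" using sum_squares_bound[of ?a ?b] by (simp only: power2_sum)
    then show ?thesis using 1 2 by (simp add: algebra_simps)
  qed
  have x1: "V * (p x)\<^sup>2 \<le> 4 * L * (V * ?A x + (LINT y|LM L. ?B y))" if x: "x \<in> Omega L 0" for x
  proof -
    \<comment> \<open>Integration in \<open>y\<close>: the mixed term vanishes by mean zero, and the
      nonnegative integral of the square of \<open>p y\<close> is dropped.\<close>
    have "(LINT y|LM L. (p x - p y)\<^sup>2) = (LINT y|LM L. (p x)\<^sup>2 - 2 * p x * p y + (p y)\<^sup>2)"
      by (intro Bochner_Integration.integral_cong refl) (simp add: power2_diff)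
    also have "\<dots> = V * (p x)\<^sup>2 - 2 * p x * (LINT y|LM L. p y) + (LINT y|LM L. (p y)\<^sup>2)"
      using I[OF pc] I[OF p2c] cst by simp
    finally have "V * (p x)\<^sup>2 \<le> (LINT y|LM L. (p x - p y)\<^sup>2)" using mean by simp
    also have "\<dots> \<le> (LINT y|LM L. 4 * L * (?A x + ?B y))"
      by (rule integral_mono) (use pw[OF x] in \<open>auto intro!: I continuous_intros pc Bc\<close>)
    also have "\<dots> = 4 * L * (V * ?A x + (LINT y|LM L. ?B y))" using I[OF Bc] cst by simp
    finally show ?thesis .
  qed
  have "V * (LINT x|LM L. (p x)\<^sup>2) = (LINT x|LM L. V * (p x)\<^sup>2)" by simp
  also have "\<dots> \<le> (LINT x|LM L. 4 * L * (V * ?A x + (LINT y|LM L. ?B y)))"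
    by (rule integral_mono) (use x1 in \<open>auto intro!: I continuous_intros pc Ac\<close>)
  also have "\<dots> = 4 * L * (V * (LINT x|LM L. ?A x) + V * (LINT y|LM L. ?B y))"
    using I[OF Ac] cst by simp
  also have "\<dots> = V * (4 * L * ((LINT x|LM L. ?A x) + (LINT y|LM L. ?B y)))" by (simp add: algebra_simps)
  finally have "(LINT x|LM L. (p x)\<^sup>2) \<le> 4 * L * ((LINT x|LM L. ?A x) + (LINT y|LM L. ?B y))" using V by simp
  also have "\<dots> = 8 * L\<^sup>2 * ((L2norm (LM L) (D 1))\<^sup>2 + (L2norm (LM L) (D 2))\<^sup>2)"
    using line_energy_integral[OF L D, of 2 1 1] line_energy_integral[OF L D, of 1 2 2] by (simp add: power2_eq_square algebra_simps)
  finally show ?thesis by (simp add: L2norm_power2)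
qed

section \<open>Energy minimisation on the torus\<close>

lemma L2norm_const: "0 < L \<Longrightarrow> L2norm (LM L) (\<lambda>_. c :: 'b::euclidean_space) = norm c * (2 * L)"
  by (simp add: L2norm_def measure_restrict_space measure_Omega real_sqrt_mult)

lemma L2_const: "(\<lambda>_. c :: 'b::euclidean_space) \<in> L2 (LM L)"
  by (rule continuous_L2_Omega) simp

lemma L2_integrable: "f \<in> L2 (LM L) \<Longrightarrow> integrable (LM L) (f :: real^2 \<Rightarrow> 'b::euclidean_space)"
  using L2_imp_integrable_compact[OF _ Omega_sets Omega_lmeasurable] by blast

lemma integral_L2_bound:
  fixes f :: "real^2 \<Rightarrow> real"
  assumes "0 < L" "f \<in> L2 (LM L)" shows "\<bar>LINT x|LM L. f x\<bar> \<le> 2 * L * L2norm (LM L) f"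
  using L2_inner_bound[OF L2_const[of 1 L] assms(2)] L2norm_const[OF assms(1), of "1 :: real"] by simp

lemma integral_nth:
  fixes f :: "'a \<Rightarrow> real^'n"
  assumes "integrable M f" shows "(LINT x|M. f x $ j) = (LINT x|M. f x) $ j"
  by (rule integral_bounded_linear[OF bounded_linear_vec_nth assms])

text \<open>By density it is enough to treat C^1 fields, whose mean is small but has to be removed.
  Each component costs \<open>sqrt 8 * L \<le> 3 * L\<close>, and adding the norms of the two
  components gives \<open>6 * L\<close>.\<close>

lemma Poincare_H1per:
  assumes L: "0 < L" and v: "v \<in> H1per L 0" and mean: "(LINT x|LM L. v x) = 0"
  shows "L2norm (LM L) v \<le> 6 * L * L2norm (LM L) (wgrad (Omega L 0) v)"
proof (rule field_le_epsilon)
  fix \<epsilon> :: real assume \<epsilon>: "\<epsilon> > 0"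
  let ?G = "wgrad (Omega L 0) v"
  \<comment> \<open>The accumulated error is
    \<open>2 * (2 * \<delta> + 3 * L * \<delta>)\<close>.\<close>
  define \<delta> where "\<delta> = \<epsilon> / (4 + 6 * L)"
  have \<delta>: "\<delta> > 0" using \<epsilon> L by (simp add: \<delta>_def)
  obtain w J where d0: "\<forall>x. (w has_derivative (\<lambda>h. J x *v h)) (at x)" and Jc: "continuous_on UNIV J"
    and n1: "L2norm (LM L) (\<lambda>x. w x - v x) < \<delta>" and n2: "L2norm (LM L) (\<lambda>x. transpose (J x) - ?G x) < \<delta>"
    using smooth_density[OF L v \<delta>] by blast
  have d: "(w has_derivative (\<lambda>h. J x *v h)) (at x)" for x using d0 by blast
  note H = H1per_0D[OF L v]
  have vL: "v \<in> L2 (LM L)" and GL: "?G \<in> L2 (LM L)" using H(2) by (auto simp: per_weak_def)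
  have wc: "continuous_on UNIV w" by (rule continuous_at_imp_continuous_on) (use has_derivative_continuous[OF d] in blast)
  have JTc: "continuous_on UNIV (\<lambda>x. transpose (J x))"
    unfolding transpose_def by (intro continuous_on_vec_lambda continuous_on_nth Jc)
  have wL: "w \<in> L2 (LM L)" and JL: "(\<lambda>x. transpose (J x)) \<in> L2 (LM L)" by (intro continuous_L2_Omega wc JTc)+
  have dwv: "(\<lambda>x. w x - v x) \<in> L2 (LM L)" by (rule L2_diff[OF wL vL])
  have JG: "L2norm (LM L) (\<lambda>x. transpose (J x)) \<le> L2norm (LM L) ?G + \<delta>"
    using L2norm_triangle_sub[OF JL GL] n2 by simp
  have "L2norm (LM L) (\<lambda>x. v x $ j) \<le> 2 * \<delta> + 3 * L * (L2norm (LM L) ?G + \<delta>)" for j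
  proof -
    define m where "m = (LINT x|LM L. w x $ j) / (2 * L)\<^sup>2"
    define p where "p x = w x $ j - m" for x
    have wjL: "(\<lambda>x. w x $ j) \<in> L2 (LM L)" and vjL: "(\<lambda>x. v x $ j) \<in> L2 (LM L)" by (intro L2_nth wL vL)+
    have pL: "p \<in> L2 (LM L)" unfolding p_def by (intro L2_diff wjL L2_const)
    have "(LINT x|LM L. p x) = 0"
      unfolding p_def using L2_integrable[OF wjL] L2_integrable[OF L2_const[of m L]] L
      by (simp add: m_def measure_restrict_space measure_Omega[OF L])
    moreover have "(p has_derivative (\<lambda>h. \<Sum>k\<in>UNIV. J x $ j $ k * h $ k)) (at x)" for x
      unfolding p_def using has_derivative_diff[OF has_derivative_component[OF d] has_derivative_const] by simp
    moreover have "continuous_on UNIV (\<lambda>x. J x $ j $ k)" for k by (intro continuous_on_nth Jc)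
    ultimately have P: "(L2norm (LM L) p)\<^sup>2 \<le> 8 * L\<^sup>2 * ((L2norm (LM L) (\<lambda>x. J x $ j $ 1))\<^sup>2 + (L2norm (LM L) (\<lambda>x. J x $ j $ 2))\<^sup>2)"
      using Poincare_C1[OF L, of p "\<lambda>k x. J x $ j $ k"] by blast
    have "(L2norm (LM L) (\<lambda>x. J x $ j $ 1))\<^sup>2 + (L2norm (LM L) (\<lambda>x. J x $ j $ 2))\<^sup>2 \<le> (L2norm (LM L) (\<lambda>x. transpose (J x)))\<^sup>2"
    proof -
      have "(L2norm (LM L) (\<lambda>x. J x $ j $ i))\<^sup>2 \<le> (L2norm (LM L) (\<lambda>x. transpose (J x) $ i))\<^sup>2" for i
        using L2norm_component_le[OF L2_nth[OF JL, of i], of j] by (intro power_mono) (simp_all add: transpose_def)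
      from add_mono[OF this[of 1] this[of 2]] show ?thesis unfolding L2norm_component_sum[OF JL] by (simp add: UNIV_2)
    qed
    then have "8 * L\<^sup>2 * ((L2norm (LM L) (\<lambda>x. J x $ j $ 1))\<^sup>2 + (L2norm (LM L) (\<lambda>x. J x $ j $ 2))\<^sup>2) \<le> (3 * L)\<^sup>2 * (L2norm (LM L) (\<lambda>x. transpose (J x)))\<^sup>2"
      by (intro mult_mono) (auto simp: power_mult_distrib)
    with P have "(L2norm (LM L) p)\<^sup>2 \<le> (3 * L * L2norm (LM L) (\<lambda>x. transpose (J x)))\<^sup>2" by (simp add: power_mult_distrib)
    then have "L2norm (LM L) p \<le> 3 * L * L2norm (LM L) (\<lambda>x. transpose (J x))" by (rule power2_le_imp_le) (use L in simp)
    also have "\<dots> \<le> 3 * L * (L2norm (LM L) ?G + \<delta>)" using JG L by (intro mult_left_mono) auto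
    finally have P': "L2norm (LM L) p \<le> 3 * L * (L2norm (LM L) ?G + \<delta>)" .
    have dj: "L2norm (LM L) (\<lambda>x. w x $ j - v x $ j) \<le> \<delta>" 
      using L2norm_component_le[OF dwv, of j] n1 by simp
    \<comment> \<open>Since \<open>v\<close> has mean zero, the mean of \<open>w\<close> is that of
      the difference and is controlled by the approximation error.\<close>
    have "(LINT x|LM L. v x $ j) = 0" using integral_nth[OF L2_integrable[OF vL], of j] mean by simp
    then have "(LINT x|LM L. w x $ j) = (LINT x|LM L. w x $ j - v x $ j)" using L2_integrable[OF wjL] L2_integrable[OF vjL] by simp
    then have "\<bar>LINT x|LM L. w x $ j\<bar> \<le> 2 * L * L2norm (LM L) (\<lambda>x. w x $ j - v x $ j)"
      using integral_L2_bound[OF L L2_diff[OF wjL vjL]] by (simp only:)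
    also have "\<dots> \<le> 2 * L * \<delta>" using L by (intro mult_left_mono dj) simp
    finally have "\<bar>LINT x|LM L. w x $ j\<bar> \<le> 2 * L * \<delta>" .
    then have "\<bar>m\<bar> * (2 * L) \<le> \<delta>" using L by (simp add: m_def power2_eq_square field_simps)
    then have mn: "L2norm (LM L) (\<lambda>_. m) \<le> \<delta>" using L2norm_const[OF L, of m] by simp
    have "L2norm (LM L) (\<lambda>x. v x $ j) \<le> L2norm (LM L) (\<lambda>x. w x $ j) + L2norm (LM L) (\<lambda>x. v x $ j - w x $ j)"
      by (rule L2norm_triangle_sub[OF vjL wjL])
    also have "L2norm (LM L) (\<lambda>x. w x $ j) \<le> L2norm (LM L) (\<lambda>_. m) + L2norm (LM L) p"
      unfolding p_def by (rule L2norm_triangle_sub[OF wjL L2_const])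
    finally show ?thesis using mn P' dj L2norm_minus_commute[of "LM L" "\<lambda>x. v x $ j" "\<lambda>x. w x $ j"] by linarith
  qed
  then have "(\<Sum>j\<in>UNIV. L2norm (LM L) (\<lambda>x. v x $ j)) \<le> (\<Sum>j\<in>(UNIV :: 2 set). 2 * \<delta> + 3 * L * (L2norm (LM L) ?G + \<delta>))" by (intro sum_mono)
  then have "L2norm (LM L) v \<le> 2 * (2 * \<delta> + 3 * L * (L2norm (LM L) ?G + \<delta>))" using L2norm_le_sum[OF vL] by simp
  also have "\<dots> = 6 * L * L2norm (LM L) ?G + \<delta> * (4 + 6 * L)" by (simp add: algebra_simps)
  also have "\<delta> * (4 + 6 * L) = \<epsilon>" using L by (simp add: \<delta>_def)
  finally show "L2norm (LM L) v \<le> 6 * L * L2norm (LM L) ?G + \<epsilon>" .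
qed

section \<open>Linear structure and closedness of the periodic solenoidal fields\<close>

lemma per_weak_lincomb:
  assumes L: "0 < L" and "per_weak L u G" "per_weak L v H"
  shows "per_weak L (\<lambda>x. u x + c *\<^sub>R v x) (\<lambda>x. G x + c *\<^sub>R H x)"
proof -
  have "has_weak_pderiv UNIV i (\<lambda>x. (u (wrap L x) + c *\<^sub>R v (wrap L x)) $ j) (\<lambda>x. (G (wrap L x) + c *\<^sub>R H (wrap L x)) $ i $ j)" for i j
    using has_weak_pderiv_lincomb[of UNIV i "\<lambda>x. u (wrap L x) $ j" "\<lambda>x. G (wrap L x) $ i $ j" "\<lambda>x. v (wrap L x) $ j" "\<lambda>x. H (wrap L x) $ i $ j" c]
      assms(2,3) by (simp add: per_weak_def)
  then show ?thesis using assms L2_lincomb[of u "LM L" v c] L2_lincomb[of G "LM L" H c] by (simp add: per_weak_def)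
qed

lemma per_weak_const: assumes "0 < L" shows "per_weak L (\<lambda>_. c) (\<lambda>_. 0)"
proof -
  have "has_weak_pderiv UNIV i (\<lambda>_. a) (\<lambda>_. 0)" for i :: 2 and a :: real
  proof -
    have "(LINT x|lebesgue. a * pderiv_at i \<phi> x) = - (LINT x|lebesgue. 0 * \<phi> x)" if "test_function UNIV \<phi>" for \<phi>
      by (rule C1_integration_by_parts[OF open_UNIV _ _ that, of _ "\<lambda>_ _. 0"]) auto
    moreover have "loc_int UNIV (\<lambda>_. a)" for a :: real by (rule continuous_loc_int) simp
    ultimately show ?thesis by (subst has_weak_pderiv_iff) auto
  qed
  then show ?thesis by (simp add: per_weak_def L2_const)
qed

lemma H1per_0_lincomb:
  assumes L: "0 < L" and "u \<in> H1per_sigma L 0" "v \<in> H1per_sigma L 0"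
  shows "(\<lambda>x. u x + c *\<^sub>R v x) \<in> H1per_sigma L 0"
proof -
  have u: "u \<in> H1per L 0" "AE x in LM L. wdiv (Omega L 0) u x = 0" and v: "v \<in> H1per L 0" "AE x in LM L. wdiv (Omega L 0) v x = 0"
    using assms by (auto simp: H1per_sigma_def)
  note p = per_weakD[OF L per_weak_lincomb[OF L H1per_0D(2)[OF L u(1)] H1per_0D(2)[OF L v(1)], of c]]
  have "AE x in LM L. wdiv (Omega L 0) (\<lambda>x. u x + c *\<^sub>R v x) x = 0"
    using p(3) u(2) v(2) by eventually_elim (simp add: wdiv_eq sum.distrib sum_distrib_left[symmetric])
  then show ?thesis using p(1) by (simp add: H1per_sigma_def)
qed

lemma H1per_0_const:
  assumes L: "0 < L" 
  shows "(\<lambda>_. c) \<in> H1per_sigma L 0" "AE x in LM L. wgrad (Omega L 0) (\<lambda>_. c) x = 0"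
proof -
  note p = per_weakD[OF L per_weak_const[OF L, of c]]
  show "AE x in LM L. wgrad (Omega L 0) (\<lambda>_. c) x = 0" by (rule p(3))
  then have "AE x in LM L. wdiv (Omega L 0) (\<lambda>_. c) x = 0" by eventually_elim (simp add: wdiv_eq)
  then show "(\<lambda>_. c) \<in> H1per_sigma L 0" using p(1) by (simp add: H1per_sigma_def)
qed

lemma H1per_0_diff_const:
  assumes L: "0 < L" and "u \<in> H1per_sigma L 0"
  shows "(\<lambda>x. u x - c) \<in> H1per_sigma L 0" "AE x in LM L. wgrad (Omega L 0) (\<lambda>x. u x - c) x = wgrad (Omega L 0) u x"
proof -
  have "u \<in> H1_field (Omega L 0)" "(\<lambda>_. c) \<in> H1_field (Omega L 0)"
    using assms(2) H1per_0_const(1)[OF L, of c] H1per_0D(1)[OF L] by (auto simp: H1per_sigma_def)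
  from H1_field_diff(2)[OF null_boundary_Omega this]
  show "AE x in LM L. wgrad (Omega L 0) (\<lambda>x. u x - c) x = wgrad (Omega L 0) u x"
    using H1per_0_const(2)[OF L, of c] by eventually_elim simp
  show "(\<lambda>x. u x - c) \<in> H1per_sigma L 0" using H1per_0_lincomb[OF assms H1per_0_const(1)[OF L, of c], of "-1"] by simp
qed

text \<open>The trace is a bounded linear function of the matrix, so the divergence constraint
  survives \<open>L2\<close> limits of gradients.\<close>

lemma trace_limit:
  fixes g :: "nat \<Rightarrow> 'a \<Rightarrow> real^2^2"
  assumes g: "\<And>n. g n \<in> L2 M" "G \<in> L2 M" "(\<lambda>n. L2norm M (\<lambda>x. g n x - G x)) \<longlonglongrightarrow> 0"
    and tr: "\<And>n. AE x in M. (\<Sum>i\<in>UNIV. g n x $ i $ i) = 0"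
  shows "AE x in M. (\<Sum>i\<in>UNIV. G x $ i $ i) = 0"
proof (rule L2norm_eq_0)
  have gi: "(\<lambda>x. g n x $ i $ i) \<in> L2 M" and Gi: "(\<lambda>x. G x $ i $ i) \<in> L2 M" for n i by (intro L2_nth g)+
  have t: "(\<lambda>x. \<Sum>i\<in>UNIV. F x $ i $ i) \<in> L2 M" if "\<And>i. (\<lambda>x. F x $ i $ i) \<in> L2 M" for F :: "'a \<Rightarrow> real^2^2"
    using L2_add[OF that[of 1] that[of 2]] by (simp add: UNIV_2)
  show TL: "(\<lambda>x. \<Sum>i\<in>UNIV. G x $ i $ i) \<in> L2 M" by (rule t[OF Gi])
  have b: "L2norm M (\<lambda>x. \<Sum>i\<in>UNIV. G x $ i $ i) \<le> 2 * L2norm M (\<lambda>x. g n x - G x)" for n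
  proof -
    have c: "L2norm M (\<lambda>x. g n x $ i $ i - G x $ i $ i) \<le> L2norm M (\<lambda>x. g n x - G x)" for i
      using L2norm_component_le[OF L2_nth[OF L2_diff[OF g(1,2)], of n i], of i] L2norm_component_le[OF L2_diff[OF g(1,2)], of n i] by simp
    have "L2norm M (\<lambda>x. \<Sum>i\<in>UNIV. G x $ i $ i) = L2norm M (\<lambda>x. (\<Sum>i\<in>UNIV. g n x $ i $ i) - (\<Sum>i\<in>UNIV. G x $ i $ i))"
    proof -
      have "L2norm M (\<lambda>x. (\<Sum>i\<in>UNIV. g n x $ i $ i) - (\<Sum>i\<in>UNIV. G x $ i $ i)) = L2norm M (\<lambda>x. - (\<Sum>i\<in>UNIV. G x $ i $ i))"
      proof (rule L2norm_cong_AE)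
        show "AE x in M. (\<Sum>i\<in>UNIV. g n x $ i $ i) - (\<Sum>i\<in>UNIV. G x $ i $ i) = - (\<Sum>i\<in>UNIV. G x $ i $ i)"
          using tr[of n] by eventually_elim simp
        show "(\<lambda>x. (\<Sum>i\<in>UNIV. g n x $ i $ i) - (\<Sum>i\<in>UNIV. G x $ i $ i)) \<in> borel_measurable M" using L2_diff[OF t[OF gi] TL] by (simp add: L2_def)
        show "(\<lambda>x. - (\<Sum>i\<in>UNIV. G x $ i $ i)) \<in> borel_measurable M" using TL by (simp add: L2_def borel_measurable_uminus)
      qed
      then show ?thesis by (simp add: L2norm_def)
    qed
    also have "\<dots> = L2norm M (\<lambda>x. (g n x $ 1 $ 1 - G x $ 1 $ 1) + (g n x $ 2 $ 2 - G x $ 2 $ 2))"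
      by (rule L2norm_cong) (simp add: UNIV_2)
    also have "\<dots> \<le> L2norm M (\<lambda>x. g n x $ 1 $ 1 - G x $ 1 $ 1) + L2norm M (\<lambda>x. g n x $ 2 $ 2 - G x $ 2 $ 2)"
      by (intro L2norm_add_le L2_diff gi Gi)
    finally show ?thesis using c[of 1] c[of 2] by simp
  qed
  have "(\<lambda>n. 2 * L2norm M (\<lambda>x. g n x - G x)) \<longlonglongrightarrow> 2 * 0" by (intro tendsto_mult_left g(3))
  from LIMSEQ_le_const[OF this, of "L2norm M (\<lambda>x. \<Sum>i\<in>UNIV. G x $ i $ i)"] b
  show "L2norm M (\<lambda>x. \<Sum>i\<in>UNIV. G x $ i $ i) = 0" by (simp add: order_antisym)
qed

lemma H1per_0_closed:
  assumes L: "0 < L" and s: "\<And>n. s n \<in> H1per_sigma L 0" and v: "v \<in> L2 (LM L)" "G \<in> L2 (LM L)"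
    and c: "(\<lambda>n. L2norm (LM L) (\<lambda>x. s n x - v x)) \<longlonglongrightarrow> 0" "(\<lambda>n. L2norm (LM L) (\<lambda>x. wgrad (Omega L 0) (s n) x - G x)) \<longlonglongrightarrow> 0"
  shows "v \<in> H1per_sigma L 0" "AE x in LM L. wgrad (Omega L 0) v x = G x"
proof -
  have sH: "s n \<in> H1per L 0" and div: "AE x in LM L. wdiv (Omega L 0) (s n) x = 0" for n using s by (auto simp: H1per_sigma_def)
  have pw: "s n \<in> L2 (LM L)" "wgrad (Omega L 0) (s n) \<in> L2 (LM L)" 
    "has_weak_pderiv UNIV i (\<lambda>x. s n (wrap L x) $ j) (\<lambda>x. wgrad (Omega L 0) (s n) (wrap L x) $ i $ j)" for n i j
    using H1per_0D(2)[OF L sH[of n]] by (auto simp: per_weak_def)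
  have "has_weak_pderiv UNIV i (\<lambda>x. v (wrap L x) $ j) (\<lambda>x. G (wrap L x) $ i $ j)" for i j
    by (rule has_weak_per_limit[OF L pw(3) L2_nth[OF pw(1)] L2_nth[OF v(1)] L2_conv_nth[OF pw(1) v(1) c(1)]
          L2_nth[OF L2_nth[OF pw(2)]] L2_nth[OF L2_nth[OF v(2)]] L2_conv_nth[OF L2_nth[OF pw(2)] L2_nth[OF v(2)] L2_conv_nth[OF pw(2) v(2) c(2)]]])
  then have "per_weak L v G" using v by (simp add: per_weak_def)
  note p = per_weakD[OF L this]
  show "AE x in LM L. wgrad (Omega L 0) v x = G x" by (rule p(3))
  have "AE x in LM L. (\<Sum>i\<in>UNIV. G x $ i $ i) = 0"
    by (rule trace_limit[OF pw(2) v(2) c(2)]) (use div in \<open>simp add: wdiv_eq\<close>)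
  then have "AE x in LM L. wdiv (Omega L 0) v x = 0" using p(3) by eventually_elim (simp add: wdiv_eq)
  then show "v \<in> H1per_sigma L 0" using p(1) by (simp add: H1per_sigma_def)
qed

section \<open>Existence and uniqueness for energy problems\<close>

definition energy :: "(real^2) set \<Rightarrow> (real^2 \<Rightarrow> real^2) \<Rightarrow> (real^2 \<Rightarrow> real^2) \<Rightarrow> real" where
  "energy S u v = (LINT x|lebesgue_on S. wgrad S u x \<bullet> wgrad S v x)"

lemma energy_diff_norm:
  assumes S: "null_boundary S" and "u \<in> H1_field S" "v \<in> H1_field S"
  shows "energy S (\<lambda>x. u x - v x) (\<lambda>x. u x - v x) = (L2norm (lebesgue_on S) (\<lambda>x. wgrad S u x - wgrad S v x))\<^sup>2"
proof -
  have "L2norm (lebesgue_on S) (\<lambda>x. wgrad S u x - wgrad S v x) = L2norm (lebesgue_on S) (wgrad S (\<lambda>x. u x - v x))"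
  proof (rule L2norm_lebesgue_cong_AE[OF null_boundaryD(1)[OF S]])
    show "(\<lambda>x. wgrad S u x - wgrad S v x) \<in> L2 (lebesgue_on S)" by (intro L2_diff H1_fieldD(3)[OF S] assms)
    show "AE x in lebesgue_on S. wgrad S u x - wgrad S v x = wgrad S (\<lambda>x. u x - v x) x"
      using H1_field_diff(2)[OF assms] by eventually_elim simp
  qed
  then show ?thesis by (simp add: energy_def L2norm_power2 power2_norm_eq_inner)
qed

text \<open>Serves the perforated square and the torus alike. By the Poincare inequality, sequences
  that are Cauchy in energy are Cauchy as fields and as gradients, so the completeness required by
  \<open>Riesz\<close> reduces to closedness of the graph of the gradient over \<open>X\<close>. The
  same inequality makes the energy definite up to null sets, which is uniqueness.\<close>

lemma energy_problem:
  assumes S: "null_boundary S" and X: "X \<noteq> {}" "X \<subseteq> H1_field S"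
    and lc: "\<And>u v c. u \<in> X \<Longrightarrow> v \<in> X \<Longrightarrow> (\<lambda>x. u x + c *\<^sub>R v x) \<in> X"
    and P: "\<And>v. v \<in> X \<Longrightarrow> L2norm (lebesgue_on S) v \<le> C * L2norm (lebesgue_on S) (wgrad S v)"
    and closed: "\<And>s v G. (\<And>n::nat. s n \<in> X) \<Longrightarrow> v \<in> L2 (lebesgue_on S) \<Longrightarrow> G \<in> L2 (lebesgue_on S) \<Longrightarrow>
      (\<lambda>n. L2norm (lebesgue_on S) (\<lambda>x. s n x - v x)) \<longlonglongrightarrow> 0 \<Longrightarrow> 
      (\<lambda>n. L2norm (lebesgue_on S) (\<lambda>x. wgrad S (s n) x - G x)) \<longlonglongrightarrow> 0 \<Longrightarrow> v \<in> X \<and> (AE x in lebesgue_on S. wgrad S v x = G x)"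
    and f: "f \<in> L2 (lebesgue_on S)"
  shows "\<exists>u. weak_solution S X f u"
    "weak_solution S X f u \<Longrightarrow> weak_solution S X f u' \<Longrightarrow> AE x in lebesgue_on S. u' x = u x"
proof -
  let ?M = "lebesgue_on S"
  have XH: "v \<in> H1_field S" if "v \<in> X" for v using that X(2) by blast
  have XL: "v \<in> L2 ?M" "wgrad S v \<in> L2 ?M" if "v \<in> X" for v using H1_fieldD(1,3)[OF S XH[OF that]] .
  interpret semi_inner X "energy S"
  proof
    fix u v w :: "real^2 \<Rightarrow> real^2" and c :: real
    show "X \<noteq> {}" by (rule X)
    show "energy S u v = energy S v u" by (simp add: energy_def inner_commute)
    show "0 \<le> energy S u u" by (simp add: energy_def)
    assume u: "u \<in> X" and v: "v \<in> X"
    show "(\<lambda>x. u x + c *\<^sub>R v x) \<in> X" by (rule lc[OF u v])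
    assume w: "w \<in> X"
    have "energy S (\<lambda>x. u x + c *\<^sub>R v x) w = (LINT x|?M. (wgrad S u x + c *\<^sub>R wgrad S v x) \<bullet> wgrad S w x)"
      unfolding energy_def
    proof (rule integral_cong_AE)
      show "(\<lambda>x. wgrad S (\<lambda>x. u x + c *\<^sub>R v x) x \<bullet> wgrad S w x) \<in> borel_measurable ?M"
        using L2_inner_integrable[OF XL(2)[OF lc[OF u v]] XL(2)[OF w]] by blast
      show "(\<lambda>x. (wgrad S u x + c *\<^sub>R wgrad S v x) \<bullet> wgrad S w x) \<in> borel_measurable ?M"
        using L2_inner_integrable[OF L2_lincomb[OF XL(2)[OF u] XL(2)[OF v]] XL(2)[OF w]] by blast
      show "AE x in ?M. wgrad S (\<lambda>x. u x + c *\<^sub>R v x) x \<bullet> wgrad S w x = (wgrad S u x + c *\<^sub>R wgrad S v x) \<bullet> wgrad S w x"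
        using H1_field_lincomb(2)[OF S XH[OF u] XH[OF v], of c] by eventually_elim simp
    qed
    also have "\<dots> = energy S u w + c * energy S v w"
      unfolding energy_def by (rule L2.lin[OF XL(2)[OF u] XL(2)[OF v] XL(2)[OF w]])
    finally show "energy S (\<lambda>x. u x + c *\<^sub>R v x) w = energy S u w + c * energy S v w" .
  qed
  have C: "L2norm ?M v \<le> \<bar>C\<bar> * L2norm ?M (wgrad S v)" if "v \<in> X" for v
    using P[OF that] by (meson L2norm_nonneg abs_ge_self mult_right_mono order_trans)
  have P_diff: "L2norm ?M (\<lambda>x. u x - v x) \<le> \<bar>C\<bar> * L2norm ?M (\<lambda>x. wgrad S u x - wgrad S v x)" if "u \<in> X" "v \<in> X" for u v
  proof -
    have "L2norm ?M (wgrad S (\<lambda>x. u x - v x)) = L2norm ?M (\<lambda>x. wgrad S u x - wgrad S v x)"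
    proof (rule L2norm_lebesgue_cong_AE[OF null_boundaryD(1)[OF S]])
      show "wgrad S (\<lambda>x. u x - v x) \<in> L2 ?M" by (rule XL(2)[OF diff[OF that]])
      show "AE x in ?M. wgrad S (\<lambda>x. u x - v x) x = wgrad S u x - wgrad S v x" by (rule H1_field_diff(2)[OF S XH[OF that(1)] XH[OF that(2)]])
    qed
    then show ?thesis using C[OF diff[OF that]] by simp
  qed
  have "\<exists>u\<in>X. \<forall>v\<in>X. energy S u v = (LINT x|?M. f x \<bullet> v x)"
  proof (rule Riesz)
    fix s :: "nat \<Rightarrow> real^2 \<Rightarrow> real^2"
    assume s: "\<And>n. s n \<in> X" and Cau: "\<And>e. e > 0 \<Longrightarrow> \<exists>K. \<forall>m\<ge>K. \<forall>n\<ge>K. energy S (\<lambda>x. s m x - s n x) (\<lambda>x. s m x - s n x) < e"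
    have Cg: "\<exists>K. \<forall>m\<ge>K. \<forall>n\<ge>K. L2norm ?M (\<lambda>x. wgrad S (s m) x - wgrad S (s n) x) < e" if e: "e > 0" for e
    proof -
      obtain K where K: "\<forall>m\<ge>K. \<forall>n\<ge>K. energy S (\<lambda>x. s m x - s n x) (\<lambda>x. s m x - s n x) < e\<^sup>2" using Cau[of "e\<^sup>2"] e by auto
      have "L2norm ?M (\<lambda>x. wgrad S (s m) x - wgrad S (s n) x) < e" if "m \<ge> K" "n \<ge> K" for m n
      proof (rule power_less_imp_less_base[of _ 2 e])
        have "energy S (\<lambda>x. s m x - s n x) (\<lambda>x. s m x - s n x) < e\<^sup>2" using K that by blast
        then show "(L2norm ?M (\<lambda>x. wgrad S (s m) x - wgrad S (s n) x))\<^sup>2 < e\<^sup>2"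
          by (simp only: energy_diff_norm[OF S XH[OF s] XH[OF s]])
      qed (use e in simp)
      then show ?thesis by blast
    qed
    then obtain G where G: "G \<in> L2 ?M" "(\<lambda>n. L2norm ?M (\<lambda>x. wgrad S (s n) x - G x)) \<longlonglongrightarrow> 0"
      using L2_complete[of "\<lambda>n. wgrad S (s n)" ?M] XL(2)[OF s] by blast
    have Cs: "\<exists>K. \<forall>m\<ge>K. \<forall>n\<ge>K. L2norm ?M (\<lambda>x. s m x - s n x) < e" if e: "e > 0" for e
    proof -
      \<comment> \<open>Adding 1 keeps the divisor positive also for \<open>C = 0\<close>.\<close>
      obtain K where K: "\<forall>m\<ge>K. \<forall>n\<ge>K. L2norm ?M (\<lambda>x. wgrad S (s m) x - wgrad S (s n) x) < e / (\<bar>C\<bar> + 1)" 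
        using Cg[of "e / (\<bar>C\<bar> + 1)"] e by auto
      have "L2norm ?M (\<lambda>x. s m x - s n x) < e" if "m \<ge> K" "n \<ge> K" for m n
      proof -
        have "L2norm ?M (\<lambda>x. s m x - s n x) \<le> (\<bar>C\<bar> + 1) * L2norm ?M (\<lambda>x. wgrad S (s m) x - wgrad S (s n) x)"
          using P_diff[OF s s, of m n] L2norm_nonneg[of ?M "\<lambda>x. wgrad S (s m) x - wgrad S (s n) x"] by (simp only: distrib_right)
        also have "\<dots> < (\<bar>C\<bar> + 1) * (e / (\<bar>C\<bar> + 1))" using K that by (intro mult_strict_left_mono) auto
        also have "\<dots> = e" by simp
        finally show ?thesis .
      qed
      then show ?thesis by blast
    qed
    then obtain v where v: "v \<in> L2 ?M" "(\<lambda>n. L2norm ?M (\<lambda>x. s n x - v x)) \<longlonglongrightarrow> 0"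
      using L2_complete[of s ?M] XL(1)[OF s] by blast
    have vX: "v \<in> X" and vG: "AE x in ?M. wgrad S v x = G x" using closed[OF s v(1) G(1) v(2) G(2)] by auto
    have "L2norm ?M (\<lambda>x. wgrad S (s n) x - wgrad S v x) = L2norm ?M (\<lambda>x. wgrad S (s n) x - G x)" for n
    proof (rule L2norm_lebesgue_cong_AE[OF null_boundaryD(1)[OF S]])
      show "(\<lambda>x. wgrad S (s n) x - wgrad S v x) \<in> L2 ?M" by (intro L2_diff XL(2) s vX)
      show "AE x in ?M. wgrad S (s n) x - wgrad S v x = wgrad S (s n) x - G x" using vG by eventually_elim simp
    qed
    then have "(\<lambda>n. energy S (\<lambda>x. s n x - v x) (\<lambda>x. s n x - v x)) = (\<lambda>n. (L2norm ?M (\<lambda>x. wgrad S (s n) x - G x))\<^sup>2)"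
      using energy_diff_norm[OF S XH[OF s] XH[OF vX]] by simp
    moreover have "(\<lambda>n. (L2norm ?M (\<lambda>x. wgrad S (s n) x - G x))\<^sup>2) \<longlonglongrightarrow> 0" using tendsto_power[OF G(2), of 2] by (simp only: zero_power2)
    ultimately have "(\<lambda>n. energy S (\<lambda>x. s n x - v x) (\<lambda>x. s n x - v x)) \<longlonglongrightarrow> 0" by (simp only:)
    then show "\<exists>l\<in>X. (\<lambda>n. energy S (\<lambda>x. s n x - l x) (\<lambda>x. s n x - l x)) \<longlonglongrightarrow> 0" using vX by blast
  next
    fix u v :: "real^2 \<Rightarrow> real^2" and c :: real assume "u \<in> X" "v \<in> X"
    then show "(LINT x|?M. f x \<bullet> (u x + c *\<^sub>R v x)) = (LINT x|?M. f x \<bullet> u x) + c * (LINT x|?M. f x \<bullet> v x)"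
      using L2_inner_integrable[OF f XL(1)] by (simp add: inner_add_right)
  next
    fix v assume v: "v \<in> X"
    have "\<bar>LINT x|?M. f x \<bullet> v x\<bar> \<le> L2norm ?M f * L2norm ?M v" by (rule L2_inner_bound[OF f XL(1)[OF v]])
    also have "\<dots> \<le> L2norm ?M f * (\<bar>C\<bar> * L2norm ?M (wgrad S v))" by (intro mult_left_mono C v) simp
    finally have "(LINT x|?M. f x \<bullet> v x)\<^sup>2 \<le> (L2norm ?M f * (\<bar>C\<bar> * L2norm ?M (wgrad S v)))\<^sup>2"
      using abs_le_square_iff[of "LINT x|?M. f x \<bullet> v x" "L2norm ?M f * (\<bar>C\<bar> * L2norm ?M (wgrad S v))"] by (simp add: abs_mult)
    also have "\<dots> = (L2norm ?M f * \<bar>C\<bar>)\<^sup>2 * energy S v v"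
      by (simp add: energy_def L2norm_power2 power_mult_distrib power2_norm_eq_inner)
    finally show "(LINT x|?M. f x \<bullet> v x)\<^sup>2 \<le> (L2norm ?M f * \<bar>C\<bar>)\<^sup>2 * energy S v v" .
  qed
  then show "\<exists>u. weak_solution S X f u" unfolding weak_solution_def energy_def by blast
  assume "weak_solution S X f u" "weak_solution S X f u'"
  then have u: "u \<in> X" "u' \<in> X" "\<And>v. v \<in> X \<Longrightarrow> energy S u v = energy S u' v"
    unfolding weak_solution_def energy_def by auto
  have "energy S (\<lambda>x. u x - u' x) (\<lambda>x. u x - u' x) = 0"
    using lin_diff[OF u(1,2) diff[OF u(1,2)]] u(3)[OF diff[OF u(1,2)]] by simp
  then have "L2norm ?M (\<lambda>x. wgrad S u x - wgrad S u' x) = 0" using energy_diff_norm[OF S XH[OF u(1)] XH[OF u(2)]] by simp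
  then have "L2norm ?M (\<lambda>x. u x - u' x) = 0" using P_diff[OF u(1,2)] L2norm_nonneg[of ?M "\<lambda>x. u x - u' x"] by simp
  from L2norm_eq_0[OF L2_diff[OF XL(1)[OF u(1)] XL(1)[OF u(2)]] this]
  show "AE x in ?M. u' x = u x" by eventually_elim simp
qed

section \<open>The space on the perforated square\<close>

lemma L2norm_lincomb_le:
  fixes f g :: "'a \<Rightarrow> 'b::euclidean_space"
  assumes "f \<in> L2 M" "g \<in> L2 M"
  shows "L2norm M (\<lambda>x. f x + c *\<^sub>R g x) \<le> L2norm M f + \<bar>c\<bar> * L2norm M g"
  using L2.triangle[OF assms, of c] by (simp only: L2norm_sq_eq)

lemma C1per_lincomb:
  assumes "w \<in> C1per L r" "w' \<in> C1per L r" shows "(\<lambda>x. w x + c *\<^sub>R w' x) \<in> C1per L r"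
proof -
  let ?E = "periodic_ext L (closure (Omega L r))"
  obtain J J' where J: "continuous_on ?E J" "\<forall>x\<in>?E. (w has_derivative (\<lambda>h. J x *v h)) (at x within ?E)"
    and J': "continuous_on ?E J'" "\<forall>x\<in>?E. (w' has_derivative (\<lambda>h. J' x *v h)) (at x within ?E)"
    and p: "periodic_field L w" "periodic_field L w'"
    using assms by (auto simp: C1per_def Let_def)
  have "((\<lambda>x. w x + c *\<^sub>R w' x) has_derivative (\<lambda>h. (J x + c *\<^sub>R J' x) *v h)) (at x within ?E)" if "x \<in> ?E" for x
  proof -
    have "((\<lambda>x. w x + c *\<^sub>R w' x) has_derivative (\<lambda>h. J x *v h + c *\<^sub>R (J' x *v h))) (at x within ?E)"
      using J(2) J'(2) that by (intro has_derivative_add has_derivative_scaleR_right) auto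
    then show ?thesis by (simp add: matrix_vector_mult_add_rdistrib scaleR_matrix_vector_assoc)
  qed
  moreover have "continuous_on ?E (\<lambda>x. J x + c *\<^sub>R J' x)" by (intro continuous_intros J J')
  moreover have "periodic_field L (\<lambda>x. w x + c *\<^sub>R w' x)" using p by (simp add: periodic_field_def)
  ultimately show ?thesis unfolding C1per_def Let_def by blast
qed

lemma C1per_circle_L2:
  assumes "0 < r" "r < L" "w \<in> C1per L r" shows "(\<lambda>\<theta>. w (circle_pt r \<theta>)) \<in> L2 (lebesgue_on {0..2*pi})"
proof -
  have "continuous_on (Cl L r) w" using C1perD[OF assms] by blast
  then have "continuous_on {0..2*pi} (\<lambda>\<theta>. w (circle_pt r \<theta>))"
    by (rule continuous_on_compose2[OF _ continuous_on_circle_pt]) (use assms circle_pt_Cl in auto)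
  then show ?thesis by (rule continuous_compact_L2) auto
qed

lemma H1norm_bounds:
  assumes S: "null_boundary S" and "u \<in> H1_field S" "v \<in> H1_field S"
  shows "L2norm (lebesgue_on S) (\<lambda>x. u x - v x) \<le> H1norm S (\<lambda>x. u x - v x)"
    "L2norm (lebesgue_on S) (\<lambda>x. wgrad S u x - wgrad S v x) \<le> H1norm S (\<lambda>x. u x - v x)"
    "H1norm S (\<lambda>x. u x - v x) \<le> L2norm (lebesgue_on S) (\<lambda>x. u x - v x) + L2norm (lebesgue_on S) (\<lambda>x. wgrad S u x - wgrad S v x)"
proof -
  have "(L2norm (lebesgue_on S) (wgrad S (\<lambda>x. u x - v x)))\<^sup>2 = (L2norm (lebesgue_on S) (\<lambda>x. wgrad S u x - wgrad S v x))\<^sup>2"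
    using energy_diff_norm[OF assms] by (simp add: energy_def L2norm_power2 power2_norm_eq_inner)
  then have e: "H1norm S (\<lambda>x. u x - v x) = sqrt ((L2norm (lebesgue_on S) (\<lambda>x. u x - v x))\<^sup>2 + (L2norm (lebesgue_on S) (\<lambda>x. wgrad S u x - wgrad S v x))\<^sup>2)"
    by (simp add: H1norm_def)
  show "L2norm (lebesgue_on S) (\<lambda>x. u x - v x) \<le> H1norm S (\<lambda>x. u x - v x)"
    "L2norm (lebesgue_on S) (\<lambda>x. wgrad S u x - wgrad S v x) \<le> H1norm S (\<lambda>x. u x - v x)"
    unfolding e by (auto intro!: real_le_rsqrt)
  show "H1norm S (\<lambda>x. u x - v x) \<le> L2norm (lebesgue_on S) (\<lambda>x. u x - v x) + L2norm (lebesgue_on S) (\<lambda>x. wgrad S u x - wgrad S v x)"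
    unfolding e by (intro sqrt_sum_squares_le_sum) auto
qed

text \<open>Membership asks for one approximating sequence for the periodic space and one for the
  trace; a sequence for the trace serves both. The formulation with \<open>e\<close> and with
  differences of gradients, rather than gradients of differences, is the one that combines under
  sums and limits.\<close>

lemma V0_sigma_iff:
  assumes r: "0 < r" "r < L"
  shows "v \<in> V0_sigma L r \<longleftrightarrow> v \<in> H1_field (Omega L r) \<and> (AE x in lebesgue_on (Omega L r). wdiv (Omega L r) v x = 0) \<and>
    (\<forall>e>0. \<exists>w\<in>C1per L r. L2norm (lebesgue_on (Omega L r)) (\<lambda>x. v x - w x) < e \<and>
       L2norm (lebesgue_on (Omega L r)) (\<lambda>x. wgrad (Omega L r) v x - wgrad (Omega L r) w x) < e \<and>
       L2norm (lebesgue_on {0..2*pi}) (\<lambda>\<theta>. w (circle_pt r \<theta>)) < e)" (is "_ \<longleftrightarrow> ?H \<and> ?D \<and> (\<forall>e>0. ?A e)")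
proof
  assume v: "v \<in> V0_sigma L r"
  have vH: ?H using v H1per_H1_field[OF r(1), of v L] by (simp add: V0_sigma_def H1per_sigma_def)
  have D: ?D using v by (simp add: V0_sigma_def H1per_sigma_def)
  obtain w where w: "\<forall>n::nat. w n \<in> C1per L r" "(\<lambda>n. H1norm (Omega L r) (\<lambda>x. v x - w n x)) \<longlonglongrightarrow> 0"
    "(\<lambda>n. L2norm (lebesgue_on {0..2*pi}) (\<lambda>\<theta>. w n (circle_pt r \<theta>) - 0)) \<longlonglongrightarrow> 0"
    using v unfolding V0_sigma_def has_trace_def by blast
  have "?A e" if "e > 0" for e
  proof -
    have "eventually (\<lambda>n. H1norm (Omega L r) (\<lambda>x. v x - w n x) < e \<and> L2norm (lebesgue_on {0..2*pi}) (\<lambda>\<theta>. w n (circle_pt r \<theta>) - 0) < e) sequentially"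
      using order_tendstoD(2)[OF w(2) that] order_tendstoD(2)[OF w(3) that] by (rule eventually_conj)
    then obtain n where n: "H1norm (Omega L r) (\<lambda>x. v x - w n x) < e" "L2norm (lebesgue_on {0..2*pi}) (\<lambda>\<theta>. w n (circle_pt r \<theta>)) < e"
      unfolding eventually_sequentially by auto
    have wn: "w n \<in> C1per L r" using w(1) by blast
    note b = H1norm_bounds[OF null_boundary_Omega vH C1per_H1_field[OF r wn]]
    show ?thesis using wn n(2) le_less_trans[OF b(1) n(1)] le_less_trans[OF b(2) n(1)] by blast
  qed
  then show "?H \<and> ?D \<and> (\<forall>e>0. ?A e)" using vH D by blast
next
  assume a: "?H \<and> ?D \<and> (\<forall>e>0. ?A e)"
  then have vH: ?H and A: "\<forall>n::nat. ?A (inverse (real (Suc n)))" by auto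
  obtain w where w: "\<forall>n. w n \<in> C1per L r \<and> L2norm (lebesgue_on (Omega L r)) (\<lambda>x. v x - w n x) < inverse (real (Suc n)) \<and>
       L2norm (lebesgue_on (Omega L r)) (\<lambda>x. wgrad (Omega L r) v x - wgrad (Omega L r) (w n) x) < inverse (real (Suc n)) \<and>
       L2norm (lebesgue_on {0..2*pi}) (\<lambda>\<theta>. w n (circle_pt r \<theta>)) < inverse (real (Suc n))"
    using choice[of "\<lambda>n w. w \<in> C1per L r \<and> L2norm (lebesgue_on (Omega L r)) (\<lambda>x. v x - w x) < inverse (real (Suc n)) \<and>
       L2norm (lebesgue_on (Omega L r)) (\<lambda>x. wgrad (Omega L r) v x - wgrad (Omega L r) w x) < inverse (real (Suc n)) \<and>
       L2norm (lebesgue_on {0..2*pi}) (\<lambda>\<theta>. w (circle_pt r \<theta>)) < inverse (real (Suc n))"] A by blast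
  have wC: "\<forall>n. w n \<in> C1per L r" using w by blast
  have b: "H1norm (Omega L r) (\<lambda>x. v x - w n x) \<le> 2 * inverse (real (Suc n))" for n
  proof -
    have "L2norm (lebesgue_on (Omega L r)) (\<lambda>x. v x - w n x) < inverse (real (Suc n))"
      "L2norm (lebesgue_on (Omega L r)) (\<lambda>x. wgrad (Omega L r) v x - wgrad (Omega L r) (w n) x) < inverse (real (Suc n))" using w by blast+
    then show ?thesis using H1norm_bounds(3)[OF null_boundary_Omega vH C1per_H1_field[OF r spec[OF wC]], of n] by linarith
  qed
  have t: "(\<lambda>n. 2 * inverse (real (Suc n))) \<longlonglongrightarrow> 0" using tendsto_mult_left[OF LIMSEQ_inverse_real_of_nat, of 2] by simp
  have "(\<lambda>n. H1norm (Omega L r) (\<lambda>x. v x - w n x)) \<longlonglongrightarrow> 0"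
    by (rule real_tendsto_sandwich[OF _ _ tendsto_const t]) (use b in \<open>auto simp: H1norm_def\<close>)
  moreover have "(\<lambda>n. L2norm (lebesgue_on {0..2*pi}) (\<lambda>\<theta>. w n (circle_pt r \<theta>))) \<longlonglongrightarrow> 0"
  proof (rule real_tendsto_sandwich[OF _ _ tendsto_const LIMSEQ_inverse_real_of_nat])
    show "\<forall>\<^sub>F n in sequentially. L2norm (lebesgue_on {0..2*pi}) (\<lambda>\<theta>. w n (circle_pt r \<theta>)) \<le> inverse (real (Suc n))"
      by (rule always_eventually) (use w in \<open>blast intro: less_imp_le\<close>)
  qed simp
  ultimately have "has_trace L r v (\<lambda>_. 0)" "\<exists>w. (\<forall>n::nat. w n \<in> C1per L r) \<and> (\<lambda>n. H1norm (Omega L r) (\<lambda>x. v x - w n x)) \<longlonglongrightarrow> 0"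
    using wC unfolding has_trace_def by (auto simp: L2_zero)
  then show "v \<in> V0_sigma L r" using a r by (simp add: V0_sigma_def H1per_sigma_def H1per_def H1_field_def)
qed

lemma V0_H1_field: "0 < r \<Longrightarrow> v \<in> V0_sigma L r \<Longrightarrow> v \<in> H1_field (Omega L r)"
  using H1per_H1_field[of r v L] by (simp add: V0_sigma_def H1per_sigma_def)

lemma V0_zero: assumes r: "0 < r" "r < L" shows "(\<lambda>_. 0) \<in> V0_sigma L r"
proof -
  have d: "((\<lambda>_. 0) has_derivative (\<lambda>h. (0 :: real^2^2) *v h)) F" for F :: "(real^2) filter" by simp
  have J: "continuous_on (Cl L r) (\<lambda>_. 0 :: real^2^2)" by simp
  have C: "(\<lambda>_. 0) \<in> C1per L r" 
  proof -
    let ?E = "periodic_ext L (closure (Omega L r))"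
    have "\<forall>x\<in>?E. ((\<lambda>_. 0) has_derivative (\<lambda>h. (0 :: real^2^2) *v h)) (at x within ?E)" using d by blast
    moreover have "continuous_on ?E (\<lambda>_. 0 :: real^2^2)" by (rule continuous_on_const)
    ultimately show ?thesis unfolding C1per_def Let_def periodic_field_def mem_Collect_eq by (intro conjI allI refl exI[of _ "\<lambda>_. 0"])
  qed
  have H: "(\<lambda>_. 0 :: real^2) \<in> H1_field (Omega L r)" and g: "AE x in lebesgue_on (Omega L r). wgrad (Omega L r) (\<lambda>_. 0) x = 0"
    using C1_H1_field(1,2)[OF J, of "\<lambda>_. 0"] d by (auto simp: transpose_def zero_vec_def)
  have "AE x in lebesgue_on (Omega L r). wdiv (Omega L r) (\<lambda>_. 0) x = 0" using g by eventually_elim (simp add: wdiv_eq)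
  then show ?thesis unfolding V0_sigma_iff[OF r] using C H by (auto intro!: bexI[of _ "\<lambda>_. 0"] simp: L2norm_def)
qed

lemma V0_lincomb:
  assumes r: "0 < r" "r < L" and u: "u \<in> V0_sigma L r" and v: "v \<in> V0_sigma L r"
  shows "(\<lambda>x. u x + c *\<^sub>R v x) \<in> V0_sigma L r"
proof -
  let ?S = "Omega L r" and ?M = "lebesgue_on (Omega L r)"
  note S = null_boundary_Omega[of L r]
  have H: "u \<in> H1_field ?S" "v \<in> H1_field ?S" and D: "AE x in ?M. wdiv ?S u x = 0" "AE x in ?M. wdiv ?S v x = 0"
    using u v unfolding V0_sigma_iff[OF r] by blast+
  note lc = H1_field_lincomb[OF S H, of c]
  have "AE x in ?M. wdiv ?S (\<lambda>x. u x + c *\<^sub>R v x) x = 0"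
    using lc(2) D by eventually_elim (simp add: wdiv_eq sum.distrib sum_distrib_left[symmetric])
  moreover have "\<exists>w\<in>C1per L r. L2norm ?M (\<lambda>x. u x + c *\<^sub>R v x - w x) < e \<and>
       L2norm ?M (\<lambda>x. wgrad ?S (\<lambda>x. u x + c *\<^sub>R v x) x - wgrad ?S w x) < e \<and>
       L2norm (lebesgue_on {0..2*pi}) (\<lambda>\<theta>. w (circle_pt r \<theta>)) < e" if "e > 0" for e
  proof -
    define e' where "e' = e / (1 + \<bar>c\<bar>)"
    have e': "e' > 0" using that by (simp add: e'_def)
    have "e' * (1 + \<bar>c\<bar>) = e" by (simp add: e'_def)
    then have ee: "e' + \<bar>c\<bar> * e' = e" by (simp add: algebra_simps)
    obtain w where w: "w \<in> C1per L r" "L2norm ?M (\<lambda>x. u x - w x) < e'" "L2norm ?M (\<lambda>x. wgrad ?S u x - wgrad ?S w x) < e'"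
      "L2norm (lebesgue_on {0..2*pi}) (\<lambda>\<theta>. w (circle_pt r \<theta>)) < e'" using u e' unfolding V0_sigma_iff[OF r] by blast
    obtain z where z: "z \<in> C1per L r" "L2norm ?M (\<lambda>x. v x - z x) < e'" "L2norm ?M (\<lambda>x. wgrad ?S v x - wgrad ?S z x) < e'"
      "L2norm (lebesgue_on {0..2*pi}) (\<lambda>\<theta>. z (circle_pt r \<theta>)) < e'" using v e' unfolding V0_sigma_iff[OF r] by blast
    note wH = C1per_H1_field[OF r w(1)] and zH = C1per_H1_field[OF r z(1)]
    have comb: "a + \<bar>c\<bar> * b < e" if "a < e'" "b < e'" for a b
      using that mult_left_mono[of b e' "\<bar>c\<bar>"] ee by linarith
    have "L2norm ?M (\<lambda>x. u x + c *\<^sub>R v x - (w x + c *\<^sub>R z x)) = L2norm ?M (\<lambda>x. (u x - w x) + c *\<^sub>R (v x - z x))"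
      by (rule L2norm_cong) (simp add: algebra_simps)
    also have "\<dots> \<le> L2norm ?M (\<lambda>x. u x - w x) + \<bar>c\<bar> * L2norm ?M (\<lambda>x. v x - z x)"
      by (intro L2norm_lincomb_le L2_diff H1_fieldD(1)[OF S] H wH zH)
    also have "\<dots> < e" by (rule comb[OF w(2) z(2)])
    finally have 1: "L2norm ?M (\<lambda>x. u x + c *\<^sub>R v x - (w x + c *\<^sub>R z x)) < e" .
    have "L2norm ?M (\<lambda>x. wgrad ?S (\<lambda>x. u x + c *\<^sub>R v x) x - wgrad ?S (\<lambda>x. w x + c *\<^sub>R z x) x)
        = L2norm ?M (\<lambda>x. (wgrad ?S u x - wgrad ?S w x) + c *\<^sub>R (wgrad ?S v x - wgrad ?S z x))"
    proof (rule L2norm_lebesgue_cong_AE[OF Omega_sets])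
      show "(\<lambda>x. wgrad ?S (\<lambda>x. u x + c *\<^sub>R v x) x - wgrad ?S (\<lambda>x. w x + c *\<^sub>R z x) x) \<in> L2 ?M"
        by (intro L2_diff H1_fieldD(3)[OF S] lc(1) H1_field_lincomb(1)[OF S] wH zH)
      show "AE x in ?M. wgrad ?S (\<lambda>x. u x + c *\<^sub>R v x) x - wgrad ?S (\<lambda>x. w x + c *\<^sub>R z x) x = (wgrad ?S u x - wgrad ?S w x) + c *\<^sub>R (wgrad ?S v x - wgrad ?S z x)"
        using lc(2) H1_field_lincomb(2)[OF S wH zH, of c] by eventually_elim (simp add: algebra_simps)
    qed
    also have "\<dots> \<le> L2norm ?M (\<lambda>x. wgrad ?S u x - wgrad ?S w x) + \<bar>c\<bar> * L2norm ?M (\<lambda>x. wgrad ?S v x - wgrad ?S z x)"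
      by (intro L2norm_lincomb_le L2_diff H1_fieldD(3)[OF S] H wH zH)
    also have "\<dots> < e" by (rule comb[OF w(3) z(3)])
    finally have 2: "L2norm ?M (\<lambda>x. wgrad ?S (\<lambda>x. u x + c *\<^sub>R v x) x - wgrad ?S (\<lambda>x. w x + c *\<^sub>R z x) x) < e" .
    have "L2norm (lebesgue_on {0..2*pi}) (\<lambda>\<theta>. w (circle_pt r \<theta>) + c *\<^sub>R z (circle_pt r \<theta>)) < e"
      using L2norm_lincomb_le[OF C1per_circle_L2[OF r w(1)] C1per_circle_L2[OF r z(1)], of c] comb[OF w(4) z(4)] by linarith
    with 1 2 show ?thesis using C1per_lincomb[OF w(1) z(1), of c] by (intro bexI[of _ "\<lambda>x. w x + c *\<^sub>R z x"] conjI)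
  qed
  ultimately show ?thesis unfolding V0_sigma_iff[OF r] using lc(1) by blast
qed

text \<open>A C^1 field that is close to \<open>s n\<close> and small on the circle is also close to
  the limit once \<open>n\<close> is large, so the approximations of the members yield those of
  \<open>v\<close>.\<close>

lemma V0_closed:
  assumes r: "0 < r" "r < L" and s: "\<And>n. s n \<in> V0_sigma L r" 
    and v: "v \<in> L2 (lebesgue_on (Omega L r))" "G \<in> L2 (lebesgue_on (Omega L r))"
    and c: "(\<lambda>n. L2norm (lebesgue_on (Omega L r)) (\<lambda>x. s n x - v x)) \<longlonglongrightarrow> 0"
      "(\<lambda>n. L2norm (lebesgue_on (Omega L r)) (\<lambda>x. wgrad (Omega L r) (s n) x - G x)) \<longlonglongrightarrow> 0"
  shows "v \<in> V0_sigma L r \<and> (AE x in lebesgue_on (Omega L r). wgrad (Omega L r) v x = G x)"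
proof -
  let ?S = "Omega L r" and ?M = "lebesgue_on (Omega L r)"
  note S = null_boundary_Omega[of L r]
  have H: "s n \<in> H1_field ?S" and D: "AE x in ?M. wdiv ?S (s n) x = 0" for n
    using s[of n] unfolding V0_sigma_iff[OF r] by blast+
  note F = H1_fieldD[OF S H]
  have wp: "has_weak_pderiv ?S i (\<lambda>x. v x $ j) (\<lambda>x. G x $ i $ j)" for i j
    by (rule has_weak_pderiv_limit[OF Omega_sets F(2) L2_nth[OF F(1)] L2_nth[OF L2_nth[OF F(3)]] L2_nth[OF v(1)] L2_nth[OF L2_nth[OF v(2)]]
      L2_conv_nth[OF F(1) v(1) c(1)] L2_conv_nth[OF L2_nth[OF F(3)] L2_nth[OF v(2)] L2_conv_nth[OF F(3) v(2) c(2)]]])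
  have vH: "v \<in> H1_field ?S" by (rule H1_fieldI[OF v wp])
  have vG: "AE x in ?M. wgrad ?S v x = G x" by (rule wgrad_eqI[OF S wp])
  have "AE x in ?M. (\<Sum>i\<in>UNIV. G x $ i $ i) = 0"
    by (rule trace_limit[OF F(3) v(2) c(2)]) (use D in \<open>simp add: wdiv_eq\<close>)
  then have "AE x in ?M. wdiv ?S v x = 0" using vG by eventually_elim (simp add: wdiv_eq)
  moreover have "\<exists>w\<in>C1per L r. L2norm ?M (\<lambda>x. v x - w x) < e \<and> L2norm ?M (\<lambda>x. wgrad ?S v x - wgrad ?S w x) < e \<and>
       L2norm (lebesgue_on {0..2*pi}) (\<lambda>\<theta>. w (circle_pt r \<theta>)) < e" if e: "e > 0" for e
  proof -
    have e2: "e / 2 > 0" using e by simp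
    have "eventually (\<lambda>n. L2norm ?M (\<lambda>x. s n x - v x) < e / 2 \<and> L2norm ?M (\<lambda>x. wgrad ?S (s n) x - G x) < e / 2) sequentially"
      using order_tendstoD(2)[OF c(1) e2] order_tendstoD(2)[OF c(2) e2] by (rule eventually_conj)
    then obtain n where n: "L2norm ?M (\<lambda>x. s n x - v x) < e / 2" "L2norm ?M (\<lambda>x. wgrad ?S (s n) x - G x) < e / 2"
      unfolding eventually_sequentially by auto
    obtain w where w: "w \<in> C1per L r" "L2norm ?M (\<lambda>x. s n x - w x) < e / 2" "L2norm ?M (\<lambda>x. wgrad ?S (s n) x - wgrad ?S w x) < e / 2"
      "L2norm (lebesgue_on {0..2*pi}) (\<lambda>\<theta>. w (circle_pt r \<theta>)) < e / 2" using s[of n] e2 unfolding V0_sigma_iff[OF r] by blast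
    note wF = H1_fieldD[OF S C1per_H1_field[OF r w(1)]]
    have "L2norm ?M (\<lambda>x. v x - w x) = L2norm ?M (\<lambda>x. (v x - s n x) + (s n x - w x))" by simp
    also have "\<dots> \<le> L2norm ?M (\<lambda>x. v x - s n x) + L2norm ?M (\<lambda>x. s n x - w x)" by (intro L2norm_add_le L2_diff v F(1) wF(1))
    finally have 1: "L2norm ?M (\<lambda>x. v x - w x) < e" using n(1) w(2) L2norm_minus_commute[of ?M v "s n"] by linarith
    have "L2norm ?M (\<lambda>x. wgrad ?S v x - wgrad ?S w x) = L2norm ?M (\<lambda>x. (G x - wgrad ?S (s n) x) + (wgrad ?S (s n) x - wgrad ?S w x))"
    proof (rule L2norm_lebesgue_cong_AE[OF Omega_sets])
      show "(\<lambda>x. wgrad ?S v x - wgrad ?S w x) \<in> L2 ?M" by (intro L2_diff wF(3) H1_fieldD(3)[OF S vH])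
      show "AE x in ?M. wgrad ?S v x - wgrad ?S w x = (G x - wgrad ?S (s n) x) + (wgrad ?S (s n) x - wgrad ?S w x)"
        using vG by eventually_elim simp
    qed
    also have "\<dots> \<le> L2norm ?M (\<lambda>x. G x - wgrad ?S (s n) x) + L2norm ?M (\<lambda>x. wgrad ?S (s n) x - wgrad ?S w x)"
      by (intro L2norm_add_le L2_diff v F(3) wF(3))
    finally have 2: "L2norm ?M (\<lambda>x. wgrad ?S v x - wgrad ?S w x) < e" using n(2) w(3) L2norm_minus_commute[of ?M G "wgrad ?S (s n)"] by linarith
    show ?thesis using w(1,4) 1 2 e by (intro bexI[of _ w] conjI) auto
  qed
  ultimately show ?thesis unfolding V0_sigma_iff[OF r] using vH vG by blast
qed

lemma ball_indicator:
  assumes "\<rho> \<le> L"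
  shows "integrable (LM L) (\<lambda>x. indicator (ball 0 \<rho>) x * (c :: real))"
    "(LINT x|LM L. indicator (ball 0 \<rho>) x * c) = measure lebesgue (ball (0 :: real^2) \<rho>) * c"
proof -
  have sub: "ball 0 \<rho> \<subseteq> Omega L 0"
  proof
    fix x :: "real^2" assume "x \<in> ball 0 \<rho>"
    then have "\<bar>x $ k\<bar> < L" for k using component_le_norm_cart[of x k] assms by simp
    then show "x \<in> Omega L 0" by (simp add: mem_Omega)
  qed
  have sm: "ball 0 \<rho> \<in> sets (LM L)" using sub by (auto simp: sets_restrict_space intro!: image_eqI[of _ _ "ball 0 \<rho>"])
  have "emeasure lebesgue (ball (0 :: real^2) \<rho>) < \<infinity>" using lmeasurable_ball[of "0 :: real^2" \<rho>] by (simp add: fmeasurable_def)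
  then show "integrable (LM L) (\<lambda>x. indicator (ball 0 \<rho>) x * c)"
    using sm by (intro integrable_mult_left) (simp add: integrable_indicator_iff Int_absorb2[OF sub] emeasure_restrict_space[OF _ sub])
  show "(LINT x|LM L. indicator (ball 0 \<rho>) x * c) = measure lebesgue (ball (0 :: real^2) \<rho>) * c"
    by (simp add: Int_absorb2[OF sub] measure_restrict_space[OF _ sub])
qed

text \<open>The zero extension \<open>U\<close> vanishes on the disc, so there its deviation from
  the mean \<open>c\<close> has modulus \<open>norm c\<close>. Hence the area \<open>b\<close> of
  the disc times the square of \<open>norm c\<close> is at most the squared norm of the deviation,
  and the inequality on the torus controls the mean as well.\<close>

lemma V0_Poincare:
  assumes r: "0 < r" "r < L"
  shows "\<exists>C. \<forall>v\<in>V0_sigma L r. L2norm (lebesgue_on (Omega L r)) v \<le> C * L2norm (lebesgue_on (Omega L r)) (wgrad (Omega L r) v)"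
proof -
  have L: "0 < L" using r by simp
  define b where "b = measure lebesgue (ball (0 :: real^2) r)"
  have b: "b > 0" using content_ball_pos[OF r(1), of "0 :: real^2"] by (simp add: b_def)
  have "L2norm (lebesgue_on (Omega L r)) v \<le> (1 + 2 * L / sqrt b) * (6 * L) * L2norm (lebesgue_on (Omega L r)) (wgrad (Omega L r) v)"
    if v: "v \<in> V0_sigma L r" for v
  proof -
    define U where "U = zero_ext r v"
    define c where "c = mean (Omega L 0) U"
    have UH: "U \<in> H1per_sigma L 0" and UG: "AE x in LM L. wgrad (Omega L 0) U x = zext r (wgrad (Omega L r) v) x"
      using V0_zero_ext[OF r v] by (simp_all add: U_def)
    note F = H1_fieldD[OF null_boundary_Omega V0_H1_field[OF r(1) v]]
    have UL: "U \<in> L2 (LM L)" unfolding U_def zero_ext_zext by (rule zext_L2[OF F(1)])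
    have UcL: "(\<lambda>x. U x - c) \<in> L2 (LM L)" by (intro L2_diff UL L2_const)
    note d = H1per_0_diff_const[OF L UH, of c]
    have dH: "(\<lambda>x. U x - c) \<in> H1per L 0" using d(1) by (simp add: H1per_sigma_def)
    have mean0: "(LINT x|LM L. U x - c) = 0"
      using L2_integrable[OF UL] L2_integrable[OF L2_const[of c L]] L
      by (simp add: c_def mean_def measure_restrict_space measure_Omega[OF L])
    have gU: "L2norm (LM L) (wgrad (Omega L 0) (\<lambda>x. U x - c)) = L2norm (lebesgue_on (Omega L r)) (wgrad (Omega L r) v)"
    proof -
      have "L2norm (LM L) (wgrad (Omega L 0) (\<lambda>x. U x - c)) = L2norm (LM L) (zext r (wgrad (Omega L r) v))"
      proof (rule L2norm_lebesgue_cong_AE[OF Omega_sets])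
        show "wgrad (Omega L 0) (\<lambda>x. U x - c) \<in> L2 (LM L)" by (rule H1_fieldD(3)[OF null_boundary_Omega H1per_0D(1)[OF L dH]])
        show "AE x in LM L. wgrad (Omega L 0) (\<lambda>x. U x - c) x = zext r (wgrad (Omega L r) v) x" using d(2) UG by eventually_elim simp
      qed
      then show ?thesis by (simp add: zext_L2norm)
    qed
    have P: "L2norm (LM L) (\<lambda>x. U x - c) \<le> 6 * L * L2norm (lebesgue_on (Omega L r)) (wgrad (Omega L r) v)"
      using Poincare_H1per[OF L dH mean0] gU by simp
    have "b * (norm c)\<^sup>2 \<le> (L2norm (LM L) (\<lambda>x. U x - c))\<^sup>2"
    proof -
      note i = ball_indicator[OF less_imp_le[OF r(2)], of "(norm c)\<^sup>2"]
      have "(LINT x|LM L. indicator (ball 0 r) x * (norm c)\<^sup>2) \<le> (LINT x|LM L. (norm (U x - c))\<^sup>2)"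
      proof (rule integral_mono[OF i(1)])
        show "integrable (LM L) (\<lambda>x. (norm (U x - c))\<^sup>2)" using UcL by (simp add: L2_def)
        show "indicator (ball 0 r) x * (norm c)\<^sup>2 \<le> (norm (U x - c))\<^sup>2" for x
          by (auto simp: U_def zero_ext_def indicator_def)
      qed
      then show ?thesis by (simp only: L2norm_power2 i(2) b_def)
    qed
    then have "sqrt (b * (norm c)\<^sup>2) \<le> L2norm (LM L) (\<lambda>x. U x - c)" by (intro real_le_lsqrt) auto
    then have nc: "norm c \<le> L2norm (LM L) (\<lambda>x. U x - c) / sqrt b" using b by (simp add: real_sqrt_mult field_simps)
    have "L2norm (LM L) U \<le> L2norm (LM L) (\<lambda>_. c) + L2norm (LM L) (\<lambda>x. U x - c)" by (rule L2norm_triangle_sub[OF UL L2_const])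
    also have "\<dots> = norm c * (2 * L) + L2norm (LM L) (\<lambda>x. U x - c)" by (simp only: L2norm_const[OF L])
    also have "\<dots> \<le> L2norm (LM L) (\<lambda>x. U x - c) / sqrt b * (2 * L) + L2norm (LM L) (\<lambda>x. U x - c)"
      using L by (intro add_right_mono mult_right_mono nc) simp
    also have "\<dots> = (1 + 2 * L / sqrt b) * L2norm (LM L) (\<lambda>x. U x - c)" by (simp add: algebra_simps)
    also have "\<dots> \<le> (1 + 2 * L / sqrt b) * (6 * L * L2norm (lebesgue_on (Omega L r)) (wgrad (Omega L r) v))"
      using L b by (intro mult_left_mono P) auto
    finally show ?thesis by (simp add: U_def zero_ext_zext zext_L2norm mult.assoc)
  qed
  then show ?thesis by blast
qed

lemma V0_solution:
  assumes r: "0 < r" "r < L" and f: "f \<in> L2 (LM L)"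
  shows "\<exists>u. weak_solution (Omega L r) (V0_sigma L r) f u"
    "weak_solution (Omega L r) (V0_sigma L r) f u \<Longrightarrow> weak_solution (Omega L r) (V0_sigma L r) f u' \<Longrightarrow>
      AE x in lebesgue_on (Omega L r). u' x = u x"
proof -
  obtain C where C: "\<forall>v\<in>V0_sigma L r. L2norm (lebesgue_on (Omega L r)) v \<le> C * L2norm (lebesgue_on (Omega L r)) (wgrad (Omega L r) v)"
    using V0_Poincare[OF r] by blast
  have ne: "V0_sigma L r \<noteq> {}" using V0_zero[OF r] by blast
  have sub: "V0_sigma L r \<subseteq> H1_field (Omega L r)" using V0_H1_field[OF r(1)] by blast
  have fr: "f \<in> L2 (lebesgue_on (Omega L r))" using L2_restrict[OF _ f, of r] r by simp
  note P = energy_problem[OF null_boundary_Omega ne sub V0_lincomb[OF r] bspec[OF C] V0_closed[OF r] fr]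
  show "\<exists>u. weak_solution (Omega L r) (V0_sigma L r) f u" by (rule P(1))
  show "weak_solution (Omega L r) (V0_sigma L r) f u \<Longrightarrow> weak_solution (Omega L r) (V0_sigma L r) f u' \<Longrightarrow>
      AE x in lebesgue_on (Omega L r). u' x = u x" by (rule P(2))
qed

section \<open>The limit problem on the torus\<close>

definition mean_zero :: "real \<Rightarrow> (real^2 \<Rightarrow> real^2) set" where
  "mean_zero L = {v \<in> H1per_sigma L 0. (LINT x|LM L. v x) = 0}"

lemma mean_free:
  assumes L: "0 < L" and "v \<in> L2 (LM L)" shows "(LINT x|LM L. v x - mean (Omega L 0) v) = 0"
  using L2_integrable[OF assms(2)] L2_integrable[OF L2_const[of "mean (Omega L 0) v" L]] L
  by (simp add: mean_def measure_restrict_space measure_Omega[OF L])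

text \<open>The inequality of Poincare is available for mean zero only, so the problem is solved on
  \<open>mean_zero L\<close>. A general test field differs from an admissible one by a constant,
  which has no gradient and is orthogonal to \<open>f\<close> because \<open>f\<close> has mean
  zero.\<close>

lemma periodic_solution:
  assumes L: "0 < L" and f: "f \<in> L2 (LM L)" and mf: "(LINT x|LM L. f x) = 0"
  shows "\<exists>u. weak_solution (Omega L 0) (H1per_sigma L 0) f u \<and> (LINT x|LM L. u x) = 0"
    "\<lbrakk>weak_solution (Omega L 0) (H1per_sigma L 0) f u; (LINT x|LM L. u x) = 0;
      weak_solution (Omega L 0) (H1per_sigma L 0) f u'; (LINT x|LM L. u' x) = 0\<rbrakk> \<Longrightarrow> AE x in LM L. u' x = u x"
proof -
  let ?S = "Omega L 0" and ?X = "mean_zero L"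
  have XH: "v \<in> H1_field ?S" if "v \<in> H1per_sigma L 0" for v using that H1per_0D(1)[OF L] by (simp add: H1per_sigma_def)
  note XL = H1_fieldD[OF null_boundary_Omega XH]
  have ne: "?X \<noteq> {}" using H1per_0_const(1)[OF L, of 0] by (auto simp: mean_zero_def)
  have sub: "?X \<subseteq> H1_field ?S" using XH by (auto simp: mean_zero_def)
  have lc: "(\<lambda>x. u x + c *\<^sub>R v x) \<in> ?X" if "u \<in> ?X" "v \<in> ?X" for u v c
    using that H1per_0_lincomb[OF L, of u v c] L2_integrable[OF XL(1), of u] L2_integrable[OF XL(1), of v] by (simp add: mean_zero_def)
  have P: "L2norm (LM L) v \<le> 6 * L * L2norm (LM L) (wgrad ?S v)" if "v \<in> ?X" for v
    using that Poincare_H1per[OF L, of v] by (simp add: mean_zero_def H1per_sigma_def)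
  have cl: "v \<in> ?X \<and> (AE x in LM L. wgrad ?S v x = G x)" if s: "\<And>n. s n \<in> ?X" and v: "v \<in> L2 (LM L)" "G \<in> L2 (LM L)"
     and c: "(\<lambda>n. L2norm (LM L) (\<lambda>x. s n x - v x)) \<longlonglongrightarrow> 0" "(\<lambda>n. L2norm (LM L) (\<lambda>x. wgrad ?S (s n) x - G x)) \<longlonglongrightarrow> 0" for s :: "nat \<Rightarrow> real^2 \<Rightarrow> real^2" and v G
  proof -
    have s': "s n \<in> H1per_sigma L 0" "(LINT x|LM L. s n x) = 0" for n using s[of n] by (auto simp: mean_zero_def)
    note h = H1per_0_closed[OF L s'(1) v c]
    \<comment> \<open>The mean passes to the limit through pairings with constant fields.\<close>
    have "(LINT x|LM L. v x) \<bullet> e = 0" for e :: "real^2"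
    proof -
      have "(\<lambda>n. LINT x|LM L. s n x \<bullet> e) \<longlonglongrightarrow> (LINT x|LM L. v x \<bullet> e)"
        by (rule L2_limit_inner[OF XL(1)[OF s'(1)] v(1) L2_const c(1)])
      moreover have "(LINT x|LM L. s n x \<bullet> e) = 0" for n
        using integral_inner_left[OF L2_integrable[OF XL(1)[OF s'(1)[of n]]], of e] s'(2) by simp
      ultimately have "(LINT x|LM L. v x \<bullet> e) = 0" using LIMSEQ_unique[OF _ tendsto_const[of 0]] by simp
      then show ?thesis using integral_inner_left[OF L2_integrable[OF v(1)], of e] by simp
    qed
    from this[of "LINT x|LM L. v x"] show ?thesis using h by (simp add: mean_zero_def)
  qed
  note E = energy_problem[OF null_boundary_Omega ne sub lc P cl f]
  have "\<exists>z. weak_solution ?S ?X f z" by (rule E(1))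
  then obtain z where z: "weak_solution ?S ?X f z" by blast
  have "(LINT x|LM L. wgrad ?S z x \<bullet> wgrad ?S v x) = (LINT x|LM L. f x \<bullet> v x)" if v: "v \<in> H1per_sigma L 0" for v
  proof -
    define c where "c = mean ?S v"
    note d = H1per_0_diff_const[OF L v, of c]
    have vc: "(\<lambda>x. v x - c) \<in> ?X" using d(1) mean_free[OF L XL(1)[OF v]] by (simp add: mean_zero_def c_def)
    have zH: "z \<in> H1per_sigma L 0" using z by (simp add: weak_solution_def mean_zero_def)
    have "(LINT x|LM L. wgrad ?S z x \<bullet> wgrad ?S v x) = (LINT x|LM L. wgrad ?S z x \<bullet> wgrad ?S (\<lambda>x. v x - c) x)"
    proof (rule integral_cong_AE)
      show "(\<lambda>x. wgrad ?S z x \<bullet> wgrad ?S v x) \<in> borel_measurable (LM L)"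
        using L2_inner_integrable[OF XL(3)[OF zH] XL(3)[OF v]] by blast
      show "(\<lambda>x. wgrad ?S z x \<bullet> wgrad ?S (\<lambda>x. v x - c) x) \<in> borel_measurable (LM L)"
        using L2_inner_integrable[OF XL(3)[OF zH] XL(3)[OF d(1)]] by blast
      show "AE x in LM L. wgrad ?S z x \<bullet> wgrad ?S v x = wgrad ?S z x \<bullet> wgrad ?S (\<lambda>x. v x - c) x"
        using d(2) by eventually_elim simp
    qed
    also have "\<dots> = (LINT x|LM L. f x \<bullet> (v x - c))" using z vc by (auto simp: weak_solution_def)
    also have "\<dots> = (LINT x|LM L. f x \<bullet> v x) - (LINT x|LM L. f x \<bullet> c)"
      using L2_inner_integrable[OF f XL(1)[OF v]] L2_inner_integrable[OF f L2_const[of c L]] by (simp add: inner_diff_right)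
    also have "(LINT x|LM L. f x \<bullet> c) = 0" using integral_inner_left[OF L2_integrable[OF f], of c] mf by simp
    finally show ?thesis by simp
  qed
  then show "\<exists>u. weak_solution ?S (H1per_sigma L 0) f u \<and> (LINT x|LM L. u x) = 0"
    using z by (auto simp: weak_solution_def mean_zero_def)
  assume a: "weak_solution ?S (H1per_sigma L 0) f u" "(LINT x|LM L. u x) = 0" "weak_solution ?S (H1per_sigma L 0) f u'" "(LINT x|LM L. u' x) = 0"
  then have "weak_solution ?S ?X f u" "weak_solution ?S ?X f u'" by (auto simp: weak_solution_def mean_zero_def)
  then show "AE x in LM L. u' x = u x" by (rule E(2)[rotated -2])
qed

section \<open>Cutting off stream functions\<close>

lemma max_power_derivative:
  "((\<lambda>t::real. (max 0 t) ^ (n + 2)) has_real_derivative (of_nat n + 2) * (max 0 t) ^ (n + 1)) (at t)"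
proof -
  consider "t < 0" | "t > 0" | "t = 0" by linarith
  then show ?thesis
  proof cases
    case 1
    have "((\<lambda>_. 0) has_real_derivative 0) (at t)" by simp
    then have "((\<lambda>t::real. (max 0 t) ^ (n + 2)) has_real_derivative 0) (at t)"
      by (rule has_field_derivative_transform_within_open[where S = "{..<0}"]) (use 1 in auto)
    then show ?thesis using 1 by simp
  next
    case 2
    have "((\<lambda>t. t ^ (n + 2)) has_real_derivative (of_nat n + 2) * t ^ (n + 1)) (at t)"
      using DERIV_pow[of "n + 2" t] by (simp add: add.commute)
    then have "((\<lambda>t::real. (max 0 t) ^ (n + 2)) has_real_derivative (of_nat n + 2) * t ^ (n + 1)) (at t)"
      by (rule has_field_derivative_transform_within_open[where S = "{0<..}"]) (use 2 in auto)
    then show ?thesis using 2 by simp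
  next
    case 3
    have "(\<lambda>h::real. \<bar>h\<bar> ^ (n + 1)) \<midarrow>0\<rightarrow> \<bar>0\<bar> ^ (n + 1)" by (intro tendsto_intros)
    then have l: "(\<lambda>h::real. \<bar>h\<bar> ^ (n + 1)) \<midarrow>0\<rightarrow> 0" by simp
    have "(\<lambda>h::real. (max 0 h) ^ (n + 2) / h) \<midarrow>0\<rightarrow> 0"
    proof (rule Lim_null_comparison[OF always_eventually l], rule allI)
      fix h :: real
      show "norm ((max 0 h) ^ (n + 2) / h) \<le> \<bar>h\<bar> ^ (n + 1)" 
      proof (cases "h \<le> 0")
        case True
        then have "max 0 h = 0" by simp
        then have "norm ((max 0 h) ^ (n + 2) / h) = 0" by (simp only: power_0_left) simp
        then show ?thesis by (simp only:) (rule zero_le_power, simp)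
      next
        case False
        then have "norm ((max 0 h) ^ (n + 2) / h) = \<bar>h\<bar> ^ (n + 1)" by (simp add: max.absorb2)
        then show ?thesis by (simp only:)
      qed
    qed
    then show ?thesis using 3 by (simp add: DERIV_def)
  qed
qed

text \<open>A piecewise polynomial cutoff, 1 for \<open>t \<le> 0\<close> and 0 for
  \<open>t \<ge> 1\<close>. The two cubes make it twice continuously differentiable, with
  derivatives \<open>cut1\<close> and \<open>cut2\<close>. This order is enough: the cut-off field
  consists of first derivatives of a cut-off stream function and has to be C^1.\<close>

definition cut :: "real \<Rightarrow> real" where "cut t = (max 0 (1 - (max 0 t) ^ 3)) ^ 3"
definition cut1 :: "real \<Rightarrow> real" where "cut1 t = - 9 * (max 0 (1 - (max 0 t) ^ 3))\<^sup>2 * (max 0 t)\<^sup>2"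
definition cut2 :: "real \<Rightarrow> real" where
  "cut2 t = 54 * max 0 (1 - (max 0 t) ^ 3) * (max 0 t) ^ 4 - 18 * (max 0 (1 - (max 0 t) ^ 3))\<^sup>2 * max 0 t"

lemma cut_derivative: "(cut has_real_derivative cut1 t) (at t)" "(cut1 has_real_derivative cut2 t) (at t)"
proof -
  have p3: "((\<lambda>t::real. (max 0 t) ^ 3) has_real_derivative 3 * (max 0 t)\<^sup>2) (at t)" for t using max_power_derivative[of 1 t] by (simp add: numeral_eq_Suc)
  have p2: "((\<lambda>t::real. (max 0 t)\<^sup>2) has_real_derivative 2 * max 0 t) (at t)" for t using max_power_derivative[of 0 t] by (simp add: numeral_eq_Suc)
  have i: "((\<lambda>t::real. 1 - (max 0 t) ^ 3) has_real_derivative - (3 * (max 0 t)\<^sup>2)) (at t)" 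
    using DERIV_diff[OF DERIV_const p3, of 1 t] by simp
  show "(cut has_real_derivative cut1 t) (at t)"
    unfolding cut_def[abs_def] by (rule DERIV_cong[OF DERIV_chain2[OF p3 i]]) (simp add: cut1_def)
  have "((\<lambda>t. (max 0 (1 - (max 0 t) ^ 3))\<^sup>2) has_real_derivative 2 * max 0 (1 - (max 0 t) ^ 3) * - (3 * (max 0 t)\<^sup>2)) (at t)"
    by (rule DERIV_chain2[OF p2 i])
  from DERIV_mult[OF DERIV_cmult[OF this, of "-9"] p2]
  show "(cut1 has_real_derivative cut2 t) (at t)"
    unfolding cut1_def[abs_def] by (rule DERIV_cong) (simp add: cut2_def power2_eq_square power4_eq_xxxx)
qed

lemma cut_continuous: "continuous_on UNIV cut" "continuous_on UNIV cut1" "continuous_on UNIV cut2"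
  unfolding cut_def cut1_def cut2_def by (intro continuous_intros)+

lemma cut_nonpos: "t \<le> 0 \<Longrightarrow> cut t = 1 \<and> cut1 t = 0 \<and> cut2 t = 0" by (simp add: cut_def cut1_def cut2_def max_def)

lemma cut_ge_1: assumes "1 \<le> t" shows "cut t = 0 \<and> cut1 t = 0 \<and> cut2 t = 0"
proof -
  have "max 0 t = t" "1 \<le> t ^ 3" using assms by (auto simp: one_le_power)
  then have "max 0 (1 - (max 0 t) ^ 3) = 0" by simp
  then show ?thesis by (simp add: cut_def cut1_def cut2_def)
qed

text \<open>For \<open>t\<close> in the unit interval every factor lies in \<open>[0, 1]\<close>. So
  9 is the coefficient of \<open>cut1\<close>, and 72 is \<open>54 + 18\<close> from the two terms
  of \<open>cut2\<close>.\<close>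

lemma cut_bounds: "\<bar>cut t\<bar> \<le> 1" "\<bar>cut1 t\<bar> \<le> 9" "\<bar>cut2 t\<bar> \<le> 72"
proof -
  consider "t \<le> 0" | "1 \<le> t" | "0 < t" "t < 1" by linarith
  then have "\<bar>cut t\<bar> \<le> 1 \<and> \<bar>cut1 t\<bar> \<le> 9 \<and> \<bar>cut2 t\<bar> \<le> 72"
  proof cases
    case 3
    define a where "a = 1 - t ^ 3"
    have "t ^ 3 \<le> 1" "0 \<le> t ^ 3" using 3 by (auto intro: power_le_one)
    then have a: "0 \<le> a" "a \<le> 1" by (auto simp: a_def)
    have p: "0 \<le> x ^ n \<and> x ^ n \<le> 1" if "0 \<le> x" "x \<le> 1" for x :: real and n using that by (auto intro: power_le_one)
    have m: "0 \<le> x * y \<and> x * y \<le> 1" if "0 \<le> x" "x \<le> 1" "0 \<le> y" "y \<le> 1" for x y :: real using that by (auto intro: mult_le_one)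
    have e: "cut t = a ^ 3" "cut1 t = - 9 * (a\<^sup>2 * t\<^sup>2)" "cut2 t = 54 * (a * t ^ 4) - 18 * (a\<^sup>2 * t)"
      using 3 a by (simp_all add: cut_def cut1_def cut2_def a_def)
    have "0 \<le> a\<^sup>2 * t\<^sup>2 \<and> a\<^sup>2 * t\<^sup>2 \<le> 1" "0 \<le> a * t ^ 4 \<and> a * t ^ 4 \<le> 1" "0 \<le> a\<^sup>2 * t \<and> a\<^sup>2 * t \<le> 1"
      using m p[OF a] p[of t] 3 a by auto
    then show ?thesis unfolding e using p[OF a, of 3] by linarith
  qed (auto dest: cut_nonpos cut_ge_1)
  then show "\<bar>cut t\<bar> \<le> 1" "\<bar>cut1 t\<bar> \<le> 9" "\<bar>cut2 t\<bar> \<le> 72" by blast+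
qed

text \<open>The clockwise quarter turn. Its square is minus the identity, so a function with
  gradient \<open>- (rot *v W x)\<close> is a stream function of \<open>W\<close>: its rotated
  gradient is \<open>W\<close>.\<close>

definition rot :: "real^2^2" where "rot = (\<chi> i j. if i = j then 0 else if i = 1 then 1 else - 1)"

lemma rot_nth: "(rot *v x) $ 1 = x $ 2" "(rot *v x) $ 2 = - x $ 1"
  by (simp_all add: rot_def matrix_vector_mult_def sum_2)

lemma norm_rot: "norm (rot *v x) = norm x" "norm rot \<le> 2"
proof -
  show "norm (rot *v x) = norm x" by (simp add: norm_eq_sqrt_inner inner_vec_def sum_2 rot_nth add.commute)
  have "norm rot = sqrt 2" by (simp add: norm_eq_sqrt_inner inner_vec_def sum_2 rot_def)
  also have "\<dots> \<le> 2" by (rule real_le_lsqrt) auto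
  finally show "norm rot \<le> 2" .
qed

definition outer :: "real^2 \<Rightarrow> real^2 \<Rightarrow> real^2^2" where "outer a b = (\<chi> i. a $ i *\<^sub>R b)"

lemma outer_mult: "outer a b *v h = (b \<bullet> h) *\<^sub>R a"
  by (simp add: vec_eq_iff outer_def matrix_vector_mult_def inner_vec_def sum_distrib_right sum_2 algebra_simps)

lemma norm_outer: "norm (outer a b) = norm a * norm b"
proof (rule power2_eq_imp_eq)
  show "(norm (outer a b))\<^sup>2 = (norm a * norm b)\<^sup>2"
    unfolding power_mult_distrib power2_norm_eq_inner by (simp add: outer_def inner_vec_def sum_2 algebra_simps)
qed auto

lemma continuous_outer: "continuous_on S f \<Longrightarrow> continuous_on S g \<Longrightarrow> continuous_on S (\<lambda>x. outer (f x) (g x))"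
  unfolding outer_def by (intro continuous_on_vec_lambda continuous_intros continuous_on_nth)

text \<open>\<open>wrap L\<close> jumps across cell boundaries, but \<open>f\<close> vanishes near
  them, so locally the composition is a single translate of \<open>f\<close>. If the reduced point
  has norm below \<open>L\<close>, nearby points are reduced by the same lattice vector; otherwise
  both sides vanish within distance \<open>L - \<rho>\<close>.\<close>

lemma wrap_local:
  assumes L: "0 < L" and \<rho>: "\<rho> < L" and f: "\<And>x. \<rho> \<le> norm x \<Longrightarrow> f x = 0"
  shows "\<exists>\<delta>>0. \<forall>y. dist y x < \<delta> \<longrightarrow> f (wrap L y) = f (y - lat L (cell L x))"
proof (cases "norm (wrap L x) < L")
  case True
  have "wrap L y = y - lat L (cell L x)" if "dist y x < L - norm (wrap L x)" for y
  proof -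
    have e: "y - lat L (cell L x) = wrap L x + (y - x)" by (simp add: wrap_def)
    have "norm (y - lat L (cell L x)) \<le> norm (wrap L x) + dist y x" unfolding e dist_norm by (rule norm_triangle_ineq)
    then have n: "norm (y - lat L (cell L x)) < L" using that by simp
    have "- L \<le> (y - lat L (cell L x)) $ i \<and> (y - lat L (cell L x)) $ i < L" for i
      using le_less_trans[OF component_le_norm_cart n, of i] by linarith
    then have "\<forall>i. - L \<le> (y - lat L (cell L x)) $ i \<and> (y - lat L (cell L x)) $ i < L" by blast
    from wrap_add_lat[OF L this, of "cell L x"] show ?thesis by simp
  qed
  then have "\<forall>y. dist y x < L - norm (wrap L x) \<longrightarrow> f (wrap L y) = f (y - lat L (cell L x))"
    by (intro allI impI arg_cong[where f = f])
  moreover have "0 < L - norm (wrap L x)" using True by simp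
  ultimately show ?thesis by blast
next
  case False
  have "f (wrap L y) = f (y - lat L (cell L x))" if y: "dist y x < L - \<rho>" for y
  proof -
    have "norm (wrap L x) - dist y x \<le> norm (y - lat L (cell L x))"
      using norm_triangle_ineq2[of "wrap L x" "x - y"] by (simp add: wrap_def dist_norm norm_minus_commute)
    then have 1: "f (y - lat L (cell L x)) = 0" using y False by (intro f) simp
    \<comment> \<open>Otherwise \<open>wrap L y\<close>, moved by less than
      \<open>L - \<rho>\<close>, would stay inside the disc of radius \<open>L\<close> and be the
      reduction of \<open>x\<close>, whose norm is at least \<open>L\<close>.\<close>
    have "\<rho> \<le> norm (wrap L y)"
    proof (rule ccontr)
      assume "\<not> \<rho> \<le> norm (wrap L y)"
      then have n: "norm (wrap L y + (x - y)) < L" using norm_triangle_ineq[of "wrap L y" "x - y"] y by (simp add: dist_norm norm_minus_commute)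
      have "- L \<le> (wrap L y + (x - y)) $ i \<and> (wrap L y + (x - y)) $ i < L" for i
        using le_less_trans[OF component_le_norm_cart n, of i] by linarith
      then have "\<forall>i. - L \<le> (wrap L y + (x - y)) $ i \<and> (wrap L y + (x - y)) $ i < L" by blast
      from wrap_add_lat[OF L this, of "cell L y"] have "wrap L x = wrap L y + (x - y)" by (simp add: wrap_def)
      then show False using n False by simp
    qed
    then show ?thesis using f 1 by simp
  qed
  then show ?thesis using \<rho> by (intro exI[of _ "L - \<rho>"]) auto
qed

text \<open>\<open>\<psi>\<close> is a stream function of the periodic solenoidal field
  \<open>W\<close>. Two instances occur: a mollified field minus its value at 0, and a constant
  field.\<close>

locale stream_cutoff =
  fixes L \<epsilon> :: real and W :: "real^2 \<Rightarrow> real^2" and J :: "real^2 \<Rightarrow> real^2^2" and \<psi> :: "real^2 \<Rightarrow> real"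
  assumes eps: "0 < \<epsilon>" "2 * \<epsilon> < L"
    and W: "\<And>x. (W has_derivative (\<lambda>h. J x *v h)) (at x)" and Jc: "continuous_on UNIV J"
    and tr: "\<And>x. (\<Sum>i\<in>UNIV. J x $ i $ i) = 0" and per: "periodic_field L W"
    and \<psi>: "\<And>x. (\<psi> has_derivative (\<lambda>h. - (rot *v W x) \<bullet> h)) (at x)"
begin

text \<open>Affine in the squared radius, hence smooth at the origin, with value 0 for
  \<open>norm x = \<epsilon>\<close> and 1 for \<open>norm x = 2 * \<epsilon>\<close>. Its gradient
  is \<open>\<kappa> *\<^sub>R x\<close>.\<close>

definition \<tau> :: "real^2 \<Rightarrow> real" where "\<tau> x = (x \<bullet> x / \<epsilon>\<^sup>2 - 1) / 3"
definition \<kappa> :: real where "\<kappa> = 2 / (3 * \<epsilon>\<^sup>2)"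

text \<open>\<open>q\<close> is the rotated gradient of \<open>cut (\<tau> x) * \<psi> x\<close>; it is divergence free, and it interpolates between \<open>W\<close>
  for \<open>\<tau> x \<le> 0\<close> and \<open>0\<close> for \<open>\<tau> x \<ge> 1\<close>.\<close>

definition q :: "real^2 \<Rightarrow> real^2" where
  "q x = (\<kappa> * cut1 (\<tau> x) * \<psi> x) *\<^sub>R (rot *v x) + cut (\<tau> x) *\<^sub>R W x"
definition Q :: "real^2 \<Rightarrow> real^2^2" where
  "Q x = (\<kappa>\<^sup>2 * cut2 (\<tau> x) * \<psi> x) *\<^sub>R outer (rot *v x) x - (\<kappa> * cut1 (\<tau> x)) *\<^sub>R outer (rot *v x) (rot *v W x)
    + (\<kappa> * cut1 (\<tau> x) * \<psi> x) *\<^sub>R rot + (\<kappa> * cut1 (\<tau> x)) *\<^sub>R outer (W x) x + cut (\<tau> x) *\<^sub>R J x"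

lemma L: "0 < L" using eps by simp

lemma \<tau>_derivative: "(\<tau> has_derivative (\<lambda>h. \<kappa> * (x \<bullet> h))) (at x)"
  unfolding \<tau>_def[abs_def] \<kappa>_def using eps by (auto intro!: derivative_eq_intros simp: inner_commute field_simps)

lemma continuous: "continuous_on UNIV W" "continuous_on UNIV \<psi>" "continuous_on UNIV \<tau>"
  by (rule continuous_at_imp_continuous_on, use has_derivative_continuous[OF W] has_derivative_continuous[OF \<psi>] 
      has_derivative_continuous[OF \<tau>_derivative] in blast)+

lemma rot_derivative: "((\<lambda>x. rot *v x) has_derivative (\<lambda>h. rot *v h)) F"
  using bounded_linear.has_derivative[OF matrix_vector_mul_bounded_linear has_derivative_ident] .

lemma q_derivative: "(q has_derivative (\<lambda>h. Q x *v h)) (at x)"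
proof -
  have c: "((\<lambda>x. cut (\<tau> x)) has_derivative (\<lambda>h. \<kappa> * (x \<bullet> h) * cut1 (\<tau> x))) (at x)"
    and c1: "((\<lambda>x. cut1 (\<tau> x)) has_derivative (\<lambda>h. \<kappa> * (x \<bullet> h) * cut2 (\<tau> x))) (at x)"
    by (rule DERIV_compose_FDERIV[OF cut_derivative(1) \<tau>_derivative] DERIV_compose_FDERIV[OF cut_derivative(2) \<tau>_derivative])+
  have s: "((\<lambda>x. \<kappa> * cut1 (\<tau> x) * \<psi> x) has_derivative (\<lambda>h. \<kappa> * cut1 (\<tau> x) * (- (rot *v W x) \<bullet> h) + \<kappa> * (\<kappa> * (x \<bullet> h) * cut2 (\<tau> x)) * \<psi> x)) (at x)"
    by (rule has_derivative_mult[OF has_derivative_mult_right[OF c1] \<psi>])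
  have e: "(\<lambda>h. Q x *v h) = (\<lambda>h. ((\<kappa> * cut1 (\<tau> x) * \<psi> x) *\<^sub>R (rot *v h) + (\<kappa> * cut1 (\<tau> x) * (- (rot *v W x) \<bullet> h) + \<kappa> * (\<kappa> * (x \<bullet> h) * cut2 (\<tau> x)) * \<psi> x) *\<^sub>R (rot *v x))
     + (cut (\<tau> x) *\<^sub>R (J x *v h) + (\<kappa> * (x \<bullet> h) * cut1 (\<tau> x)) *\<^sub>R W x))"
    unfolding Q_def
    by (rule ext) (simp add: matrix_vector_mult_add_rdistrib matrix_vector_mult_diff_rdistrib scaleR_matrix_vector_assoc[symmetric] outer_mult 
        scaleR_left.add scaleR_left.diff power2_eq_square mult_ac)
  show ?thesis unfolding q_def[abs_def] e
    by (rule has_derivative_add[OF has_derivative_scaleR[OF s rot_derivative] has_derivative_scaleR[OF c W]])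
qed

lemma Q_continuous: "continuous_on UNIV Q"
proof -
  have c: "continuous_on UNIV (\<lambda>x. cut (\<tau> x))" "continuous_on UNIV (\<lambda>x. cut1 (\<tau> x))" "continuous_on UNIV (\<lambda>x. cut2 (\<tau> x))"
    by (rule continuous_on_compose2[OF _ continuous(3)], rule cut_continuous, simp)+
  have r: "continuous_on UNIV (\<lambda>x. rot *v f x)" if "continuous_on UNIV f" for f :: "real^2 \<Rightarrow> real^2"
    by (rule bounded_linear.continuous_on[OF matrix_vector_mul_bounded_linear that])
  show ?thesis unfolding Q_def[abs_def] by (intro continuous_intros continuous_outer r c continuous Jc)
qed

text \<open>\<open>rot *v x\<close> is orthogonal to \<open>x\<close>, \<open>rot\<close> has zero
  diagonal, and the two mixed outer products have opposite traces because \<open>rot\<close>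
  preserves inner products.\<close>

lemma Q_trace: "(\<Sum>i\<in>UNIV. Q x $ i $ i) = 0"
proof -
  have "J x $ 2 $ 2 = - J x $ 1 $ 1" using tr[of x] by (simp add: sum_2)
  moreover have "rot $ 1 $ 1 = 0" "rot $ 2 $ 2 = 0" by (simp_all add: rot_def)
  ultimately show ?thesis by (simp add: sum_2 Q_def outer_def rot_nth algebra_simps)
qed

lemma inner_region: assumes "norm x \<le> \<epsilon>" shows "q x = W x" "Q x = J x"
proof -
  have "x \<bullet> x \<le> \<epsilon>\<^sup>2" using assms by (simp add: power2_norm_eq_inner[symmetric] power_mono)
  then have "\<tau> x \<le> 0" using eps by (simp add: \<tau>_def field_simps)
  from cut_nonpos[OF this] show "q x = W x" "Q x = J x" by (simp_all add: q_def Q_def)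
qed

lemma outer_region: assumes "2 * \<epsilon> \<le> norm x" shows "q x = 0" "Q x = 0"
proof -
  have "(2 * \<epsilon>)\<^sup>2 \<le> (norm x)\<^sup>2" using assms eps by (intro power_mono) auto
  then have "4 * \<epsilon>\<^sup>2 \<le> x \<bullet> x" by (simp add: power2_norm_eq_inner power_mult_distrib)
  then have "1 \<le> \<tau> x" using eps by (simp add: \<tau>_def field_simps)
  from cut_ge_1[OF this] show "q x = 0" "Q x = 0" by (simp_all add: q_def Q_def)
qed

lemma q_bound: "norm (q x) \<le> 12 * \<bar>\<psi> x\<bar> / \<epsilon> + norm (W x)"
proof (cases "2 * \<epsilon> \<le> norm x")
  case True
  then show ?thesis using eps by (simp add: outer_region)
next
  case False
  have "norm (q x) \<le> \<kappa> * \<bar>cut1 (\<tau> x)\<bar> * \<bar>\<psi> x\<bar> * norm x + \<bar>cut (\<tau> x)\<bar> * norm (W x)"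
    unfolding q_def using eps by (intro order_trans[OF norm_triangle_ineq]) (simp add: norm_rot abs_mult \<kappa>_def)
  also have "\<dots> \<le> \<kappa> * 9 * \<bar>\<psi> x\<bar> * (2 * \<epsilon>) + 1 * norm (W x)"
    using False eps by (intro add_mono mult_mono cut_bounds) (auto simp: \<kappa>_def)
  also have "\<kappa> * 9 * \<bar>\<psi> x\<bar> * (2 * \<epsilon>) = 12 * \<bar>\<psi> x\<bar> / \<epsilon>" using eps by (simp add: \<kappa>_def field_simps power2_eq_square)
  finally show ?thesis by simp
qed

text \<open>Within the disc of radius \<open>2 * \<epsilon>\<close> the constant 140 is
  \<open>128 + 12\<close>, from \<open>cut2\<close> with the square of \<open>norm x\<close> and
  from \<open>cut1\<close> with \<open>rot\<close>; 24 collects the two mixed terms, 12 each. All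
  terms stay bounded as the scale shrinks when \<open>\<psi>\<close> is quadratically small and
  \<open>W\<close> linearly small at 0.\<close>

lemma Q_bound: "norm (Q x) \<le> 140 * \<bar>\<psi> x\<bar> / \<epsilon>\<^sup>2 + 24 * norm (W x) / \<epsilon> + norm (J x)"
proof (cases "2 * \<epsilon> \<le> norm x")
  case True
  then show ?thesis using eps by (simp add: outer_region)
next
  case False
  have k: "0 \<le> \<kappa>" by (simp add: \<kappa>_def)
  have "norm (Q x) \<le> norm ((\<kappa>\<^sup>2 * cut2 (\<tau> x) * \<psi> x) *\<^sub>R outer (rot *v x) x) + norm ((\<kappa> * cut1 (\<tau> x)) *\<^sub>R outer (rot *v x) (rot *v W x))
    + norm ((\<kappa> * cut1 (\<tau> x) * \<psi> x) *\<^sub>R rot) + norm ((\<kappa> * cut1 (\<tau> x)) *\<^sub>R outer (W x) x) + norm (cut (\<tau> x) *\<^sub>R J x)"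
    unfolding Q_def by (intro order_trans[OF norm_triangle_ineq] order_trans[OF norm_triangle_ineq4] add_mono order_refl)
  also have "\<dots> = \<kappa>\<^sup>2 * \<bar>cut2 (\<tau> x)\<bar> * \<bar>\<psi> x\<bar> * (norm x * norm x) + \<kappa> * \<bar>cut1 (\<tau> x)\<bar> * (norm x * norm (W x))
    + \<kappa> * \<bar>cut1 (\<tau> x)\<bar> * \<bar>\<psi> x\<bar> * norm rot + \<kappa> * \<bar>cut1 (\<tau> x)\<bar> * (norm (W x) * norm x) + \<bar>cut (\<tau> x)\<bar> * norm (J x)"
    using k by (simp add: norm_outer norm_rot abs_mult)
  also have "\<dots> \<le> \<kappa>\<^sup>2 * 72 * \<bar>\<psi> x\<bar> * ((2 * \<epsilon>) * (2 * \<epsilon>)) + \<kappa> * 9 * ((2 * \<epsilon>) * norm (W x))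
    + \<kappa> * 9 * \<bar>\<psi> x\<bar> * 2 + \<kappa> * 9 * (norm (W x) * (2 * \<epsilon>)) + 1 * norm (J x)"
    using False eps k by (intro add_mono mult_mono cut_bounds norm_rot mult_nonneg_nonneg order_refl) auto
  also have "\<dots> = 140 * \<bar>\<psi> x\<bar> / \<epsilon>\<^sup>2 + 24 * norm (W x) / \<epsilon> + norm (J x)"
    using eps by (simp add: \<kappa>_def field_simps power2_eq_square)
  finally show ?thesis .
qed

text \<open>Zero on the discs of radius \<open>\<epsilon>\<close> about the lattice points and equal
  to \<open>W\<close> off those of radius \<open>2 * \<epsilon>\<close>. Since \<open>q\<close> is
  supported within the cell, its periodic copy stays C^1.\<close>

definition V :: "real^2 \<Rightarrow> real^2" where "V x = W x - q (wrap L x)"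

lemma V_derivative: "(V has_derivative (\<lambda>h. (J x - Q (wrap L x)) *v h)) (at x)"
proof -
  let ?a = "lat L (cell L x)"
  obtain \<delta> where \<delta>: "\<delta> > 0" "\<forall>y. dist y x < \<delta> \<longrightarrow> q (wrap L y) = q (y - ?a)"
    using wrap_local[OF L eps(2), of q x] outer_region(1) by blast
  have "((\<lambda>y. y - ?a) has_derivative (\<lambda>h. h)) (at x)" by (auto intro!: derivative_eq_intros)
  then have "((\<lambda>y. q (y - ?a)) has_derivative (\<lambda>h. Q (x - ?a) *v h)) (at x)"
    by (rule has_derivative_compose) (rule q_derivative)
  then have "((\<lambda>y. q (wrap L y)) has_derivative (\<lambda>h. Q (x - ?a) *v h)) (at x)"
    by (rule has_derivative_transform_within[OF _ \<delta>(1)]) (use \<delta>(2) in auto)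
  from has_derivative_diff[OF W this] show ?thesis
    by (simp add: V_def[abs_def] matrix_vector_mult_diff_rdistrib wrap_def)
qed

lemma V_Jacobian_continuous: "continuous_on UNIV (\<lambda>x. J x - Q (wrap L x))"
proof (intro continuous_on_diff Jc continuous_at_imp_continuous_on ballI)
  fix x
  let ?a = "lat L (cell L x)"
  obtain \<delta> where \<delta>: "\<delta> > 0" "\<forall>y. dist y x < \<delta> \<longrightarrow> Q (wrap L y) = Q (y - ?a)"
    using wrap_local[OF L eps(2), of Q x] outer_region(2) by blast
  have "continuous_on UNIV (\<lambda>y. Q (y - ?a))" by (rule continuous_on_compose2[OF Q_continuous]) (auto intro: continuous_intros)
  then have "continuous (at x) (\<lambda>y. Q (y - ?a))" by (simp add: continuous_on_eq_continuous_at)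
  then show "continuous (at x) (\<lambda>y. Q (wrap L y))"
    by (rule continuous_transform_within[OF _ \<delta>(1)]) (use \<delta>(2) in auto)
qed

lemma V_trace: "(\<Sum>i\<in>UNIV. (J x - Q (wrap L x)) $ i $ i) = 0"
  using tr[of x] Q_trace[of "wrap L x"] by (simp add: sum_subtractf)

lemma V_inner: assumes "norm x \<le> \<epsilon>" shows "V x = 0"
proof -
  have "- L \<le> x $ i \<and> x $ i < L" for i using component_le_norm_cart[of x i] assms eps by linarith
  then have "wrap L x = x" by (intro wrap_id[OF L] allI)
  then show ?thesis using inner_region(1)[OF assms] by (simp add: V_def)
qed

lemma V_periodic: "periodic_field L V"
  using per periodic_field_comp_wrap[OF L, of q] by (simp add: V_def[abs_def] periodic_field_def)

lemma V_H1:
  shows "V \<in> H1_field (Omega L r)" "AE x in lebesgue_on (Omega L r). wgrad (Omega L r) V x = transpose (J x - Q (wrap L x))"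
  using C1_H1_field(1,2)[of L r "\<lambda>x. J x - Q (wrap L x)" V] continuous_on_subset[OF V_Jacobian_continuous] V_derivative
  by (auto intro: has_derivative_at_withinI)

text \<open>\<open>V\<close> is C^1 and periodic on the whole plane and vanishes on the circle, so
  it approximates itself both in norm and in trace.\<close>

lemma V_in_V0:
  assumes r: "0 < r" "r \<le> \<epsilon>"
  shows "V \<in> V0_sigma L r" "zero_ext r V = V"
proof -
  have rL: "r < L" using r eps by simp
  let ?E = "periodic_ext L (closure (Omega L r))"
  have C: "V \<in> C1per L r" 
  proof -
    have "\<forall>x\<in>?E. (V has_derivative (\<lambda>h. (J x - Q (wrap L x)) *v h)) (at x within ?E)"
      using has_derivative_at_withinI[OF V_derivative] by blast
    then show ?thesis unfolding C1per_def Let_def mem_Collect_eq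
      by (intro conjI V_periodic exI[of _ "\<lambda>x. J x - Q (wrap L x)"] continuous_on_subset[OF V_Jacobian_continuous subset_UNIV])
  qed
  have "AE x in lebesgue_on (Omega L r). wdiv (Omega L r) V x = 0"
    using V_H1(2)[of r] by eventually_elim (use V_trace in \<open>simp add: wdiv_eq transpose_def\<close>)
  moreover have "V (circle_pt r \<theta>) = 0" for \<theta> by (rule V_inner) (use r norm_circle_pt[of r \<theta>] in simp)
  ultimately show "V \<in> V0_sigma L r"
    unfolding V0_sigma_iff[OF r(1) rL] using V_H1(1)[of r] C by (auto intro!: bexI[of _ V] simp: L2norm_def)
  show "zero_ext r V = V" by (rule ext) (use V_inner r in \<open>auto simp: zero_ext_def\<close>)
qed

lemma V_Omega: "x \<in> Omega L 0 \<Longrightarrow> V x = W x - q x" by (simp add: V_def wrap_Omega[OF L])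

lemma V_wgrad: "AE x in LM L. wgrad (Omega L 0) V x = transpose (J x) - transpose (Q x)"
proof -
  have "AE x in LM L. x \<in> Omega L 0" by (rule AE_I2) (simp add: space_restrict_space)
  moreover have "transpose (A - B) = transpose A - transpose B" for A B :: "real^2^2" by (simp add: transpose_def vec_eq_iff)
  ultimately show ?thesis using V_H1(2)[of 0] by (auto elim!: eventually_elim2 simp: wrap_Omega[OF L])
qed

end

section \<open>The limit of vanishing obstacles\<close>

lemma zero_ext_weak_equation:
  assumes r: "0 < r" "r < L" and u: "weak_solution (Omega L r) (V0_sigma L r) f u" and v: "v \<in> V0_sigma L r"
  shows "(LINT x|LM L. wgrad (Omega L 0) (zero_ext r u) x \<bullet> wgrad (Omega L 0) (zero_ext r v) x) = (LINT x|LM L. f x \<bullet> zero_ext r v x)"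
proof -
  have L: "0 < L" using r by simp
  have uV: "u \<in> V0_sigma L r" using u by (simp add: weak_solution_def)
  have ZL: "wgrad (Omega L 0) (zero_ext r z) \<in> L2 (LM L)" if "z \<in> V0_sigma L r" for z
    using V0_zero_ext(1)[OF r that] H1_fieldD(3)[OF null_boundary_Omega H1per_0D(1)[OF L]] by (simp add: H1per_sigma_def)
  note F = H1_fieldD(3)[OF null_boundary_Omega V0_H1_field[OF r(1)]]
  have "(LINT x|LM L. wgrad (Omega L 0) (zero_ext r u) x \<bullet> wgrad (Omega L 0) (zero_ext r v) x)
      = (LINT x|LM L. zext r (wgrad (Omega L r) u) x \<bullet> zext r (wgrad (Omega L r) v) x)"
  proof (rule integral_cong_AE)
    show "(\<lambda>x. wgrad (Omega L 0) (zero_ext r u) x \<bullet> wgrad (Omega L 0) (zero_ext r v) x) \<in> borel_measurable (LM L)"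
      using L2_inner_integrable[OF ZL[OF uV] ZL[OF v]] by blast
    show "(\<lambda>x. zext r (wgrad (Omega L r) u) x \<bullet> zext r (wgrad (Omega L r) v) x) \<in> borel_measurable (LM L)"
      using L2_inner_integrable[OF zext_L2[OF F[OF uV]] zext_L2[OF F[OF v]]] by blast
    show "AE x in LM L. wgrad (Omega L 0) (zero_ext r u) x \<bullet> wgrad (Omega L 0) (zero_ext r v) x
      = zext r (wgrad (Omega L r) u) x \<bullet> zext r (wgrad (Omega L r) v) x"
      using V0_zero_ext(2)[OF r uV] V0_zero_ext(2)[OF r v] by eventually_elim simp
  qed
  also have "(\<lambda>x. zext r (wgrad (Omega L r) u) x \<bullet> zext r (wgrad (Omega L r) v) x) = zext r (\<lambda>x. wgrad (Omega L r) u x \<bullet> wgrad (Omega L r) v x)"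
    by (rule ext) (simp add: zext_def)
  also have "(LINT x|LM L. zext r (\<lambda>x. wgrad (Omega L r) u x \<bullet> wgrad (Omega L r) v x) x) = (LINT x|lebesgue_on (Omega L r). f x \<bullet> v x)"
    unfolding zext_integral using u v by (simp add: weak_solution_def)
  also have "\<dots> = (LINT x|LM L. zext r (\<lambda>x. f x \<bullet> v x) x)" by (rule zext_integral[symmetric])
  also have "zext r (\<lambda>x. f x \<bullet> v x) = (\<lambda>x. f x \<bullet> zero_ext r v x)" by (rule ext) (simp add: zext_def zero_ext_def)
  finally show ?thesis .
qed

lemma L2_orthogonal_le:
  assumes "f \<in> L2 M" "g \<in> L2 M" "(LINT x|M. f x \<bullet> g x) = 0" shows "L2norm M f \<le> L2norm M (\<lambda>x. f x + g x)"
proof -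
  have "(LINT x|M. (f x + 1 *\<^sub>R g x) \<bullet> (f x + 1 *\<^sub>R g x)) = (LINT x|M. f x \<bullet> f x) + 2 * 1 * (LINT x|M. f x \<bullet> g x) + 1\<^sup>2 * (LINT x|M. g x \<bullet> g x)"
    by (rule L2.expand[OF assms(1,2)])
  moreover have "0 \<le> (LINT x|M. g x \<bullet> g x)" by simp
  ultimately show ?thesis using assms(3) by (simp add: L2norm_sq_eq)
qed

lemma zero_ext_best_approximation:
  assumes r: "0 < r" "r < L" and u: "weak_solution (Omega L r) (V0_sigma L r) f u" and v: "v \<in> V0_sigma L r"
    and u0: "weak_solution (Omega L 0) (H1per_sigma L 0) f u0"
  shows "L2norm (LM L) (\<lambda>x. wgrad (Omega L 0) (zero_ext r u) x - wgrad (Omega L 0) u0 x)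
    \<le> L2norm (LM L) (\<lambda>x. wgrad (Omega L 0) (zero_ext r v) x - wgrad (Omega L 0) u0 x)"
proof -
  let ?g = "\<lambda>v. wgrad (Omega L 0) v"
  have L: "0 < L" using r by simp
  have GL: "?g z \<in> L2 (LM L)" if "z \<in> H1per_sigma L 0" for z
    using that H1_fieldD(3)[OF null_boundary_Omega H1per_0D(1)[OF L]] by (simp add: H1per_sigma_def)
  have uV: "u \<in> V0_sigma L r" using u by (simp add: weak_solution_def)
  have u0X: "u0 \<in> H1per_sigma L 0" using u0 by (simp add: weak_solution_def)
  note Z = V0_zero_ext(1)[OF r]
  let ?d = "\<lambda>x. ?g (zero_ext r u) x - ?g u0 x" and ?e = "\<lambda>x. ?g (zero_ext r v) x - ?g (zero_ext r u) x"
  have d: "?d \<in> L2 (LM L)" and e: "?e \<in> L2 (LM L)" by (intro L2_diff GL Z uV v u0X)+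
  \<comment> \<open>Zero extensions are admissible test fields on the torus, so both equations hold
    for \<open>z\<close> with the same right-hand side.\<close>
  have o: "(LINT x|LM L. ?d x \<bullet> ?g (zero_ext r z) x) = 0" if z: "z \<in> V0_sigma L r" for z
  proof -
    have "(LINT x|LM L. ?d x \<bullet> ?g (zero_ext r z) x) = (LINT x|LM L. ?g (zero_ext r u) x \<bullet> ?g (zero_ext r z) x) - (LINT x|LM L. ?g u0 x \<bullet> ?g (zero_ext r z) x)"
      by (rule L2.lin_diff[OF GL[OF Z[OF uV]] GL[OF u0X] GL[OF Z[OF z]]])
    also have "(LINT x|LM L. ?g u0 x \<bullet> ?g (zero_ext r z) x) = (LINT x|LM L. f x \<bullet> zero_ext r z x)"
      using u0 Z[OF z] by (simp add: weak_solution_def)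
    finally show ?thesis using zero_ext_weak_equation[OF r u z] by simp
  qed
  have "(LINT x|LM L. ?e x \<bullet> ?d x) = (LINT x|LM L. ?g (zero_ext r v) x \<bullet> ?d x) - (LINT x|LM L. ?g (zero_ext r u) x \<bullet> ?d x)"
    by (rule L2.lin_diff[OF GL[OF Z[OF v]] GL[OF Z[OF uV]] d])
  then have "(LINT x|LM L. ?d x \<bullet> ?e x) = 0" using o[OF v] o[OF uV] by (simp add: inner_commute)
  from L2_orthogonal_le[OF d e this] show ?thesis by simp
qed

lemma norm_transpose: "norm (transpose A) = norm (A :: real^2^2)"
  by (simp add: norm_eq_sqrt_inner inner_vec_def sum_2 transpose_def)

lemma onorm_matrix_le: "onorm (\<lambda>h. A *v h) \<le> norm (A :: real^2^2)"
proof (rule onorm_bound)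
  fix h
  have "norm (A *v h) = L2_set (\<lambda>i. norm (A $ i \<bullet> h)) UNIV" by (simp add: norm_vec_def matrix_vector_mul_component)
  also have "\<dots> \<le> L2_set (\<lambda>i. norm (A $ i) * norm h) UNIV" by (rule L2_set_mono) (simp_all add: Cauchy_Schwarz_ineq2)
  also have "\<dots> = norm A * norm h" by (simp add: norm_vec_def[of A] L2_set_left_distrib)
  finally show "norm (A *v h) \<le> norm A * norm h" .
qed simp

text \<open>The sup bound times the square root of the area of the disc, and that area is at most
  \<open>(2 * \<rho>)\<^sup>2\<close> since \<open>pi < 4\<close>.\<close>

lemma L2norm_ball_bound:
  fixes f :: "real^2 \<Rightarrow> 'b::euclidean_space"
  assumes \<rho>: "0 \<le> \<rho>" "\<rho> < L" and C: "0 \<le> C" and f: "f \<in> L2 (LM L)" 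
    and b: "\<And>x. norm x < \<rho> \<Longrightarrow> norm (f x) \<le> C" and z: "\<And>x. \<rho> \<le> norm x \<Longrightarrow> f x = 0"
  shows "L2norm (LM L) f \<le> 2 * C * \<rho>"
proof -
  note i = ball_indicator[OF less_imp_le[OF \<rho>(2)], of "C\<^sup>2"]
  have "(LINT x|LM L. (norm (f x))\<^sup>2) \<le> (LINT x|LM L. indicator (ball 0 \<rho>) x * C\<^sup>2)"
  proof (rule integral_mono[OF _ i(1)])
    show "integrable (LM L) (\<lambda>x. (norm (f x))\<^sup>2)" using f by (simp add: L2_def)
    show "(norm (f x))\<^sup>2 \<le> indicator (ball 0 \<rho>) x * C\<^sup>2" for x
    proof (cases "norm x < \<rho>")
      case True then show ?thesis using power_mono[OF b[OF True], of 2] by simp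
    next
      case False then show ?thesis using z[of x] by simp
    qed
  qed
  also have "\<dots> = measure lebesgue (ball (0 :: real^2) \<rho>) * C\<^sup>2" by (rule i(2))
  also have "\<dots> = \<rho>\<^sup>2 * pi * C\<^sup>2" using circle_area[OF \<rho>(1), of 0] by simp
  also have "\<dots> \<le> \<rho>\<^sup>2 * 4 * C\<^sup>2" using pi_less_4 by (intro mult_right_mono mult_left_mono) auto
  also have "\<dots> = (2 * C * \<rho>)\<^sup>2" by (simp add: power_mult_distrib)
  finally show ?thesis unfolding L2norm_def using \<rho> C by (intro real_le_lsqrt) auto
qed

text \<open>The integral of \<open>- rot (W (t x)) \<bullet> x\<close> over \<open>0 \<le> t \<le> 1\<close>. Since \<open>J\<close> has trace \<open>0\<close>, \<open>rot ** J\<close> is symmetric, which makes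
  the gradient of the integrand a derivative in \<open>t\<close>.\<close>

lemma stream_function:
  fixes W :: "real^2 \<Rightarrow> real^2" and J :: "real^2 \<Rightarrow> real^2^2"
  assumes W: "\<And>x. (W has_derivative (\<lambda>h. J x *v h)) (at x)" and Jc: "continuous_on UNIV J"
    and tr: "\<And>x. (\<Sum>i\<in>UNIV. J x $ i $ i) = 0"
  shows "\<exists>\<psi>. (\<forall>x. (\<psi> has_derivative (\<lambda>h. - (rot *v W x) \<bullet> h)) (at x)) \<and>
    (\<forall>x B. (\<forall>t\<in>{0..1}. norm (W (t *\<^sub>R x)) \<le> B) \<longrightarrow> \<bar>\<psi> x\<bar> \<le> B * norm x)"
proof -
  define f where "f x t = - (rot *v W (t *\<^sub>R x)) \<bullet> x" for x t
  define a where "a x t = - (t *\<^sub>R (rot *v (J (t *\<^sub>R x) *v x)) + rot *v W (t *\<^sub>R x))" for x t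
  define \<psi> where "\<psi> x = integral (cbox 0 (1 :: real)) (f x)" for x
  have sym: "(rot *v (J y *v h)) \<bullet> x = (rot *v (J y *v x)) \<bullet> h" for x y h
  proof -
    have "J y $ 2 $ 2 = - J y $ 1 $ 1" using tr[of y] by (simp add: sum_2)
    then show ?thesis by (simp add: inner_vec_def sum_2 rot_nth matrix_vector_mult_def[of "J y"] algebra_simps)
  qed
  have Wc: "continuous_on UNIV W" by (rule continuous_at_imp_continuous_on) (use has_derivative_continuous[OF W] in blast)
  have rd: "((\<lambda>x. rot *v g x) has_derivative (\<lambda>h. rot *v g' h)) F" if "(g has_derivative g') F" for g g' and F :: "'z::real_normed_vector filter"
    by (rule bounded_linear.has_derivative[OF matrix_vector_mul_bounded_linear that])
  have rc: "continuous_on S (\<lambda>x. rot *v g x)" if "continuous_on S g" for g and S :: "'z::topological_space set"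
    by (rule bounded_linear.continuous_on[OF matrix_vector_mul_bounded_linear that])
  have fd: "((\<lambda>x. f x t) has_derivative blinfun_apply (blinfun_inner_right (a x t))) (at x within UNIV)" for x t
  proof -
    have "((\<lambda>x. t *\<^sub>R x) has_derivative (\<lambda>h. t *\<^sub>R h)) (at x)" by (auto intro!: derivative_eq_intros)
    then have "((\<lambda>x. W (t *\<^sub>R x)) has_derivative (\<lambda>h. J (t *\<^sub>R x) *v (t *\<^sub>R h))) (at x)"
      by (rule has_derivative_compose) (rule W)
    from has_derivative_inner[OF has_derivative_minus[OF rd[OF this]] has_derivative_ident]
    have "((\<lambda>x. f x t) has_derivative (\<lambda>h. - (rot *v W (t *\<^sub>R x)) \<bullet> h + - (rot *v (J (t *\<^sub>R x) *v (t *\<^sub>R h))) \<bullet> x)) (at x)"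
      by (simp add: f_def)
    also have "(\<lambda>h. - (rot *v W (t *\<^sub>R x)) \<bullet> h + - (rot *v (J (t *\<^sub>R x) *v (t *\<^sub>R h))) \<bullet> x) = blinfun_apply (blinfun_inner_right (a x t))"
      by (rule ext) (simp add: a_def matrix_vector_mult_scaleR sym inner_add_left inner_diff_left)
    finally show ?thesis by simp
  qed
  have fc: "continuous_on (cbox 0 1) (f x)" for x
    unfolding f_def[abs_def] by (intro continuous_intros rc continuous_on_compose2[OF Wc] subset_UNIV)
  have mv: "continuous_on S (\<lambda>p. A p *v y p)" if "continuous_on S A" "continuous_on S y" for A :: "'z::topological_space \<Rightarrow> real^2^2" and y S
    unfolding matrix_vector_mult_def by (intro continuous_on_vec_lambda continuous_intros continuous_on_nth that)
  have "continuous_on (UNIV \<times> cbox 0 1) (\<lambda>p. a (fst p) (snd p))"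
    unfolding a_def by (intro continuous_intros rc mv continuous_on_compose2[OF Wc] continuous_on_compose2[OF Jc] subset_UNIV)
  then have ac: "continuous_on (UNIV \<times> cbox 0 1) (\<lambda>(x, t). blinfun_inner_right (a x t))"
    unfolding split_beta by (rule bounded_linear.continuous_on[OF bounded_linear_blinfun_inner_right])
  \<comment> \<open>The primitive carries a factor \<open>t\<close>, so its value at
    \<open>t = 0\<close> vanishes and only the value at \<open>t = 1\<close> remains.\<close>
  have FTC: "(a x has_integral - (rot *v W x)) (cbox 0 1)" for x
  proof -
    have "((\<lambda>t. - (t *\<^sub>R (rot *v W (t *\<^sub>R x)))) has_vector_derivative a x t) (at t within {0..1})" for t
    proof -
      have "((\<lambda>t. t *\<^sub>R x) has_derivative (\<lambda>h. h *\<^sub>R x)) (at t)" by (auto intro!: derivative_eq_intros)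
      then have "((\<lambda>t. W (t *\<^sub>R x)) has_derivative (\<lambda>h. J (t *\<^sub>R x) *v (h *\<^sub>R x))) (at t)"
        by (rule has_derivative_compose) (rule W)
      from has_derivative_minus[OF has_derivative_scaleR[OF has_derivative_ident rd[OF this]]]
      have "((\<lambda>t. - (t *\<^sub>R (rot *v W (t *\<^sub>R x)))) has_derivative (\<lambda>h. h *\<^sub>R a x t)) (at t)"
        by (rule has_derivative_eq_rhs) (simp add: fun_eq_iff a_def matrix_vector_mult_scaleR algebra_simps)
      then show ?thesis unfolding has_vector_derivative_def by (rule has_derivative_at_withinI)
    qed
    from fundamental_theorem_of_calculus[of 0 1, OF _ this] show ?thesis by simp
  qed
  have "(\<psi> has_derivative (\<lambda>h. - (rot *v W x) \<bullet> h)) (at x)" for x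
  proof -
    have "(\<psi> has_derivative blinfun_apply (integral (cbox 0 1) (\<lambda>t. blinfun_inner_right (a x t)))) (at x within UNIV)"
      unfolding \<psi>_def[abs_def] by (rule leibniz_rule[OF fd integrable_continuous[OF fc] ac]) auto
    also have "integral (cbox 0 1) (\<lambda>t. blinfun_inner_right (a x t)) = blinfun_inner_right (- (rot *v W x))"
      using has_integral_linear[OF FTC bounded_linear_blinfun_inner_right] by (simp add: o_def integral_unique)
    finally show ?thesis by (simp add: blinfun_inner_right.rep_eq)
  qed
  moreover have "\<bar>\<psi> x\<bar> \<le> B * norm x" if B: "\<forall>t\<in>{0..1}. norm (W (t *\<^sub>R x)) \<le> B" for x B
  proof -
    have B0: "0 \<le> B" using order_trans[OF norm_ge_zero bspec[OF B, of 0]] by simp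
    have "(f x has_integral \<psi> x) (cbox 0 1)" unfolding \<psi>_def by (rule integrable_integral[OF integrable_continuous[OF fc]])
    moreover have "norm (f x t) \<le> B * norm x" if "t \<in> cbox 0 1" for t
    proof -
      have "norm (f x t) \<le> norm (W (t *\<^sub>R x)) * norm x"
        using Cauchy_Schwarz_ineq2[of "rot *v W (t *\<^sub>R x)" x] by (simp add: f_def norm_rot)
      also have "\<dots> \<le> B * norm x" using B that by (intro mult_right_mono) auto
      finally show ?thesis .
    qed
    ultimately have "norm (\<psi> x) \<le> B * norm x * measure lborel (cbox 0 (1 :: real))" using B0 by (intro has_integral_bound[of "B * norm x" "f x"]) auto
    then show ?thesis by simp
  qed
  ultimately show ?thesis by blast
qed

lemma V0_approximation:
  assumes L: "0 < L" and u0: "u0 \<in> H1per_sigma L 0" and \<delta>: "0 < \<delta>"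
  shows "\<exists>\<epsilon>>0. \<exists>v. \<epsilon> < L \<and> (\<forall>r. 0 < r \<and> r \<le> \<epsilon> \<longrightarrow> v \<in> V0_sigma L r \<and> zero_ext r v = v) \<and>
    L2norm (LM L) (\<lambda>x. wgrad (Omega L 0) v x - wgrad (Omega L 0) u0 x) < \<delta>"
proof -
  have u0H: "u0 \<in> H1per L 0" and div: "AE x in LM L. wdiv (Omega L 0) u0 x = 0" using u0 by (auto simp: H1per_sigma_def)
  have d2: "0 < \<delta> / 2" using \<delta> by simp
  obtain w J where w: "\<forall>x. (w has_derivative (\<lambda>h. J x *v h)) (at x)" and Jc: "continuous_on UNIV J" and pw: "periodic_field L w"
    and close: "L2norm (LM L) (\<lambda>x. transpose (J x) - wgrad (Omega L 0) u0 x) < \<delta> / 2" and tr: "\<forall>x. (\<Sum>i\<in>UNIV. J x $ i $ i) = 0"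
    using smooth_density[OF L u0H d2] div by blast
  \<comment> \<open>Only gradients are approximated, so a constant may be removed. On the disc of
    radius \<open>L\<close> this yields the bounds \<open>K * norm x\<close> for \<open>W\<close>
    and \<open>K * norm x * norm x\<close> for \<open>\<psi>\<close>.\<close>
  define W where "W x = w x - w 0" for x
  have W: "(W has_derivative (\<lambda>h. J x *v h)) (at x)" for x
    unfolding W_def[abs_def] using has_derivative_diff[OF spec[OF w] has_derivative_const] by simp
  have per: "periodic_field L W" using pw by (simp add: periodic_field_def W_def)
  obtain \<psi> where \<psi>: "\<forall>x. (\<psi> has_derivative (\<lambda>h. - (rot *v W x) \<bullet> h)) (at x)"
    and \<psi>b: "\<forall>x B. (\<forall>t\<in>{0..1}. norm (W (t *\<^sub>R x)) \<le> B) \<longrightarrow> \<bar>\<psi> x\<bar> \<le> B * norm x"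
    using stream_function[OF W Jc spec[OF tr]] by blast
  have "bounded (J ` cball 0 L)" by (intro compact_imp_bounded compact_continuous_image continuous_on_subset[OF Jc]) auto
  then obtain K where K: "0 < K" "\<forall>x\<in>cball 0 L. norm (J x) \<le> K" unfolding bounded_pos by auto
  have Wb: "norm (W x) \<le> K * norm x" if "norm x \<le> L" for x
  proof -
    have "norm (W x - W 0) \<le> K * norm (x - 0)"
    proof (rule differentiable_bound[of "cball 0 L"])
      show "(W has_derivative (\<lambda>h. J x *v h)) (at x within cball 0 L)" for x by (rule has_derivative_at_withinI[OF W])
      show "onorm (\<lambda>h. J x *v h) \<le> K" if "x \<in> cball 0 L" for x using onorm_matrix_le[of "J x"] K(2) that by fastforce
    qed (use that L in auto)
    then show ?thesis by (simp add: W_def)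
  qed
  have pb: "\<bar>\<psi> x\<bar> \<le> K * norm x * norm x" if x: "norm x \<le> L" for x
  proof -
    have "norm (W (t *\<^sub>R x)) \<le> K * norm x" if t: "t \<in> {0..1}" for t
    proof -
      have n: "norm (t *\<^sub>R x) \<le> norm x" using t by (simp add: mult_left_le_one_le)
      have "norm (W (t *\<^sub>R x)) \<le> K * norm (t *\<^sub>R x)" by (rule Wb) (use n x in linarith)
      also have "\<dots> \<le> K * norm x" using K(1) by (intro mult_left_mono n) simp
      finally show ?thesis .
    qed
    then show ?thesis using \<psi>b by blast
  qed
  \<comment> \<open>On the disc of radius \<open>2 * \<epsilon>\<close>, \<open>Q_bound\<close>
    gives \<open>560 * K + 48 * K + K = 609 * K\<close>. By \<open>L2norm_ball_bound\<close> the
    norm of \<open>Q\<close> is then at most \<open>4 * 609 * K * \<epsilon>\<close>, which has to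
    stay below \<open>\<delta> / 2\<close>.\<close>
  define \<epsilon> where "\<epsilon> = min (L / 4) (\<delta> / (8 * 609 * K))"
  have e: "0 < \<epsilon>" "2 * \<epsilon> < L" "\<epsilon> * (8 * 609 * K) \<le> \<delta>"
  proof -
    show "0 < \<epsilon>" using L \<delta> K by (simp add: \<epsilon>_def)
    show "2 * \<epsilon> < L" using L by (simp add: \<epsilon>_def min_def)
    have "\<epsilon> \<le> \<delta> / (8 * 609 * K)" by (simp add: \<epsilon>_def)
    then show "\<epsilon> * (8 * 609 * K) \<le> \<delta>" using K by (simp add: pos_le_divide_eq)
  qed
  interpret stream_cutoff L \<epsilon> W J \<psi>
    using e W Jc tr per \<psi> by unfold_locales auto
  have TQ: "(\<lambda>x. transpose (Q x)) \<in> L2 (LM L)" "(\<lambda>x. transpose (J x)) \<in> L2 (LM L)"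
    unfolding transpose_def by (intro continuous_L2_Omega continuous_on_vec_lambda continuous_on_nth Q_continuous Jc)+
  have "L2norm (LM L) (\<lambda>x. transpose (Q x)) \<le> 2 * (609 * K) * (2 * \<epsilon>)"
  proof (rule L2norm_ball_bound[OF _ e(2) _ TQ(1)])
    fix x :: "real^2"
    show "2 * \<epsilon> \<le> norm x \<Longrightarrow> transpose (Q x) = 0" using outer_region(2)[of x] by (simp add: transpose_def vec_eq_iff)
    assume x: "norm x < 2 * \<epsilon>"
    then have xL: "norm x \<le> L" using e by simp
    have "\<bar>\<psi> x\<bar> \<le> K * norm x * norm x" by (rule pb[OF xL])
    also have "\<dots> \<le> K * (2 * \<epsilon>) * (2 * \<epsilon>)" using x K e by (intro mult_mono) auto
    finally have "140 * \<bar>\<psi> x\<bar> / \<epsilon>\<^sup>2 \<le> 560 * K" using e by (simp add: pos_divide_le_eq power2_eq_square)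
    moreover have "norm (W x) \<le> K * (2 * \<epsilon>)" using Wb[OF xL] mult_left_mono[of "norm x" "2 * \<epsilon>" K] x K by linarith
    then have "24 * norm (W x) / \<epsilon> \<le> 48 * K" using e by (simp add: pos_divide_le_eq)
    moreover have "norm (J x) \<le> K" using K(2) xL by simp
    ultimately show "norm (transpose (Q x)) \<le> 609 * K" using Q_bound[of x] by (simp only: norm_transpose)
  qed (use e K in auto)
  also have "\<dots> \<le> \<delta> / 2" using e(3) by (simp add: mult_ac)
  finally have small: "L2norm (LM L) (\<lambda>x. transpose (Q x)) \<le> \<delta> / 2" .
  have gu: "wgrad (Omega L 0) u0 \<in> L2 (LM L)" by (rule H1_fieldD(3)[OF null_boundary_Omega H1per_0D(1)[OF L u0H]])
  have "L2norm (LM L) (\<lambda>x. wgrad (Omega L 0) V x - wgrad (Omega L 0) u0 x) = L2norm (LM L) (\<lambda>x. (transpose (J x) - wgrad (Omega L 0) u0 x) - transpose (Q x))"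
  proof (rule L2norm_lebesgue_cong_AE[OF Omega_sets])
    show "(\<lambda>x. wgrad (Omega L 0) V x - wgrad (Omega L 0) u0 x) \<in> L2 (LM L)" by (intro L2_diff gu H1_fieldD(3)[OF null_boundary_Omega V_H1(1)])
    show "AE x in LM L. wgrad (Omega L 0) V x - wgrad (Omega L 0) u0 x = (transpose (J x) - wgrad (Omega L 0) u0 x) - transpose (Q x)"
      using V_wgrad by eventually_elim simp
  qed
  also have "\<dots> \<le> L2norm (LM L) (\<lambda>x. transpose (J x) - wgrad (Omega L 0) u0 x) + L2norm (LM L) (\<lambda>x. transpose (Q x))"
    by (intro L2norm_diff_le L2_diff TQ gu)
  finally have "L2norm (LM L) (\<lambda>x. wgrad (Omega L 0) V x - wgrad (Omega L 0) u0 x) < \<delta>" using close small by linarith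
  then show ?thesis using e V_in_V0 by (intro exI[of _ \<epsilon>] conjI exI[of _ V] allI impI) auto
qed

text \<open>For a constant field the stream function is linear, so the gradient created by the
  cutoff is of order \<open>norm c / \<epsilon>\<close> on a disc of radius of order
  \<open>\<epsilon>\<close>, and the powers of \<open>\<epsilon>\<close> cancel in the norm.
  \<open>G\<close> is a representative of the gradient that vanishes off the annulus at every point,
  so disjoint annuli give exactly orthogonal gradients.\<close>

lemma annular_field:
  assumes e: "0 < \<epsilon>" "2 * \<epsilon> < L"
  shows "\<exists>v G. (\<forall>r. 0 < r \<and> r \<le> \<epsilon> \<longrightarrow> v \<in> V0_sigma L r \<and> zero_ext r v = v) \<and> G \<in> L2 (LM L) \<and>
    (AE x in LM L. wgrad (Omega L 0) v x = G x) \<and> (\<forall>x. norm x \<le> \<epsilon> \<or> 2 * \<epsilon> \<le> norm x \<longrightarrow> G x = 0) \<and>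
    L2norm (LM L) G \<le> 1216 * norm c \<and> v \<in> L2 (LM L) \<and> L2norm (LM L) (\<lambda>x. c - v x) \<le> 100 * norm c * \<epsilon>"
proof -
  have L: "0 < L" using e by simp
  define \<psi> where "\<psi> x = - (rot *v c) \<bullet> x" for x
  have d0: "((\<lambda>_. c) has_derivative (\<lambda>h. (0 :: real^2^2) *v h)) (at x)" for x :: "real^2" by simp
  have d\<psi>: "(\<psi> has_derivative (\<lambda>h. - (rot *v c) \<bullet> h)) (at x)" for x
    unfolding \<psi>_def[abs_def] by (rule bounded_linear.has_derivative[OF bounded_linear_inner_right has_derivative_ident])
  interpret stream_cutoff L \<epsilon> "\<lambda>_. c" "\<lambda>_. 0" \<psi>
    using e d0 d\<psi> by unfold_locales (auto simp: periodic_field_def)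
  have pb: "\<bar>\<psi> x\<bar> \<le> norm c * (2 * \<epsilon>)" if "norm x < 2 * \<epsilon>" for x
  proof -
    have "\<bar>\<psi> x\<bar> \<le> norm c * norm x" using Cauchy_Schwarz_ineq2[of "rot *v c" x] by (simp add: \<psi>_def norm_rot)
    also have "\<dots> \<le> norm c * (2 * \<epsilon>)" using that by (intro mult_left_mono) auto
    finally show ?thesis .
  qed
  define G where "G x = - transpose (Q x)" for x
  have "continuous_on UNIV G" unfolding G_def[abs_def] transpose_def 
    by (intro continuous_on_minus continuous_on_vec_lambda continuous_on_nth Q_continuous)
  then have GL: "G \<in> L2 (LM L)" by (rule continuous_L2_Omega)
  have G0: "\<forall>x. norm x \<le> \<epsilon> \<or> 2 * \<epsilon> \<le> norm x \<longrightarrow> G x = 0"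
    using inner_region(2) outer_region(2) by (auto simp: G_def transpose_def vec_eq_iff)
  \<comment> \<open>304 is \<open>280 + 24\<close>: \<open>Q_bound\<close> with
    \<open>\<bar>\<psi> x\<bar> \<le> norm c * (2 * \<epsilon>)\<close> and zero Jacobian. The disc
    of radius \<open>2 * \<epsilon>\<close> multiplies this by \<open>4 * \<epsilon>\<close>, which
    gives 1216.\<close>
  have "L2norm (LM L) G \<le> 2 * (304 * norm c / \<epsilon>) * (2 * \<epsilon>)"
  proof (rule L2norm_ball_bound[OF _ e(2) _ GL])
    fix x :: "real^2"
    show "2 * \<epsilon> \<le> norm x \<Longrightarrow> G x = 0" using G0 by blast
    assume x: "norm x < 2 * \<epsilon>"
    have "140 * \<bar>\<psi> x\<bar> / \<epsilon>\<^sup>2 \<le> 280 * norm c / \<epsilon>" using pb[OF x] e by (simp add: field_simps power2_eq_square)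
    moreover have "304 * norm c / \<epsilon> = 280 * norm c / \<epsilon> + 24 * norm c / \<epsilon>" by (simp add: add_divide_distrib[symmetric])
    ultimately have "140 * \<bar>\<psi> x\<bar> / \<epsilon>\<^sup>2 + 24 * norm c / \<epsilon> \<le> 304 * norm c / \<epsilon>" by simp
    then show "norm (G x) \<le> 304 * norm c / \<epsilon>" using Q_bound[of x] by (simp add: G_def norm_transpose)
  qed (use e in auto)
  then have GC: "L2norm (LM L) G \<le> 1216 * norm c" using e by simp
  have qL: "q \<in> L2 (LM L)"
    by (intro continuous_L2_Omega continuous_at_imp_continuous_on) (use has_derivative_continuous[OF q_derivative] in blast)
  have "L2norm (LM L) q \<le> 2 * (25 * norm c) * (2 * \<epsilon>)"
  proof (rule L2norm_ball_bound[OF _ e(2) _ qL])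
    fix x :: "real^2"
    show "2 * \<epsilon> \<le> norm x \<Longrightarrow> q x = 0" by (rule outer_region(1))
    assume x: "norm x < 2 * \<epsilon>"
    have "12 * \<bar>\<psi> x\<bar> / \<epsilon> \<le> 24 * norm c" using pb[OF x] e by (simp add: field_simps)
    then show "norm (q x) \<le> 25 * norm c" using q_bound[of x] by simp
  qed (use e in auto)
  moreover have "L2norm (LM L) (\<lambda>x. c - V x) = L2norm (LM L) q"
    by (rule L2norm_cong) (simp add: space_restrict_space V_Omega)
  ultimately have qC: "L2norm (LM L) (\<lambda>x. c - V x) \<le> 100 * norm c * \<epsilon>" by simp
  have "AE x in LM L. wgrad (Omega L 0) V x = G x" using V_wgrad by eventually_elim (simp add: G_def transpose_def vec_eq_iff)
  then show ?thesis using V_in_V0 GL G0 GC qC H1_fieldD(1)[OF null_boundary_Omega V_H1(1)]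
    by (intro exI[of _ V] exI[of _ G] conjI allI impI) auto
qed

text \<open>Pairing \<open>G\<close> with the sum of the first \<open>n\<close> members gives at
  least \<open>real n * b\<close>, while orthogonality keeps the squared norm of that sum at most
  \<open>real n * C\<^sup>2\<close>. Cauchy-Schwarz and division by \<open>n\<close>
  conclude.\<close>

lemma orthogonal_family_bound:
  assumes g: "\<And>k. g k \<in> L2 M" "\<And>k. L2norm M (g k) \<le> C" and orth: "\<And>j k. j < k \<Longrightarrow> (LINT x|M. g j x \<bullet> g k x) = 0"
    and G: "G \<in> L2 M" and b: "0 \<le> b" "\<And>k. k < n \<Longrightarrow> b \<le> (LINT x|M. G x \<bullet> g k x)"
  shows "real n * b\<^sup>2 \<le> (L2norm M G)\<^sup>2 * C\<^sup>2"
proof (cases "n = 0")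
  case False
  define H where "H m x = (\<Sum>k<m. g k x)" for m :: nat and x
  have HS: "H (Suc m) = (\<lambda>x. H m x + 1 *\<^sub>R g m x)" for m by (rule ext) (simp add: H_def)
  have HL: "H m \<in> L2 M" for m
  proof (induction m)
    case 0 show ?case by (simp add: H_def[abs_def] L2_zero)
  next
    case (Suc m) show ?case unfolding HS by (rule L2_lincomb[OF Suc g(1)])
  qed
  have lin: "(LINT x|M. H m x \<bullet> z x) = (\<Sum>k<m. LINT x|M. g k x \<bullet> z x)" if z: "z \<in> L2 M" for z m
  proof (induction m)
    case 0 show ?case by (simp add: H_def)
  next
    case (Suc m) show ?case unfolding HS L2.lin[OF HL g(1) z] Suc by simp
  qed
  have C: "0 \<le> C" using order_trans[OF L2norm_nonneg g(2)] .
  have n2: "(LINT x|M. H m x \<bullet> H m x) \<le> real m * C\<^sup>2" for m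
  proof (induction m)
    case 0 show ?case by (simp add: H_def)
  next
    case (Suc m)
    have "(LINT x|M. H m x \<bullet> g m x) = 0" unfolding lin[OF g(1)] by (rule sum.neutral) (use orth in auto)
    moreover have "(LINT x|M. g m x \<bullet> g m x) \<le> C\<^sup>2"
      using power_mono[OF g(2)[of m] L2norm_nonneg, of 2] by (simp add: L2norm_power2 power2_norm_eq_inner)
    ultimately show ?case unfolding HS L2.expand[OF HL g(1)] using Suc by (simp add: algebra_simps)
  qed
  have "real n * b = (\<Sum>k<n. b)" by simp
  also have "\<dots> \<le> (\<Sum>k<n. LINT x|M. g k x \<bullet> G x)" by (intro sum_mono) (use b(2) in \<open>simp add: inner_commute\<close>)
  also have "\<dots> = (LINT x|M. H n x \<bullet> G x)" by (rule lin[OF G, symmetric])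
  finally have "(real n * b)\<^sup>2 \<le> (LINT x|M. H n x \<bullet> G x)\<^sup>2" using b by (intro power_mono) auto
  also have "\<dots> \<le> (LINT x|M. H n x \<bullet> H n x) * (LINT x|M. G x \<bullet> G x)" by (rule L2.Cauchy_Schwarz[OF HL G])
  also have "(LINT x|M. G x \<bullet> G x) = (L2norm M G)\<^sup>2" by (simp add: L2norm_power2 power2_norm_eq_inner)
  also have "(LINT x|M. H n x \<bullet> H n x) * (L2norm M G)\<^sup>2 \<le> real n * C\<^sup>2 * (L2norm M G)\<^sup>2" by (intro mult_right_mono n2) simp
  finally have "real n * (real n * b\<^sup>2) \<le> real n * ((L2norm M G)\<^sup>2 * C\<^sup>2)" by (simp add: power_mult_distrib power2_eq_square mult_ac)
  then show ?thesis using False by simp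
qed simp

lemma unbounded_gradients:
  assumes L: "0 < L" and f: "f \<in> L2 (LM L)" and c: "(LINT x|LM L. f x) = c" "c \<noteq> 0"
    and u: "\<forall>r. 0 < r \<and> r < L \<longrightarrow> weak_solution (Omega L r) (V0_sigma L r) f (u r)"
  shows "\<exists>\<^sub>F r in at_right 0. L2norm (LM L) (wgrad (Omega L 0) (zero_ext r (u r))) > M"
proof (rule ccontr)
  assume "\<not> ?thesis"
  then have "\<forall>\<^sub>F r in at_right 0. L2norm (LM L) (wgrad (Omega L 0) (zero_ext r (u r))) \<le> M" by (simp add: frequently_def not_less)
  then obtain \<rho> where \<rho>: "0 < \<rho>" "\<forall>r. 0 < r \<and> r < \<rho> \<longrightarrow> L2norm (LM L) (wgrad (Omega L 0) (zero_ext r (u r))) \<le> M"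
    unfolding eventually_at_right_field by auto
  \<comment> \<open>\<open>L / 4\<close> keeps the largest annulus inside the square. The second
    bound makes the deviation \<open>100 * norm c * \<epsilon>0\<close> of the test fields from
    \<open>c\<close> cost at most half of \<open>(norm c)\<^sup>2\<close> when paired with
    \<open>f\<close>; the summand 1 keeps the divisor positive.\<close>
  define \<epsilon>0 where "\<epsilon>0 = min (L / 4) (norm c / (200 * (L2norm (LM L) f + 1)))"
  have nf: "0 < 200 * (L2norm (LM L) f + 1)" by (intro mult_pos_pos add_nonneg_pos) auto
  have "\<epsilon>0 \<le> L / 4" unfolding \<epsilon>0_def by (rule min.cobounded1)
  then have e0: "0 < \<epsilon>0" "2 * \<epsilon>0 < L" using L c(2) nf by (auto simp: \<epsilon>0_def)
  have "\<epsilon>0 \<le> norm c / (200 * (L2norm (LM L) f + 1))" by (simp add: \<epsilon>0_def)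
  then have e0': "\<epsilon>0 * (200 * (L2norm (LM L) f + 1)) \<le> norm c" using nf by (simp only: pos_le_divide_eq)
  \<comment> \<open>Halving the scale makes the annuli
    \<open>\<epsilon> k < norm x < 2 * \<epsilon> k\<close> pairwise disjoint.\<close>
  define \<epsilon> where "\<epsilon> k = \<epsilon>0 / 2 ^ k" for k :: nat
  have e: "0 < \<epsilon> k" "\<epsilon> k \<le> \<epsilon>0" "2 * \<epsilon> k < L" for k
  proof -
    show "0 < \<epsilon> k" using e0 by (simp add: \<epsilon>_def)
    show "\<epsilon> k \<le> \<epsilon>0" using e0 by (simp add: \<epsilon>_def divide_le_eq)
    then show "2 * \<epsilon> k < L" using e0 by simp
  qed
  have dec: "2 * \<epsilon> k \<le> \<epsilon> j" if "j < k" for j k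
  proof -
    have "(2::real) ^ Suc j \<le> 2 ^ k" using that by (intro power_increasing) auto
    then show ?thesis using e0 by (simp add: \<epsilon>_def field_simps)
  qed
  have "\<forall>k. \<exists>v G. (\<forall>r. 0 < r \<and> r \<le> \<epsilon> k \<longrightarrow> v \<in> V0_sigma L r \<and> zero_ext r v = v) \<and> G \<in> L2 (LM L) \<and>
    (AE x in LM L. wgrad (Omega L 0) v x = G x) \<and> (\<forall>x. norm x \<le> \<epsilon> k \<or> 2 * \<epsilon> k \<le> norm x \<longrightarrow> G x = 0) \<and>
    L2norm (LM L) G \<le> 1216 * norm c \<and> v \<in> L2 (LM L) \<and> L2norm (LM L) (\<lambda>x. c - v x) \<le> 100 * norm c * \<epsilon> k"
    using annular_field[OF e(1,3)] by blast
  from choice[OF this] obtain v where "\<forall>k. \<exists>G. (\<forall>r. 0 < r \<and> r \<le> \<epsilon> k \<longrightarrow> v k \<in> V0_sigma L r \<and> zero_ext r (v k) = v k) \<and> G \<in> L2 (LM L) \<and>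
    (AE x in LM L. wgrad (Omega L 0) (v k) x = G x) \<and> (\<forall>x. norm x \<le> \<epsilon> k \<or> 2 * \<epsilon> k \<le> norm x \<longrightarrow> G x = 0) \<and>
    L2norm (LM L) (G) \<le> 1216 * norm c \<and> v k \<in> L2 (LM L) \<and> L2norm (LM L) (\<lambda>x. c - v k x) \<le> 100 * norm c * \<epsilon> k" ..
  from choice[OF this] obtain G where vG: "\<forall>k. (\<forall>r. 0 < r \<and> r \<le> \<epsilon> k \<longrightarrow> v k \<in> V0_sigma L r \<and> zero_ext r (v k) = v k) \<and> G k \<in> L2 (LM L) \<and>
    (AE x in LM L. wgrad (Omega L 0) (v k) x = G k x) \<and> (\<forall>x. norm x \<le> \<epsilon> k \<or> 2 * \<epsilon> k \<le> norm x \<longrightarrow> G k x = 0) \<and>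
    L2norm (LM L) (G k) \<le> 1216 * norm c \<and> v k \<in> L2 (LM L) \<and> L2norm (LM L) (\<lambda>x. c - v k x) \<le> 100 * norm c * \<epsilon> k" ..
  have v0: "v k \<in> V0_sigma L r" "zero_ext r (v k) = v k" if "0 < r" "r \<le> \<epsilon> k" for k r using vG that by blast+
  have GL: "G k \<in> L2 (LM L)" and vg: "AE x in LM L. wgrad (Omega L 0) (v k) x = G k x" and Gb: "L2norm (LM L) (G k) \<le> 1216 * norm c"
    and vL: "v k \<in> L2 (LM L)" and vc: "L2norm (LM L) (\<lambda>x. c - v k x) \<le> 100 * norm c * \<epsilon> k" for k using vG by blast+
  have G0: "G k x = 0" if "norm x \<le> \<epsilon> k \<or> 2 * \<epsilon> k \<le> norm x" for k x using vG that by blast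
  have orth: "(LINT x|LM L. G j x \<bullet> G k x) = 0" if "j < k" for j k
  proof -
    have "G j x \<bullet> G k x = 0" for x
      using G0[of x j] G0[of x k] dec[OF that] by (cases "2 * \<epsilon> k \<le> norm x") auto
    then show ?thesis by simp
  qed
  \<comment> \<open>\<open>f\<close> integrates to \<open>c\<close> and \<open>v k\<close> is close
    to \<open>c\<close>, so the pairing is close to \<open>c \<bullet> c\<close>.\<close>
  have load: "(norm c)\<^sup>2 / 2 \<le> (LINT x|LM L. f x \<bullet> v k x)" for k
  proof -
    have "(LINT x|LM L. f x \<bullet> c) = c \<bullet> c" using integral_inner_left[OF L2_integrable[OF f], of c] c(1) by simp
    moreover have "\<bar>LINT x|LM L. f x \<bullet> (c - v k x)\<bar> \<le> L2norm (LM L) f * L2norm (LM L) (\<lambda>x. c - v k x)"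
      by (rule L2_inner_bound[OF f L2_diff[OF L2_const vL]])
    moreover have "(LINT x|LM L. f x \<bullet> (c - v k x)) = (LINT x|LM L. f x \<bullet> c) - (LINT x|LM L. f x \<bullet> v k x)"
      using L2_inner_integrable[OF f vL] L2_inner_integrable[OF f L2_const[of c L]] by (simp add: inner_diff_right)
    moreover have "L2norm (LM L) f * L2norm (LM L) (\<lambda>x. c - v k x) \<le> (norm c)\<^sup>2 / 2"
    proof -
      have "L2norm (LM L) f * L2norm (LM L) (\<lambda>x. c - v k x) \<le> (L2norm (LM L) f + 1) * (100 * norm c * \<epsilon>0)"
      proof (rule mult_mono)
        show "L2norm (LM L) (\<lambda>x. c - v k x) \<le> 100 * norm c * \<epsilon>0"
          using vc[of k] mult_left_mono[OF e(2), of "100 * norm c" k] by simp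
      qed auto
      also have "\<dots> = norm c * (\<epsilon>0 * (200 * (L2norm (LM L) f + 1))) / 2" by simp
      also have "\<dots> \<le> norm c * norm c / 2" using mult_left_mono[OF e0', of "norm c"] by simp
      finally show ?thesis by (simp add: power2_eq_square)
    qed
    ultimately show ?thesis by (simp add: power2_norm_eq_inner)
  qed
  have bound: "real n * ((norm c)\<^sup>2 / 2)\<^sup>2 \<le> M\<^sup>2 * (1216 * norm c)\<^sup>2" for n
  proof -
    \<comment> \<open>Small enough both for the assumed bound \<open>M\<close> and for all
      \<open>v k\<close> with \<open>k < n\<close> to vanish on the disc and be admissible at this
      one radius.\<close>
    define r where "r = min (\<rho> / 2) (\<epsilon> n)"
    have r: "0 < r" "r < L" "r < \<rho>" "r \<le> \<epsilon> n"
      using \<rho>(1) e[of n] by (auto simp: r_def min_def)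
    have ur: "weak_solution (Omega L r) (V0_sigma L r) f (u r)" using u r by blast
    let ?U = "wgrad (Omega L 0) (zero_ext r (u r))"
    have uV: "u r \<in> V0_sigma L r" using ur by (simp add: weak_solution_def)
    have UL: "?U \<in> L2 (LM L)"
      using V0_zero_ext(1)[OF r(1,2) uV] H1_fieldD(3)[OF null_boundary_Omega H1per_0D(1)[OF L]] by (simp add: H1per_sigma_def)
    have UM: "L2norm (LM L) ?U \<le> M" using \<rho>(2) r by blast
    have "(norm c)\<^sup>2 / 2 \<le> (LINT x|LM L. ?U x \<bullet> G k x)" if "k < n" for k
    proof -
      have rk: "r \<le> \<epsilon> k" using r(4) dec[OF that] e(1)[of n] by linarith
      have "(LINT x|LM L. f x \<bullet> v k x) = (LINT x|LM L. ?U x \<bullet> wgrad (Omega L 0) (v k) x)"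
        using zero_ext_weak_equation[OF r(1,2) ur v0(1)[OF r(1) rk]] v0(2)[OF r(1) rk] by simp
      also have "\<dots> = (LINT x|LM L. ?U x \<bullet> G k x)"
      proof (rule integral_cong_AE)
        show "(\<lambda>x. ?U x \<bullet> G k x) \<in> borel_measurable (LM L)" using L2_inner_integrable[OF UL GL] by blast
        have "wgrad (Omega L 0) (v k) \<in> L2 (LM L)"
          using H1_fieldD(3)[OF null_boundary_Omega H1per_0D(1)[OF L]] V0_zero_ext(1)[OF r(1,2) v0(1)[OF r(1) rk]] v0(2)[OF r(1) rk]
          by (simp add: H1per_sigma_def)
        then show "(\<lambda>x. ?U x \<bullet> wgrad (Omega L 0) (v k) x) \<in> borel_measurable (LM L)" using L2_inner_integrable[OF UL] by blast
        show "AE x in LM L. ?U x \<bullet> wgrad (Omega L 0) (v k) x = ?U x \<bullet> G k x" using vg[of k] by eventually_elim simp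
      qed
      finally show ?thesis using load[of k] by simp
    qed
    from orthogonal_family_bound[OF GL Gb orth UL _ this]
    have "real n * ((norm c)\<^sup>2 / 2)\<^sup>2 \<le> (L2norm (LM L) ?U)\<^sup>2 * (1216 * norm c)\<^sup>2" by simp
    also have "\<dots> \<le> M\<^sup>2 * (1216 * norm c)\<^sup>2" by (intro mult_right_mono power_mono UM) auto
    finally show ?thesis .
  qed
  have "0 < ((norm c)\<^sup>2 / 2)\<^sup>2" using c(2) by simp
  from reals_Archimedean3[OF this] obtain n where "M\<^sup>2 * (1216 * norm c)\<^sup>2 < real n * ((norm c)\<^sup>2 / 2)\<^sup>2" by blast
  then show False using bound[of n] by linarith
qed

section \<open>Convergence to the solution on the torus\<close>

lemma gradient_convergence:
  assumes L: "0 < L" and u0: "weak_solution (Omega L 0) (H1per_sigma L 0) f u0"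
    and u: "\<forall>r. 0 < r \<and> r < L \<longrightarrow> weak_solution (Omega L r) (V0_sigma L r) f (u r)"
  shows "((\<lambda>r. L2norm (LM L) (\<lambda>x. wgrad (Omega L 0) (zero_ext r (u r)) x - wgrad (Omega L 0) u0 x)) \<longlongrightarrow> 0) (at_right 0)"
proof (rule tendstoI)
  fix \<delta> :: real assume \<delta>: "0 < \<delta>"
  have u0X: "u0 \<in> H1per_sigma L 0" using u0 by (simp add: weak_solution_def)
  obtain \<epsilon> v where e: "0 < \<epsilon>" "\<epsilon> < L" and v: "\<forall>r. 0 < r \<and> r \<le> \<epsilon> \<longrightarrow> v \<in> V0_sigma L r \<and> zero_ext r v = v"
    and d: "L2norm (LM L) (\<lambda>x. wgrad (Omega L 0) v x - wgrad (Omega L 0) u0 x) < \<delta>"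
    using V0_approximation[OF L u0X \<delta>] by blast
  have "dist (L2norm (LM L) (\<lambda>x. wgrad (Omega L 0) (zero_ext r (u r)) x - wgrad (Omega L 0) u0 x)) 0 < \<delta>" if r: "0 < r" "r < \<epsilon>" for r
  proof -
    have rL: "r < L" using r e by simp
    have "v \<in> V0_sigma L r" and zv: "zero_ext r v = v" using v r by auto
    from zero_ext_best_approximation[OF r(1) rL _ this(1) u0, of "u r"]
    have "L2norm (LM L) (\<lambda>x. wgrad (Omega L 0) (zero_ext r (u r)) x - wgrad (Omega L 0) u0 x)
       \<le> L2norm (LM L) (\<lambda>x. wgrad (Omega L 0) v x - wgrad (Omega L 0) u0 x)" using u r(1) rL zv by simp
    then show ?thesis using d by (simp add: dist_real_def)
  qed
  then show "\<forall>\<^sub>F r in at_right 0. dist (L2norm (LM L) (\<lambda>x. wgrad (Omega L 0) (zero_ext r (u r)) x - wgrad (Omega L 0) u0 x)) 0 < \<delta>"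
    unfolding eventually_at_right_field using e(1) by blast
qed

text \<open>The constant belongs to the torus and is independent of the hole, so convergence of the
  gradients carries over to the fields after removal of the mean.\<close>

lemma Poincare_difference:
  assumes L: "0 < L" and U: "U \<in> H1per_sigma L 0" and u0: "u0 \<in> H1per_sigma L 0" "(LINT x|LM L. u0 x) = 0"
  shows "(\<lambda>x. (U x - mean (Omega L 0) U) - u0 x) \<in> L2 (LM L)"
    "(\<lambda>x. wgrad (Omega L 0) U x - wgrad (Omega L 0) u0 x) \<in> L2 (LM L)"
    "L2norm (LM L) (\<lambda>x. (U x - mean (Omega L 0) U) - u0 x) \<le> 6 * L * L2norm (LM L) (\<lambda>x. wgrad (Omega L 0) U x - wgrad (Omega L 0) u0 x)"
proof -
  let ?c = "mean (Omega L 0) U"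
  have H: "z \<in> H1_field (Omega L 0)" if "z \<in> H1per_sigma L 0" for z using that H1per_0D(1)[OF L] by (simp add: H1per_sigma_def)
  note F = H1_fieldD[OF null_boundary_Omega H]
  note d = H1per_0_diff_const[OF L U, of ?c]
  have z: "(\<lambda>x. (U x - ?c) - u0 x) \<in> H1per_sigma L 0" using H1per_0_lincomb[OF L d(1) u0(1), of "-1"] by simp
  show "(\<lambda>x. (U x - ?c) - u0 x) \<in> L2 (LM L)" by (rule F(1)[OF z])
  show gL: "(\<lambda>x. wgrad (Omega L 0) U x - wgrad (Omega L 0) u0 x) \<in> L2 (LM L)" by (intro L2_diff F(3) U u0)
  have "L2norm (LM L) (wgrad (Omega L 0) (\<lambda>x. (U x - ?c) - u0 x)) = L2norm (LM L) (\<lambda>x. wgrad (Omega L 0) U x - wgrad (Omega L 0) u0 x)"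
  proof (rule L2norm_lebesgue_cong_AE[OF Omega_sets F(3)[OF z]])
    show "AE x in LM L. wgrad (Omega L 0) (\<lambda>x. (U x - ?c) - u0 x) x = wgrad (Omega L 0) U x - wgrad (Omega L 0) u0 x"
      using H1_field_diff(2)[OF null_boundary_Omega H[OF d(1)] H[OF u0(1)]] d(2) by eventually_elim simp
  qed
  moreover have "(LINT x|LM L. (U x - ?c) - u0 x) = 0"
    using Bochner_Integration.integral_diff[OF L2_integrable[OF F(1)[OF d(1)]] L2_integrable[OF F(1)[OF u0(1)]]] mean_free[OF L F(1)[OF U]] u0(2) by simp
  ultimately show "L2norm (LM L) (\<lambda>x. (U x - ?c) - u0 x) \<le> 6 * L * L2norm (LM L) (\<lambda>x. wgrad (Omega L 0) U x - wgrad (Omega L 0) u0 x)"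
    using Poincare_H1per[OF L, of "\<lambda>x. (U x - ?c) - u0 x"] z by (simp add: H1per_sigma_def)
qed

lemma componentwise_convergence:
  assumes L: "0 < L" and u0: "weak_solution (Omega L 0) (H1per_sigma L 0) f u0" "(LINT x|LM L. u0 x) = 0"
    and u: "\<forall>r. 0 < r \<and> r < L \<longrightarrow> weak_solution (Omega L r) (V0_sigma L r) f (u r)"
  shows "((\<lambda>r. L2norm (LM L) (\<lambda>x. (zero_ext r (u r) x - mean (Omega L 0) (zero_ext r (u r))) $ j - u0 x $ j)) \<longlongrightarrow> 0) (at_right 0)"
    "((\<lambda>r. L2norm (LM L) (\<lambda>x. wgrad (Omega L 0) (zero_ext r (u r)) x $ i $ j - wgrad (Omega L 0) u0 x $ i $ j)) \<longlongrightarrow> 0) (at_right 0)"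
proof -
  let ?D = "\<lambda>r. L2norm (LM L) (\<lambda>x. wgrad (Omega L 0) (zero_ext r (u r)) x - wgrad (Omega L 0) u0 x)"
  have conv: "(?D \<longlongrightarrow> 0) (at_right 0)" by (rule gradient_convergence[OF L u0(1) u])
  have u0X: "u0 \<in> H1per_sigma L 0" using u0 by (simp add: weak_solution_def)
  have Z: "zero_ext r (u r) \<in> H1per_sigma L 0" if "0 < r" "r < L" for r
    using V0_zero_ext(1)[OF that, of "u r"] u that by (simp add: weak_solution_def)
  have near: "\<forall>\<^sub>F r in at_right 0. P r" if "\<And>r. 0 < r \<Longrightarrow> r < L \<Longrightarrow> P r" for P :: "real \<Rightarrow> bool"
    unfolding eventually_at_right_field using that L by blast
  have conv6: "((\<lambda>r. 6 * L * ?D r) \<longlongrightarrow> 0) (at_right 0)" using tendsto_mult_left[OF conv, of "6 * L"] by simp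
  show "((\<lambda>r. L2norm (LM L) (\<lambda>x. (zero_ext r (u r) x - mean (Omega L 0) (zero_ext r (u r))) $ j - u0 x $ j)) \<longlongrightarrow> 0) (at_right 0)"
  proof (rule real_tendsto_sandwich[OF always_eventually near tendsto_const conv6])
    fix r assume "0 < r" "r < L"
    note P = Poincare_difference[OF L Z[OF this] u0X u0(2)]
    show "L2norm (LM L) (\<lambda>x. (zero_ext r (u r) x - mean (Omega L 0) (zero_ext r (u r))) $ j - u0 x $ j) \<le> 6 * L * ?D r"
      using order_trans[OF L2norm_component_le[OF P(1), of j] P(3)] by simp
  qed simp
  show "((\<lambda>r. L2norm (LM L) (\<lambda>x. wgrad (Omega L 0) (zero_ext r (u r)) x $ i $ j - wgrad (Omega L 0) u0 x $ i $ j)) \<longlongrightarrow> 0) (at_right 0)"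
  proof (rule real_tendsto_sandwich[OF always_eventually near tendsto_const conv])
    fix r assume "0 < r" "r < L"
    note P = Poincare_difference(2)[OF L Z[OF this] u0X u0(2)]
    show "L2norm (LM L) (\<lambda>x. wgrad (Omega L 0) (zero_ext r (u r)) x $ i $ j - wgrad (Omega L 0) u0 x $ i $ j) \<le> ?D r"
      using order_trans[OF L2norm_component_le[OF L2_nth[OF P, of i], of j] L2norm_component_le[OF P, of i]] by simp
  qed simp
qed

theorem theorem3p1:
  fixes L :: real and f :: "real^2 \<Rightarrow> real^2"
  assumes "L > 0"
    and "f \<in> L2 (lebesgue_on (Omega L 0))"
  shows
    "(\<forall>r. 0 < r \<and> r < L \<longrightarrow>
        (\<exists>u. weak_solution (Omega L r) (V0_sigma L r) f u \<and>
             (\<forall>u'. weak_solution (Omega L r) (V0_sigma L r) f u' \<longrightarrow>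
                   (AE x in lebesgue_on (Omega L r). u' x = u x))))
   \<and> (\<forall>u :: real \<Rightarrow> real^2 \<Rightarrow> real^2.
        (\<forall>r. 0 < r \<and> r < L \<longrightarrow> weak_solution (Omega L r) (V0_sigma L r) f (u r)) \<longrightarrow>
        (\<forall>r. 0 < r \<and> r < L \<longrightarrow> zero_ext r (u r) \<in> H1per_sigma L 0))
   \<and> ((LINT x|lebesgue_on (Omega L 0). f x) = 0 \<longrightarrow>
        (\<exists>u0. weak_solution (Omega L 0) (H1per_sigma L 0) f u0 \<and>
              (LINT x|lebesgue_on (Omega L 0). u0 x) = 0 \<and>
              (\<forall>u'. weak_solution (Omega L 0) (H1per_sigma L 0) f u' \<and>
                    (LINT x|lebesgue_on (Omega L 0). u' x) = 0 \<longrightarrow>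
                    (AE x in lebesgue_on (Omega L 0). u' x = u0 x)) \<and>
              (\<forall>u :: real \<Rightarrow> real^2 \<Rightarrow> real^2.
                 (\<forall>r. 0 < r \<and> r < L \<longrightarrow> weak_solution (Omega L r) (V0_sigma L r) f (u r)) \<longrightarrow>
                 (\<forall>j. ((\<lambda>r. L2norm (lebesgue_on (Omega L 0))
                         (\<lambda>x. (zero_ext r (u r) x - mean (Omega L 0) (zero_ext r (u r))) $ j - u0 x $ j))
                       \<longlongrightarrow> 0) (at_right 0)) \<and>
                 (\<forall>i j. ((\<lambda>r. L2norm (lebesgue_on (Omega L 0))
                         (\<lambda>x. wgrad (Omega L 0) (zero_ext r (u r)) x $ i $ j - wgrad (Omega L 0) u0 x $ i $ j))
                       \<longlongrightarrow> 0) (at_right 0)))))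
   \<and> ((LINT x|lebesgue_on (Omega L 0). f x) \<noteq> 0 \<longrightarrow>
        (\<forall>u :: real \<Rightarrow> real^2 \<Rightarrow> real^2.
           (\<forall>r. 0 < r \<and> r < L \<longrightarrow> weak_solution (Omega L r) (V0_sigma L r) f (u r)) \<longrightarrow>
           (\<forall>M. \<exists>\<^sub>F r in at_right 0.
              L2norm (lebesgue_on (Omega L 0)) (wgrad (Omega L 0) (zero_ext r (u r))) > M)))"
proof -
  note L = assms(1) and f = assms(2)
  have A: "\<exists>u. weak_solution (Omega L r) (V0_sigma L r) f u \<and>
      (\<forall>u'. weak_solution (Omega L r) (V0_sigma L r) f u' \<longrightarrow> (AE x in lebesgue_on (Omega L r). u' x = u x))" if "0 < r \<and> r < L" for r
    using V0_solution[of r L f] that f by blast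
  have B: "zero_ext r (u r) \<in> H1per_sigma L 0"
    if "\<forall>r. 0 < r \<and> r < L \<longrightarrow> weak_solution (Omega L r) (V0_sigma L r) f (u r)" "0 < r \<and> r < L" for u :: "real \<Rightarrow> real^2 \<Rightarrow> real^2" and r
    using V0_zero_ext(1)[of r L "u r"] that by (simp add: weak_solution_def)
  have C: "\<exists>u0. weak_solution (Omega L 0) (H1per_sigma L 0) f u0 \<and> (LINT x|LM L. u0 x) = 0 \<and>
      (\<forall>u'. weak_solution (Omega L 0) (H1per_sigma L 0) f u' \<and> (LINT x|LM L. u' x) = 0 \<longrightarrow> (AE x in LM L. u' x = u0 x)) \<and>
      (\<forall>u :: real \<Rightarrow> real^2 \<Rightarrow> real^2.
         (\<forall>r. 0 < r \<and> r < L \<longrightarrow> weak_solution (Omega L r) (V0_sigma L r) f (u r)) \<longrightarrow>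
         (\<forall>j. ((\<lambda>r. L2norm (LM L) (\<lambda>x. (zero_ext r (u r) x - mean (Omega L 0) (zero_ext r (u r))) $ j - u0 x $ j)) \<longlongrightarrow> 0) (at_right 0)) \<and>
         (\<forall>i j. ((\<lambda>r. L2norm (LM L) (\<lambda>x. wgrad (Omega L 0) (zero_ext r (u r)) x $ i $ j - wgrad (Omega L 0) u0 x $ i $ j)) \<longlongrightarrow> 0) (at_right 0)))"
    if mf: "(LINT x|LM L. f x) = 0"
  proof -
    obtain u0 where u0: "weak_solution (Omega L 0) (H1per_sigma L 0) f u0" "(LINT x|LM L. u0 x) = 0"
      using periodic_solution(1)[OF L f mf] by blast
    show ?thesis
      by (intro exI[of _ u0] conjI allI impI u0 componentwise_convergence[OF L u0]) (use periodic_solution(2)[OF L f mf u0] in blast)+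
  qed
  show ?thesis
    by (intro conjI allI impI A B C unbounded_gradients[OF L f refl]) blast+
qed

end
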